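(* Let $\mathfrak{F} = (F; +, \cdot, <)$ be an ordered field and $T = \mathrm{Th}(\mathfrak{F})$. The following are equivalent: (1) $T$ is VC-minimal; (2) $T$ is convexly orderable; (3) $T$ is dp-small; (4) $\mathfrak{F}$ is real closed.
   Context: Let $T$ be a complete theory in a language $L$ with monster model $\mathcal{U}$; for a tuple of variables $y$, $\mathcal{U}_y$ denotes the set of $|y|$-tuples from $\mathcal{U}$, and a variable $x$ with $|x|=1$ is "of the home sort". A set of formulas $\Psi = \{\psi_i(x;y_i) : i \in I\}$ is directed if for all $i,j\in I$, $b\in\mathcal{U}_{y_i}$, $c \in \mathcal{U}_{y_j}$, either $\psi_i(x;b)$ implies $\psi_j(x;c)$, or $\psi_j(x;c)$ implies $\psi_i(x;b)$, or $\psi_i(x;b)\wedge\psi_j(x;c)$ is inconsistent. $T$ is VC-minimal if there is a directed $\Psi$ with $x$ of the home sort such that every $L(\mathcal{U})$-formula $\theta(x)$ is a boolean combination of instances of formulas from $\Psi$. An $L$-structure $M$ is convexly orderable if there is a linear order $\lhd$ on $M$ (not necessarily definable) such that for every $L$-formula $\varphi(x;y)$ with $x$ of the home sort there is $K_\varphi<\omega$ with $\varphi(M;b)$ a union of at most $K_\varphi$ $\lhd$-convex sets for every $b\in M_y$; $T$ is convexly orderable if some (equivalently every) model is. A partial type $\pi(x)$ is dp-small if there do not exist $L(\mathcal{U})$-formulas $\varphi_i(x)$ ($i<\omega$), an $L$-formula $\psi(x;y)$ and $b_j\in\mathcal{U}_y$ ($j<\omega$) such that for all $i_0,j_0<\omega$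 the type $\pi(x)\cup\{\varphi_{i_0}(x),\psi(x;b_{j_0})\}\cup\{\neg\varphi_i(x): i\ne i_0\}\cup\{\neg\psi(x;b_j): j\neq j_0\}$ is consistent. $T$ is dp-small if $x=x$ is dp-small for $x$ of the home sort. *)

theory Defs
  imports Main "HOL-Library.Countable_Set" "HOL-Computational_Algebra.Polynomial"
begin

datatype tm = Var nat | Add tm tm | Mul tm tm

datatype fm = Eq tm tm | Lt tm tm | Neg fm | Conj fm fm | Ex nat fm

fun fvt :: "tm \<Rightarrow> nat set" where
  "fvt (Var n) = {n}"
| "fvt (Add s t) = fvt s \<union> fvt t"
| "fvt (Mul s t) = fvt s \<union> fvt t"

fun fv :: "fm \<Rightarrow> nat set" where
  "fv (Eq s t) = fvt s \<union> fvt t"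
| "fv (Lt s t) = fvt s \<union> fvt t"
| "fv (Neg p) = fv p"
| "fv (Conj p q) = fv p \<union> fv q"
| "fv (Ex n p) = fv p - {n}"

record 'b struc =
  carrier :: "'b set"
  sadd :: "'b \<Rightarrow> 'b \<Rightarrow> 'b"
  smul :: "'b \<Rightarrow> 'b \<Rightarrow> 'b"
  slt :: "'b \<Rightarrow> 'b \<Rightarrow> bool"

fun evalt :: "'b struc \<Rightarrow> (nat \<Rightarrow> 'b) \<Rightarrow> tm \<Rightarrow> 'b" where
  "evalt M e (Var n) = e n"
| "evalt M e (Add s t) = sadd M (evalt M e s) (evalt M e t)"
| "evalt M e (Mul s t) = smul M (evalt M e s) (evalt M e t)"

fun sat :: "'b struc \<Rightarrow> (nat \<Rightarrow> 'b) \<Rightarrow> fm \<Rightarrow> bool" where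
  "sat M e (Eq s t) = (evalt M e s = evalt M e t)"
| "sat M e (Lt s t) = slt M (evalt M e s) (evalt M e t)"
| "sat M e (Neg p) = (\<not> sat M e p)"
| "sat M e (Conj p q) = (sat M e p \<and> sat M e q)"
| "sat M e (Ex n p) = (\<exists>a\<in>carrier M. sat M (e(n := a)) p)"

definition is_struc :: "'b struc \<Rightarrow> bool" where
  "is_struc M \<longleftrightarrow> carrier M \<noteq> {} \<and>
     (\<forall>a\<in>carrier M. \<forall>b\<in>carrier M. sadd M a b \<in> carrier M \<and> smul M a b \<in> carrier M)"

definition valid :: "'b struc \<Rightarrow> (nat \<Rightarrow> 'b) \<Rightarrow> bool" where
  "valid M e \<longleftrightarrow> range e \<subseteq> carrier M"

definition ofield :: "'a::linordered_field struc" where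
  "ofield = \<lparr>carrier = UNIV, sadd = (+), smul = (*), slt = (<)\<rparr>"

definition Th :: "'b struc \<Rightarrow> fm set" where
  "Th M = {\<phi>. fv \<phi> = {} \<and> (\<forall>e. valid M e \<longrightarrow> sat M e \<phi>)}"

definition is_model :: "'c struc \<Rightarrow> fm set \<Rightarrow> bool" where
  "is_model U T \<longleftrightarrow> is_struc U \<and> (\<forall>\<phi>\<in>T. \<forall>e. valid U e \<longrightarrow> sat U e \<phi>)"

text \<open>The home-sort variable x is variable 0; the remaining free variables are the
  parameter variables y. The set defined by phi(x;b), b given by the assignment e.\<close>
definition dset :: "'b struc \<Rightarrow> fm \<Rightarrow> (nat \<Rightarrow> 'b) \<Rightarrow> 'b set" where
  "dset M \<phi> e = {a \<in> carrier M. sat M (e(0 := a)) \<phi>}"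

text \<open>Monster model (sufficiently saturated model): here aleph_1-saturation, i.e. every
  finitely satisfiable set of formulas in x with countably many parameters is realized.\<close>
definition aleph1_saturated :: "'b struc \<Rightarrow> bool" where
  "aleph1_saturated U \<longleftrightarrow>
     (\<forall>A \<subseteq> carrier U. countable A \<longrightarrow>
       (\<forall>P :: (fm \<times> (nat \<Rightarrow> 'b)) set.
          (\<forall>(\<phi>, e)\<in>P. valid U e \<and> e ` (fv \<phi> - {0}) \<subseteq> A) \<longrightarrow>
          (\<forall>Q \<subseteq> P. finite Q \<longrightarrow> (\<exists>a\<in>carrier U. \<forall>(\<phi>, e)\<in>Q. sat U (e(0 := a)) \<phi>)) \<longrightarrow>
          (\<exists>a\<in>carrier U. \<forall>(\<phi>, e)\<in>P. sat U (e(0 := a)) \<phi>)))"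

definition monster_of :: "fm set \<Rightarrow> 'b struc \<Rightarrow> bool" where
  "monster_of T U \<longleftrightarrow> is_model U T \<and> aleph1_saturated U"

inductive_set bool_comb :: "'b set \<Rightarrow> 'b set set \<Rightarrow> 'b set set" for C :: "'b set" and S :: "'b set set" where
  basic: "X \<in> S \<Longrightarrow> X \<in> bool_comb C S"
| top: "C \<in> bool_comb C S"
| compl: "X \<in> bool_comb C S \<Longrightarrow> C - X \<in> bool_comb C S"
| union: "X \<in> bool_comb C S \<Longrightarrow> Y \<in> bool_comb C S \<Longrightarrow> X \<union> Y \<in> bool_comb C S"

definition directed :: "'b struc \<Rightarrow> fm set \<Rightarrow> bool" where
  "directed U \<Psi> \<longleftrightarrow> (\<forall>\<psi>\<in>\<Psi>. \<forall>\<psi>'\<in>\<Psi>. \<forall>b c. valid U b \<longrightarrow> valid U c \<longrightarrow>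
      dset U \<psi> b \<subseteq> dset U \<psi>' c \<or> dset U \<psi>' c \<subseteq> dset U \<psi> b \<or>
      dset U \<psi> b \<inter> dset U \<psi>' c = {})"

definition VC_minimal :: "'b struc \<Rightarrow> bool" where
  "VC_minimal U \<longleftrightarrow> (\<exists>\<Psi>. directed U \<Psi> \<and>
     (\<forall>\<theta> e. valid U e \<longrightarrow>
        dset U \<theta> e \<in> bool_comb (carrier U) {dset U \<psi> b | \<psi> b. \<psi> \<in> \<Psi> \<and> valid U b}))"

definition convex_wrt :: "'b set \<Rightarrow> ('b \<Rightarrow> 'b \<Rightarrow> bool) \<Rightarrow> 'b set \<Rightarrow> bool" where
  "convex_wrt C R X \<longleftrightarrow> X \<subseteq> C \<and>
     (\<forall>a\<in>X. \<forall>c\<in>X. \<forall>b\<in>C. R a b \<longrightarrow> R b c \<longrightarrow> b \<in> X)"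

definition strict_linear_order_on :: "'b set \<Rightarrow> ('b \<Rightarrow> 'b \<Rightarrow> bool) \<Rightarrow> bool" where
  "strict_linear_order_on C R \<longleftrightarrow>
     (\<forall>a\<in>C. \<not> R a a) \<and>
     (\<forall>a\<in>C. \<forall>b\<in>C. \<forall>c\<in>C. R a b \<longrightarrow> R b c \<longrightarrow> R a c) \<and>
     (\<forall>a\<in>C. \<forall>b\<in>C. R a b \<or> a = b \<or> R b a)"

definition convexly_orderable :: "'b struc \<Rightarrow> bool" where
  "convexly_orderable M \<longleftrightarrow> (\<exists>R. strict_linear_order_on (carrier M) R \<and>
     (\<forall>\<phi>. \<exists>K::nat. \<forall>b. valid M b \<longrightarrow>
        (\<exists>\<C>. finite \<C> \<and> card \<C> \<le> K \<and> (\<forall>X\<in>\<C>. convex_wrt (carrier M) R X) \<and>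
             \<Union>\<C> = dset M \<phi> b)))"

text \<open>A set of L(U)-formulas in x (formula + parameter assignment) is consistent
  (with the elementary diagram of U) iff it is finitely satisfiable in U.\<close>
definition consistent_in :: "'b struc \<Rightarrow> (fm \<times> (nat \<Rightarrow> 'b)) set \<Rightarrow> bool" where
  "consistent_in U P \<longleftrightarrow>
     (\<forall>Q \<subseteq> P. finite Q \<longrightarrow> (\<exists>a\<in>carrier U. \<forall>(\<phi>, e)\<in>Q. sat U (e(0 := a)) \<phi>))"

definition dp_small :: "'b struc \<Rightarrow> bool" where
  "dp_small U \<longleftrightarrow> \<not> (\<exists>(\<phi> :: nat \<Rightarrow> fm) (c :: nat \<Rightarrow> nat \<Rightarrow> 'b) (\<psi> :: fm) (b :: nat \<Rightarrow> nat \<Rightarrow> 'b).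
      (\<forall>i. valid U (c i)) \<and> (\<forall>j. valid U (b j)) \<and>
      (\<forall>i0 j0. consistent_in U
         ({(\<phi> i0, c i0), (\<psi>, b j0)} \<union>
          {(Neg (\<phi> i), c i) | i. i \<noteq> i0} \<union>
          {(Neg \<psi>, b j) | j. j \<noteq> j0})))"

definition real_closed :: "'a::linordered_field itself \<Rightarrow> bool" where
  "real_closed _ \<longleftrightarrow>
     (\<forall>x::'a. 0 < x \<longrightarrow> (\<exists>y. y * y = x)) \<and>
     (\<forall>p :: 'a poly. odd (degree p) \<longrightarrow> (\<exists>x. poly p x = 0))"

end

theory Submission
  imports "HOL-Algebra.Algebraic_Closure_Type" "HOL-Library.FuncSet" Defs
begin

text \<open>
  VC-minimality and convex orderability both represent definable sets by boundedly many members of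
  a family of pairwise nested or disjoint sets; such a member cuts at most one class of a finite
  partition generated by others, so there is no array of the kind excluded by dp-smallness.

  If the field \<open>F\<close> is dp-small, arrays with non-uniform rows show that definable subgroups of the
  positive elements are divisible and convex, which makes definable sets tame in one variable and
  gives a dimension theory with an open mapping property for finite-to-one definable maps.
  Applied to \<open>u \<mapsto> g\<close>, where \<open>g\<close> is the minimal polynomial of \<open>u\<close> modulo \<open>f\<close>, it excludes a
  polynomial \<open>f\<close> without roots that takes arbitrarily small values on an interval. A polynomial of
  minimal degree violating the intermediate value property can be rescaled to a small perturbation
  of a linear one; Newton's method then yields a definable valuation ring over whose residue field,
  which is again dp-small, the polynomial is of the excluded kind.

  Conversely, a real closed field has the intermediate value property by Laplace's argument, hence
  quantifier elimination by sign matrices, and is o-minimal uniformly in parameters; this is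
  expressed by sentences and so holds in the monster model.
\<close>

text \<open>A failure of the intermediate value property need not come with small values: a
  polynomial can change sign while its absolute values stay above a positive element. The elements
  below all these absolute values form an ideal, and only modulo this ideal do the values come
  arbitrarily close to 0. This is why the residue field is needed, and why dp-smallness has to be
  shown to pass to it.

  Small values without a root are refuted by dimension instead of continuity. A bad polynomial
  \<open>f\<close> of least degree behaves like an irreducible one. The annihilators modulo
  \<open>f\<close> of non-constant polynomials of lower degree contain an open box of monic
  polynomials, because only boundedly many of these polynomials share an annihilator; yet an
  arbitrarily small change of a constant term gives some annihilator a root in the field.

  The field itself is not saturated, and its order topology is neither compact nor complete. All
  finiteness statements are therefore uniform in parameters, and these bounds replace compactness,
  for instance when a definable positive radius is made constant on a box.\<close>

no_notation var (\<open>X\<index>\<close>)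

section \<open>Formulas and saturation\<close>

lemma evalt_cong: "(!!i. i \<in> fvt t ==> e i = e' i) ==> evalt M e t = evalt M e' t"
 by (induction t) auto

lemma sat_cong: "(!!i. i \<in> fv p ==> e i = e' i) ==> sat M e p = sat M e' p"
proof (induction p arbitrary: e e')
 case (Eq s t)
 then show ?case using evalt_cong[of s e e' M] evalt_cong[of t e e' M] by auto
next
 case (Lt s t)
 then show ?case using evalt_cong[of s e e' M] evalt_cong[of t e e' M] by auto
next
 case (Neg p)
 have "sat M e p = sat M e' p" by (rule Neg.IH) (use Neg.prems in auto)
 then show ?case by simp
next
 case (Conj p q)
 have "sat M e p = sat M e' p" by (rule Conj.IH) (use Conj.prems in auto)
 moreover have "sat M e q = sat M e' q" by (rule Conj.IH) (use Conj.prems in auto)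
 ultimately show ?case by simp
next
 case (Ex n p)
 have "sat M (e(n := a)) p = sat M (e'(n := a)) p" for a
  by (rule Ex.IH) (use Ex.prems in auto)
 then show ?case by simp
qed

lemma finite_fvt [simp]: "finite (fvt t)"
 by (induction t) auto

lemma finite_fv [simp]: "finite (fv p)"
 by (induction p) auto

section \<open>Renaming of variables, finite conjunctions and quantifier blocks\<close>

fun rnt :: "(nat => nat) => tm => tm" where
 "rnt \<rho> (Var n) = Var (\<rho> n)"
| "rnt \<rho> (Add s t) = Add (rnt \<rho> s) (rnt \<rho> t)"
| "rnt \<rho> (Mul s t) = Mul (rnt \<rho> s) (rnt \<rho> t)"

text \<open>Capture is avoided by always choosing a fresh bound variable.\<close>

fun rn :: "(nat => nat) => fm => fm" where
 "rn \<rho> (Eq s t) = Eq (rnt \<rho> s) (rnt \<rho> t)"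
| "rn \<rho> (Lt s t) = Lt (rnt \<rho> s) (rnt \<rho> t)"
| "rn \<rho> (Neg p) = Neg (rn \<rho> p)"
| "rn \<rho> (Conj p q) = Conj (rn \<rho> p) (rn \<rho> q)"
| "rn \<rho> (Ex n p) =
   (let m = Suc (Max (insert 0 (\<rho> ` (fv p - {n})))) in Ex m (rn (\<rho>(n := m)) p))"

lemma evalt_rnt: "evalt M e (rnt \<rho> t) = evalt M (e \<circ> \<rho>) t"
 by (induction t) auto

lemma fvt_rnt: "fvt (rnt \<rho> t) = \<rho> ` fvt t"
 by (induction t) auto

lemma fresh_Max: "finite A ==> Suc (Max (insert 0 A)) ~: A"
 by (metis Max_ge finite.insertI insertI2 not_less_eq_eq order_refl)

lemma sat_rn: "sat M e (rn \<rho> p) = sat M (e \<circ> \<rho>) p"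
proof (induction p arbitrary: e \<rho>)
 case (Ex n p)
 define m where "m = Suc (Max (insert 0 (\<rho> ` (fv p - {n}))))"
 have m: "m ~: \<rho> ` (fv p - {n})" unfolding m_def by (rule fresh_Max) auto
 have "sat M (e(m := a)) (rn (\<rho>(n := m)) p) = sat M ((e \<circ> \<rho>)(n := a)) p" for a
  unfolding Ex.IH by (rule sat_cong) (use m in auto)
 then show ?case by (simp only: rn.simps Let_def m_def[symmetric] sat.simps)
qed (auto simp: evalt_rnt)

lemma fv_rn: "fv (rn \<rho> p) = \<rho> ` fv p"
proof (induction p arbitrary: \<rho>)
 case (Ex n p)
 define m where "m = Suc (Max (insert 0 (\<rho> ` (fv p - {n}))))"
 have m: "m ~: \<rho> ` (fv p - {n})" unfolding m_def by (rule fresh_Max) auto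
 show ?case using m by (auto simp add: Let_def m_def[symmetric] Ex.IH)
qed (auto simp: fvt_rnt)

definition Tru :: fm where "Tru = Neg (Ex 0 (Neg (Eq (Var 0) (Var 0))))"

lemma sat_Tru [simp]: "sat M e Tru" and fv_Tru [simp]: "fv Tru = {}"
 by (auto simp: Tru_def)

definition conjs :: "fm list => fm" where "conjs ps = foldr Conj ps Tru"

lemma sat_conjs [simp]: "sat M e (conjs ps) \<longleftrightarrow> (ALL p:set ps. sat M e p)"
 by (induction ps) (auto simp: conjs_def)

lemma fv_conjs [simp]: "fv (conjs ps) = (\<Union>p\<in>set ps. fv p)"
 by (induction ps) (auto simp: conjs_def)

definition exs :: "nat list => fm => fm" where "exs xs p = foldr Ex xs p"

lemma fv_exs [simp]: "fv (exs xs p) = fv p - set xs"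
 by (induction xs) (auto simp: exs_def)

lemma sat_exs: "sat M e (exs xs p) \<longleftrightarrow>
 (EX e'. (ALL i. i ~: set xs --> e' i = e i) & (ALL i:set xs. e' i \<in> carrier M) & sat M e' p)"
proof (induction xs arbitrary: e)
 case Nil
 have "e' = e" if "ALL i. e' i = e i" for e' :: "nat => 'a" using that by auto
 then show ?case by (auto simp: exs_def)
next
 case (Cons x xs)
 have *: "exs (x # xs) p = Ex x (exs xs p)" by (simp add: exs_def)
 show ?case unfolding * sat.simps Cons.IH
 proof safe
  fix a e' assume a: "a \<in> carrier M" "ALL i. i ~: set xs --> e' i = (e(x := a)) i"
   "ALL i:set xs. e' i \<in> carrier M" "sat M e' p"
  have "e' i \<in> carrier M" if "i \<in> set (x # xs)" for i
   using a that by (cases "i \<in> set xs") auto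
  moreover have "e' i = e i" if "i ~: set (x # xs)" for i using a that by auto
  ultimately show "EX e'. (ALL i. i ~: set (x # xs) --> e' i = e i) & (ALL i:set (x # xs). e' i \<in> carrier M) & sat M e' p"
   using a(4) by blast
 next
  fix e' assume a: "ALL i. i ~: set (x # xs) --> e' i = e i" "ALL i:set (x # xs). e' i \<in> carrier M" "sat M e' p"
  then show "EX a:carrier M. EX e'. (ALL i. i ~: set xs --> e' i = (e(x := a)) i) & (ALL i:set xs. e' i \<in> carrier M) & sat M e' p"
   by (intro bexI[of _ "e' x"] exI[of _ e']) auto
 qed
qed

lemma valid_ofield [simp]: "valid ofield e" "carrier ofield = UNIV"
 "sadd ofield = (+)" "smul ofield = (*)" "slt ofield = (<)"
 by (auto simp: valid_def ofield_def)

lemma sat_closed: "fv p = {} ==> sat M e p = sat M e' p"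
 by (rule sat_cong) auto

text \<open>The theory of a single structure is complete: the sentence or its negation belongs to
  it, so truth passes in both directions.\<close>

lemma Th_transfer:
 fixes U :: "'b struc"
 assumes "is_model U (Th (ofield :: 'a::linordered_field struc))" "fv p = {}" "valid U e"
 shows "sat U e p \<longleftrightarrow> sat (ofield :: 'a struc) e' p"
proof (cases "sat (ofield :: 'a struc) e' p")
 case True
 then have "p \<in> Th (ofield :: 'a struc)" using assms(2) sat_closed[of p] by (auto simp: Th_def)
 then show ?thesis using assms True by (auto simp: is_model_def)
next
 case False
 then have "Neg p \<in> Th (ofield :: 'a struc)" using assms(2) sat_closed[of p] by (auto simp: Th_def)
 then have "sat U e (Neg p)" using assms by (auto simp: is_model_def)
 then show ?thesis using False by auto
qed

text \<open>Saturation in one variable gives it in countably many: variables are assigned one after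
  the other, and the invariant \<open>good\<close> keeps every finite part of \<open>S\<close>
  satisfiable together with the values already chosen. The next value realises the type in which all
  later variables are quantified existentially.\<close>

lemma omega_saturated:
 fixes U :: "'b struc"
 assumes sat: "aleph1_saturated U"
  and fin: "!!Q. Q \<subseteq> S ==> finite Q ==> EX e. valid U e & (ALL p:Q. sat U e p)"
 shows "EX e. valid U e & (ALL p:S. sat U e p)"
proof -
 define good where "good n e \<longleftrightarrow> valid U e & (\<forall>Q\<subseteq> S. finite Q -->
   (EX e'. valid U e' & (ALL i<n. e' i = e i) & (ALL p:Q. sat U e' p)))" for n and e :: "nat => 'b"
 obtain e0 where e0: "valid U e0" using fin[of "{}"] by auto
 have good0: "good 0 e0" using e0 fin by (auto simp: good_def)
 have step: "EX e'. good (Suc n) e' & (ALL i<n. e' i = e i)" if g: "good n e" for n e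
 proof -
  \<comment> \<open>The variable being assigned becomes the home variable 0; the others move up by
    one, and \<open>c\<close> moves their values along.\<close>
  define \<rho> where "\<rho> i = (if i = n then 0 else Suc i)" for i
  define c where "c i = (case i of 0 => e 0 | Suc j => e j)" for i
  have vc: "valid U c" using g by (auto simp: c_def valid_def good_def split: nat.splits)
  define vs where "vs Q = sorted_list_of_set ((\<Union>p\<in>Q. fv p) - {..n})" for Q
  define \<theta> where "\<theta> Q = exs (vs Q) (conjs (SOME l. set l = Q))" for Q
  have set_some: "set (SOME l. set l = Q) = Q" if "finite Q" for Q :: "fm set"
   using finite_list[OF that] by (rule someI_ex)
  have fv\<theta>: "fv (\<theta> Q) \<subseteq> {..n}" if "finite Q" for Q
   using that by (auto simp: \<theta>_def vs_def set_some)
  have sat\<theta>: "sat U (c(0 := a)) (rn \<rho> (\<theta> Q)) \<longleftrightarrow>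
    (EX e'. valid U e' & (ALL i<n. e' i = e i) & e' n = a & (ALL p:Q. sat U e' p))"
   if Q: "finite Q" and a: "a \<in> carrier U" for Q a
  proof
   assume "sat U (c(0 := a)) (rn \<rho> (\<theta> Q))"
   then obtain e' where e': "ALL i. i ~: set (vs Q) --> e' i = (c(0 := a) \<circ> \<rho>) i"
    "ALL i:set (vs Q). e' i \<in> carrier U" "ALL p:Q. sat U e' p"
    unfolding sat_rn \<theta>_def sat_exs using Q by (auto simp: set_some)
   have "valid U (c(0 := a) \<circ> \<rho>)" using vc a by (auto simp: valid_def)
   then have "valid U e'" using e'(1,2) unfolding valid_def
    by (metis image_subset_iff rangeI)
   moreover have "set (vs Q) \<inter> {..n} = {}" using Q by (auto simp: vs_def)
   then have "ALL i<=n. e' i = (c(0 := a) \<circ> \<rho>) i" using e'(1) by auto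
   then have "ALL i<n. e' i = e i" "e' n = a" by (auto simp: \<rho>_def c_def)
   ultimately show "EX e'. valid U e' & (ALL i<n. e' i = e i) & e' n = a & (ALL p:Q. sat U e' p)"
    using e'(3) by blast
  next
   assume "EX e'. valid U e' & (ALL i<n. e' i = e i) & e' n = a & (ALL p:Q. sat U e' p)"
   then obtain e' where e': "valid U e'" "ALL i<n. e' i = e i" "e' n = a" "ALL p:Q. sat U e' p" by auto
   define e2 where "e2 i = (if i \<in> set (vs Q) then e' i else (c(0 := a) \<circ> \<rho>) i)" for i
   have "sat U e2 p" if "p \<in> Q" for p
   proof -
    have "sat U e2 p = sat U e' p"
    proof (rule sat_cong)
     fix i assume i: "i \<in> fv p"
     show "e2 i = e' i"
     proof (cases "i <= n")
      case True
      have "i ~: set (vs Q)" using Q True by (auto simp: vs_def)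
      then show ?thesis using e' True by (auto simp: e2_def \<rho>_def c_def)
     next
      case False
      then have "i \<in> set (vs Q)" using Q i that by (auto simp: vs_def)
      then show ?thesis by (auto simp: e2_def)
     qed
    qed
    then show ?thesis using e' that by auto
   qed
   then show "sat U (c(0 := a)) (rn \<rho> (\<theta> Q))"
    unfolding sat_rn \<theta>_def sat_exs using Q e'(1)
    by (intro exI[of _ e2]) (auto simp: set_some e2_def valid_def)
  qed
  let ?P = "{(rn \<rho> (\<theta> Q), c) | Q. Q \<subseteq> S & finite Q}"
  have "EX a:carrier U. ALL (\<phi>, e):?P. sat U (e(0 := a)) \<phi>"
  proof (rule sat[unfolded aleph1_saturated_def, rule_format, of "insert (e 0) (e ` {..<n})"])
   show "insert (e 0) (e ` {..<n}) \<subseteq> carrier U" using g by (auto simp: good_def valid_def)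
   show "case x of (\<phi>, e') => valid U e' & e' ` (fv \<phi> - {0}) \<subseteq> insert (e 0) (e ` {..<n})"
    if xP: "x \<in> ?P" for x
   proof -
    obtain Q where Q: "x = (rn \<rho> (\<theta> Q), c)" "finite Q" using xP by blast
    have "c ` (\<rho> ` fv (\<theta> Q) - {0}) \<subseteq> e ` {..<n}"
     using fv\<theta>[OF Q(2)] by (auto simp: \<rho>_def c_def split: if_splits)
    then show ?thesis using Q vc by (auto simp: fv_rn)
   qed
   fix R assume R: "R \<subseteq> ?P" "finite R"
   have "ALL x:R. EX Q. x = (rn \<rho> (\<theta> Q), c) & Q \<subseteq> S & finite Q" using R by auto
   then obtain q where q: "ALL x:R. x = (rn \<rho> (\<theta> (q x)), c) & q x \<subseteq> S & finite (q x)" by metis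
   let ?Q = "\<Union>x\<in>R. q x"
   have "?Q \<subseteq> S" "finite ?Q" using q R by auto
   then obtain e' where e': "valid U e'" "ALL i<n. e' i = e i" "ALL p:?Q. sat U e' p"
    using g unfolding good_def by blast
   have a: "e' n \<in> carrier U" using e' by (auto simp: valid_def)
   show "EX a:carrier U. ALL (\<phi>, e):R. sat U (e(0 := a)) \<phi>"
   proof (intro bexI[OF _ a], safe)
    fix \<phi> e2 assume x: "(\<phi>, e2) \<in> R"
    then have *: "\<phi> = rn \<rho> (\<theta> (q (\<phi>, e2)))" "e2 = c" "finite (q (\<phi>, e2))" using q by blast+
    have "sat U (c(0 := e' n)) (rn \<rho> (\<theta> (q (\<phi>, e2))))"
     unfolding sat\<theta>[OF *(3) a] using e' x by blast
    then show "sat U (e2(0 := e' n)) \<phi>" using * by simp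
   qed
  qed auto
  then obtain a where a: "a \<in> carrier U" and aP: "ALL (\<phi>, e):?P. sat U (e(0 := a)) \<phi>" by blast
  have "good (Suc n) (e(n := a))"
   unfolding good_def
  proof (intro conjI allI impI)
   show "valid U (e(n := a))" using g a by (auto simp: good_def valid_def)
   fix Q assume Q: "Q \<subseteq> S" "finite Q"
   then have "sat U (c(0 := a)) (rn \<rho> (\<theta> Q))" using aP by blast
   then show "EX e'. valid U e' & (ALL i<Suc n. e' i = (e(n := a)) i) & (ALL p:Q. sat U e' p)"
    unfolding sat\<theta>[OF Q(2) a] by (auto simp: less_Suc_eq)
  qed
  then show ?thesis by (intro exI[of _ "e(n := a)"]) auto
 qed
 obtain f where f: "!!n. good n (f n)" "!!n. ALL i<n. f (Suc n) i = f n i"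
  using dependent_nat_choice[of good "%n e e'. ALL i<n. e' i = e i"] good0 step by blast
 define e where "e i = f (Suc i) i" for i
 have agree: "f n i = e i" if "i < n" for i n
  using that
 proof (induction n)
  case (Suc n)
  then show ?case using f(2)[of n] by (cases "i = n") (auto simp: e_def)
 qed simp
 have "valid U e" using f(1) unfolding good_def valid_def e_def by (auto simp: image_subset_iff)
 moreover have "sat U e p" if p: "p \<in> S" for p
 proof -
  define N where "N = Suc (Max (insert 0 (fv p)))"
  have N: "i < N" if "i \<in> fv p" for i unfolding N_def using that by (simp add: le_imp_less_Suc)
  obtain e' where e': "ALL i<N. e' i = f N i" "sat U e' p"
   using f(1)[of N] p unfolding good_def by (metis empty_subsetI finite.simps insert_subset singletonI)
  have "sat U e p = sat U e' p" by (rule sat_cong) (use N e' agree in auto)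
  then show ?thesis using e' by auto
 qed
 ultimately show ?thesis by blast
qed

section \<open>Definability over an ordered field\<close>

text \<open>Each variable of the formula is read off either a coordinate of the assignment or a constant.\<close>

definition proj :: "((nat => 'a) => 'a) => bool" where
 "proj t \<longleftrightarrow> (EX k. t = (%e. e k)) | (EX c. t = (%_. c))"

definition Def :: "((nat => 'a::linordered_field) => bool) => bool" where
 "Def P \<longleftrightarrow> (EX \<phi> v. (ALL i. proj (v i)) & (ALL e. P e = sat ofield (%i. v i e) \<phi>))"

definition DefT :: "((nat => 'a::linordered_field) => 'a) => bool" where
 "DefT t \<longleftrightarrow> Def (%e. e 0 = t (%i. e (Suc i)))"

section \<open>Closure properties of definable predicates and terms\<close>

lemma proj_coord [simp]: "proj (%e. e k)" "proj (%_. c)"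
 by (auto simp: proj_def)

lemma proj_if: "proj s ==> proj t ==> proj (%e. if b then s e else t e)"
 by (cases b) auto

lemma DefI: "(!!i. proj (v i)) ==> (!!e. P e = sat ofield (%i. v i e) \<phi>) ==> Def P"
 unfolding Def_def by (intro exI[of _ \<phi>] exI[of _ v]) auto

lemma proj_comp:
 assumes "proj t" "!!i. proj (u i)" shows "proj (%e. t (%k. u k e))"
 using assms(1) unfolding proj_def[of t]
proof
 assume "EX k. t = (%e. e k)"
 then show ?thesis using assms(2) by auto
next
 assume "EX c. t = (%_. c)"
 then show ?thesis by auto
qed

lemma Def_proj:
 assumes "Def P" "!!i. proj (u i)" shows "Def (%e. P (%i. u i e))"
proof -
 obtain v \<phi> where v': "(ALL i. proj (v i)) & (ALL e. P e = sat ofield (%i. v i e) \<phi>)"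
  using assms(1) unfolding Def_def by (elim exE) (rule that)
 note v = v'[THEN conjunct1, THEN spec] v'[THEN conjunct2, THEN spec]
 have "proj (%e. v i (%k. u k e))" for i
  by (rule proj_comp[of "v i" u]) (use v assms(2) in auto)
 then show ?thesis
  by (rule DefI[where \<phi> = \<phi>]) (use v in auto)
qed

lemma Def_not: assumes "Def P" shows "Def (%e. ~ P e)"
proof -
 obtain v \<phi> where v': "(ALL i. proj (v i)) & (ALL e. P e = sat ofield (%i. v i e) \<phi>)"
  using assms(1) unfolding Def_def by (elim exE) (rule that)
 note v = v'[THEN conjunct1, THEN spec] v'[THEN conjunct2, THEN spec]
 show ?thesis by (rule DefI[where \<phi> = "Neg \<phi>" and v = v]) (use v in auto)
qed

lemma Def_conj: assumes "Def P" "Def Q" shows "Def (%e. P e & Q e)"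
proof -
 obtain v \<phi> where h1: "(ALL i. proj (v i)) & (ALL e. P e = sat ofield (%i. v i e) \<phi>)"
  using assms(1) unfolding Def_def by (elim exE) (rule that)
 note 1 = h1[THEN conjunct1, THEN spec] h1[THEN conjunct2, THEN spec]
 obtain w \<psi> where h2: "(ALL i. proj (w i)) & (ALL e. Q e = sat ofield (%i. w i e) \<psi>)"
  using assms(2) unfolding Def_def by (elim exE) (rule that)
 note 2 = h2[THEN conjunct1, THEN spec] h2[THEN conjunct2, THEN spec]
 \<comment> \<open>Even variables serve the first formula and odd ones the second, so that a single
   family of reads fits both.\<close>
 show ?thesis
  by (rule DefI[where \<phi> = "Conj (rn (%i. 2 * i) \<phi>) (rn (%i. 2 * i + 1) \<psi>)"
    and v = "%i. if even i then v (i div 2) else w (i div 2)"])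
   (use 1 2 in \<open>auto simp: sat_rn comp_def\<close>)
qed

lemma Def_ex: assumes "Def (%e. Q (%i. e (Suc i)) (e 0))" shows "Def (%e. EX a. Q e a)"
proof -
 obtain v \<phi> where h1: "(ALL i. proj (v i)) & (ALL e. Q (%i. e (Suc i)) (e 0) = sat ofield (%i. v i e) \<phi>)"
  using assms(1) unfolding Def_def by (elim exE) (rule that)
 note 1 = h1[THEN conjunct1, THEN spec] h1[THEN conjunct2, THEN spec]
 \<comment> \<open>Variables that read coordinate 0 are merged into the bound variable 0. The others
   move up by one; they do not depend on coordinate 0, which \<open>w\<close> may therefore fill
   with a dummy.\<close>
 define \<rho> where "\<rho> i = (if v i = (%e. e 0) then 0 else Suc i)" for i
 define w where "w j = (%e. v (j - 1) (case_nat 0 e))" for j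
 have ind: "v i (case_nat a e) = v i (case_nat b e)" if "v i ~= (%e. e 0)" for i a b e
  using 1(1)[of i] that unfolding proj_def by (auto split: nat.splits)
 have "proj (w j)" for j
  unfolding w_def using 1(1)[of "j - 1"] unfolding proj_def
 proof (elim disjE exE)
  fix k assume "v (j - 1) = (%e. e k)"
  then show "(EX k. (%e. v (j - 1) (case_nat 0 e)) = (%e. e k)) | (EX c. (%e. v (j - 1) (case_nat 0 e)) = (%_. c))"
   by (cases k) auto
 qed auto
 moreover have "(EX a. Q e a) = sat ofield (%i. w i e) (Ex 0 (rn \<rho> \<phi>))" for e
 proof -
  have "Q e a = sat ofield ((%i. w i e)(0 := a)) (rn \<rho> \<phi>)" for a
  proof -
   have "(%i. v i (case_nat a e)) = ((%i. w i e)(0 := a)) \<circ> \<rho>"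
    using ind[of _ 0 e a] by (auto simp: \<rho>_def w_def fun_eq_iff)
   then show ?thesis using 1(2)[of "case_nat a e"] by (simp add: sat_rn)
  qed
  then show ?thesis by auto
 qed
 ultimately show ?thesis by (intro DefI[where \<phi> = "Ex 0 (rn \<rho> \<phi>)" and v = w])
qed

lemma Def_all: assumes "Def (%e. Q (%i. e (Suc i)) (e 0))" shows "Def (%e. ALL a. Q e a)"
proof -
 have "Def (%e. ~ (EX a. ~ Q e a))" by (rule Def_not, rule Def_ex, rule Def_not, rule assms)
 then show ?thesis by simp
qed

lemma Def_disj: assumes "Def P" "Def Q" shows "Def (%e. P e | Q e)"
proof -
 have "Def (%e. ~ (~ P e & ~ Q e))" by (intro Def_not Def_conj assms)
 then show ?thesis by simp
qed

lemma Def_imp: assumes "Def P" "Def Q" shows "Def (%e. P e --> Q e)"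
proof -
 have "Def (%e. ~ (P e & ~ Q e))" by (intro Def_not Def_conj assms)
 then show ?thesis by simp
qed

lemma Def_iff: assumes "Def P" "Def Q" shows "Def (%e. P e \<longleftrightarrow> Q e)"
proof -
 have "Def (%e. (P e --> Q e) & (Q e --> P e))" by (intro Def_imp Def_conj assms)
 then show ?thesis by (simp add: iff_conv_conj_imp)
qed

lemma Def_const: "Def (%e. c)"
 by (rule DefI[where \<phi> = "if c then Tru else Neg Tru" and v = "%i e. 0"]) auto

lemma Def_eq_proj: assumes "proj s" "proj t" shows "Def (%e. s e = t e)"
 by (rule DefI[where \<phi> = "Eq (Var 0) (Var 1)" and v = "%i. if i = 0 then s else t"]) (use assms in auto)

lemma Def_less_proj: assumes "proj s" "proj t" shows "Def (%e. s e < t e)"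
 by (rule DefI[where \<phi> = "Lt (Var 0) (Var 1)" and v = "%i. if i = 0 then s else t"]) (use assms in auto)

lemma Def_add_proj: assumes "proj s" "proj t" "proj u" shows "Def (%e. s e + t e = u e)"
 by (rule DefI[where \<phi> = "Eq (Add (Var 0) (Var 1)) (Var 2)" and v = "%i. if i = 0 then s else if i = 1 then t else u"])
  (use assms in auto)

lemma Def_mult_proj: assumes "proj s" "proj t" "proj u" shows "Def (%e. s e * t e = u e)"
 by (rule DefI[where \<phi> = "Eq (Mul (Var 0) (Var 1)) (Var 2)" and v = "%i. if i = 0 then s else if i = 1 then t else u"])
  (use assms in auto)

lemma Def_subst1:
 assumes "Def (%e. Q (%i. e (Suc i)) (e 0))" "DefT t" shows "Def (%e. Q e (t e))"
proof -
 have "Def (%e. EX a. a = t e & Q e a)"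
  by (rule Def_ex, rule Def_conj) (use assms in \<open>auto simp: DefT_def\<close>)
 then show ?thesis by simp
qed

lemma sat_depends:
 assumes "Def P" obtains N where "!!e e'. (!!k. k < N ==> e k = e' k) ==> P e = P e'"
proof -
 obtain v \<phi> where h1: "(ALL i. proj (v i)) & (ALL e. P e = sat ofield (%i. v i e) \<phi>)"
  using assms(1) unfolding Def_def by (elim exE) (rule that)
 note 1 = h1[THEN conjunct1, THEN spec] h1[THEN conjunct2, THEN spec]
 have "EX k. ALL e e'. e k = e' k --> v i e = v i e'" for i
  using 1(1)[of i] by (auto simp: proj_def)
 then obtain \<kappa> where \<kappa>: "!!i e e'. e (\<kappa> i) = e' (\<kappa> i) ==> v i e = v i e'" by metis
 define N where "N = Suc (Max (insert 0 (\<kappa> ` fv \<phi>)))"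
 have N: "\<kappa> i < N" if "i \<in> fv \<phi>" for i
  unfolding N_def using that by (simp add: le_imp_less_Suc)
 show thesis
 proof (rule that)
  fix e e' :: "nat => 'a" assume "!!k. k < N ==> e k = e' k"
  then have "v i e = v i e'" if "i \<in> fv \<phi>" for i using \<kappa>[of e i e'] N[OF that] by auto
  then show "P e = P e'" unfolding 1(2) by (intro sat_cong) auto
 qed
qed

lemma DefT_proj: "proj t ==> DefT t"
 unfolding DefT_def
 by (rule Def_eq_proj) (use proj_comp[of t "%i e. e (Suc i)"] in auto)

text \<open>A formula looks at finitely many coordinates, so infinitely many substitutions reduce to
  \<open>N\<close> of them, made one at a time. The arguments of \<open>u\<close> are read from
  position \<open>N\<close> on, out of reach of the coordinates already replaced.\<close>

lemma Def_subst:
 assumes "Def P" "!!i. DefT (%e. u e i)" shows "Def (%e. P (u e))"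
proof -
 obtain N where N: "!!e e'. (!!k. k < N ==> e k = e' k) ==> P e = P e'"
  using sat_depends[OF assms(1)] by blast
 have "n <= N ==> Def (%e. P (%i. if i < n then u (%k. e (k + N)) i else e i))" for n
 proof (induction n)
  case 0
  then show ?case using assms(1) by simp
 next
  case (Suc n)
  let ?Q = "%e a. P (%i. if i < n then u (%k. e (k + N)) i else if i = n then a else e i)"
  have "Def (%e. ?Q e (u (%k. e (k + N)) n))"
  proof (rule Def_subst1)
   have IH: "Def (%e. P (%i. if i < n then u (%k. e (k + N)) i else e i))" using Suc by auto
   have pj: "proj (%e. if j = n then e 0 else e (Suc j))" for j by (intro proj_if proj_coord)
   have "(%e. P (%i. if i < n then u (%k. (%j. if j = n then e 0 else e (Suc j)) (k + N)) i
             else (%j. if j = n then e 0 else e (Suc j)) i)) =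
     (%e. ?Q (%i. e (Suc i)) (e 0))"
    using Suc.prems by (auto intro!: ext arg_cong[where f = P] simp: fun_eq_iff)
   with Def_proj[OF IH, of "%j e. if j = n then e 0 else e (Suc j)", OF pj]
   show "Def (%e. ?Q (%i. e (Suc i)) (e 0))" by simp
   show "DefT (%e. u (%k. e (k + N)) n)"
    using Def_proj[OF assms(2)[of n, unfolded DefT_def], of "%i e. if i = 0 then e 0 else e (i + N)"]
    unfolding DefT_def by (simp add: proj_if)
  qed
  moreover have "(%e. ?Q e (u (%k. e (k + N)) n)) = (%e. P (%i. if i < Suc n then u (%k. e (k + N)) i else e i))"
   by (auto intro!: ext arg_cong[where f = P] simp: fun_eq_iff less_Suc_eq)
  ultimately show ?case by simp
 qed
 from this[of N] have "Def (%e. P (%i. if i < N then u (%k. e (k + N)) i else e i))" by simp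
 moreover have "(%e. P (%i. if i < N then u (%k. e (k + N)) i else e i)) = (%e. P (u (%k. e (k + N))))"
  by (rule ext, rule N) auto
 ultimately have "Def (%e. P (u (%k. e (k + N))))" by simp
 \<comment> \<open>Reading \<open>e (j - N)\<close> undoes the shift, because
   \<open>(k + N) - N = k\<close>.\<close>
 from Def_proj[OF this, of "%j e. e (j - N)"] show ?thesis by auto
qed

lemma DefT_coord: "DefT (%e. e k)" "DefT (%_. c)"
 by (auto intro: DefT_proj)

lemma DefT_subst:
 assumes "DefT t" "!!i. DefT (%e. u e i)" shows "DefT (%e. t (u e))"
proof -
 have sh: "DefT (%e. u (%i. e (Suc i)) j)" for j
  using Def_proj[OF assms(2)[of j, unfolded DefT_def], of "%i e. if i = 0 then e 0 else e (Suc i)"]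
  unfolding DefT_def by (simp add: proj_if)
 have "DefT (%e. case_nat (e 0) (u (%i. e (Suc i))) j)" for j
  using sh DefT_coord by (cases j) auto
 from Def_subst[OF assms(1)[unfolded DefT_def], of "%e. case_nat (e 0) (u (%i. e (Suc i)))", OF this]
 show ?thesis unfolding DefT_def by simp
qed

lemma DefT_case_nat:
 assumes "DefT s" "!!i. DefT (%e. f e i)" shows "DefT (%e. case_nat (s e) (f e) i)"
 using assms by (cases i) auto

lemma DefT_shift: assumes "DefT t" shows "DefT (%e. t (%i. e (Suc i)))"
 by (rule DefT_subst[OF assms, of "%e i. e (Suc i)"]) (rule DefT_coord)

lemma Def_shift: assumes "Def P" shows "Def (%e. P (%i. e (Suc i)))"
 by (rule Def_subst[OF assms, of "%e i. e (Suc i)"]) (rule DefT_coord)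

lemma Def_less: assumes "DefT s" "DefT t" shows "Def (%e. s e < t e)"
 using Def_subst[OF Def_less_proj[OF proj_coord(1)[of 0] proj_coord(1)[of 1]], where u = "%e. case_nat (s e) (%_. t e)"]
  DefT_case_nat[OF assms(1), of "%e _. t e"] assms by auto

lemma Def_eq: assumes "DefT s" "DefT t" shows "Def (%e. s e = t e)"
 using Def_subst[OF Def_eq_proj[OF proj_coord(1)[of 0] proj_coord(1)[of 1]], where u = "%e. case_nat (s e) (%_. t e)"]
  DefT_case_nat[OF assms(1), of "%e _. t e"] assms by auto

lemma Def_le: assumes "DefT s" "DefT t" shows "Def (%e. s e <= t e)"
 using Def_not[OF Def_less[OF assms(2,1)]] by (simp add: not_less)

lemma DefT_op2:
 assumes "Def (%e. e 0 = f (e 1) (e 2))" "DefT s" "DefT t" shows "DefT (%e. f (s e) (t e))"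
proof -
 have "DefT (%e. (case_nat (e 0) (case_nat (s (%i. e (Suc i))) (%_. t (%i. e (Suc i))))) i)" for i
  by (intro DefT_case_nat DefT_coord DefT_shift assms)
 from Def_subst[OF assms(1), of "%e. case_nat (e 0) (case_nat (s (%i. e (Suc i))) (%_. t (%i. e (Suc i))))", OF this]
 show ?thesis unfolding DefT_def by (simp add: numeral_2_eq_2)
qed

lemma DefT_add: "DefT s ==> DefT t ==> DefT (%e. s e + t e)"
 using DefT_op2[of "(+)" s t] Def_add_proj[OF proj_coord(1)[of 1] proj_coord(1)[of 2] proj_coord(1)[of 0]]
 by (simp add: eq_commute)

lemma DefT_mult: "DefT s ==> DefT t ==> DefT (%e. s e * t e)"
 using DefT_op2[of "(*)" s t] Def_mult_proj[OF proj_coord(1)[of 1] proj_coord(1)[of 2] proj_coord(1)[of 0]]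
 by (simp add: eq_commute)

lemma DefT_diff: "DefT s ==> DefT t ==> DefT (%e. s e - t e)"
 using DefT_op2[of "(-)" s t] Def_add_proj[OF proj_coord(1)[of 0] proj_coord(1)[of 2] proj_coord(1)[of 1]]
 by (simp add: eq_diff_eq)

lemma DefT_uminus: "DefT t ==> DefT (%e. - t e)"
 using DefT_diff[OF DefT_coord(2)[of 0]] by simp

lemma DefT_if: assumes "Def P" "DefT s" "DefT t" shows "DefT (%e. if P e then s e else t e)"
proof -
 have "Def (%e. (P (%i. e (Suc i)) --> e 0 = s (%i. e (Suc i))) & (~ P (%i. e (Suc i)) --> e 0 = t (%i. e (Suc i))))"
  by (intro Def_conj Def_imp Def_not Def_shift Def_eq DefT_shift DefT_coord assms)
 then show ?thesis unfolding DefT_def by (simp add: if_split)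
qed

lemma DefT_divide:
 fixes s t :: "(nat => 'a::linordered_field) => 'a"
 shows "DefT s ==> DefT t ==> DefT (%e. s e / t e)"
proof (rule DefT_op2[where f = "(/)"])
 have "Def (%e :: nat => 'a. (e 2 = 0 --> e 0 = 0) & (e 2 ~= 0 --> e 0 * e 2 = e 1))"
  by (intro Def_conj Def_imp Def_not Def_eq DefT_mult DefT_coord)
 moreover have "(%e :: nat => 'a. (e 2 = 0 --> e 0 = 0) & (e 2 ~= 0 --> e 0 * e 2 = e 1)) = (%e. e 0 = e 1 / e 2)"
  by (auto simp: fun_eq_iff field_simps)
 ultimately show "Def (%e :: nat => 'a. e 0 = e 1 / e 2)" by simp
qed

lemma DefT_abs: "DefT t ==> DefT (%e. \<bar>t e\<bar>)"
 unfolding abs_if by (intro DefT_if DefT_uminus Def_less DefT_coord)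

lemma DefT_power: "DefT t ==> DefT (%e. t e ^ n)"
 by (induction n) (simp_all add: DefT_mult DefT_coord)

lemmas DefT_intros = DefT_coord DefT_add DefT_mult DefT_diff DefT_uminus DefT_divide DefT_abs DefT_power
lemmas Def_intros = Def_not Def_conj Def_disj Def_imp Def_iff Def_ex Def_all Def_less Def_le Def_eq Def_const DefT_intros

definition Def1 :: "('a::linordered_field => (nat => 'a) => bool) => bool" where
 "Def1 X \<longleftrightarrow> Def (%e. X (e 0) (%i. e (Suc i)))"

lemma Def1_app:
 assumes "Def1 X" "DefT t" "!!i. DefT (%e. u e i)" shows "Def (%e. X (t e) (u e))"
 using Def_subst[OF assms(1)[unfolded Def1_def], where u = "%e. case_nat (t e) (u e)"]
  DefT_case_nat[OF assms(2,3)] by auto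

lemma Def_finite_all: "finite I ==> (!!i. i \<in> I ==> Def (P i)) ==> Def (%e. ALL i:I. P i e)"
 by (induction I rule: finite_induct) (simp_all add: Def_const Def_conj)

lemma Def_finite_ex: "finite I ==> (!!i. i \<in> I ==> Def (P i)) ==> Def (%e. EX i:I. P i e)"
 by (induction I rule: finite_induct) (simp_all add: Def_const Def_disj)

text \<open>Leads back from semantic definability to the syntax used by \<open>dp_small\<close>:
  reads of coordinate 0 become the home variable, and all else is a parameter.\<close>

lemma Def1_formula:
 assumes "Def1 X" shows "EX \<phi>. ALL e. EX c. ALL x. X x e = sat ofield (c(0 := x)) \<phi>"
proof -
 obtain v \<phi> where h1: "(ALL i. proj (v i)) & (ALL e. X (e 0) (%i. e (Suc i)) = sat ofield (%i. v i e) \<phi>)"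
  using assms(1) unfolding Def_def Def1_def by (elim exE) (rule that)
 note 1 = h1[THEN conjunct1, THEN spec] h1[THEN conjunct2, THEN spec]
 define \<rho> where "\<rho> i = (if v i = (%e. e 0) then 0 else Suc i)" for i
 have ind: "v i (case_nat a e) = v i (case_nat b e)" if "v i ~= (%e. e 0)" for i a b e
  using 1(1)[of i] that unfolding proj_def by (auto split: nat.splits)
 have "X x e = sat ofield ((%j. v (j - 1) (case_nat 0 e))(0 := x)) (rn \<rho> \<phi>)" for x e
 proof -
  have "(%i. v i (case_nat x e)) = ((%j. v (j - 1) (case_nat 0 e))(0 := x)) \<circ> \<rho>"
   using ind[of _ 0 e x] by (auto simp: \<rho>_def fun_eq_iff)
  then show ?thesis using 1(2)[of "case_nat x e"] by (simp add: sat_rn)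
 qed
 then show ?thesis by blast
qed

section \<open>Dp-smallness and nested families\<close>

definition array :: "nat => (nat => 'x => bool) => (nat => 'x => bool) => bool" where
 "array n A B \<longleftrightarrow>
  (ALL i0<n. ALL j0<n. EX x. (ALL i<n. A i x \<longleftrightarrow> i = i0) & (ALL j<n. B j x \<longleftrightarrow> j = j0))"

text \<open>The finitary version of dp-smallness, which does not need saturation.\<close>

definition dps :: "'a::linordered_field itself => bool" where
 "dps _ \<longleftrightarrow> ~ (EX (\<Phi> :: nat => 'a => (nat => 'a) => bool) \<Psi>.
   (ALL i. Def1 (\<Phi> i)) & Def1 \<Psi> &
   (ALL n. EX c b. array n (%i x. \<Phi> i x (c i)) (%j x. \<Psi> x (b j))))"

lemma array_mono: "array n A B ==> m <= n ==> array m A B"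
 unfolding array_def by (meson less_le_trans)

lemma finite_UN_mono:
 fixes R :: "nat => 'x set"
 assumes "finite Q" "Q \<subseteq> (\<Union>m. R m)" "mono R" shows "EX m. Q \<subseteq> R m"
 using assms(1,2)
proof (induction Q rule: finite_induct)
 case (insert x Q)
 then obtain m k where "Q \<subseteq> R m" "x \<in> R k" by auto
 moreover have "R m \<subseteq> R (max m k)" "R k \<subseteq> R (max m k)" using monoD[OF assms(3)] by auto
 ultimately show ?case by blast
qed auto

text \<open>By contraposition: that an array of size \<open>n\<close> exists is a first-order
  statement, so all finite sizes pass from the field to \<open>U\<close>, where saturation joins
  them into an infinite array.\<close>

lemma dp_small_imp_dps:
 fixes U :: "'b struc"
 assumes U: "monster_of (Th (ofield :: 'a::linordered_field struc)) U" and small: "dp_small U"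
 shows "dps TYPE('a)"
 unfolding dps_def
proof
 assume "EX (\<Phi> :: nat => 'a => (nat => 'a) => bool) \<Psi>.
   (ALL i. Def1 (\<Phi> i)) & Def1 \<Psi> &
   (ALL n. EX c b. array n (%i x. \<Phi> i x (c i)) (%j x. \<Psi> x (b j)))"
 then obtain \<Phi> :: "nat => 'a => (nat => 'a) => bool" and \<Psi> where
  D: "!!i. Def1 (\<Phi> i)" "Def1 \<Psi>" and
  A: "!!n. EX c b. array n (%i x. \<Phi> i x (c i)) (%j x. \<Psi> x (b j))" by blast
 obtain \<phi> where \<phi>: "!!i e. EX c. ALL x. \<Phi> i x e = sat ofield (c(0 := x)) (\<phi> i)"
  using Def1_formula[OF D(1)] by metis
 then obtain f where f: "!!i e x. \<Phi> i x e = sat ofield ((f i e)(0 := x)) (\<phi> i)" by metis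
 obtain \<psi> where \<psi>: "!!e. EX c. ALL x. \<Psi> x e = sat ofield (c(0 := x)) \<psi>"
  using Def1_formula[OF D(2)] by metis
 then obtain g where g: "!!e x. \<Psi> x e = sat ofield ((g e)(0 := x)) \<psi>" by metis
 \<comment> \<open>Row parameters occupy odd variables and column parameters positive even ones;
   variable 0 stays free for the home sort.\<close>
 define vc where "vc i k = Suc (2 * prod_encode (i, k))" for i k
 define vb where "vb j k = Suc (Suc (2 * prod_encode (j, k)))" for j k
 define \<sigma> where "\<sigma> i k = (if k = 0 then 0 else vc i k)" for i k
 define \<tau> where "\<tau> j k = (if k = 0 then 0 else vb j k)" for j k
 define \<chi> where "\<chi> n i0 j0 = Ex 0 (conjs
   (map (%i. if i = i0 then rn (\<sigma> i) (\<phi> i) else Neg (rn (\<sigma> i) (\<phi> i))) [0..<n] @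
   map (%j. if j = j0 then rn (\<tau> j) \<psi> else Neg (rn (\<tau> j) \<psi>)) [0..<n]))" for n i0 j0 :: nat
 have c1: "(E(0 := x)) \<circ> \<sigma> i = (%k. E (vc i k))(0 := x)" for E :: "nat => 'x" and x i
  by (auto simp: \<sigma>_def vc_def fun_eq_iff)
 have c2: "(E(0 := x)) \<circ> \<tau> i = (%k. E (vb i k))(0 := x)" for E :: "nat => 'x" and x i
  by (auto simp: \<tau>_def vb_def fun_eq_iff)
 have sat\<chi>: "sat M E (\<chi> n i0 j0) \<longleftrightarrow> (EX x:carrier M.
   (ALL i<n. sat M ((%k. E (vc i k))(0 := x)) (\<phi> i) \<longleftrightarrow> i = i0) &
   (ALL j<n. sat M ((%k. E (vb j k))(0 := x)) \<psi> \<longleftrightarrow> j = j0))" for M :: "'x struc" and E n i0 j0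
  unfolding \<chi>_def sat.simps sat_conjs set_append set_map ball_Un Ball_image_comp comp_def set_upt
  by (intro bex_cong conj_cong refl) (auto simp: sat_rn c1 c2)
 define S where "S = {\<chi> n i0 j0 | n i0 j0. i0 < n & j0 < n}"
 have U': "is_model U (Th (ofield :: 'a struc))" "aleph1_saturated U" "is_struc U"
  using U by (auto simp: monster_of_def is_model_def)
 obtain u0 where u0: "u0 \<in> carrier U" using U'(3) by (auto simp: is_struc_def)
 have vu0: "valid U (%_. u0)" using u0 by (auto simp: valid_def)
 have "EX e. valid U e & (ALL p:S. sat U e p)"
 proof (rule omega_saturated[OF U'(2)])
  fix Q assume Q: "Q \<subseteq> S" "finite Q"
  define R where "R m = {\<chi> n i0 j0 | n i0 j0. i0 < n & j0 < n & n <= m}" for m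
  have "mono R" by (auto simp: R_def mono_def) (use le_trans in blast)
  moreover have "Q \<subseteq> (\<Union>m. R m)" using Q by (fastforce simp: S_def R_def)
  ultimately obtain N where N: "Q \<subseteq> R N" using finite_UN_mono[OF Q(2)] by blast
  obtain c b where cb: "array N (%i x. \<Phi> i x (c i)) (%j x. \<Psi> x (b j))" using A by blast
  define E where "E m = (let p = prod_decode ((m - 1) div 2) in
    if odd m then f (fst p) (c (fst p)) (snd p) else g (b (fst p)) (snd p))" for m
  have Ec: "E (vc i k) = f i (c i) k" for i k by (simp add: E_def vc_def)
  have Eb: "E (vb j k) = g (b j) k" for j k by (simp add: E_def vb_def)
  have E: "sat ofield E (\<chi> n i0 j0)" if "i0 < n" "j0 < n" "n <= N" for n i0 j0
   unfolding sat\<chi> Ec Eb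
   using array_mono[OF cb that(3)] that unfolding array_def f g
   by (auto simp: fun_upd_def cong: if_cong)
  obtain ql where ql: "set ql = Q" using finite_list[OF Q(2)] by blast
  \<comment> \<open>Quantifying all free variables turns satisfiability of the finite set into a
    sentence, which transfers to \<open>U\<close>.\<close>
  define L where "L = sorted_list_of_set (\<Union>p\<in>Q. fv p)"
  have L: "set L = (\<Union>p\<in>Q. fv p)" using Q by (simp add: L_def)
  have "sat ofield E (exs L (conjs ql))"
   unfolding sat_exs using E N ql by (intro exI[of _ E]) (auto simp: R_def)
  then have "sat U (%_. u0) (exs L (conjs ql))"
   using Th_transfer[OF U'(1) _ vu0, of "exs L (conjs ql)" E] by (simp add: L ql)
  then obtain e where e: "ALL i. i ~: set L --> e i = u0" "ALL i:set L. e i \<in> carrier U" "sat U e (conjs ql)"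
   unfolding sat_exs by auto
  then have "valid U e" unfolding valid_def using u0 by (metis image_subset_iff)
  then show "EX e. valid U e & (ALL p:Q. sat U e p)" using e ql by auto
 qed
 then obtain E where E: "valid U E" "!!p. p \<in> S ==> sat U E p" by blast
 define c where "c i k = E (vc i k)" for i k
 define b where "b j k = E (vb j k)" for j k
 have "~ dp_small U"
  unfolding dp_small_def not_not
 proof (intro exI conjI allI)
  show "valid U (c i)" "valid U (b i)" for i using E(1) by (auto simp: c_def b_def valid_def)
  fix i0 j0
  show "consistent_in U ({(\<phi> i0, c i0), (\<psi>, b j0)} \<union> {(Neg (\<phi> i), c i) | i. i ~= i0} \<union> {(Neg \<psi>, b j) | j. j ~= j0})"
   unfolding consistent_in_def
  proof (intro allI impI)
   fix Q :: "(fm \<times> (nat => 'b)) set"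
   assume Q: "Q \<subseteq> {(\<phi> i0, c i0), (\<psi>, b j0)} \<union> {(Neg (\<phi> i), c i) | i. i ~= i0} \<union> {(Neg \<psi>, b j) | j. j ~= j0}" "finite Q"
   define R where "R m = {(\<phi> i0, c i0), (\<psi>, b j0)} \<union> {(Neg (\<phi> i), c i) | i. i ~= i0 & i < m} \<union> {(Neg \<psi>, b j) | j. j ~= j0 & j < m}" for m
   have "mono R" unfolding R_def mono_def by (auto intro: less_le_trans)
   moreover have "Q \<subseteq> (\<Union>m. R m)"
   proof
    fix q assume "q \<in> Q"
    with Q(1) consider "q = (\<phi> i0, c i0) | q = (\<psi>, b j0)" | i where "i ~= i0" "q = (Neg (\<phi> i), c i)"
     | j where "j ~= j0" "q = (Neg \<psi>, b j)" by blast
    then show "q \<in> (\<Union>m. R m)"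
    proof cases
     case 1 then show ?thesis by (auto simp: R_def)
    next
     case (2 i) then have "q \<in> R (Suc i)" unfolding R_def by blast
     then show ?thesis by blast
    next
     case (3 j) then have "q \<in> R (Suc j)" unfolding R_def by blast
     then show ?thesis by blast
    qed
   qed
   ultimately obtain m where m: "Q \<subseteq> R m" using finite_UN_mono[OF Q(2)] by blast
   define n where "n = m + Suc i0 + Suc j0"
   have "\<chi> n i0 j0 \<in> S" unfolding S_def n_def by force
   then have "sat U E (\<chi> n i0 j0)" by (rule E)
   then obtain x where x: "x \<in> carrier U" "ALL i<n. sat U ((c i)(0 := x)) (\<phi> i) \<longleftrightarrow> i = i0"
    "ALL j<n. sat U ((b j)(0 := x)) \<psi> \<longleftrightarrow> j = j0"
    unfolding sat\<chi> c_def b_def by blast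
   show "EX a:carrier U. ALL (\<phi>, e):Q. sat U (e(0 := a)) \<phi>"
   proof (intro bexI[OF _ x(1)], clarify)
    fix p e assume "(p, e) \<in> Q"
    then have "(p, e) \<in> R m" using m by auto
    then show "sat U (e(0 := x)) p" using x(2,3) unfolding R_def n_def by auto
   qed
  qed
 qed
 then show False using small by simp
qed

text \<open>A member of a family of pairwise nested or disjoint sets cuts at most one class of the
 finite partition generated by other members; a formula whose instances are determined by at
 most \<open>K\<close> members therefore cannot cut \<open>K + 1\<close> classes, which gives dp-smallness.\<close>

definition determined :: "'b set => 'b set set => 'b set => bool" where
 "determined C F X \<longleftrightarrow> (ALL x:C. ALL y:C. (ALL B:F. x \<in> B \<longleftrightarrow> y \<in> B) --> (x \<in> X \<longleftrightarrow> y \<in> X))"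

definition nested :: "'b set set => bool" where
 "nested BB \<longleftrightarrow> (ALL B:BB. ALL B':BB. B \<subseteq> B' | B' \<subseteq> B | B \<inter> B' = {})"

text \<open>If \<open>B\<close> is contained in \<open>S\<close>, both cut classes lie inside
  \<open>S\<close>; if \<open>S\<close> is contained in \<open>B\<close> or disjoint from it, both
  lie outside.\<close>

lemma nested_cuts_one_class:
 assumes n: "nested BB" and T: "T \<subseteq> BB" and B: "B \<in> BB"
  and a: "a \<in> B" "a' ~: B" "ALL S:T. a \<in> S \<longleftrightarrow> a' \<in> S"
  and d: "d \<in> B" "d' ~: B" "ALL S:T. d \<in> S \<longleftrightarrow> d' \<in> S"
  and S: "S \<in> T"
 shows "a \<in> S \<longleftrightarrow> d \<in> S"
proof -
 have "B \<subseteq> S | S \<subseteq> B | B \<inter> S = {}" using n T B S unfolding nested_def by blast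
 then show ?thesis using a d S by blast
qed

lemma nested_dp_small:
 fixes U :: "'b struc"
 assumes n: "nested BB"
  and K: "!!\<psi>. EX K::nat. ALL e. valid U e --> (\<exists>F\<subseteq>BB. finite F & card F <= K & determined (carrier U) F (dset U \<psi> e))"
 shows "dp_small U"
 unfolding dp_small_def
proof
 assume "EX (\<phi> :: nat => fm) (c :: nat => nat => 'b) (\<psi> :: fm) (b :: nat => nat => 'b).
   (ALL i. valid U (c i)) & (ALL j. valid U (b j)) &
   (ALL i0 j0. consistent_in U
     ({(\<phi> i0, c i0), (\<psi>, b j0)} \<union>
     {(Neg (\<phi> i), c i) | i. i ~= i0} \<union>
     {(Neg \<psi>, b j) | j. j ~= j0}))"
 then obtain \<phi> :: "nat => fm" and c :: "nat => nat => 'b" and \<psi> and b :: "nat => nat => 'b" where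
  v: "!!i. valid U (c i)" "!!j. valid U (b j)" and
  con: "!!i0 j0. consistent_in U
     ({(\<phi> i0, c i0), (\<psi>, b j0)} \<union>
     {(Neg (\<phi> i), c i) | i. i ~= i0} \<union>
     {(Neg \<psi>, b j) | j. j ~= j0})" by blast
 have pts: "EX x:carrier U. ALL i<=m. (x \<in> dset U (\<phi> i) (c i) \<longleftrightarrow> i = i0) & (x \<in> dset U \<psi> (b i) \<longleftrightarrow> i = j0)"
  if "i0 <= m" "j0 <= m" for m i0 j0
 proof -
  let ?Q = "insert (\<phi> i0, c i0) (insert (\<psi>, b j0) ((%i. (Neg (\<phi> i), c i)) ` ({..m} - {i0}) \<union> (%j. (Neg \<psi>, b j)) ` ({..m} - {j0})))"
  have "?Q \<subseteq> {(\<phi> i0, c i0), (\<psi>, b j0)} \<union> {(Neg (\<phi> i), c i) | i. i ~= i0} \<union> {(Neg \<psi>, b j) | j. j ~= j0}"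
   by blast
  moreover have "finite ?Q" by auto
  ultimately obtain a where a: "a \<in> carrier U" "ALL (\<phi>, e):?Q. sat U (e(0 := a)) \<phi>"
   using con[of i0 j0] unfolding consistent_in_def by meson
  show ?thesis
  proof (rule bexI[OF _ a(1)], intro allI impI conjI)
   fix i assume i: "i <= m"
   show "a \<in> dset U (\<phi> i) (c i) \<longleftrightarrow> i = i0"
   proof (cases "i = i0")
    case True
    then show ?thesis using a by (auto simp: dset_def)
   next
    case False
    then have "(Neg (\<phi> i), c i) \<in> ?Q" using i by blast
    then have "sat U ((c i)(0 := a)) (Neg (\<phi> i))" using a(2) by blast
    then show ?thesis using False by (auto simp: dset_def)
   qed
   show "a \<in> dset U \<psi> (b i) \<longleftrightarrow> i = j0"
   proof (cases "i = j0")
    case True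
    then show ?thesis using a by (auto simp: dset_def)
   next
    case False
    then have "(Neg \<psi>, b i) \<in> ?Q" using i by blast
    then have "sat U ((b i)(0 := a)) (Neg \<psi>)" using a(2) by blast
    then show ?thesis using False by (auto simp: dset_def)
   qed
  qed
 qed
 obtain K where K\<psi>: "!!e. valid U e ==> \<exists>F\<subseteq>BB. finite F & card F <= K & determined (carrier U) F (dset U \<psi> e)"
  using K[of \<psi>] by blast
 have "ALL i. \<exists>F\<subseteq>BB. finite F & determined (carrier U) F (dset U (\<phi> i) (c i))"
  using K v(1) by meson
 then obtain F where F: "!!i. F i \<subseteq> BB" "!!i. finite (F i)" "!!i. determined (carrier U) (F i) (dset U (\<phi> i) (c i))"
  by metis
 \<comment> \<open>The balls determining the row formulas 0 to \<open>K\<close>. Points of one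
   column in different rows are separated by a member of \<open>T\<close>.\<close>
 define T where "T = (\<Union>i\<le>K. F i)"
 have T: "finite T" "T \<subseteq> BB" using F by (auto simp: T_def)
 define cl where "cl x = {S \<in> T. x \<in> S}" for x
 \<comment> \<open>The columns 0 to \<open>m\<close> outnumber the ways to assign classes to
   \<open>K + 1\<close> rows, so two columns agree in all rows; the summand \<open>K\<close> makes
   sure that the rows fit in as well.\<close>
 define m where "m = card (PiE {..K} (%_. Pow T)) + K"
 have pts': "ALL i j. EX x. i <= K --> j <= m --> x \<in> carrier U & (ALL i'<=m. (x \<in> dset U (\<phi> i') (c i') \<longleftrightarrow> i' = i) & (x \<in> dset U \<psi> (b i') \<longleftrightarrow> i' = j))"
 proof (intro allI)
  fix i j
  show "EX x. i <= K --> j <= m --> x \<in> carrier U & (ALL i'<=m. (x \<in> dset U (\<phi> i') (c i') \<longleftrightarrow> i' = i) & (x \<in> dset U \<psi> (b i') \<longleftrightarrow> i' = j))"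
  proof (cases "i <= K & j <= m")
   case True
   then have "i <= m" by (simp add: m_def)
   with True pts[of i m j] show ?thesis by blast
  qed blast
 qed
 then obtain p where p: "!!i j. i <= K ==> j <= m ==> p i j \<in> carrier U"
  "!!i j i'. i <= K ==> j <= m ==> i' <= m ==> p i j \<in> dset U (\<phi> i') (c i') \<longleftrightarrow> i' = i"
  "!!i j i'. i <= K ==> j <= m ==> i' <= m ==> p i j \<in> dset U \<psi> (b i') \<longleftrightarrow> i' = j"
 proof -
  obtain p where "ALL i j. i <= K --> j <= m --> p i j \<in> carrier U & (ALL i'<=m. (p i j \<in> dset U (\<phi> i') (c i') \<longleftrightarrow> i' = i) & (p i j \<in> dset U \<psi> (b i') \<longleftrightarrow> i' = j))"
   using pts'[unfolded choice_iff] by blast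
  then show thesis by (intro that[of p]) blast+
 qed
 have "~ inj_on (%j. \<lambda>i\<in>{..K}. cl (p i j)) {..m}"
 proof (rule pigeonhole)
  have "(%j. \<lambda>i\<in>{..K}. cl (p i j)) ` {..m} \<subseteq> PiE {..K} (%_. Pow T)" by (auto simp: cl_def)
  then have "card ((%j. \<lambda>i\<in>{..K}. cl (p i j)) ` {..m}) <= card (PiE {..K} (%_. Pow T))"
   by (rule card_mono[rotated]) (use T in \<open>auto intro!: finite_PiE\<close>)
  then show "card ((%j. \<lambda>i\<in>{..K}. cl (p i j)) ` {..m}) < card {..m}" unfolding m_def by simp
 qed
 then obtain j j' where j: "j <= m" "j' <= m" "j ~= j'" "(\<lambda>i\<in>{..K}. cl (p i j)) = (\<lambda>i\<in>{..K}. cl (p i j'))"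
  unfolding inj_on_def by auto
 have same: "ALL S:T. p i j \<in> S \<longleftrightarrow> p i j' \<in> S" if "i <= K" for i
  using fun_cong[OF j(4), of i] that by (auto simp: cl_def)
 have diff: "EX S:T. (p i j \<in> S) ~= (p i' j \<in> S)" if "i <= K" "i' <= K" "i ~= i'" for i i'
 proof (rule ccontr)
  assume "~ ?thesis"
  then have eq: "ALL B:F i. p i j \<in> B \<longleftrightarrow> p i' j \<in> B" using that(1) by (auto simp: T_def)
  have "p i j \<in> dset U (\<phi> i) (c i) \<longleftrightarrow> p i' j \<in> dset U (\<phi> i) (c i)"
   by (rule F(3)[of i, unfolded determined_def, rule_format, OF p(1)[OF that(1) j(1)] p(1)[OF that(2) j(1)]])
    (use eq in blast)
  moreover have "i <= m" using that by (simp add: m_def)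
  ultimately show False using p(2)[OF that(1) j(1), of i] p(2)[OF that(2) j(1), of i] that(3) by simp
 qed
 obtain G where G: "G \<subseteq> BB" "finite G" "card G <= K" "determined (carrier U) G (dset U \<psi> (b j))"
  using K\<psi>[OF v(2)] by blast
 have "EX B:G. (p i j \<in> B) ~= (p i j' \<in> B)" if "i <= K" for i
 proof (rule ccontr)
  assume no: "~ ?thesis"
  have "p i j \<in> dset U \<psi> (b j) \<longleftrightarrow> p i j' \<in> dset U \<psi> (b j)"
   by (rule G(4)[unfolded determined_def, rule_format, OF p(1)[OF that j(1)] p(1)[OF that j(2)]])
    (use no in blast)
  then show False using p(3)[OF that j(1) j(1)] p(3)[OF that j(2) j(1)] j(3) by simp
 qed
 \<comment> \<open>In row \<open>i\<close> the two points share a class but are separated by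
   \<open>\<psi>\<close>, so a ball of \<open>G\<close> cuts that class. Different rows have
   different classes, hence \<open>h\<close> is injective and \<open>G\<close> has more than
   \<open>K\<close> members.\<close>
 then obtain h where h: "!!i. i <= K ==> h i \<in> G & (p i j \<in> h i) ~= (p i j' \<in> h i)" by metis
 have "inj_on h {..K}"
 proof (rule inj_onI, rule ccontr)
  fix i i' assume i: "i \<in> {..K}" "i' \<in> {..K}" "h i = h i'" "i ~= i'"
  then have hi: "i <= K" "i' <= K" by auto
  obtain S where S: "S \<in> T" "(p i j \<in> S) ~= (p i' j \<in> S)" using diff[OF hi i(4)] by blast
  define a where "a = (if p i j \<in> h i then p i j else p i j')"
  define a' where "a' = (if p i j \<in> h i then p i j' else p i j)"
  define d where "d = (if p i' j \<in> h i then p i' j else p i' j')"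
  define d' where "d' = (if p i' j \<in> h i then p i' j' else p i' j)"
  have "a \<in> S \<longleftrightarrow> d \<in> S"
  proof (rule nested_cuts_one_class[OF n T(2), of "h i" a a' d d'])
   show "h i \<in> BB" using h[OF hi(1)] G by auto
   show "a \<in> h i" "a' ~: h i" using h[OF hi(1)] by (auto simp: a_def a'_def)
   show "d \<in> h i" "d' ~: h i" using h[OF hi(2)] i(3) by (auto simp: d_def d'_def)
   show "ALL S:T. a \<in> S \<longleftrightarrow> a' \<in> S" using same[OF hi(1)] by (auto simp: a_def a'_def)
   show "ALL S:T. d \<in> S \<longleftrightarrow> d' \<in> S" using same[OF hi(2)] by (auto simp: d_def d'_def)
  qed (rule S)
  then show False using S same[OF hi(1)] same[OF hi(2)] by (auto simp: a_def d_def split: if_splits)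
 qed
 moreover have "h ` {..K} \<subseteq> G" using h by auto
 ultimately have "card {..K} <= card G" using G(2) card_inj_on_le by blast
 then show False using G(3) by simp
qed

section \<open>VC-minimal and convexly ordered structures are dp-small\<close>

lemma determined_mono: "determined C F X ==> F \<subseteq> G ==> determined C G X"
 unfolding determined_def by (meson subsetD)

lemma determinedD:
 assumes "determined C F X" "x \<in> C" "y \<in> C" "!!B. B \<in> F ==> x \<in> B \<longleftrightarrow> y \<in> B"
 shows "x \<in> X \<longleftrightarrow> y \<in> X"
 using assms(1)[unfolded determined_def, THEN bspec, OF assms(2), THEN bspec, OF assms(3), THEN mp]
  assms(4) by simp

lemma determined_bool_comb:
 assumes "X \<in> bool_comb C S" shows "\<exists>F\<subseteq>S. finite F & determined C F X"
 using assms
proof induction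
 case (basic X)
 then show ?case by (intro exI[of _ "{X}"]) (auto simp: determined_def)
next
 case top
 then show ?case by (intro exI[of _ "{}"]) (auto simp: determined_def)
next
 case (compl X)
 then obtain F where F: "F \<subseteq> S" "finite F" "determined C F X" by blast
 have "determined C F (C - X)"
  unfolding determined_def
 proof (intro ballI impI)
  fix x y assume xy: "x \<in> C" "y \<in> C" "ALL B:F. (x \<in> B) = (y \<in> B)"
  have "x \<in> X \<longleftrightarrow> y \<in> X" by (rule determinedD[OF F(3) xy(1,2)]) (use xy(3) in blast)
  then show "x \<in> C - X \<longleftrightarrow> y \<in> C - X" using xy by simp
 qed
 then show ?case using F(1,2) by blast
next
 case (union X Y)
 then obtain F G where *: "F \<subseteq> S" "finite F" "determined C F X" "G \<subseteq> S" "finite G" "determined C G Y" by blast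
 have "determined C (F \<union> G) (X \<union> Y)"
  unfolding determined_def
 proof (intro ballI impI)
  fix x y assume xy: "x \<in> C" "y \<in> C" "ALL B:F \<union> G. (x \<in> B) = (y \<in> B)"
  have "x \<in> X \<longleftrightarrow> y \<in> X" by (rule determinedD[OF *(3) xy(1,2)]) (use xy(3) in blast)
  moreover have "x \<in> Y \<longleftrightarrow> y \<in> Y" by (rule determinedD[OF *(6) xy(1,2)]) (use xy(3) in blast)
  ultimately show "x \<in> X \<union> Y \<longleftrightarrow> y \<in> X \<union> Y" by auto
 qed
 then show ?case using * by (intro exI[of _ "F \<union> G"]) auto
qed

text \<open>The existence of a representation by balls is turned by saturation into one with a
 uniformly bounded number of balls.\<close>

lemma VC_minimal_imp_dp_small:
 fixes U :: "'b struc"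
 assumes U: "is_struc U" "aleph1_saturated U" and vc: "VC_minimal U"
 shows "dp_small U"
proof -
 obtain \<Psi> where dir: "directed U \<Psi>" and
  bc: "!!\<theta> e. valid U e ==> dset U \<theta> e \<in> bool_comb (carrier U) {dset U \<psi> b | \<psi> b. \<psi> \<in> \<Psi> & valid U b}"
  using vc unfolding VC_minimal_def by blast
 define BB where "BB = {dset U \<psi> b | \<psi> b. \<psi> \<in> \<Psi> & valid U b}"
 have "nested BB"
  using dir unfolding nested_def directed_def BB_def by blast
 moreover have "EX K::nat. ALL e. valid U e --> (\<exists>F\<subseteq>BB. finite F & card F <= K & determined (carrier U) F (dset U \<theta> e))" for \<theta>
 proof -
  define ok where "ok L e \<longleftrightarrow> (EX b. (ALL k. valid U (b k)) &
   determined (carrier U) ((%k. dset U (L ! k) (b k)) ` {..<length L}) (dset U \<theta> e))" for L :: "fm list" and e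
  have ok_append: "ok (L @ L') e" if "ok L e | ok L' e" for L L' e
   using that
  proof
   assume "ok L e"
   then obtain b where b: "ALL k. valid U (b k)" "determined (carrier U) ((%k. dset U (L ! k) (b k)) ` {..<length L}) (dset U \<theta> e)"
    unfolding ok_def by blast
   have "(%k. dset U (L ! k) (b k)) ` {..<length L} \<subseteq> (%k. dset U ((L @ L') ! k) (b k)) ` {..<length (L @ L')}"
   proof
    fix x assume "x \<in> (%k. dset U (L ! k) (b k)) ` {..<length L}"
    then obtain k where k: "k < length L" "x = dset U (L ! k) (b k)" by auto
    then show "x \<in> (%k. dset U ((L @ L') ! k) (b k)) ` {..<length (L @ L')}"
     by (intro image_eqI[of _ _ k]) (auto simp: nth_append)
   qed
   then show "ok (L @ L') e" using b(1) determined_mono[OF b(2)] unfolding ok_def by blast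
  next
   assume "ok L' e"
   then obtain b where b: "ALL k. valid U (b k)" "determined (carrier U) ((%k. dset U (L' ! k) (b k)) ` {..<length L'}) (dset U \<theta> e)"
    unfolding ok_def by blast
   have "(%k. dset U (L' ! k) (b k)) ` {..<length L'} \<subseteq> (%k. dset U ((L @ L') ! k) (b (k - length L))) ` {..<length (L @ L')}"
   proof
    fix x assume "x \<in> (%k. dset U (L' ! k) (b k)) ` {..<length L'}"
    then obtain k where k: "k < length L'" "x = dset U (L' ! k) (b k)" by auto
    then show "x \<in> (%k. dset U ((L @ L') ! k) (b (k - length L))) ` {..<length (L @ L')}"
     by (intro image_eqI[of _ _ "length L + k"]) (auto simp: nth_append)
   qed
   then show "ok (L @ L') e" using b(1) determined_mono[OF b(2)] unfolding ok_def
    by (intro exI[of _ "%k. b (k - length L)"]) blast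
  qed
  have ok_concat: "ok (concat LL) e" if "ok L e" "L \<in> set LL" for L LL e
   using that by (induction LL) (auto intro: ok_append)
  have all_ok: "EX L. set L \<subseteq> \<Psi> & ok L e" if e: "valid U e" for e
  proof -
   obtain F where F: "F \<subseteq> BB" "finite F" "determined (carrier U) F (dset U \<theta> e)"
    using determined_bool_comb[OF bc[OF e, of \<theta>]] unfolding BB_def by blast
   obtain fl where fl: "set fl = F" using finite_list F(2) by blast
   have "ALL k. EX \<psi>b. k < length fl --> fl ! k = dset U (fst \<psi>b) (snd \<psi>b) & fst \<psi>b \<in> \<Psi> & valid U (snd \<psi>b)"
   proof
    fix k
    show "EX \<psi>b. k < length fl --> fl ! k = dset U (fst \<psi>b) (snd \<psi>b) & fst \<psi>b \<in> \<Psi> & valid U (snd \<psi>b)"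
    proof (cases "k < length fl")
     case True
     then have "fl ! k \<in> BB" using F(1) fl nth_mem by blast
     then obtain \<psi> b where "fl ! k = dset U \<psi> b" "\<psi> \<in> \<Psi>" "valid U b" unfolding BB_def by blast
     then show ?thesis by (intro exI[of _ "(\<psi>, b)"]) simp
    qed blast
   qed
   from choice[OF this] obtain q where q: "ALL k. k < length fl --> fl ! k = dset U (fst (q k)) (snd (q k)) & fst (q k) \<in> \<Psi> & valid U (snd (q k))" ..
   define p where "p k = fst (q k)" for k
   define b where "b k = snd (q k)" for k
   have pb: "!!k. k < length fl ==> fl ! k = dset U (p k) (b k) & p k \<in> \<Psi> & valid U (b k)"
    using q by (simp add: p_def b_def)
   define L where "L = map p [0..<length fl]"
   have "(%k. dset U (L ! k) (if k < length fl then b k else e)) ` {..<length L} = (%k. fl ! k) ` {..<length fl}"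
    by (rule image_cong) (use pb in \<open>auto simp: L_def\<close>)
   also have "\<dots> = F" using fl by (auto simp: set_conv_nth)
   finally have "determined (carrier U) ((%k. dset U (L ! k) (if k < length fl then b k else e)) ` {..<length L}) (dset U \<theta> e)"
    using F(3) by simp
   moreover have "ALL k. valid U (if k < length fl then b k else e)" using pb e by simp
   ultimately have "ok L e" unfolding ok_def
    by (intro exI[of _ "%k. if k < length fl then b k else e"] conjI)
   moreover have "set L \<subseteq> \<Psi>" using pb by (auto simp: L_def)
   ultimately show ?thesis by blast
  qed
  \<comment> \<open>If each list fails at some \<open>e\<close>, then finitely many lists fail at a
    common one, namely where their concatenation fails. Saturation then gives one \<open>e\<close>
    at which all lists fail, against VC-minimality.\<close>
  have "EX L. set L \<subseteq> \<Psi> & (ALL e. valid U e --> ok L e)"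
  proof (rule ccontr)
   assume no: "\<nexists>L. set L \<subseteq> \<Psi> & (ALL e. valid U e --> ok L e)"
   define vv where "vv k = (%i. if i = 0 then 0 else 3 + prod_encode (k, i))" for k
   \<comment> \<open>Variables 1 and 2 hold the points compared. From 3 on, code
     \<open>(0, i)\<close> is parameter \<open>i\<close> of \<open>\<theta>\<close>, and code
     \<open>(Suc k, i)\<close> is parameter \<open>i\<close> of the \<open>k\<close>-th listed
     formula.\<close>
   define \<theta>' where "\<theta>' t = rn (%i. if i = 0 then t else 3 + prod_encode (0, i)) \<theta>" for t
   define mem where "mem t k \<psi> = rn (%i. if i = 0 then t else 3 + prod_encode (Suc k, i)) \<psi>" for t k \<psi>
   define iff where "iff p q = Neg (Neg (Conj (Neg (Conj p (Neg q))) (Neg (Conj q (Neg p)))))" for p q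
   have sat_iff: "sat M E (iff p q) \<longleftrightarrow> (sat M E p \<longleftrightarrow> sat M E q)" for M :: "'b struc" and E p q
    by (auto simp: iff_def)
   define \<delta> where "\<delta> L = Neg (Ex 1 (Ex 2 (Conj
     (conjs (map (%k. iff (mem 1 k (L ! k)) (mem 2 k (L ! k))) [0..<length L]))
     (Neg (iff (\<theta>' 1) (\<theta>' 2))))))" for L
   \<comment> \<open>The parameters of the balls are quantified away; only those of
     \<open>\<theta>\<close> remain free.\<close>
   define \<gamma> where "\<gamma> L = exs (sorted_list_of_set (fv (\<delta> L) - range (%i. 3 + prod_encode (0, i)))) (\<delta> L)" for L
   have c0: "(E(t := x)) \<circ> (%i. if i = 0 then t else 3 + prod_encode (k, i)) = (%i. E (3 + prod_encode (k, i)))(0 := x)"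
    if "t < 3" for E :: "nat => 'b" and t x k using that by (auto simp: fun_eq_iff)
   have sat\<delta>: "sat U E (\<delta> L) \<longleftrightarrow> determined (carrier U)
     ((%k. dset U (L ! k) (%i. E (3 + prod_encode (Suc k, i)))) ` {..<length L})
     (dset U \<theta> (%i. E (3 + prod_encode (0, i))))" for E L
   proof -
    have m1: "sat U (E(1 := x, 2 := y)) (mem 1 k \<psi>) \<longleftrightarrow> sat U ((%i. E (3 + prod_encode (Suc k, i)))(0 := x)) \<psi>"
     "sat U (E(1 := x, 2 := y)) (mem 2 k \<psi>) \<longleftrightarrow> sat U ((%i. E (3 + prod_encode (Suc k, i)))(0 := y)) \<psi>" for x y k \<psi>
     unfolding mem_def sat_rn by (rule arg_cong[where f = "%e. sat U e \<psi>"]; auto simp: fun_eq_iff)+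
    have m2: "sat U (E(1 := x, 2 := y)) (\<theta>' 1) \<longleftrightarrow> sat U ((%i. E (3 + prod_encode (0, i)))(0 := x)) \<theta>"
     "sat U (E(1 := x, 2 := y)) (\<theta>' 2) \<longleftrightarrow> sat U ((%i. E (3 + prod_encode (0, i)))(0 := y)) \<theta>" for x y
     unfolding \<theta>'_def sat_rn by (rule arg_cong[where f = "%e. sat U e \<theta>"]; auto simp: fun_eq_iff)+
    show ?thesis
     unfolding \<delta>_def sat.simps sat_conjs set_map Ball_image_comp comp_def sat_iff m1 m2 determined_def dset_def
     by (auto simp: lessThan_atLeast0)
   qed
   have sat\<gamma>: "sat U E (\<gamma> L) \<longleftrightarrow> ok L (%i. E (3 + prod_encode (0, i)))" if "valid U E" for E L
   proof
    assume "sat U E (\<gamma> L)"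
    then obtain E' where E': "ALL i. i ~: fv (\<delta> L) - range (%i. 3 + prod_encode (0, i)) --> E' i = E i"
      "ALL i:fv (\<delta> L) - range (%i. 3 + prod_encode (0, i)). E' i \<in> carrier U" "sat U E' (\<delta> L)"
     unfolding \<gamma>_def sat_exs by auto
    have "valid U E'" using E'(1,2) that unfolding valid_def by (metis image_subset_iff rangeI)
    moreover have "(%i. E' (3 + prod_encode (0, i))) = (%i. E (3 + prod_encode (0, i)))" using E'(1) by auto
    ultimately show "ok L (%i. E (3 + prod_encode (0, i)))"
     using E'(3) unfolding sat\<delta> ok_def
     by (intro exI[of _ "%k i. E' (3 + prod_encode (Suc k, i))"]) (auto simp: valid_def)
   next
    assume "ok L (%i. E (3 + prod_encode (0, i)))"
    then obtain b where b: "ALL k. valid U (b k)" "determined (carrier U) ((%k. dset U (L ! k) (b k)) ` {..<length L})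
      (dset U \<theta> (%i. E (3 + prod_encode (0, i))))" unfolding ok_def by blast
    define E' where "E' m = (case prod_decode (m - 3) of (k, i) => if m < 3 | k = 0 then E m else b (k - 1) i)" for m
    have E'0: "E' (3 + prod_encode (0, i)) = E (3 + prod_encode (0, i))" for i by (simp add: E'_def)
    have E'1: "(%i. E' (3 + prod_encode (Suc k, i))) = b k" for k by (auto simp: E'_def)
    have d: "sat U E' (\<delta> L)" unfolding sat\<delta> E'0 E'1 by (rule b(2))
    have vE': "E' i \<in> carrier U" for i using b(1) that by (auto simp: E'_def valid_def split: prod.splits)
    define E2 where "E2 i = (if i \<in> fv (\<delta> L) - range (%i. 3 + prod_encode (0, i)) then E' i else E i)" for i
    have "sat U E2 (\<delta> L) = sat U E' (\<delta> L)"
     by (rule sat_cong) (auto simp: E2_def E'0)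
    then show "sat U E (\<gamma> L)" unfolding \<gamma>_def sat_exs using d vE'
     by (intro exI[of _ E2]) (auto simp: E2_def)
   qed
   have "EX E. valid U E & (ALL p:{Neg (\<gamma> L) | L. set L \<subseteq> \<Psi>}. sat U E p)"
   proof (rule omega_saturated[OF U(2)])
    fix Q assume Q: "Q \<subseteq> {Neg (\<gamma> L) | L. set L \<subseteq> \<Psi>}" "finite Q"
    have "ALL q:Q. EX L. q = Neg (\<gamma> L) & set L \<subseteq> \<Psi>" using Q by blast
    then obtain l where l: "!!q. q \<in> Q ==> q = Neg (\<gamma> (l q)) & set (l q) \<subseteq> \<Psi>" by metis
    obtain ql where ql: "set ql = Q" using finite_list Q(2) by blast
    define LL where "LL = map l ql"
    have "set (concat LL) \<subseteq> \<Psi>" using l ql by (auto simp: LL_def)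
    then obtain e where e: "valid U e" "~ ok (concat LL) e" using no by blast
    define E where "E m = (if m < 3 then e 0 else e (snd (prod_decode (m - 3))))" for m
    have vE: "valid U E" using e(1) by (auto simp: E_def valid_def)
    have Ee: "(%i. E (3 + prod_encode (0, i))) = e" by (auto simp: E_def)
    have "sat U E q" if "q \<in> Q" for q
    proof -
     have "~ ok (l q) e" using ok_concat[of "l q" e LL] e(2) that ql by (auto simp: LL_def)
     then have "sat U E (Neg (\<gamma> (l q)))" using sat\<gamma>[OF vE] Ee by simp
     then show ?thesis using l[OF that] by simp
    qed
    then show "EX e. valid U e & (ALL p:Q. sat U e p)" using vE by blast
   qed
   then obtain E where E: "valid U E" "!!L. set L \<subseteq> \<Psi> ==> sat U E (Neg (\<gamma> L))" by blast
   have "valid U (%i. E (3 + prod_encode (0, i)))" using E(1) by (auto simp: valid_def)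
   then obtain L where "set L \<subseteq> \<Psi>" "ok L (%i. E (3 + prod_encode (0, i)))" using all_ok by blast
   then show False using E(2)[of L] sat\<gamma>[OF E(1), of L] by simp
  qed
  then obtain L where L: "set L \<subseteq> \<Psi>" "!!e. valid U e ==> ok L e" by blast
  show ?thesis
  proof (intro exI[of _ "length L"] allI impI)
   fix e assume "valid U e"
   then obtain b where b: "ALL k. valid U (b k)"
    "determined (carrier U) ((%k. dset U (L ! k) (b k)) ` {..<length L}) (dset U \<theta> e)"
    using L(2) unfolding ok_def by blast
   have "(%k. dset U (L ! k) (b k)) ` {..<length L} \<subseteq> BB"
    using L(1) b(1) unfolding BB_def by (force dest: nth_mem)
   moreover have "card ((%k. dset U (L ! k) (b k)) ` {..<length L}) <= length L"
    using card_image_le[of "{..<length L}"] by simp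
   ultimately show "\<exists>F\<subseteq>BB. finite F & card F <= length L & determined (carrier U) F (dset U \<theta> e)"
    using b(2) by blast
  qed
 qed
 ultimately show ?thesis by (rule nested_dp_small)
qed

text \<open>Initial segments of a linear order form a chain, and a convex set is the difference of
  two of them, so \<open>2 * K\<close> segments determine a union of \<open>K\<close> convex sets.
  The balls in \<open>nested_dp_small\<close> are arbitrary sets, hence the order may be
  undefinable.\<close>

lemma convexly_orderable_imp_dp_small:
 fixes U :: "'b struc"
 assumes "convexly_orderable U" shows "dp_small U"
proof -
 obtain R where R: "strict_linear_order_on (carrier U) R" and
  K: "!!\<phi>. EX K::nat. ALL b. valid U b -->
    (EX \<C>. finite \<C> & card \<C> <= K & (ALL X:\<C>. convex_wrt (carrier U) R X) & \<Union>\<C> = dset U \<phi> b)"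
  using assms unfolding convexly_orderable_def by blast
 let ?C = "carrier U"
 have irr: "!!a. a \<in> ?C ==> ~ R a a"
  and tr: "!!a b c. a \<in> ?C ==> b \<in> ?C ==> c \<in> ?C ==> R a b ==> R b c ==> R a c"
  and tot: "!!a b. a \<in> ?C ==> b \<in> ?C ==> R a b | a = b | R b a"
  using R unfolding strict_linear_order_on_def by blast+
 define BB where "BB = {I. I \<subseteq> ?C & (ALL x:I. ALL y:?C. R y x --> y \<in> I)}"
 have "nested BB"
  unfolding nested_def BB_def
 proof (safe)
  fix A B x y z
  assume "A \<subseteq> ?C" "ALL x:A. ALL y:?C. R y x --> y \<in> A" "B \<subseteq> ?C" "ALL x:B. ALL y:?C. R y x --> y \<in> B"
   "x \<in> A" "x ~: B" "y \<in> B" "y ~: A"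
  then show "z \<in> {}" using tot[of x y] by blast
 qed
 moreover have "EX K::nat. ALL e. valid U e --> (\<exists>F\<subseteq>BB. finite F & card F <= K & determined ?C F (dset U \<psi> e))" for \<psi>
 proof -
  obtain K where K: "!!b. valid U b ==>
    (EX \<C>. finite \<C> & card \<C> <= K & (ALL X:\<C>. convex_wrt ?C R X) & \<Union>\<C> = dset U \<psi> b)"
   using K[of \<psi>] by blast
  show ?thesis
  proof (intro exI[of _ "2 * K"] allI impI)
   fix e assume "valid U e"
   from K[OF this] obtain \<C> where \<C>': "finite \<C> & card \<C> <= K & (ALL X:\<C>. convex_wrt ?C R X) & \<Union>\<C> = dset U \<psi> e" ..
   then have \<C>: "finite \<C>" "card \<C> <= K" "!!X. X \<in> \<C> ==> convex_wrt ?C R X" "\<Union>\<C> = dset U \<psi> e"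
    by simp_all
   define up where "up X = {y \<in> ?C. EX x:X. y = x | R y x}" for X
   define lo where "lo X = {y \<in> ?C. ALL x:X. R y x}" for X
   have sub: "X \<subseteq> ?C" if "X \<in> \<C>" for X using \<C>(3)[OF that] by (auto simp: convex_wrt_def)
   have "up X \<in> BB" "lo X \<in> BB" if "X \<in> \<C>" for X
    using sub[OF that] tr unfolding BB_def up_def lo_def by blast+
   then have 1: "up ` \<C> \<union> lo ` \<C> \<subseteq> BB" by auto
   have X: "y \<in> X \<longleftrightarrow> y \<in> up X & y ~: lo X" if "X \<in> \<C>" "y \<in> ?C" for X y
   proof
    assume "y \<in> X"
    then show "y \<in> up X & y ~: lo X" using that irr by (auto simp: up_def lo_def)
   next
    assume "y \<in> up X & y ~: lo X"
    then obtain x x' where x: "x \<in> X" "y = x | R y x" "x' \<in> X" "~ R y x'"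
     using that by (auto simp: up_def lo_def)
    show "y \<in> X"
    proof (cases "y = x | y = x'")
     case False
     then have "R x' y" "R y x" using x tot[of y x'] sub that by blast+
     then show ?thesis using \<C>(3)[OF that(1)] x that(2) unfolding convex_wrt_def by blast
    qed (use x in auto)
   qed
   have "determined ?C (up ` \<C> \<union> lo ` \<C>) (dset U \<psi> e)"
    unfolding determined_def \<C>(4)[symmetric]
   proof (intro ballI impI)
    fix x y assume xy: "x \<in> ?C" "y \<in> ?C" "ALL B:up ` \<C> \<union> lo ` \<C>. (x \<in> B) = (y \<in> B)"
    have "x \<in> X \<longleftrightarrow> y \<in> X" if "X \<in> \<C>" for X
     using X[OF that] xy that by blast
    then show "x \<in> \<Union>\<C> \<longleftrightarrow> y \<in> \<Union>\<C>" by blast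
   qed
   moreover have "card (up ` \<C> \<union> lo ` \<C>) <= 2 * K"
    using card_Un_le[of "up ` \<C>" "lo ` \<C>"] card_image_le[OF \<C>(1), of up] card_image_le[OF \<C>(1), of lo] \<C>(2) by linarith
   ultimately show "\<exists>F\<subseteq>BB. finite F & card F <= 2 * K & determined ?C F (dset U \<psi> e)"
    using 1 \<C>(1) by (intro exI[of _ "up ` \<C> \<union> lo ` \<C>"]) auto
  qed
 qed
 ultimately show ?thesis by (rule nested_dp_small)
qed

section \<open>Definable sets in one variable\<close>

lemma dpsD:
 fixes \<Phi> :: "nat => 'a::linordered_field => (nat => 'a) => bool"
 assumes "dps TYPE('a)" "!!i. Def1 (\<Phi> i)" "Def1 \<Psi>"
 shows "EX n. ALL c b. ~ array n (%i x. \<Phi> i x (c i)) (%j x. \<Psi> x (b j))"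
 using assms unfolding dps_def by blast

text \<open>If all \<open>n\<close> row patterns occur cofinally in \<open>C\<close>, an increasing
  sequence in \<open>C\<close> can be chosen with every pattern occurring between consecutive terms;
  rows and intervals then form an array.\<close>

lemma cofinal_pattern:
 fixes \<Phi> :: "nat => 'a::linordered_field => (nat => 'a) => bool"
 assumes dps: "dps TYPE('a)" and D: "!!i. Def1 (\<Phi> i)"
 shows "EX n. ALL c C. C ~= {} --> ~ (ALL i0<n. ALL b:C. EX x:C. b < x & (ALL i<n. \<Phi> i x (c i) \<longleftrightarrow> i = i0))"
proof -
 define \<Psi> where "\<Psi> x e = (e 0 < x & x < e (Suc 0))" for x :: 'a and e :: "nat => 'a"
 have "Def1 \<Psi>" unfolding Def1_def \<Psi>_def by (intro Def_intros)
 from dpsD[where \<Phi> = \<Phi>, OF dps D this] obtain n where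
  n: "!!c b. ~ array n (%i x. \<Phi> i x (c i)) (%j x. \<Psi> x (b j))" by blast
 have n0: "n > 0" using n by (auto simp: array_def intro: gr0I)
 show ?thesis
 proof (intro exI[of _ n] allI impI notI)
  fix c and C :: "'a set"
  assume C: "C ~= {}" and ex: "ALL i0<n. ALL b:C. EX x:C. b < x & (ALL i<n. \<Phi> i x (c i) \<longleftrightarrow> i = i0)"
  define good where "good b b' \<longleftrightarrow> (ALL i0<n. EX x. b < x & x < b' & (ALL i<n. \<Phi> i x (c i) \<longleftrightarrow> i = i0))" for b b'
  have step: "EX b'. b' \<in> C & b < b' & good b b'" if b: "b \<in> C" for b
  proof -
   have "ALL i0. EX x. i0 < n --> x \<in> C & b < x & (ALL i<n. \<Phi> i x (c i) \<longleftrightarrow> i = i0)"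
    using ex b by blast
   then obtain f where f: "!!i0. i0 < n ==> f i0 \<in> C & b < f i0 & (ALL i<n. \<Phi> i (f i0) (c i) \<longleftrightarrow> i = i0)"
    by metis
   define m where "m = Max (f ` {..<n})"
   have "m \<in> f ` {..<n}" unfolding m_def using n0 by (intro Max_in) auto
   then have m: "m \<in> C" "b < m" using f by auto
   have fm: "f i <= m" if "i < n" for i unfolding m_def using that by (intro Max_ge) auto
   obtain b' where b': "b' \<in> C" "m < b'" using ex m n0 by blast
   have "good b b'" unfolding good_def
   proof (intro allI impI)
    fix i0 assume "i0 < n"
    then show "EX x. b < x & x < b' & (ALL i<n. \<Phi> i x (c i) \<longleftrightarrow> i = i0)"
     using f[of i0] fm[of i0] b'(2) by (intro exI[of _ "f i0"]) auto
   qed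
   then show ?thesis using b' m by (intro exI[of _ b']) auto
  qed
  obtain t0 where "t0 \<in> C" using C by blast
  then obtain t where t: "!!j. t j \<in> C" "!!j. t j < t (Suc j) & good (t j) (t (Suc j))"
   using dependent_nat_choice[of "%_ b. b \<in> C" "%_ b b'. b < b' & good b b'"] step by blast
  have mono: "t i <= t j" if "i <= j" for i j
  proof -
   have "t k <= t (Suc k)" for k using t(2)[of k] by simp
   then show ?thesis using that by (rule lift_Suc_mono_le)
  qed
  have "array n (%i x. \<Phi> i x (c i)) (%j x. \<Psi> x (%k. if k = 0 then t j else t (Suc j)))"
   unfolding array_def
  proof (intro allI impI)
   fix i0 j0 assume "i0 < n" "j0 < n"
   then obtain x where x: "t j0 < x" "x < t (Suc j0)" "ALL i<n. \<Phi> i x (c i) \<longleftrightarrow> i = i0"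
    using t(2)[of j0] unfolding good_def by blast
   have "\<Psi> x (%k. if k = 0 then t j else t (Suc j)) \<longleftrightarrow> j = j0" for j
   proof
    assume "\<Psi> x (%k. if k = 0 then t j else t (Suc j))"
    then have "t j < x" "x < t (Suc j)" by (auto simp: \<Psi>_def)
    then have "t j < t (Suc j0)" "t j0 < t (Suc j)" using x by auto
    then have "~ Suc j0 <= j" "~ Suc j <= j0" using mono[of "Suc j0" j] mono[of "Suc j" j0] by auto
    then show "j = j0" by auto
   qed (use x in \<open>auto simp: \<Psi>_def\<close>)
   then show "EX x. (ALL i<n. \<Phi> i x (c i) \<longleftrightarrow> i = i0) & (ALL j<n. \<Psi> x (%k. if k = 0 then t j else t (Suc j)) \<longleftrightarrow> j = j0)"
    using x(3) by blast
  qed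
  then show False using n[of c "%j k. if k = 0 then t j else t (Suc j)"] by simp
 qed
qed

text \<open>The reflection of \<open>cofinal_pattern\<close>, with the negative elements as
  \<open>C\<close>.\<close>

lemma germ_pattern:
 fixes \<Phi> :: "nat => 'a::linordered_field => (nat => 'a) => bool"
 assumes dps: "dps TYPE('a)" and D: "!!i. Def1 (\<Phi> i)"
 shows "EX n. ALL c. ~ (ALL i0<n. ALL \<epsilon>>0. EX x. 0 < x & x < \<epsilon> & (ALL i<n. \<Phi> i x (c i) \<longleftrightarrow> i = i0))"
proof -
 have "Def1 (%x. \<Phi> i (- x))" for i
  unfolding Def1_def by (rule Def1_app[OF D]) (intro DefT_intros)+
 from cofinal_pattern[where \<Phi> = "%i x. \<Phi> i (- x)", OF dps this] obtain n where n:
  "!!c C. C ~= {} ==> ~ (ALL i0<n. ALL b:C. EX x:C. b < x & (ALL i<n. \<Phi> i (- x) (c i) \<longleftrightarrow> i = i0))" by blast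
 show ?thesis
 proof (intro exI[of _ n] allI notI)
  fix c assume *: "ALL i0<n. ALL \<epsilon>>0. EX x. 0 < x & x < \<epsilon> & (ALL i<n. \<Phi> i x (c i) \<longleftrightarrow> i = i0)"
  have "ALL i0<n. ALL b:{..<0}. EX x:{..<0}. b < x & (ALL i<n. \<Phi> i (- x) (c i) \<longleftrightarrow> i = i0)"
  proof (intro allI ballI impI)
   fix i0 and b :: 'a assume "i0 < n" "b \<in> {..<0}"
   then obtain x where "0 < x" "x < - b" "ALL i<n. \<Phi> i x (c i) \<longleftrightarrow> i = i0"
    using *[rule_format, of i0 "- b"] by auto
   then show "EX x:{..<0}. b < x & (ALL i<n. \<Phi> i (- x) (c i) \<longleftrightarrow> i = i0)"
    by (intro bexI[of _ "- x"]) auto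
  qed
  then show False using n[of "{..<0}" c] lt_ex[of 0] by blast
 qed
qed

section \<open>Definable groups of positive elements\<close>

definition subgrp :: "'a::linordered_field set => bool" where
 "subgrp S \<longleftrightarrow> (ALL x:S. x > 0) & 1 \<in> S & (ALL x:S. ALL y:S. x * y \<in> S) & (ALL x:S. inverse x \<in> S)"

lemma subgrpD:
 assumes "subgrp S"
 shows "x \<in> S ==> x > 0" "1 \<in> S" "x \<in> S ==> y \<in> S ==> x * y \<in> S" "x \<in> S ==> inverse x \<in> S"
  "x \<in> S ==> y \<in> S ==> x / y \<in> S" "x \<in> S ==> x ^ n \<in> S"
proof -
 show *: "x \<in> S ==> x > 0" "1 \<in> S" "x \<in> S ==> y \<in> S ==> x * y \<in> S" "x \<in> S ==> inverse x \<in> S" for x y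
  using assms unfolding subgrp_def by blast+
 show "x \<in> S ==> y \<in> S ==> x / y \<in> S" unfolding divide_inverse using * by blast
 show "x \<in> S ==> x ^ n \<in> S" by (induction n) (use * in auto)
qed

lemma Def_mem: "Def (%e. e 0 \<in> S) ==> DefT t ==> Def (%e. t e \<in> S)"
 using Def_subst[of "%e. e 0 \<in> S" "%e _. t e"] by simp

text \<open>If \<open>s \<in> S\<close> had no \<open>M\<close>-th root in \<open>S\<close>, the sets of \<open>M^i\<close>-th powers that are not
 \<open>M^(i+1)\<close>-th powers would be cofinal in \<open>S\<close>, and form an array with intervals. This is the
 point where non-uniform rows are essential.\<close>

lemma subgrp_divisible:
 assumes dps: "dps TYPE('a::linordered_field)" and D: "Def (%e. e 0 \<in> (S :: 'a set))"
  and S: "subgrp S" and M: "M > 0" and s: "s \<in> S"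
 shows "EX t:S. t ^ M = s"
proof (rule ccontr)
 assume no: "~ ?thesis"
 then have M2: "M >= 2" using s M by (cases "M = 1") auto
 have s1: "s ~= 1" using no subgrpD(2)[OF S] by force
 have s0: "s > 0" using subgrpD(1)[OF S s] .
 define \<Phi> where "\<Phi> i x e = ((EX t. t \<in> S & x = t ^ (M ^ i)) & ~ (EX t. t \<in> S & x = t ^ (M ^ Suc i)))" for i x and e :: "nat => 'a"
 have "Def1 (\<Phi> i)" for i unfolding Def1_def \<Phi>_def by (intro Def_intros Def_mem[OF D])
 from cofinal_pattern[where \<Phi> = \<Phi>, OF dps this] obtain n where n:
  "!!c C. C ~= {} ==> ~ (ALL i0<n. ALL b:C. EX x:C. b < x & (ALL i<n. \<Phi> i x (c i) \<longleftrightarrow> i = i0))" by blast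
 have "EX x:S. b < x & (ALL i<n. \<Phi> i x (%_. 0) \<longleftrightarrow> i = i0)" if b: "b \<in> S" for b i0
 proof -
  define g where "g = (if s > 1 then s else inverse s)"
  have g: "g \<in> S" "g > 1" using s s1 s0 subgrpD(4)[OF S s] by (auto simp: g_def one_less_inverse_iff)
  \<comment> \<open>\<open>u\<close> lies in \<open>S\<close> above \<open>b\<close>,
    \<open>inverse s\<close> and 1. The second bound gives \<open>s * u > 1\<close>, whence
    \<open>x >= u > b\<close> below.\<close>
  define u where "u = max (max b (inverse s)) 1 * g"
  have "max (max b (inverse s)) 1 \<in> S" using b subgrpD(2)[OF S] subgrpD(4)[OF S s] by (auto simp: max_def)
  then have u: "u \<in> S" unfolding u_def using subgrpD(3)[OF S] g by blast
  have "max (max b (inverse s)) 1 < u" unfolding u_def using g by (intro mult_less_cancel_left1[THEN iffD2]) (auto simp: max_def)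
  then have u': "b < u" "inverse s < u" "1 < u" by auto
  have su: "s * u > 1" using u'(2) s0 by (simp add: field_simps)
  \<comment> \<open>An \<open>M^i0\<close>-th power of an element of \<open>S\<close>. If it were
    \<open>t^(M^(i0+1))\<close> with \<open>t\<close> in \<open>S\<close>, then
    \<open>(t / u)^M = s\<close>, and \<open>s\<close> would have a root in
    \<open>S\<close>.\<close>
  define x where "x = (s * u ^ M) ^ (M ^ i0)"
  have x: "x \<in> S" unfolding x_def by (intro subgrpD(6)[OF S] subgrpD(3)[OF S] s u)
  have "x = (s * u) ^ (M ^ i0) * (u ^ (M - 1)) ^ (M ^ i0)"
  proof -
   have "u ^ M = u * u ^ (M - 1)" using M by (metis power_minus_mult mult.commute)
   then show ?thesis unfolding x_def by (simp add: power_mult_distrib mult.assoc)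
  qed
  moreover have "(s * u) ^ (M ^ i0) >= 1" using su by (intro one_le_power) auto
  moreover have "(u ^ (M - 1)) ^ (M ^ i0) >= u"
  proof -
   have "u ^ 1 <= u ^ ((M - 1) * M ^ i0)" using u' M2 by (intro power_increasing) auto
   then show ?thesis by (simp add: power_mult)
  qed
  ultimately have "x >= u" using u' mult_mono[of 1 "(s * u) ^ (M ^ i0)" u "(u ^ (M - 1)) ^ (M ^ i0)"] by auto
  then have bx: "b < x" using u' by auto
  have nr: "x ~= t ^ (M ^ Suc i0)" if t: "t \<in> S" for t
  proof
   assume "x = t ^ (M ^ Suc i0)"
   then have "(s * u ^ M) ^ (M ^ i0) = (t ^ M) ^ (M ^ i0)" unfolding x_def by (simp add: power_mult)
   then have "s * u ^ M = t ^ M"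
    by (rule power_eq_imp_eq_base) (use s0 u' subgrpD(1)[OF S t] M in auto)
   then have "(t / u) ^ M = s" using u' by (simp add: power_divide field_simps)
   then show False using no subgrpD(5)[OF S t u] by blast
  qed
  have "\<Phi> i x (%_. 0) \<longleftrightarrow> i = i0" for i
  proof
   assume \<Phi>: "\<Phi> i x (%_. 0)"
   show "i = i0"
   proof (rule ccontr)
    assume "i ~= i0"
    then consider "i < i0" | "i0 < i" by linarith
    then show False
    proof cases
     case 1
     then obtain k where k: "i0 = Suc i + k" using less_imp_Suc_add by auto
     have "x = ((s * u ^ M) ^ (M ^ k)) ^ (M ^ Suc i)"
      unfolding x_def k by (simp add: power_add mult_ac flip: power_mult)
     moreover have "(s * u ^ M) ^ (M ^ k) \<in> S" by (intro subgrpD(6)[OF S] subgrpD(3)[OF S] s u)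
     ultimately show False using \<Phi> unfolding \<Phi>_def by blast
    next
     case 2
     then obtain k where k: "i = Suc i0 + k" using less_imp_Suc_add by auto
     obtain t where t: "t \<in> S" "x = t ^ (M ^ i)" using \<Phi> unfolding \<Phi>_def by blast
     have "x = (t ^ (M ^ k)) ^ (M ^ Suc i0)"
      unfolding t(2) k by (simp add: power_add mult_ac flip: power_mult)
     then show False using nr[OF subgrpD(6)[OF S t(1)]] by blast
    qed
   qed
  next
   assume "i = i0"
   moreover have "s * u ^ M \<in> S" by (intro subgrpD(3)[OF S] subgrpD(6)[OF S] s u)
   ultimately show "\<Phi> i x (%_. 0)" unfolding \<Phi>_def using nr x_def by blast
  qed
  then show ?thesis using x bx by blast
 qed
 then show False using n[of S "%_ _. 0"] s by blast
qed

text \<open>If a positive power of \<open>x\<close> were in \<open>S\<close>, divisibility and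
  uniqueness of positive roots would put \<open>x\<close> into \<open>S\<close>. So the cosets
  \<open>x^i S\<close> are pairwise disjoint, and as rows they give a forbidden pattern.\<close>

lemma subgrp_convex:
 assumes dps: "dps TYPE('a::linordered_field)" and D: "Def (%e. e 0 \<in> (S :: 'a set))"
  and S: "subgrp S" and s: "s \<in> S" and x: "1 <= x" "x <= s"
 shows "x \<in> S"
proof (rule ccontr)
 assume no: "x ~: S"
 then have x1: "1 < x" using x subgrpD(2)[OF S] by (cases "x = 1") auto
 have pw: "k = 0" if xk: "x ^ k \<in> S" for k
 proof (rule ccontr)
  assume "k ~= 0"
  then obtain t where t: "t \<in> S" "t ^ k = x ^ k" using subgrp_divisible[OF dps D S _ xk] by blast
  then have "t = x" using x1 subgrpD(1)[OF S t(1)] \<open>k ~= 0\<close> by (intro power_eq_imp_eq_base[of t k x]) auto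
  then show False using t no by auto
 qed
 have pw2: "x ^ i / x ^ j \<in> S \<longleftrightarrow> i = j" for i j
 proof
  assume q: "x ^ i / x ^ j \<in> S"
  show "i = j"
  proof (cases "j <= i")
   case True
   then have "x ^ (i - j) \<in> S" using q x1 by (simp add: power_diff)
   then show ?thesis using pw True by force
  next
   case False
   then have "x ^ (j - i) \<in> S" using subgrpD(4)[OF S q] x1 by (simp add: power_diff)
   then show ?thesis using pw False by force
  qed
 qed (use x1 subgrpD(2)[OF S] in auto)
 define \<Phi> where "\<Phi> i y e = (y / e 0 \<in> S)" for i :: nat and y and e :: "nat => 'a"
 have "Def1 (\<Phi> i)" for i unfolding Def1_def \<Phi>_def by (intro Def_intros Def_mem[OF D])
 from cofinal_pattern[where \<Phi> = \<Phi>, OF dps this] obtain n where n: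
  "!!c C. C ~= {} ==> ~ (ALL i0<n. ALL b:C. EX x:C. b < x & (ALL i<n. \<Phi> i x (c i) \<longleftrightarrow> i = i0))" by blast
 \<comment> \<open>The downward closure of \<open>S\<close>. As \<open>x <= s\<close>, every coset
   \<open>x^i S\<close> is cofinal in it.\<close>
 define C where "C = {y. EX s:S. y <= s}"
 have "EX y:C. b < y & (ALL i<n. \<Phi> i y (%_. x ^ i) \<longleftrightarrow> i = i0)" if b: "b \<in> C" for b i0
 proof -
  obtain s0 where s0: "s0 \<in> S" "b <= s0" using b by (auto simp: C_def)
  define y where "y = s0 * s * x ^ i0"
  have pos: "s0 > 0" "s > 1" using subgrpD(1)[OF S s0(1)] x x1 by auto
  have "y <= s0 * s * s ^ i0" unfolding y_def using pos x x1 by (intro mult_left_mono power_mono) auto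
  moreover have "s0 * s * s ^ i0 \<in> S" by (intro subgrpD(3)[OF S] subgrpD(6)[OF S] s0(1) s)
  ultimately have "y \<in> C" by (auto simp: C_def)
  moreover have "b < y"
  proof -
   have "s0 * 1 < s0 * s" using pos by (intro mult_strict_left_mono) auto
   moreover have "s0 * s * 1 <= y" unfolding y_def using pos x1 by (intro mult_left_mono one_le_power) auto
   ultimately show ?thesis using s0 by auto
  qed
  moreover have "\<Phi> i y (%_. x ^ i) \<longleftrightarrow> i = i0" for i
  proof -
   have ss: "s0 * s \<in> S" by (intro subgrpD(3)[OF S] s0(1) s)
   have y: "y / x ^ i = (s0 * s) * (x ^ i0 / x ^ i)" by (simp add: y_def)
   have "y / x ^ i \<in> S \<longleftrightarrow> x ^ i0 / x ^ i \<in> S"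
   proof
    assume "y / x ^ i \<in> S"
    then have "(y / x ^ i) / (s0 * s) \<in> S" using ss subgrpD(5)[OF S] by blast
    then show "x ^ i0 / x ^ i \<in> S" unfolding y using pos by simp
   next
    assume "x ^ i0 / x ^ i \<in> S"
    then show "y / x ^ i \<in> S" unfolding y by (rule subgrpD(3)[OF S ss])
   qed
   then show ?thesis unfolding \<Phi>_def pw2 by auto
  qed
  ultimately show ?thesis by blast
 qed
 moreover have "C ~= {}" using s by (auto simp: C_def)
 ultimately show False using n[of C "%i _. x ^ i"] by blast
qed

section \<open>Germs at 0\<close>

definition acc :: "'a::linordered_field set => bool" where
 "acc Y \<longleftrightarrow> (ALL \<epsilon>>0. EX x:Y. 0 < x & x < \<epsilon>)"

lemma acc_mono: "acc Y ==> Y \<subseteq> Z ==> acc Z"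
 unfolding acc_def by blast

lemma acc_split: assumes "acc Y" shows "acc (Y \<inter> A) | acc (Y - A)"
proof (rule ccontr)
 assume "~ ?thesis"
 then obtain a b where "a > 0" "b > 0" "ALL x:Y \<inter> A. 0 < x --> ~ x < a" "ALL x:Y - A. 0 < x --> ~ x < b"
  unfolding acc_def by blast
 then show False using assms[unfolded acc_def, rule_format, of "min a b"] by auto
qed

lemma acc_atom:
 assumes "finite K" "acc Y"
 shows "\<exists>v\<subseteq>Y. acc v & (ALL k:K. v \<subseteq> G k | v \<inter> G k = {})"
 using assms(1)
proof (induction K rule: finite_induct)
 case empty
 then show ?case using assms(2) by blast
next
 case (insert k K)
 then obtain v where v: "v \<subseteq> Y" "acc v" "ALL k:K. v \<subseteq> G k | v \<inter> G k = {}" by blast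
 from acc_split[OF v(2), of "G k"] show ?case
 proof
  assume "acc (v \<inter> G k)"
  then show ?thesis using v(1,3) by (intro exI[of _ "v \<inter> G k"]) blast
 next
  assume "acc (v - G k)"
  then show ?thesis using v(1,3) by (intro exI[of _ "v - G k"]) blast
 qed
qed

text \<open>Halving: among \<open>2 ^ m\<close> sets with distinct germs there are \<open>m\<close> symmetric differences none
 of which is covered by the previous ones near \<open>0\<close>.\<close>

lemma germ_halving:
 fixes G :: "nat => 'a::linordered_field set"
 assumes "!!k l. k ~= l ==> acc {x. (x \<in> G k) ~= (x \<in> G l)}"
 shows "finite K ==> 2 ^ m <= card K ==> EX p q. (ALL l<m. p l \<in> K & q l \<in> K &
   acc {x. (x \<in> G (p l)) ~= (x \<in> G (q l)) & (ALL l'<l. (x \<in> G (p l')) = (x \<in> G (q l')))})"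
proof (induction m arbitrary: K)
 case 0
 then show ?case by auto
next
 case (Suc m)
 have "2 ^ Suc m >= (2::nat)" by simp
 then have "~ card K <= 1" using Suc.prems by linarith
 then obtain k k' where k: "k \<in> K" "k' \<in> K" "k ~= k'"
  using card_le_Suc0_iff_eq[OF Suc.prems(1)] by auto
 from acc_atom[OF Suc.prems(1) assms[OF k(3)], of G] obtain v where
  v: "v \<subseteq> {x. (x \<in> G k) ~= (x \<in> G k')}" "acc v" "ALL k:K. v \<subseteq> G k | v \<inter> G k = {}" by blast
 \<comment> \<open>Each set contains \<open>v\<close> or is disjoint from it. The sets of the larger
   half agree on \<open>v\<close>, so all differences chosen inside that half vanish there, while
   \<open>G k\<close> and \<open>G k'\<close> differ on \<open>v\<close>.\<close>
 define K1 where "K1 = {j \<in> K. v \<subseteq> G j}"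
 define K0 where "K0 = {j \<in> K. v \<inter> G j = {}}"
 have "K = K1 \<union> K0" using v(3) by (auto simp: K1_def K0_def)
 then have "card K <= card K1 + card K0" using card_Un_le by metis
 then have "2 ^ m <= card K1 | 2 ^ m <= card K0" using Suc.prems(2) by auto
 moreover have f: "finite K1" "finite K0" using Suc.prems by (auto simp: K1_def K0_def)
 ultimately obtain K' where K': "finite K'" "2 ^ m <= card K'" "K' = K1 | K' = K0" by blast
 then have same: "(x \<in> G i) = (x \<in> G j)" if "x \<in> v" "i \<in> K'" "j \<in> K'" for x i j
  using that by (auto simp: K1_def K0_def)
 obtain p q where pq: "!!l. l < m ==> p l \<in> K' & q l \<in> K' &
   acc {x. (x \<in> G (p l)) ~= (x \<in> G (q l)) & (ALL l'<l. (x \<in> G (p l')) = (x \<in> G (q l')))}"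
  using Suc.IH[OF K'(1,2)] by blast
 have sub: "K' \<subseteq> K" using K'(3) by (auto simp: K1_def K0_def)
 show ?case
 proof (rule exI[of _ "p(m := k)"], rule exI[of _ "q(m := k')"], intro allI impI)
  fix l assume l: "l < Suc m"
  show "(p(m := k)) l \<in> K & (q(m := k')) l \<in> K &
   acc {x. (x \<in> G ((p(m := k)) l)) ~= (x \<in> G ((q(m := k')) l)) &
    (ALL l'<l. (x \<in> G ((p(m := k)) l')) = (x \<in> G ((q(m := k')) l')))}"
  proof (cases "l = m")
   case True
   have "v \<subseteq> {x. (x \<in> G k) ~= (x \<in> G k') & (ALL l'<m. (x \<in> G (p l')) = (x \<in> G (q l')))}"
    using v(1) same pq by blast
   from acc_mono[OF v(2) this] show ?thesis using True k by (simp cong: conj_cong)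
  next
   case False
   then have "l < m" using l by simp
   from pq[OF this] have "acc {x. (x \<in> G (p l)) ~= (x \<in> G (q l)) & (ALL l'<l. (x \<in> G (p l')) = (x \<in> G (q l')))}" by blast
   also have "{x. (x \<in> G (p l)) ~= (x \<in> G (q l)) & (ALL l'<l. (x \<in> G (p l')) = (x \<in> G (q l')))} =
    {x. (x \<in> G ((p(m := k)) l)) ~= (x \<in> G ((q(m := k')) l)) &
    (ALL l'<l. (x \<in> G ((p(m := k)) l')) = (x \<in> G ((q(m := k')) l')))}"
    using \<open>l < m\<close> by (intro Collect_cong) auto
   finally show ?thesis using pq[OF \<open>l < m\<close>] sub False by auto
  qed
 qed
qed

text \<open>Otherwise the sets \<open>{x. c^k * x \<in> X}\<close> have pairwise different germs at
  0. Halving then yields differences of pairs none of which is covered by its predecessors, and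
  these are the rows of a forbidden pattern at 0.\<close>

lemma germ_periodic:
 assumes dps: "dps TYPE('a::linordered_field)" and D: "Def (%e. e 0 \<in> (X :: 'a set))" and c: "c > 0"
 shows "EX M>0. EX \<epsilon>>0. ALL x. 0 < x --> x < \<epsilon> --> (x \<in> X \<longleftrightarrow> c ^ M * x \<in> X)"
proof (rule ccontr)
 assume no: "~ ?thesis"
 define G where "G k = {x. c ^ k * x \<in> X}" for k :: nat
 have less: "acc {x. (x \<in> G k) ~= (x \<in> G l)}" if "k < l" for k l
  unfolding acc_def
 proof (intro allI impI)
  fix \<epsilon> :: 'a assume \<epsilon>: "\<epsilon> > 0"
  then have "\<epsilon> * c ^ k > 0" using c by simp
  moreover have "l - k > 0" using that by simp
  ultimately have "~ (ALL x. 0 < x --> x < \<epsilon> * c ^ k --> (x \<in> X \<longleftrightarrow> c ^ (l - k) * x \<in> X))" using no by blast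
  then obtain y where y: "0 < y" "y < \<epsilon> * c ^ k" "(y \<in> X) ~= (c ^ (l - k) * y \<in> X)" by blast
  have "c ^ k * (y / c ^ k) = y" "c ^ l * (y / c ^ k) = c ^ (l - k) * y"
   using c that by (auto simp: power_diff)
  then have "(y / c ^ k \<in> G k) ~= (y / c ^ k \<in> G l)" using y(3) by (simp add: G_def)
  moreover have "0 < y / c ^ k" "y / c ^ k < \<epsilon>" using y c by (auto simp: field_simps)
  ultimately show "EX x:{x. (x \<in> G k) ~= (x \<in> G l)}. 0 < x & x < \<epsilon>" by blast
 qed
 have ne: "acc {x. (x \<in> G k) ~= (x \<in> G l)}" if "k ~= l" for k l
 proof (cases "k < l")
  case False
  then have "acc {x. (x \<in> G l) ~= (x \<in> G k)}" using less that by auto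
  then show ?thesis by (rule acc_mono) auto
 qed (rule less)
 \<comment> \<open>Parameters \<open>2 * l\<close> and \<open>2 * l + 1\<close> are the multipliers
   of the \<open>l\<close>-th pair; \<open>\<Phi>\<close> removes the earlier differences to make
   the rows disjoint.\<close>
 define \<Delta> where "\<Delta> l x e = ((e (2 * l) * x \<in> X) \<longleftrightarrow> ~ (e (2 * l + 1) * x \<in> X))" for l x and e :: "nat => 'a"
 define \<Phi> where "\<Phi> l x e = (\<Delta> l x e & (ALL l':{..<l}. ~ \<Delta> l' x e))" for l x and e :: "nat => 'a"
 have "Def1 (\<Phi> i)" for i unfolding Def1_def \<Phi>_def \<Delta>_def
  by (intro Def_conj Def_finite_all Def_not Def_iff Def_mem[OF D] DefT_intros) auto
 from germ_pattern[where \<Phi> = \<Phi>, OF dps this] obtain n where n: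
  "!!c. ~ (ALL i0<n. ALL \<epsilon>>0. EX x. 0 < x & x < \<epsilon> & (ALL i<n. \<Phi> i x (c i) \<longleftrightarrow> i = i0))" by blast
 obtain p q where pq: "!!l. l < n ==>
   acc {x. (x \<in> G (p l)) ~= (x \<in> G (q l)) & (ALL l'<l. (x \<in> G (p l')) = (x \<in> G (q l')))}"
 proof -
  assume *: "!!p q. (!!l. l < n ==> acc {x. (x \<in> G (p l)) ~= (x \<in> G (q l)) & (ALL l'<l. (x \<in> G (p l')) = (x \<in> G (q l')))}) ==> thesis"
  obtain p q where "ALL l<n. p l \<in> {..<2 ^ n} & q l \<in> {..<2 ^ n} &
    acc {x. (x \<in> G (p l)) ~= (x \<in> G (q l)) & (ALL l'<l. (x \<in> G (p l')) = (x \<in> G (q l')))}"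
   using germ_halving[of G "{..<2 ^ n}" n, OF ne] by auto
  then show thesis by (intro *[of p q]) blast
 qed
 define e where "e k = (if even k then c ^ (p (k div 2)) else c ^ (q (k div 2)))" for k
 have \<Delta>: "\<Delta> l x e \<longleftrightarrow> (x \<in> G (p l)) ~= (x \<in> G (q l))" for l x
  by (auto simp: \<Delta>_def e_def G_def)
 have "EX x. 0 < x & x < \<epsilon> & (ALL i<n. \<Phi> i x e \<longleftrightarrow> i = i0)" if i0: "i0 < n" and \<epsilon>: "\<epsilon> > 0" for i0 \<epsilon>
 proof -
  obtain x where x: "0 < x" "x < \<epsilon>" "(x \<in> G (p i0)) ~= (x \<in> G (q i0))" "ALL l'<i0. (x \<in> G (p l')) = (x \<in> G (q l'))"
   using pq[OF i0] \<epsilon> unfolding acc_def by blast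
  then have "\<Phi> i0 x e" unfolding \<Phi>_def \<Delta> by auto
  moreover have "i = i0" if "\<Phi> i x e" for i
   using that \<open>\<Phi> i0 x e\<close> unfolding \<Phi>_def by (metis lessThan_iff nat_neq_iff)
  ultimately show ?thesis using x by blast
 qed
 then show False using n[of "%_. e"] by blast
qed

text \<open>The \<open>c\<close> for which \<open>X\<close> and \<open>c X\<close> agree on \<open>(0, r)\<close> form a definable, hence convex, group.\<close>

lemma germ_doubling:
 assumes dps: "dps TYPE('a::linordered_field)" and D: "Def (%e. e 0 \<in> (X :: 'a set))"
 shows "EX r>0. ALL x y. 0 < x --> x <= y --> y < r --> y <= 2 * x --> (x \<in> X \<longleftrightarrow> y \<in> X)"
proof -
 obtain M r where M: "M > 0" "r > 0" "!!x. 0 < x ==> x < r ==> (x \<in> X \<longleftrightarrow> 2 ^ M * x \<in> X)"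
  using germ_periodic[OF dps D, of 2] by auto
 define S where "S = {c. c > 0 & (ALL x. 0 < x --> x < r --> c * x < r --> (x \<in> X \<longleftrightarrow> c * x \<in> X))}"
 have DS: "Def (%e. e 0 \<in> S)" unfolding S_def mem_Collect_eq by (intro Def_intros Def_mem[OF D])
 have "subgrp S" unfolding subgrp_def
 proof (intro conjI ballI)
  show "1 \<in> S" "x \<in> S ==> x > 0" for x by (auto simp: S_def)
  fix a assume a: "a \<in> S"
  have a': "a > 0" "!!x. 0 < x ==> x < r ==> a * x < r ==> (x \<in> X \<longleftrightarrow> a * x \<in> X)"
   using a by (auto simp: S_def)
  have "x \<in> X \<longleftrightarrow> inverse a * x \<in> X" if "0 < x" "x < r" "inverse a * x < r" for x
  proof -
   have ax: "a * (inverse a * x) = x" using a'(1) by simp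
   show ?thesis using a'(2)[of "inverse a * x"] that a'(1) unfolding ax by simp
  qed
  then show "inverse a \<in> S" using a'(1) by (auto simp: S_def)
  fix b assume b: "b \<in> S"
  have ab0: "a > 0" "b > 0" using a b by (auto simp: S_def)
  have "x \<in> X \<longleftrightarrow> a * b * x \<in> X" if x: "0 < x" "x < r" "a * b * x < r" for x
  proof (cases "b * x < r")
   case True
   then have "x \<in> X \<longleftrightarrow> b * x \<in> X" using b x by (auto simp: S_def)
   also have "\<dots> \<longleftrightarrow> a * (b * x) \<in> X" using a x True ab0 by (auto simp: S_def mult.assoc)
   finally show ?thesis by (simp add: mult.assoc)
  next
   case False
   \<comment> \<open>\<open>b * x\<close> may leave \<open>(0, r)\<close> although
     \<open>a * b * x\<close> does not. In that case \<open>a < 1\<close>, and the two factors are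
     applied in the other order.\<close>
   have "a < 1"
   proof (rule ccontr)
    assume "~ a < 1"
    then have "1 * (b * x) <= a * (b * x)" using ab0 x by (intro mult_right_mono) auto
    then show False using False x(3) by (simp add: mult.assoc)
   qed
   then have "a * x < 1 * x" using x(1) by (rule mult_strict_right_mono)
   then have "a * x < r" using x(2) by (metis less_trans mult_1)
   then have "x \<in> X \<longleftrightarrow> a * x \<in> X" using a x by (auto simp: S_def)
   also have "\<dots> \<longleftrightarrow> b * (a * x) \<in> X" using b x \<open>a * x < r\<close> ab0 by (auto simp: S_def mult_ac)
   finally show ?thesis by (simp add: mult_ac)
  qed
  then show "a * b \<in> S" using ab0 by (auto simp: S_def)
 qed
 moreover have "2 ^ M \<in> S" using M by (auto simp: S_def)
 moreover have "(2::'a) <= 2 ^ M" using M(1) self_le_power[of 2 M] by auto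
 \<comment> \<open>Periodicity only puts \<open>2^M\<close> into the group; convexity adds all of
   \<open>[1, 2]\<close>.\<close>
 ultimately have S: "c \<in> S" if "1 <= c" "c <= 2" for c
  using subgrp_convex[OF dps DS, of "2 ^ M" c] that by auto
 show ?thesis
 proof (intro exI[of _ r] conjI allI impI)
  fix x y :: 'a assume xy: "0 < x" "x <= y" "y < r" "y <= 2 * x"
  then have "y / x \<in> S" by (intro S) (auto simp: field_simps)
  then show "x \<in> X \<longleftrightarrow> y \<in> X" using xy unfolding S_def by auto
 qed (rule M)
qed

section \<open>Uniform finiteness of sets without intervals\<close>

definition has_ival :: "('a::linordered_field => bool) => bool" where
 "has_ival P \<longleftrightarrow> (EX u v. u < v & (ALL x. u < x --> x < v --> P x))"

text \<open>Near 0, membership of \<open>t\<close> is shared by all of \<open>[t, 2 * t)\<close>, so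
  a single small member brings an interval with it.\<close>

lemma isolated_right:
 assumes dps: "dps TYPE('a::linordered_field)" and D: "Def (%e. X (e 0 :: 'a))" and no: "~ has_ival X"
 shows "EX r>0. ALL t. 0 < t --> t < r --> ~ X t"
proof -
 obtain r where r: "r > 0" "!!x y. 0 < x ==> x <= y ==> y < r ==> y <= 2 * x ==> (X x \<longleftrightarrow> X y)"
  using germ_doubling[OF dps, of "Collect X"] D by auto
 have "~ X t" if t: "0 < t" "t < r" for t
 proof
  assume X: "X t"
  have "has_ival X" unfolding has_ival_def
  proof (intro exI conjI allI impI)
   show "t < min (2 * t) r" using t by auto
   fix x assume "t < x" "x < min (2 * t) r"
   then show "X x" using r(2)[of t x] X t by auto
  qed
  then show False using no by simp
 qed
 then show ?thesis using r(1) by blast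
qed

lemma isolated:
 assumes dps: "dps TYPE('a::linordered_field)" and D: "Def (%e. X (e 0 :: 'a))" and no: "~ has_ival X"
 shows "EX r>0. ALL x. X x --> \<bar>x - a\<bar> < r --> x = a"
proof -
 have D1: "Def (%e. X (a + e 0))" "Def (%e. X (a - e 0))"
 proof -
  have T: "DefT (%e. a + e 0)" "DefT (%e. a - e 0)" by (intro DefT_intros)+
  show "Def (%e. X (a + e 0))" "Def (%e. X (a - e 0))"
   using Def_subst[OF D, of "%e _. a + e 0", OF T(1)] Def_subst[OF D, of "%e _. a - e 0", OF T(2)] by simp_all
 qed
 have no1: "~ has_ival (%t. X (a + t))"
 proof
  assume "has_ival (%t. X (a + t))"
  then obtain u v where uv: "u < v" "!!x. u < x ==> x < v ==> X (a + x)" by (auto simp: has_ival_def)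
  have "X x" if "a + u < x" "x < a + v" for x
   using that uv(2)[of "x - a"] by (auto simp: less_diff_eq diff_less_eq add.commute)
  then show False using no uv(1) unfolding has_ival_def by (metis add_strict_left_mono)
 qed
 have no2: "~ has_ival (%t. X (a - t))"
 proof
  assume "has_ival (%t. X (a - t))"
  then obtain u v where uv: "u < v" "!!x. u < x ==> x < v ==> X (a - x)" by (auto simp: has_ival_def)
  have "X x" if "a - v < x" "x < a - u" for x
   using that uv(2)[of "a - x"] by (auto simp: less_diff_eq diff_less_eq add.commute)
  then show False using no uv(1) unfolding has_ival_def by (metis diff_strict_left_mono)
 qed
 obtain r1 where r1: "r1 > 0" "!!t. 0 < t ==> t < r1 ==> ~ X (a + t)"
  using isolated_right[OF dps D1(1) no1] by blast
 obtain r2 where r2: "r2 > 0" "!!t. 0 < t ==> t < r2 ==> ~ X (a - t)"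
  using isolated_right[OF dps D1(2) no2] by blast
 show ?thesis
 proof (intro exI[of _ "min r1 r2"] conjI allI impI)
  fix x assume x: "X x" "\<bar>x - a\<bar> < min r1 r2"
  show "x = a"
  proof (rule ccontr)
   assume "x ~= a"
   then consider "x > a" | "x < a" by linarith
   then show False
   proof cases
    case 1 then show False using r1(2)[of "x - a"] x by auto
   next
    case 2 then show False using r2(2)[of "a - x"] x by auto
   qed
  qed
 qed (use r1 r2 in auto)
qed

text \<open>Points of a set without intervals are isolated. Given \<open>n\<close> of them, small
  neighbourhoods as rows and small translates of \<open>X\<close> as columns form an array of size
  \<open>n\<close>, so the number of points is bounded in terms of the formulas alone.\<close>

theorem fin_or_ival:
 assumes dps: "dps TYPE('a::linordered_field)" and D: "Def1 (X :: 'a => _)"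
 shows "EX N. ALL e. has_ival (%x. X x e) | (finite {x. X x e} & card {x. X x e} <= N)"
proof -
 define \<Phi> where "\<Phi> i x e = (\<bar>x - e 0\<bar> < e (Suc 0))" for i :: nat and x :: 'a and e :: "nat => 'a"
 have D1: "Def1 (\<Phi> i)" for i unfolding Def1_def \<Phi>_def by (intro Def_intros)
 define \<Psi> where "\<Psi> x e = X (x - e 0) (%i. e (Suc i))" for x :: 'a and e
 have D2: "Def1 \<Psi>" unfolding Def1_def \<Psi>_def by (intro Def1_app[OF D] DefT_intros)
 from dpsD[where \<Phi> = \<Phi>, OF dps D1 D2] obtain n where
  n: "!!c b. ~ array n (%i x. \<Phi> i x (c i)) (%j x. \<Psi> x (b j))" by blast
 show ?thesis
 proof (intro exI[of _ n] allI)
  fix e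
  show "has_ival (%x. X x e) | (finite {x. X x e} & card {x. X x e} <= n)"
  proof (rule ccontr)
   assume "~ ?thesis"
   then have no: "~ has_ival (%x. X x e)" and big: "~ (finite {x. X x e} & card {x. X x e} <= n)" by auto
   have "\<exists>F\<subseteq>{x. X x e}. finite F & card F = n"
   proof (cases "finite {x. X x e}")
    case True
    then show ?thesis using big obtain_subset_with_card_n[of n "{x. X x e}"] by (metis nat_le_linear finite_subset)
   next
    case False
    then show ?thesis using infinite_arbitrarily_large[of "{x. X x e}" n] by blast
   qed
   then obtain F where F: "F \<subseteq> {x. X x e}" "finite F" "card F = n" by blast
   obtain p where p: "bij_betw p {0..<n} F" using ex_bij_betw_nat_finite[OF F(2)] F(3) by blast
   have pX: "X (p i) e" if "i < n" for i using p F(1) that unfolding bij_betw_def by force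
   have pinj: "p i = p j \<longleftrightarrow> i = j" if "i < n" "j < n" for i j
    using p that by (auto simp: bij_betw_def inj_on_def)
   have De: "Def (%e'. X (e' 0) e)" by (rule Def1_app[OF D]) (intro DefT_intros)+
   have "ALL i. EX r>0. ALL x. X x e --> \<bar>x - p i\<bar> < r --> x = p i"
    using isolated[OF dps De no] by blast
   then obtain r where r: "!!i. r i > 0" "!!i x. X x e ==> \<bar>x - p i\<bar> < r i ==> x = p i" by metis
   define \<eta> where "\<eta> = Min (insert 1 (r ` {..<n}))"
   have \<eta>0: "\<eta> > 0" unfolding \<eta>_def using r(1) by (subst Min_gr_iff) auto
   have \<eta>r: "\<eta> <= r i" if "i < n" for i unfolding \<eta>_def using that by (intro Min_le) auto
   \<comment> \<open>Distinct shifts of at most a quarter of the common isolation radius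
     \<open>\<eta>\<close>: if \<open>p i0 + \<delta> j0 - \<delta> j\<close> belongs to
     \<open>X\<close>, it must be \<open>p i0\<close> itself, and \<open>j = j0\<close>.\<close>
   define \<delta> where "\<delta> j = \<eta> / 4 / of_nat (j + 1)" for j
   have \<delta>0: "\<delta> j > 0" for j using \<eta>0 by (simp add: \<delta>_def del: of_nat_Suc of_nat_add)
   have \<delta>1: "\<delta> j <= \<eta> / 4" for j
   proof -
    have "(\<eta> / 4) * 1 <= (\<eta> / 4) * of_nat (j + 1)" using \<eta>0 by (intro mult_left_mono) auto
    then show ?thesis unfolding \<delta>_def by (subst pos_divide_le_eq) (auto simp: add_pos_nonneg)
   qed
   have \<delta>inj: "\<delta> j = \<delta> k \<longleftrightarrow> j = k" for j k
   proof
    assume "\<delta> j = \<delta> k"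
    then have "(of_nat (j + 1) :: 'a) = of_nat (k + 1)"
     unfolding \<delta>_def using \<eta>0 by (simp add: field_simps del: of_nat_Suc of_nat_add)
    then show "j = k" by (simp only: of_nat_eq_iff)
   qed simp
   have "array n (%i x. \<Phi> i x (%k. if k = 0 then p i else \<eta> / 2)) (%j x. \<Psi> x (case_nat (\<delta> j) e))"
    unfolding array_def
   proof (intro allI impI)
    fix i0 j0 assume ij: "i0 < n" "j0 < n"
    show "EX x. (ALL i<n. \<Phi> i x (%k. if k = 0 then p i else \<eta> / 2) \<longleftrightarrow> i = i0) & (ALL j<n. \<Psi> x (case_nat (\<delta> j) e) \<longleftrightarrow> j = j0)"
    proof (intro exI[of _ "p i0 + \<delta> j0"] conjI allI impI)
     fix i assume i: "i < n"
     show "\<Phi> i (p i0 + \<delta> j0) (%k. if k = 0 then p i else \<eta> / 2) \<longleftrightarrow> i = i0"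
     proof
      assume "\<Phi> i (p i0 + \<delta> j0) (%k. if k = 0 then p i else \<eta> / 2)"
      then have "\<bar>p i0 + \<delta> j0 - p i\<bar> < \<eta> / 2" by (simp add: \<Phi>_def)
      then have "\<bar>p i0 - p i\<bar> < \<eta>" using \<delta>0[of j0] \<delta>1[of j0] \<eta>0 unfolding abs_less_iff by linarith
      then have "p i0 = p i" using r(2)[OF pX[OF ij(1)], of i] \<eta>r[OF i] by auto
      then show "i = i0" using pinj ij i by auto
     next
      assume "i = i0"
      then show "\<Phi> i (p i0 + \<delta> j0) (%k. if k = 0 then p i else \<eta> / 2)"
       using \<delta>0[of j0] \<delta>1[of j0] \<eta>0 by (simp add: \<Phi>_def)
     qed
    next
     fix j assume j: "j < n"
     show "\<Psi> (p i0 + \<delta> j0) (case_nat (\<delta> j) e) \<longleftrightarrow> j = j0"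
     proof
      assume "\<Psi> (p i0 + \<delta> j0) (case_nat (\<delta> j) e)"
      then have "X (p i0 + \<delta> j0 - \<delta> j) e" by (simp add: \<Psi>_def)
      moreover have "\<bar>(p i0 + \<delta> j0 - \<delta> j) - p i0\<bar> < r i0"
       using \<delta>0[of j0] \<delta>1[of j0] \<delta>0[of j] \<delta>1[of j] \<eta>0 \<eta>r[OF ij(1)] by (simp add: abs_less_iff)
      ultimately have "p i0 + \<delta> j0 - \<delta> j = p i0" by (rule r(2))
      then show "j = j0" using \<delta>inj[of j j0] by auto
     qed (use pX[OF ij(1)] in \<open>simp add: \<Psi>_def\<close>)
    qed
   qed
   then show False using n[of "%i k. if k = 0 then p i else \<eta> / 2" "%j. case_nat (\<delta> j) e"] by simp
  qed
 qed
qed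

section \<open>Definable sets and functions in several variables\<close>

definition near :: "'a::linordered_field list => 'a => 'a list => bool" where
 "near c r xs \<longleftrightarrow> list_all2 (%x y. \<bar>x - y\<bar> < r) xs c"

definition fat :: "nat => ('a::linordered_field list => bool) => bool" where
 "fat n P \<longleftrightarrow> (EX c r. length c = n & r > 0 & (ALL xs. near c r xs --> P xs))"

lemma near_Nil [simp]: "near [] r xs \<longleftrightarrow> xs = []"
 by (auto simp: near_def)

lemma near_Cons [simp]: "near (c # cs) r (x # xs) \<longleftrightarrow> \<bar>x - c\<bar> < r & near cs r xs"
 by (auto simp: near_def)

lemma near_Cons_iff: "near (c # cs) r zs \<longleftrightarrow> (EX x xs. zs = x # xs & \<bar>x - c\<bar> < r & near cs r xs)"
 by (cases zs) (auto simp: near_def)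

lemma near_length: "near c r xs ==> length xs = length c"
 by (auto simp: near_def dest: list_all2_lengthD)

lemma near_conv: "near c r xs \<longleftrightarrow> length xs = length c & (ALL i<length c. \<bar>xs ! i - c ! i\<bar> < r)"
 by (auto simp: near_def list_all2_conv_all_nth)

lemma near_refl: "r > 0 ==> near c r c"
 by (auto simp: near_conv)

lemma near_mono: "near c r xs ==> r <= r' ==> near c r' xs"
 by (fastforce simp: near_conv)

lemma fatI: "length c = n ==> r > 0 ==> (!!xs. near c r xs ==> P xs) ==> fat n P"
 by (auto simp: fat_def)

lemma fatE:
 assumes "fat n P" obtains c r where "length c = n" "r > 0" "!!xs. near c r xs ==> P xs"
 using assms by (auto simp: fat_def)

lemma fat_mono: "fat n P ==> (!!xs. length xs = n ==> P xs ==> Q xs) ==> fat n Q"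
 unfolding fat_def by (metis near_length)

definition DefV :: "nat => ((nat => 'a::linordered_field) => 'a list) => bool" where
 "DefV n L \<longleftrightarrow> (ALL e. length (L e) = n) & (ALL i<n. DefT (%e. L e ! i))"

definition DefL :: "nat => ('a::linordered_field list => bool) => bool" where
 "DefL n P \<longleftrightarrow> Def (%e. P (map e [0..<n]))"

definition DefF :: "nat => ('a::linordered_field list => 'a) => bool" where
 "DefF n h \<longleftrightarrow> DefT (%e. h (map e [0..<n]))"

definition DefB :: "nat => ('a::linordered_field => 'a list => bool) => bool" where
 "DefB n B \<longleftrightarrow> Def (%e. B (e 0) (map (%i. e (Suc i)) [0..<n]))"

lemma DefV_Nil: "DefV 0 (%e. [])"
 by (simp add: DefV_def)

lemma DefV_Cons: assumes "DefT t" "DefV n L" shows "DefV (Suc n) (%e. t e # L e)"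
proof -
 have "DefT (%e. (t e # L e) ! i)" if "i < Suc n" for i
  using assms that by (cases i) (auto simp: DefV_def)
 then show ?thesis using assms(2) by (simp add: DefV_def)
qed

lemma DefV_const: "length c = n ==> DefV n (%e. c)"
 by (simp add: DefV_def DefT_coord)

lemma DefV_map: "DefV n (%e. map (%i. e (f i)) [0..<n])" "DefV n (%e. map e [0..<n])"
 by (simp_all add: DefV_def DefT_coord)

lemmas DefV_intros = DefV_Nil DefV_Cons DefV_const DefV_map

lemma DefV_subst: "DefV n L ==> (%e. map (%i. if i < n then L e ! i else 0) [0..<n]) = L"
 by (auto simp: DefV_def fun_eq_iff intro!: nth_equalityI)

lemma DefV_DefT: "DefV n L ==> DefT (%e. if i < n then L e ! i else 0)"
 by (cases "i < n") (auto simp: DefV_def DefT_coord)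

lemma DefL_app: assumes "DefL n P" "DefV n L" shows "Def (%e. P (L e))"
proof -
 have "Def (%e. P (map (%i. if i < n then L e ! i else 0) [0..<n]))"
  using Def_subst[OF assms(1)[unfolded DefL_def], of "%e i. if i < n then L e ! i else 0"] DefV_DefT[OF assms(2)] by simp
 then show ?thesis using DefV_subst[OF assms(2)] by (simp add: fun_eq_iff)
qed

lemma DefF_app: assumes "DefF n h" "DefV n L" shows "DefT (%e. h (L e))"
proof -
 have "DefT (%e. h (map (%i. if i < n then L e ! i else 0) [0..<n]))"
  using DefT_subst[OF assms(1)[unfolded DefF_def], of "%e i. if i < n then L e ! i else 0"] DefV_DefT[OF assms(2)] by simp
 then show ?thesis using DefV_subst[OF assms(2)] by (simp add: fun_eq_iff)
qed

lemma DefB_app: assumes "DefB n B" "DefT t" "DefV n L" shows "Def (%e. B (t e) (L e))"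
proof -
 have "DefT (%e. case_nat (t e) (%i. if i < n then L e ! i else 0) j)" for j
  by (rule DefT_case_nat[OF assms(2) DefV_DefT[OF assms(3)]])
 from Def_subst[OF assms(1)[unfolded DefB_def], of "%e. case_nat (t e) (%i. if i < n then L e ! i else 0)", OF this]
 have "Def (%e. B (t e) (map (%i. if i < n then L e ! i else 0) [0..<n]))" by simp
 then show ?thesis using DefV_subst[OF assms(3)] by (simp add: fun_eq_iff)
qed

lemma Def_near: assumes "DefV n C" "DefT r" "DefV n L" shows "Def (%e. near (C e) (r e) (L e))"
proof -
 have "Def (%e. ALL i:{..<n}. \<bar>L e ! i - C e ! i\<bar> < r e)"
  by (rule Def_finite_all) (use assms in \<open>auto simp: DefV_def intro!: Def_less DefT_abs DefT_diff\<close>)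
 moreover have "near (C e) (r e) (L e) \<longleftrightarrow> (ALL i:{..<n}. \<bar>L e ! i - C e ! i\<bar> < r e)" for e
  using assms by (simp add: near_conv DefV_def Ball_def)
 ultimately show ?thesis by simp
qed

lemma Def_exL:
 "Def (%e. Q (%i. e (n + i)) (map e [0..<n])) ==> Def (%e. EX xs. length xs = n & Q e xs)"
proof (induction n arbitrary: Q)
 case 0
 then show ?case by simp
next
 case (Suc n)
 \<comment> \<open>The bound list occupies the first coordinates. Its head is moved behind the other
   entries, so that it becomes coordinate 0, ready for the outer quantifier, once the induction
   hypothesis has bound the rest.\<close>
 let ?u = "%e j. if j = 0 then e n else if j <= n then e (j - 1) else e j"
 have "DefT (%e. ?u e j)" for j by (cases "j = 0"; cases "j <= n"; simp add: DefT_coord)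
 from Def_subst[OF Suc.prems, of ?u, OF this]
 have "Def (%e. Q (%i. ?u e (Suc n + i)) (map (?u e) [0..<Suc n]))" .
 moreover have "map (?u e) [0..<Suc n] = e n # map e [0..<n]" for e :: "nat => 'a"
 proof -
  have "map (?u e) (map Suc [0..<n]) = map e [0..<n]" by auto
  then show ?thesis by (simp add: upt_conv_Cons map_Suc_upt[symmetric] del: upt_Suc map_map)
 qed
 ultimately have "Def (%e. Q (%i. e (n + Suc i)) (e n # map e [0..<n]))" by simp
 from Suc.IH[of "%e xs. Q (%i. e (Suc i)) (e 0 # xs)"] this
 have "Def (%e. EX xs. length xs = n & Q (%i. e (Suc i)) (e 0 # xs))" by simp
 then have "Def (%e. EX a. EX xs. length xs = n & Q e (a # xs))" by (rule Def_ex)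
 moreover have "(EX a. EX xs. length xs = n & Q e (a # xs)) = (EX xs. length xs = Suc n & Q e xs)" for e
  by (metis length_Suc_conv)
 ultimately show ?case by simp
qed

lemma Def_allL:
 assumes "Def (%e. Q (%i. e (n + i)) (map e [0..<n]))" shows "Def (%e. ALL xs. length xs = n --> Q e xs)"
proof -
 have "Def (%e. ~ (EX xs. length xs = n & ~ Q e xs))" by (rule Def_not, rule Def_exL, rule Def_not, rule assms)
 then show ?thesis by simp
qed

lemma Def_ival:
 assumes "Def (%e. P (%i. e (Suc i)) (e 0))" shows "Def (%e. has_ival (P e))"
proof -
 have T: "DefT (%e. if j = 0 then e 0 else e (Suc (Suc j)))" for j
  by (cases "j = 0") (simp_all add: DefT_coord)
 have "Def (%e. P (%i. e (Suc (Suc (Suc i)))) (e 0))"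
  using Def_subst[OF assms, of "%e j. if j = 0 then e 0 else e (Suc (Suc j))", OF T] by simp
 then show ?thesis unfolding has_ival_def by (intro Def_intros)
qed

section \<open>Fat sets: unions and uniform radii\<close>

definition Uprop :: "'a::linordered_field itself => nat => bool" where
 "Uprop _ n \<longleftrightarrow> (ALL P Q :: 'a list => bool. DefL n P --> DefL n Q --> fat n (%xs. P xs | Q xs) --> fat n P | fat n Q)"

text \<open>Stands in for compactness: a positive radius that exists pointwise is made constant on a
  smaller box.\<close>

definition Mprop :: "'a::linordered_field itself => nat => bool" where
 "Mprop _ n \<longleftrightarrow> (ALL B :: 'a => 'a list => bool. DefB n B -->
   (ALL r r' xs. 0 < r' --> r' <= r --> B r xs --> B r' xs) -->
   fat n (%xs. EX r>0. B r xs) --> (EX r>0. fat n (B r)))"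

lemma fat_finite_ex:
 assumes U: "Uprop TYPE('a::linordered_field) n" and F: "finite F" "!!x. x \<in> F ==> DefL n (P x :: 'a list => bool)"
  and fat: "fat n (%xs. EX x:F. P x xs)"
 shows "EX x:F. fat n (P x)"
 using F fat
proof (induction F rule: finite_induct)
 case empty
 then obtain c :: "'a list" and r where "r > 0" "!!xs. ~ near c r xs" unfolding fat_def by auto
 then show ?case using near_refl by blast
next
 case (insert x F)
 have "DefL n (%xs. EX x:F. P x xs)"
  using insert.prems(1) insert.hyps(1) unfolding DefL_def by (intro Def_finite_ex) auto
 moreover have "fat n (%xs. P x xs | (EX x:F. P x xs))" using insert.prems(2) by simp
 ultimately have "fat n (P x) | fat n (%xs. EX x:F. P x xs)"
  using U insert.prems(1)[of x] unfolding Uprop_def by blast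
 then show ?case using insert.IH insert.prems(1) by auto
qed

lemma fin_or_ival_list:
 assumes dps: "dps TYPE('a::linordered_field)" and D: "DefB n (G :: 'a => _)"
 shows "EX N. ALL ys. length ys = n --> has_ival (%x. G x ys) | (finite {x. G x ys} & card {x. G x ys} <= N)"
proof -
 have "Def1 (%x e. G x (map e [0..<n]))" using D unfolding Def1_def DefB_def by simp
 from fin_or_ival[OF dps this] obtain N where
  N: "!!e. has_ival (%x. G x (map e [0..<n])) | (finite {x. G x (map e [0..<n])} & card {x. G x (map e [0..<n])} <= N)" by blast
 show ?thesis
 proof (intro exI[of _ N] allI impI)
  fix ys :: "'a list" assume "length ys = n"
  then have "map (%i. ys ! i) [0..<n] = ys" by (auto intro: nth_equalityI)
  then show "has_ival (%x. G x ys) | (finite {x. G x ys} & card {x. G x ys} <= N)" using N[of "%i. ys ! i"] by simp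
 qed
qed

lemma infinite_ival: "u < v ==> infinite {x :: 'a::linordered_field. u < x & x < v}"
 using infinite_Ioo[of u v] by (simp add: greaterThanLessThan_eq greaterThan_def lessThan_def Int_def)

text \<open>A fixed finite set of test points suffices, as the exceptional points of a fibre are
 boundedly many; by \<open>Uprop\<close> one test point serves a fat set of fibres.\<close>

lemma choose_point:
 assumes dps: "dps TYPE('a::linordered_field)" and U: "Uprop TYPE('a) n"
  and P: "DefL n P" "fat n P" and G: "DefB n (G :: 'a => _)" and uv: "u < v"
  and no: "!!ys. length ys = n ==> P ys ==> ~ has_ival (%x. u < x & x < v & ~ G x ys)"
 shows "EX x. u < x & x < v & fat n (%ys. P ys & G x ys)"
proof -
 have "DefB n (%x ys. u < x & x < v & ~ G x ys)"
  unfolding DefB_def by (intro Def_intros DefB_app[OF G] DefV_intros)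
 from fin_or_ival_list[OF dps this] obtain N where
  N: "!!ys. length ys = n ==> P ys ==> finite {x. u < x & x < v & ~ G x ys} & card {x. u < x & x < v & ~ G x ys} <= N"
  using no by blast
 obtain F where F: "F \<subseteq> {x. u < x & x < v}" "finite F" "card F = Suc N"
  using infinite_arbitrarily_large[OF infinite_ival[OF uv]] by blast
 have "EX x:F. G x ys" if "length ys = n" "P ys" for ys
 proof (rule ccontr)
  assume "~ ?thesis"
  then have "F \<subseteq> {x. u < x & x < v & ~ G x ys}" using F by auto
  then have "card F <= N" using N[OF that] card_mono by (meson order_trans)
  then show False using F by simp
 qed
 then have "fat n (%ys. EX x:F. P ys & G x ys)" by (intro fat_mono[OF P(2)]) auto
 moreover have "DefL n (%ys. P ys & G x ys)" for x
  unfolding DefL_def by (intro Def_intros DefL_app[OF P(1)] DefB_app[OF G] DefV_intros)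
 ultimately obtain x where "x \<in> F" "fat n (%ys. P ys & G x ys)"
  using fat_finite_ex[OF U F(2), of "%x ys. P ys & G x ys"] by blast
 then show ?thesis using F by auto
qed

lemma has_ivalE:
 assumes "has_ival P" obtains x r where "r > 0" "!!y. \<bar>y - x\<bar> < r ==> P y"
proof -
 obtain u v where uv: "u < v" "!!x. u < x ==> x < v ==> P x" using assms by (auto simp: has_ival_def)
 show thesis
 proof (rule that)
  show "(v - u) / 2 > 0" using uv by simp
  fix y assume y: "\<bar>y - (u + v) / 2\<bar> < (v - u) / 2"
  then have "u < y" "y < v" unfolding abs_less_iff by (auto simp: field_simps)
  then show "P y" by (rule uv(2))
 qed
qed

lemma has_ivalI: "r > 0 ==> (!!y. \<bar>y - x\<bar> < r ==> P y) ==> has_ival P"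
 unfolding has_ival_def by (intro exI[of _ "x - r"] exI[of _ "x + r"]) (auto simp: abs_less_iff)

lemma has_ival_mono: "has_ival P ==> (!!x. P x ==> Q x) ==> has_ival Q"
 unfolding has_ival_def by blast

lemma has_ival_infinite: assumes "has_ival P" shows "infinite {x. P x}"
proof -
 obtain u v where uv: "u < v" "!!x. u < x ==> x < v ==> P x" using assms unfolding has_ival_def by blast
 then have "{x. u < x & x < v} \<subseteq> {x. P x}" by blast
 then show ?thesis using infinite_ival[OF uv(1)] finite_subset by blast
qed

lemma fat_SucE:
 assumes "fat (Suc n) P"
 obtains c0 c r where "length c = n" "r > 0" "!!x ys. \<bar>x - c0\<bar> < r ==> near c r ys ==> P (x # ys)"
proof -
 obtain zs r where z: "length zs = Suc n" "r > 0" "!!xs. near zs r xs ==> P xs" using fatE[OF assms] by blast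
 then obtain c0 c where c: "zs = c0 # c" "length c = n" by (auto simp: length_Suc_conv)
 show thesis by (rule that[of c r c0]) (use z c in auto)
qed

text \<open>Both properties are proved by slicing. In a fibre all but finitely many points have a
  neighbourhood inside one of the two sets (inside \<open>B r\<close> for some \<open>r\<close>,
  respectively); \<open>choose_point\<close> fixes one such point for a fat set of fibres, and the
  properties in dimension \<open>n\<close> choose the set and make the radius uniform.\<close>

lemma UM_step:
 assumes dps: "dps TYPE('a::linordered_field)" and U: "Uprop TYPE('a) n" and M: "Mprop TYPE('a) n"
 shows "Uprop TYPE('a) (Suc n)" "Mprop TYPE('a) (Suc n)"
proof -
 have MD: "EX r>0. fat n (B r)" if "DefB n B" "!!r r' xs. 0 < r' ==> r' <= r ==> B r xs ==> B r' xs"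
  "fat n (%xs. EX r>0. B r xs)" for B :: "'a => 'a list => bool"
  using M that unfolding Mprop_def by blast
 have fat_Suc: "fat (Suc n) P" if r: "r > 0" and f: "fat n (%ys. ALL x'. \<bar>x' - x\<bar> < r --> P (x' # ys))" for P r x
 proof -
  obtain c s where c: "length c = n" "s > 0" "!!ys. near c s ys ==> ALL x'. \<bar>x' - x\<bar> < r --> P (x' # ys)"
   using f unfolding fat_def by blast
  show ?thesis
  proof (rule fatI[of "x # c" _ "min r s"])
   fix zs assume "near (x # c) (min r s) zs"
   then show "P zs" using c(3) near_mono[of c "min r s" _ s] by (auto simp: near_Cons_iff)
  qed (use r c in auto)
 qed
 show "Uprop TYPE('a) (Suc n)"
  unfolding Uprop_def
 proof (intro allI impI)
  fix P Q :: "'a list => bool"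
  assume D: "DefL (Suc n) P" "DefL (Suc n) Q" and f: "fat (Suc n) (%xs. P xs | Q xs)"
  obtain c0 c r0 where c: "length c = n" "r0 > 0" "!!x ys. \<bar>x - c0\<bar> < r0 ==> near c r0 ys ==> P (x # ys) | Q (x # ys)"
   using fat_SucE[OF f] by metis
  define G where "G x ys = ((EX r>0. ALL x'. \<bar>x' - x\<bar> < r --> P (x' # ys)) | (EX r>0. ALL x'. \<bar>x' - x\<bar> < r --> Q (x' # ys)))" for x ys
  have DG: "DefB n G" unfolding DefB_def G_def
   by (intro Def_intros DefL_app[OF D(1)] DefL_app[OF D(2)] DefV_intros)
  have Dn: "DefL n (near c r0)" unfolding DefL_def by (intro Def_near[where n = n] DefV_intros DefT_intros c(1))
  have "EX x. c0 - r0 < x & x < c0 + r0 & fat n (%ys. near c r0 ys & G x ys)"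
  proof (rule choose_point[OF dps U Dn _ DG])
   show "fat n (near c r0)" using c by (intro fatI[of c]) auto
   show "c0 - r0 < c0 + r0" using c by simp
   fix ys :: "'a list" assume ys: "length ys = n" "near c r0 ys"
   show "~ has_ival (%x. c0 - r0 < x & x < c0 + r0 & ~ G x ys)"
   proof
    assume "has_ival (%x. c0 - r0 < x & x < c0 + r0 & ~ G x ys)"
    then obtain x1 r1 where x1: "r1 > 0" "!!x. \<bar>x - x1\<bar> < r1 ==> c0 - r0 < x & x < c0 + r0 & ~ G x ys"
     by (rule has_ivalE) blast
    have *: "finite {x. \<bar>x - x1\<bar> < r1 & R (x # ys)}"
     if R: "R = P | R = Q" for R
    proof -
     have "DefB n (%x ys. \<bar>x - x1\<bar> < r1 & R (x # ys))"
      unfolding DefB_def using R D by (auto intro!: Def_intros DefL_app[of "Suc n" R] DefV_intros)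
     then have "has_ival (%x. \<bar>x - x1\<bar> < r1 & R (x # ys)) | finite {x. \<bar>x - x1\<bar> < r1 & R (x # ys)}"
      using fin_or_ival_list[OF dps] ys(1) by blast
     moreover have "~ has_ival (%x. \<bar>x - x1\<bar> < r1 & R (x # ys))"
     proof
      assume "has_ival (%x. \<bar>x - x1\<bar> < r1 & R (x # ys))"
      then obtain x2 r2 where x2: "r2 > 0" "!!x. \<bar>x - x2\<bar> < r2 ==> \<bar>x - x1\<bar> < r1 & R (x # ys)"
       by (rule has_ivalE) blast
      then have "G x2 ys" using R unfolding G_def by blast
      then show False using x1(2)[of x2] x2(2)[of x2] x2(1) by auto
     qed
     ultimately show ?thesis by blast
    qed
    have "{x. \<bar>x - x1\<bar> < r1} \<subseteq> {x. \<bar>x - x1\<bar> < r1 & P (x # ys)} \<union> {x. \<bar>x - x1\<bar> < r1 & Q (x # ys)}"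
    proof
     fix x assume "x \<in> {x. \<bar>x - x1\<bar> < r1}"
     then have x: "\<bar>x - x1\<bar> < r1" by simp
     then have "\<bar>x - c0\<bar> < r0" using x1(2)[OF x] by (auto simp: abs_less_iff)
     then show "x \<in> {x. \<bar>x - x1\<bar> < r1 & P (x # ys)} \<union> {x. \<bar>x - x1\<bar> < r1 & Q (x # ys)}" using c(3)[of x ys] ys x by auto
    qed
    then have "finite {x. \<bar>x - x1\<bar> < r1}" using *[of P] *[of Q] finite_subset by blast
    moreover have "has_ival (%x. \<bar>x - x1\<bar> < r1)" using x1(1) by (intro has_ivalI[of r1 x1]) auto
    ultimately show False using has_ival_infinite by blast
   qed
  qed
  then obtain x where "fat n (%ys. near c r0 ys & G x ys)" by blast
  then have "fat n (%ys. (EX r>0. ALL x'. \<bar>x' - x\<bar> < r --> P (x' # ys)) | (EX r>0. ALL x'. \<bar>x' - x\<bar> < r --> Q (x' # ys)))"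
   by (rule fat_mono) (auto simp: G_def)
  moreover have D1: "DefL n (%ys. EX r>0. ALL x'. \<bar>x' - x\<bar> < r --> R (x' # ys))" if "DefL (Suc n) R" for R
   unfolding DefL_def by (intro Def_intros DefL_app[OF that] DefV_intros)
  ultimately have "EX R. (R = P | R = Q) & fat n (%ys. EX r>0. ALL x'. \<bar>x' - x\<bar> < r --> R (x' # ys))"
   using U D unfolding Uprop_def by blast
  then obtain R where R: "R = P | R = Q" "fat n (%ys. EX r>0. ALL x'. \<bar>x' - x\<bar> < r --> R (x' # ys))" by blast
  have DR: "DefL (Suc n) R" using R(1) D by blast
  have "EX r>0. fat n (%ys. ALL x'. \<bar>x' - x\<bar> < r --> R (x' # ys))"
  proof (rule MD)
   show "DefB n (%r ys. ALL x'. \<bar>x' - x\<bar> < r --> R (x' # ys))"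
    unfolding DefB_def by (intro Def_intros DefL_app[OF DR] DefV_intros)
  qed (use R(2) in auto)
  then have "fat (Suc n) R" using fat_Suc by blast
  then show "fat (Suc n) P | fat (Suc n) Q" using R(1) by blast
 qed
 show "Mprop TYPE('a) (Suc n)"
  unfolding Mprop_def
 proof (intro allI impI)
  fix B :: "'a => 'a list => bool"
  assume D: "DefB (Suc n) B" and mono: "ALL r r' xs. 0 < r' --> r' <= r --> B r xs --> B r' xs"
   and f: "fat (Suc n) (%xs. EX r>0. B r xs)"
  obtain c0 c r0 where c: "length c = n" "r0 > 0" "!!x ys. \<bar>x - c0\<bar> < r0 ==> near c r0 ys ==> EX r>0. B r (x # ys)"
   using fat_SucE[OF f] by metis
  define G where "G x ys = (EX r>0. ALL x'. \<bar>x' - x\<bar> < r --> B r (x' # ys))" for x ys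
  have DG: "DefB n G" unfolding DefB_def G_def
   by (intro Def_intros DefB_app[OF D] DefV_intros)
  have Dn: "DefL n (near c r0)" unfolding DefL_def by (intro Def_near[where n = n] DefV_intros DefT_intros c(1))
  have "EX x. c0 - r0 < x & x < c0 + r0 & fat n (%ys. near c r0 ys & G x ys)"
  proof (rule choose_point[OF dps U Dn _ DG])
   show "fat n (near c r0)" using c by (intro fatI[of c]) auto
   show "c0 - r0 < c0 + r0" using c by simp
   fix ys :: "'a list" assume ys: "length ys = n" "near c r0 ys"
   show "~ has_ival (%x. c0 - r0 < x & x < c0 + r0 & ~ G x ys)"
   proof
    assume "has_ival (%x. c0 - r0 < x & x < c0 + r0 & ~ G x ys)"
    then obtain x1 r1 where x1: "r1 > 0" "!!x. \<bar>x - x1\<bar> < r1 ==> c0 - r0 < x & x < c0 + r0 & ~ G x ys"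
     by (rule has_ivalE) blast
    have "DefB (Suc n) (%x zs. \<bar>x - x1\<bar> < r1 & B (hd zs) (x # tl zs))"
    proof -
     have "(%e :: nat => 'a. \<bar>e 0 - x1\<bar> < r1 & B (hd (map (%i. e (Suc i)) [0..<Suc n])) (e 0 # tl (map (%i. e (Suc i)) [0..<Suc n]))) =
      (%e. \<bar>e 0 - x1\<bar> < r1 & B (e (Suc 0)) (e 0 # map (%i. e (Suc (Suc i))) [0..<n]))"
      by (simp add: upt_conv_Cons map_Suc_upt[symmetric] comp_def del: upt_Suc)
     then show ?thesis unfolding DefB_def
      by (simp only:) (intro Def_intros DefB_app[OF D] DefV_intros)
    qed
    from fin_or_ival_list[OF dps this] obtain N where N: "!!zs. length zs = Suc n ==>
      has_ival (%x. \<bar>x - x1\<bar> < r1 & B (hd zs) (x # tl zs)) |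
      (finite {x. \<bar>x - x1\<bar> < r1 & B (hd zs) (x # tl zs)} & card {x. \<bar>x - x1\<bar> < r1 & B (hd zs) (x # tl zs)} <= N)" by blast
    have fin: "finite {x. \<bar>x - x1\<bar> < r1 & B r (x # ys)} & card {x. \<bar>x - x1\<bar> < r1 & B r (x # ys)} <= N" if "r > 0" for r
    proof -
     have "~ has_ival (%x. \<bar>x - x1\<bar> < r1 & B r (x # ys))"
     proof
      assume "has_ival (%x. \<bar>x - x1\<bar> < r1 & B r (x # ys))"
      then obtain x2 r2 where x2: "r2 > 0" "!!x. \<bar>x - x2\<bar> < r2 ==> \<bar>x - x1\<bar> < r1 & B r (x # ys)"
       by (rule has_ivalE) blast
      have "B (min r r2) (x # ys)" if "\<bar>x - x2\<bar> < min r r2" for x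
       using x2(2)[of x] that mono[rule_format, of "min r r2" r "x # ys"] x2(1) \<open>r > 0\<close> by auto
      then have "G x2 ys" unfolding G_def using x2(1) \<open>r > 0\<close> by (intro exI[of _ "min r r2"]) auto
      then show False using x1(2)[of x2] x2(2)[of x2] x2(1) by auto
     qed
     then show ?thesis using N[of "r # ys"] ys(1) by simp
    qed
    have "has_ival (%x. \<bar>x - x1\<bar> < r1)" using x1(1) by (intro has_ivalI[of r1 x1]) auto
    then obtain F where F: "F \<subseteq> {x. \<bar>x - x1\<bar> < r1}" "finite F" "card F = Suc N"
     using infinite_arbitrarily_large[OF has_ival_infinite] by blast
    have "ALL x:F. EX r>0. B r (x # ys)"
    proof
     fix x assume "x \<in> F"
     then have x: "\<bar>x - x1\<bar> < r1" using F by auto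
     then have "\<bar>x - c0\<bar> < r0" using x1(2)[OF x] by (auto simp: abs_less_iff)
     then show "EX r>0. B r (x # ys)" using c(3) ys by auto
    qed
    then obtain \<rho> where \<rho>: "!!x. x \<in> F ==> \<rho> x > 0 & B (\<rho> x) (x # ys)" by metis
    \<comment> \<open>At the least of these radii all \<open>N + 1\<close> points belong to a fibre
      set of at most \<open>N\<close> elements.\<close>
    define m where "m = Min (insert 1 (\<rho> ` F))"
    have m0: "m > 0" unfolding m_def using F(2) \<rho> by (subst Min_gr_iff) auto
    have mle: "m <= \<rho> x" if "x \<in> F" for x unfolding m_def using F(2) that by (intro Min_le) auto
    have "F \<subseteq> {x. \<bar>x - x1\<bar> < r1 & B m (x # ys)}" using F(1) \<rho> mono m0 mle by blast
    then have "card F <= N" using fin[OF m0] card_mono by (meson order_trans)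
    then show False using F by simp
   qed
  qed
  then obtain x where "fat n (%ys. near c r0 ys & G x ys)" by blast
  then have f2: "fat n (%ys. EX r>0. ALL x'. \<bar>x' - x\<bar> < r --> B r (x' # ys))"
   by (rule fat_mono) (auto simp: G_def)
  have "EX r>0. fat n (%ys. ALL x'. \<bar>x' - x\<bar> < r --> B r (x' # ys))"
  proof (rule MD[OF _ _ f2])
   show "DefB n (%r ys. ALL x'. \<bar>x' - x\<bar> < r --> B r (x' # ys))"
    unfolding DefB_def by (intro Def_intros DefB_app[OF D] DefV_intros)
  qed (use mono in \<open>meson order_less_le_trans\<close>)
  then show "EX r>0. fat (Suc n) (B r)" using fat_Suc by blast
 qed
qed

lemma UM:
 assumes dps: "dps TYPE('a::linordered_field)"
 shows "Uprop TYPE('a) n & Mprop TYPE('a) n"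
proof (induction n)
 case 0
 then show ?case by (auto simp: Uprop_def Mprop_def fat_def)
next
 case (Suc n)
 then show ?case using UM_step[OF dps] by blast
qed

section \<open>Small oscillation\<close>

lemma near_trans:
 "near a r xs ==> near b s a ==> near b (r + s) xs"
proof -
 assume *: "near a r xs" "near b s a"
 then have l: "length xs = length a" "length a = length b" by (auto dest: near_length)
 have "\<bar>xs ! i - b ! i\<bar> < r + s" if "i < length b" for i
 proof -
  have "\<bar>xs ! i - a ! i\<bar> < r" "\<bar>a ! i - b ! i\<bar> < s" using * that l by (auto simp: near_conv)
  then show ?thesis by linarith
 qed
 then show ?thesis using l by (simp add: near_conv)
qed

lemma DefV_shift: assumes "DefV n Y" shows "DefV n (%e. Y (%i. e (Suc i)))"
 using assms DefT_shift unfolding DefV_def by blast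

lemma U: "dps TYPE('a::linordered_field) ==> Uprop TYPE('a) n"
 using UM by blast

lemma MD:
 assumes "dps TYPE('a::linordered_field)" "DefB n (B :: 'a => _)"
  "!!r r' xs. 0 < r' ==> r' <= r ==> B r xs ==> B r' xs" "fat n (%xs. EX r>0. B r xs)"
 shows "EX r>0. fat n (B r)"
 using UM[OF assms(1), of n] assms(2-) unfolding Mprop_def by blast

lemma DefL_near: "length c = n ==> DefL n (near c r)"
 unfolding DefL_def by (intro Def_near[where n = n] DefV_intros DefT_intros) auto

lemma fat_near: "length c = n ==> r > 0 ==> fat n (near c r)"
 by (rule fatI[of c]) auto

text \<open>A finite image together with finite fibres would make the interval finite.\<close>

lemma nonconst_ival:
 assumes dps: "dps TYPE('a::linordered_field)" and D: "DefF (Suc n) (h :: 'a list => 'a)" and ys: "length ys = n"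
  and r: "r > 0" and fin: "!!t. finite {x. \<bar>x - x0\<bar> < r & h (x # ys) = t}"
 shows "has_ival (%t. EX x. \<bar>x - x0\<bar> < r & h (x # ys) = t)"
proof (rule ccontr)
 assume no: "~ ?thesis"
 have "DefB n (%t ys. EX x. \<bar>x - x0\<bar> < r & h (x # ys) = t)"
  unfolding DefB_def by (intro Def_intros DefF_app[OF D] DefV_intros)
 then have "finite {t. EX x. \<bar>x - x0\<bar> < r & h (x # ys) = t}"
  using fin_or_ival_list[OF dps] no ys by blast
 then have "finite (\<Union>t\<in>{t. EX x. \<bar>x - x0\<bar> < r & h (x # ys) = t}. {x. \<bar>x - x0\<bar> < r & h (x # ys) = t})"
  using fin by blast
 moreover have "{x. \<bar>x - x0\<bar> < r} \<subseteq> (\<Union>t\<in>{t. EX x. \<bar>x - x0\<bar> < r & h (x # ys) = t}. {x. \<bar>x - x0\<bar> < r & h (x # ys) = t})"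
  by blast
 ultimately have "finite {x. \<bar>x - x0\<bar> < r}" by (rule finite_subset[rotated])
 moreover have "has_ival (%x. \<bar>x - x0\<bar> < r)" using r by (rule has_ivalI) simp
 ultimately show False using has_ival_infinite by blast
qed

text \<open>A substitute for continuity, on some smaller box and for one \<open>r\<close> only. If
  no point of an interval had oscillation below \<open>r / 3\<close>, each band
  \<open>|h - t| < r / 6\<close> would be finite there; the image still contains an interval by
  \<open>nonconst_ival\<close>, and infinitely many of its values would come from one finite band.
  The thirds pay for two moves of the first coordinate and one of the rest.\<close>

lemma small_oscillation:
 assumes dps: "dps TYPE('a::linordered_field)"
 shows "DefF n (h :: 'a list => 'a) ==> length c = n ==> r0 > 0 ==> r > 0 ==>
  EX c' \<rho>. length c' = n & \<rho> > 0 & (ALL xs. near c' \<rho> xs --> near c r0 xs) &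
   (ALL xs ys. near c' \<rho> xs --> near c' \<rho> ys --> \<bar>h xs - h ys\<bar> < r)"
proof (induction n arbitrary: h c r0 r)
 case 0
 then show ?case by (intro exI[of _ "[]"] exI[of _ 1]) auto
next
 case (Suc n)
 obtain c0 cs where c: "c = c0 # cs" "length cs = n" using Suc.prems(2) by (auto simp: length_Suc_conv)
 note D = Suc.prems(1)
 define G where "G x ys = (EX s>0. ALL x'. \<bar>x' - x\<bar> < s --> \<bar>h (x' # ys) - h (x # ys)\<bar> < r / 3)" for x ys
 have DG: "DefB n G" unfolding DefB_def G_def by (intro Def_intros DefF_app[OF D] DefV_intros)
 have "EX x. c0 - r0 < x & x < c0 + r0 & fat n (%ys. near cs r0 ys & G x ys)"
 proof (rule choose_point[OF dps U[OF dps] DefL_near[OF c(2)] fat_near[OF c(2) Suc.prems(3)] DG])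
  show "c0 - r0 < c0 + r0" using Suc.prems by simp
  fix ys :: "'a list" assume ys: "length ys = n"
  show "~ has_ival (%x. c0 - r0 < x & x < c0 + r0 & ~ G x ys)"
  proof
   assume "has_ival (%x. c0 - r0 < x & x < c0 + r0 & ~ G x ys)"
   then obtain x1 r1 where x1: "r1 > 0" "!!x. \<bar>x - x1\<bar> < r1 ==> c0 - r0 < x & x < c0 + r0 & ~ G x ys"
    by (rule has_ivalE) blast
   have fin: "finite {x. \<bar>x - x1\<bar> < r1 & \<bar>h (x # ys) - t\<bar> < r / 6}" for t
   proof -
    have "DefB n (%x ys. \<bar>x - x1\<bar> < r1 & \<bar>h (x # ys) - t\<bar> < r / 6)"
     unfolding DefB_def by (intro Def_intros DefF_app[OF D] DefV_intros)
    moreover have "~ has_ival (%x. \<bar>x - x1\<bar> < r1 & \<bar>h (x # ys) - t\<bar> < r / 6)"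
    proof
     assume "has_ival (%x. \<bar>x - x1\<bar> < r1 & \<bar>h (x # ys) - t\<bar> < r / 6)"
     then obtain x2 r2 where x2: "r2 > 0" "!!x. \<bar>x - x2\<bar> < r2 ==> \<bar>x - x1\<bar> < r1 & \<bar>h (x # ys) - t\<bar> < r / 6"
      by (rule has_ivalE) blast
     have "\<bar>h (x' # ys) - h (x2 # ys)\<bar> < r / 3" if "\<bar>x' - x2\<bar> < r2" for x'
     proof -
      have "\<bar>h (x' # ys) - t\<bar> < r / 6" "\<bar>h (x2 # ys) - t\<bar> < r / 6" using x2(2)[OF that] x2(2)[of x2] x2(1) by auto
      then show ?thesis by linarith
     qed
     then have "G x2 ys" unfolding G_def using x2(1) by blast
     then show False using x1(2)[of x2] x2(2)[of x2] x2(1) by auto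
    qed
    ultimately show ?thesis using fin_or_ival_list[OF dps] ys by blast
   qed
   have "finite {x. \<bar>x - x1\<bar> < r1 & h (x # ys) = t}" for t
    by (rule finite_subset[OF _ fin[of t]]) (use Suc.prems in auto)
   from nonconst_ival[OF dps D ys x1(1) this]
   obtain t s where t: "s > 0" "!!t'. \<bar>t' - t\<bar> < s ==> EX x. \<bar>x - x1\<bar> < r1 & h (x # ys) = t'"
    by (rule has_ivalE) blast
   have "{t'. \<bar>t' - t\<bar> < min s (r / 6)} \<subseteq> (%x. h (x # ys)) ` {x. \<bar>x - x1\<bar> < r1 & \<bar>h (x # ys) - t\<bar> < r / 6}"
    using t(2) by fastforce
   then have "finite {t'. \<bar>t' - t\<bar> < min s (r / 6)}" using fin finite_surj by blast
   moreover have "has_ival (%t'. \<bar>t' - t\<bar> < min s (r / 6))"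
    by (rule has_ivalI[of "min s (r / 6)" t]) (use t(1) Suc.prems in auto)
   ultimately show False using has_ival_infinite by blast
  qed
 qed
 then obtain x where x: "c0 - r0 < x" "x < c0 + r0" "fat n (%ys. near cs r0 ys & G x ys)" by blast
 have "EX s>0. fat n (%ys. near cs r0 ys & (ALL x'. \<bar>x' - x\<bar> < s --> \<bar>h (x' # ys) - h (x # ys)\<bar> < r / 3))"
 proof (rule MD[OF dps])
  show "DefB n (%s ys. near cs r0 ys & (ALL x'. \<bar>x' - x\<bar> < s --> \<bar>h (x' # ys) - h (x # ys)\<bar> < r / 3))"
   unfolding DefB_def by (intro Def_intros Def_near[where n = n] DefF_app[OF D] DefV_intros c(2))
  show "fat n (%ys. EX s>0. near cs r0 ys & (ALL x'. \<bar>x' - x\<bar> < s --> \<bar>h (x' # ys) - h (x # ys)\<bar> < r / 3))"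
   by (rule fat_mono[OF x(3)]) (auto simp: G_def)
 qed (meson order_less_le_trans)
 then obtain s c1 r1 where s: "s > 0" "length c1 = n" "r1 > 0"
  "!!ys. near c1 r1 ys ==> near cs r0 ys & (ALL x'. \<bar>x' - x\<bar> < s --> \<bar>h (x' # ys) - h (x # ys)\<bar> < r / 3)"
  unfolding fat_def by blast
 have D2: "DefF n (%ys. h (x # ys))" unfolding DefF_def by (intro DefF_app[OF D] DefV_intros DefT_intros)
 have "r / 3 > 0" using Suc.prems by simp
 from Suc.IH[OF D2 s(2,3) this] obtain c2 r2 where c2: "length c2 = n" "r2 > 0"
  "!!ys. near c2 r2 ys ==> near c1 r1 ys" "!!ys zs. near c2 r2 ys ==> near c2 r2 zs ==> \<bar>h (x # ys) - h (x # zs)\<bar> < r / 3"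
  by blast
 define \<rho> where "\<rho> = min (min s r2) (r0 - \<bar>x - c0\<bar>)"
 have \<rho>: "\<rho> > 0" "\<rho> <= s" "\<rho> <= r2" "\<rho> <= r0 - \<bar>x - c0\<bar>" using s c2 x by (auto simp: \<rho>_def abs_less_iff)
 show ?case
 proof (intro exI[of _ "x # c2"] exI[of _ \<rho>] conjI allI impI)
  show "length (x # c2) = Suc n" "\<rho> > 0" using c2 \<rho> by auto
  fix zs assume z: "near (x # c2) \<rho> zs"
  then obtain z0 zt where z': "zs = z0 # zt" "\<bar>z0 - x\<bar> < \<rho>" "near c2 \<rho> zt" by (auto simp: near_Cons_iff)
  have nz: "near c2 r2 zt" using near_mono[OF z'(3) \<rho>(3)] .
  have "\<bar>z0 - c0\<bar> < r0" using z'(2) \<rho>(4) by linarith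
  then show "near c r0 zs" using s(4)[OF c2(3)[OF nz]] c z' by auto
  fix ws assume "near (x # c2) \<rho> ws"
  then obtain w0 wt where w': "ws = w0 # wt" "\<bar>w0 - x\<bar> < \<rho>" "near c2 \<rho> wt" by (auto simp: near_Cons_iff)
  have nw: "near c2 r2 wt" using near_mono[OF w'(3) \<rho>(3)] .
  have "\<bar>h zs - h (x # zt)\<bar> < r / 3" "\<bar>h ws - h (x # wt)\<bar> < r / 3"
   using s(4)[OF c2(3)[OF nz]] s(4)[OF c2(3)[OF nw]] z' w' \<rho> by auto
  moreover have "\<bar>h (x # zt) - h (x # wt)\<bar> < r / 3" using c2(4)[OF nz nw] .
  ultimately show "\<bar>h zs - h ws\<bar> < r" by linarith
 qed
qed

lemma small_oscillation_list:
 fixes m :: nat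
 assumes dps: "dps TYPE('a::linordered_field)" and D: "!!k. k < m ==> DefF n (H k :: 'a list => 'a)"
  and c: "length c = n" "r0 > 0" "r > 0"
 shows "EX c' \<rho>. length c' = n & \<rho> > 0 & (ALL xs. near c' \<rho> xs --> near c r0 xs) &
   (ALL k<m. ALL xs ys. near c' \<rho> xs --> near c' \<rho> ys --> \<bar>H k xs - H k ys\<bar> < r)"
 using D
proof (induction m)
 case 0
 then show ?case using c by blast
next
 case (Suc m)
 then obtain c1 r1 where c1: "length c1 = n" "r1 > 0" "!!xs. near c1 r1 xs ==> near c r0 xs"
  "!!k xs ys. k < m ==> near c1 r1 xs ==> near c1 r1 ys ==> \<bar>H k xs - H k ys\<bar> < r" by (metis less_SucI)
 obtain c2 r2 where c2: "length c2 = n" "r2 > 0" "!!xs. near c2 r2 xs ==> near c1 r1 xs"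
  "!!xs ys. near c2 r2 xs ==> near c2 r2 ys ==> \<bar>H m xs - H m ys\<bar> < r"
  using small_oscillation[OF dps Suc.prems[of m] c1(1,2) c(3)] by auto
 show ?case
  by (intro exI[of _ c2] exI[of _ r2]) (use c1 c2 in \<open>auto simp: less_Suc_eq\<close>)
qed

section \<open>Images of finite-to-one maps\<close>

definition ins :: "nat => 'a => 'a list => 'a list" where
 "ins i t zs = take i zs @ t # drop i zs"

definition rmv :: "nat => 'a list => 'a list" where
 "rmv i zs = take i zs @ drop (Suc i) zs"

lemma length_rmv: "i < Suc n ==> length zs = Suc n ==> length (rmv i zs) = n"
 by (auto simp: rmv_def)

lemma ins_rmv: "i < length zs ==> ins i (zs ! i) (rmv i zs) = zs"
 by (auto simp: ins_def rmv_def min_def id_take_nth_drop[symmetric])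

lemma nth_ins: "i < Suc n ==> length ws = n ==> ins i t ws ! i = t"
 by (auto simp: ins_def nth_append)

lemma rmv_ins: "i < Suc n ==> length ws = n ==> rmv i (ins i t ws) = ws"
 by (auto simp: ins_def rmv_def)

lemma nth_rmv: "i < Suc n ==> length zs = Suc n ==> k < n ==> rmv i zs ! k = zs ! (if k < i then k else Suc k)"
 by (auto simp: rmv_def nth_append)

lemma near_rmv:
 assumes "i < Suc n" "length c = Suc n" "near c r zs" shows "near (rmv i c) r (rmv i zs)"
proof -
 have "length zs = Suc n" using assms near_length by force
 then show ?thesis using assms by (auto simp: near_conv length_rmv[of i n] nth_rmv[of i n])
qed

text \<open>The induction takes a component \<open>g i\<close> that is finite-to-one in
 the first variable, uses it as a new first coordinate, and inverts it by the definable choice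
 of a least preimage.\<close>

definition Jprop :: "'a::linordered_field itself => nat => bool" where
 "Jprop _ n \<longleftrightarrow> (ALL (g :: 'a list => 'a list) c r N. (ALL xs. length xs = n --> length (g xs) = n) -->
   (ALL k<n. DefF n (%xs. g xs ! k)) --> length c = n --> r > 0 -->
   (ALL zs. finite {xs. near c r xs & g xs = zs} & card {xs. near c r xs & g xs = zs} <= N) -->
   fat n (%zs. EX xs. near c r xs & g xs = zs))"

lemma Jstep:
 assumes dps: "dps TYPE('a::linordered_field)" and J: "Jprop TYPE('a) n"
 shows "Jprop TYPE('a) (Suc n)"
 unfolding Jprop_def
proof (intro allI impI)
 fix g :: "'a list => 'a list" and c r0 N
 assume len: "ALL xs. length xs = Suc n --> length (g xs) = Suc n" and D: "ALL k<Suc n. DefF (Suc n) (%xs. g xs ! k)"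
  and c_len: "length c = Suc n" and r0: "r0 > 0"
  and fto: "ALL zs. finite {xs. near c r0 xs & g xs = zs} & card {xs. near c r0 xs & g xs = zs} <= N"
 obtain c0 cs where c: "c = c0 # cs" "length cs = n" using c_len by (auto simp: length_Suc_conv)
 have box: "near c r0 (x # ys) \<longleftrightarrow> \<bar>x - c0\<bar> < r0 & near cs r0 ys" for x ys using c by simp

 \<comment> \<open>\<open>H\<close> makes component \<open>i\<close> finite-to-one near
   \<open>x\<close> in the first variable; the absence of intervals is the definable form of
   finiteness.\<close>
 define H where "H i s x ys = (ALL t. ~ has_ival (%x'. \<bar>x' - x\<bar> < s & g (x' # ys) ! i = t))" for i s x ys
 define G where "G x ys = (EX i:{..<Suc n}. EX s>0. H i s x ys)" for x ys
 have DH: "DefF (Suc n) (%xs. g xs ! i)" if "i < Suc n" for i using D that by blast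
 have DG: "DefB n G" unfolding DefB_def G_def H_def
  by (intro Def_finite_ex Def_intros Def_ival DefF_app[OF DH] DefV_intros) auto
 have "EX x. c0 - r0 < x & x < c0 + r0 & fat n (%ys. near cs r0 ys & G x ys)"
 proof (rule choose_point[OF dps U[OF dps] DefL_near[OF c(2)] fat_near[OF c(2) r0] DG])
  show "c0 - r0 < c0 + r0" using r0 by simp
  fix ys :: "'a list" assume ys: "length ys = n" "near cs r0 ys"
  show "~ has_ival (%x. c0 - r0 < x & x < c0 + r0 & ~ G x ys)"
  proof
   assume "has_ival (%x. c0 - r0 < x & x < c0 + r0 & ~ G x ys)"
   then obtain x1 r1 where x1: "r1 > 0" "!!x. \<bar>x - x1\<bar> < r1 ==> c0 - r0 < x & x < c0 + r0 & ~ G x ys"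
    by (rule has_ivalE) blast
   \<comment> \<open>Where no component qualifies, shrinking once for each component makes all of
     them constant on an interval, against the finite fibres of \<open>g\<close>.\<close>
   have "i <= Suc n ==> EX x2 r2 ts. r2 > 0 & (ALL x. \<bar>x - x2\<bar> < r2 --> \<bar>x - x1\<bar> < r1 & (ALL k<i. g (x # ys) ! k = ts k))" for i
   proof (induction i)
    case 0
    then show ?case using x1(1) by (intro exI[of _ x1] exI[of _ r1]) auto
   next
    case (Suc i)
    then obtain x2 r2 ts where x2: "r2 > 0" "!!x. \<bar>x - x2\<bar> < r2 ==> \<bar>x - x1\<bar> < r1 & (ALL k<i. g (x # ys) ! k = ts k)"
     by (metis Suc_leD)
    have "\<bar>x2 - x1\<bar> < r1" using x2(2)[of x2] x2(1) by simp
    then have "~ G x2 ys" using x1(2) by blast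
    then have "~ H i r2 x2 ys" using Suc.prems x2(1) unfolding G_def by auto
    then obtain t where "has_ival (%x'. \<bar>x' - x2\<bar> < r2 & g (x' # ys) ! i = t)" unfolding H_def by blast
    then obtain x3 r3 where x3: "r3 > 0" "!!x. \<bar>x - x3\<bar> < r3 ==> \<bar>x - x2\<bar> < r2 & g (x # ys) ! i = t"
     by (rule has_ivalE) blast
    show ?case
    proof (intro exI conjI allI impI)
     show "r3 > 0" by (rule x3)
     fix x assume x: "\<bar>x - x3\<bar> < r3"
     show "\<bar>x - x1\<bar> < r1" using x2(2) x3(2)[OF x] by blast
     fix k assume "k < Suc i"
     then show "g (x # ys) ! k = (ts(i := t)) k" using x2(2) x3(2)[OF x] by (auto simp: less_Suc_eq)
    qed
   qed
   from this[of "Suc n"] obtain x2 r2 ts where x2: "r2 > 0"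
    "!!x. \<bar>x - x2\<bar> < r2 ==> \<bar>x - x1\<bar> < r1 & (ALL k<Suc n. g (x # ys) ! k = ts k)" by blast
   have gx: "g (x # ys) = map ts [0..<Suc n]" if "\<bar>x - x2\<bar> < r2" for x
    using x2(2)[OF that] len ys by (intro nth_equalityI) (auto simp del: upt_Suc)
   have "(%x. x # ys) ` {x. \<bar>x - x2\<bar> < r2} \<subseteq> {xs. near c r0 xs & g xs = map ts [0..<Suc n]}"
   proof safe
    fix x assume x: "\<bar>x - x2\<bar> < r2"
    then have "\<bar>x - c0\<bar> < r0" using x1(2)[of x] x2(2)[OF x] by (auto simp: abs_less_iff)
    then show "near c r0 (x # ys)" "g (x # ys) = map ts [0..<Suc n]" using ys gx[OF x] box by auto
   qed
   then have "finite ((%x. x # ys) ` {x. \<bar>x - x2\<bar> < r2})" using fto finite_subset by blast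
   then have "finite {x. \<bar>x - x2\<bar> < r2}" by (rule finite_imageD) (auto simp: inj_on_def)
   moreover have "has_ival (%x. \<bar>x - x2\<bar> < r2)" using x2(1) by (rule has_ivalI) simp
   ultimately show False using has_ival_infinite by blast
  qed
 qed
 then obtain x1 where x1: "\<bar>x1 - c0\<bar> < r0" "fat n (%ys. near cs r0 ys & G x1 ys)" by (auto simp: abs_less_iff algebra_simps)
 have "fat n (%ys. EX i:{..<Suc n}. EX s>0. near cs r0 ys & H i s x1 ys)"
  by (rule fat_mono[OF x1(2)]) (auto simp: G_def)
 moreover have "DefL n (%ys. EX s>0. near cs r0 ys & H i s x1 ys)" if "i \<in> {..<Suc n}" for i
  unfolding DefL_def H_def using that
  by (intro Def_intros Def_ival Def_near[where n = n] DefF_app[OF DH] DefV_intros c(2)) auto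
 ultimately obtain i where i: "i < Suc n" "fat n (%ys. EX s>0. near cs r0 ys & H i s x1 ys)"
  using fat_finite_ex[OF U[OF dps], of "{..<Suc n}" n "%i ys. EX s>0. near cs r0 ys & H i s x1 ys"] by auto
 have "EX s>0. fat n (%ys. near cs r0 ys & H i s x1 ys)"
 proof (rule MD[OF dps _ _ i(2)])
  show "DefB n (%s ys. near cs r0 ys & H i s x1 ys)" unfolding DefB_def H_def
   by (intro Def_intros Def_ival Def_near[where n = n] DefF_app[OF DH[OF i(1)]] DefV_intros c(2))
  fix r r' :: 'a and xs assume "0 < r'" "r' <= r" "near cs r0 xs & H i r x1 xs"
  then show "near cs r0 xs & H i r' x1 xs" unfolding H_def
   using has_ival_mono[of "%x'. \<bar>x' - x1\<bar> < r' & g (x' # xs) ! i = _" "%x'. \<bar>x' - x1\<bar> < r & g (x' # xs) ! i = _"] by fastforce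
 qed
 then obtain s0 c1 r1 where s0: "s0 > 0" and c1: "length c1 = n" "r1 > 0"
  "!!ys. near c1 r1 ys ==> near cs r0 ys & H i s0 x1 ys" unfolding fat_def by blast
 define s1 where "s1 = min s0 (r0 - \<bar>x1 - c0\<bar>)"
 have s1: "s1 > 0" "s1 <= s0" "!!x. \<bar>x - x1\<bar> < s1 ==> \<bar>x - c0\<bar> < r0"
  using s0 x1(1) by (auto simp: s1_def)
 define h where "h xs = g xs ! i" for xs
 have Dh: "DefF (Suc n) h" unfolding h_def using DH[OF i(1)] .
 have fin: "finite {x. \<bar>x - x1\<bar> < s1 & h (x # ys) = t}" if ys: "near c1 r1 ys" for ys t
 proof -
  have "DefB n (%x ys. \<bar>x - x1\<bar> < s1 & h (x # ys) = t)"
   unfolding DefB_def by (intro Def_intros DefF_app[OF Dh] DefV_intros)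
  moreover have "~ has_ival (%x. \<bar>x - x1\<bar> < s1 & h (x # ys) = t)"
  proof
   assume "has_ival (%x. \<bar>x - x1\<bar> < s1 & h (x # ys) = t)"
   then have "has_ival (%x. \<bar>x - x1\<bar> < s0 & g (x # ys) ! i = t)"
    by (rule has_ival_mono) (use s1(2) in \<open>auto simp: h_def\<close>)
   then show False using c1(3)[OF ys] unfolding H_def by blast
  qed
  moreover have "length ys = n" using near_length[OF ys] c1(1) by simp
  ultimately show ?thesis using fin_or_ival_list[OF dps] by blast
 qed

 \<comment> \<open>The aim is an interval of values of \<open>h\<close> common to all fibres: one
   around \<open>h (p # ys)\<close> with a uniform radius, then one around a fixed
   \<open>t0\<close>, since \<open>h (p # ys)\<close> hardly varies with \<open>ys\<close>.\<close>
 define \<Omega> where "\<Omega> ys t = (EX x. \<bar>x - x1\<bar> < s1 & h (x # ys) = t)" for ys t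
 define G2 where "G2 x ys = (EX s>0. ALL t. \<bar>t - h (x # ys)\<bar> < s --> \<Omega> ys t)" for x ys
 have DG2: "DefB n G2" unfolding DefB_def G2_def \<Omega>_def by (intro Def_intros DefF_app[OF Dh] DefV_intros)
 have "EX x. x1 - s1 < x & x < x1 + s1 & fat n (%ys. near c1 r1 ys & G2 x ys)"
 proof (rule choose_point[OF dps U[OF dps] DefL_near[OF c1(1)] fat_near[OF c1(1,2)] DG2])
  show "x1 - s1 < x1 + s1" using s1 by simp
  fix ys :: "'a list" assume ys: "length ys = n" "near c1 r1 ys"
  show "~ has_ival (%x. x1 - s1 < x & x < x1 + s1 & ~ G2 x ys)"
  proof
   assume "has_ival (%x. x1 - s1 < x & x < x1 + s1 & ~ G2 x ys)"
   then obtain x2 r2 where x2: "r2 > 0" "!!x. \<bar>x - x2\<bar> < r2 ==> x1 - s1 < x & x < x1 + s1 & ~ G2 x ys"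
    by (rule has_ivalE) blast
   have "finite {x. \<bar>x - x2\<bar> < r2 & h (x # ys) = t}" for t
    by (rule finite_subset[OF _ fin[OF ys(2), of t]]) (use x2(2) in \<open>auto simp: abs_less_iff algebra_simps\<close>)
   from nonconst_ival[OF dps Dh ys(1) x2(1) this] obtain t s where
    t: "s > 0" "!!t'. \<bar>t' - t\<bar> < s ==> EX x. \<bar>x - x2\<bar> < r2 & h (x # ys) = t'"
    by (rule has_ivalE) blast
   obtain x3 where x3: "\<bar>x3 - x2\<bar> < r2" "h (x3 # ys) = t" using t(2)[of t] t(1) by auto
   have "G2 x3 ys" unfolding G2_def \<Omega>_def x3(2)
   proof (rule exI[of _ s], intro conjI allI impI)
    fix t' assume "\<bar>t' - t\<bar> < s"
    then obtain x where "\<bar>x - x2\<bar> < r2" "h (x # ys) = t'" using t(2) by blast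
    then show "EX x. \<bar>x - x1\<bar> < s1 & h (x # ys) = t'"
     using x2(2)[of x] by (intro exI[of _ x]) (auto simp: abs_less_iff algebra_simps)
   qed (rule t)
   then show False using x2(2)[OF x3(1)] by blast
  qed
 qed
 then obtain p where p: "fat n (%ys. near c1 r1 ys & G2 p ys)" by blast
 have "EX s>0. fat n (%ys. near c1 r1 ys & (ALL t. \<bar>t - h (p # ys)\<bar> < s --> \<Omega> ys t))"
 proof (rule MD[OF dps])
  show "DefB n (%s ys. near c1 r1 ys & (ALL t. \<bar>t - h (p # ys)\<bar> < s --> \<Omega> ys t))"
   unfolding DefB_def \<Omega>_def by (intro Def_intros Def_near[where n = n] DefF_app[OF Dh] DefV_intros c1(1))
  show "fat n (%ys. EX s>0. near c1 r1 ys & (ALL t. \<bar>t - h (p # ys)\<bar> < s --> \<Omega> ys t))"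
   by (rule fat_mono[OF p]) (auto simp: G2_def)
 qed (meson order_less_le_trans)
 then obtain s2 c2 r2 where s2: "s2 > 0" and c2: "length c2 = n" "r2 > 0"
  "!!ys. near c2 r2 ys ==> near c1 r1 ys & (ALL t. \<bar>t - h (p # ys)\<bar> < s2 --> \<Omega> ys t)" unfolding fat_def by blast
 have Dp: "DefF n (%ys. h (p # ys))" unfolding DefF_def by (intro DefF_app[OF Dh] DefV_intros DefT_intros)
 have "s2 / 2 > 0" using s2 by simp
 from small_oscillation[OF dps Dp c2(1,2) this] obtain c3 r3 where c3: "length c3 = n" "r3 > 0"
  "!!ys. near c3 r3 ys ==> near c2 r2 ys" "!!xs ys. near c3 r3 xs ==> near c3 r3 ys ==> \<bar>h (p # xs) - h (p # ys)\<bar> < s2 / 2" by blast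
 define t0 where "t0 = h (p # c3)"
 have \<Omega>: "\<Omega> ys t" if ys: "near c3 r3 ys" and t: "\<bar>t - t0\<bar> < s2 / 2" for ys t
 proof -
  have "\<bar>h (p # c3) - h (p # ys)\<bar> < s2 / 2" by (rule c3(4)[OF near_refl[OF c3(2)] ys])
  then have "\<bar>t - h (p # ys)\<bar> < s2" using t unfolding t0_def by linarith
  then show ?thesis using c2(3)[OF c3(3)[OF ys]] by blast
 qed

 \<comment> \<open>A definable section of \<open>h\<close>: the least of the finitely many
   preimages, and 0 where there is none.\<close>
 define L where "L t ys x = (\<bar>x - x1\<bar> < s1 & h (x # ys) = t & (ALL x'. \<bar>x' - x1\<bar> < s1 --> h (x' # ys) = t --> x <= x'))" for t ys x
 define \<xi> where "\<xi> t ys = (if EX x. L t ys x then (THE x. L t ys x) else 0)" for t ys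
 have Luniq: "x = x'" if "L t ys x" "L t ys x'" for t ys x x'
 proof (rule antisym)
  show "x <= x'" "x' <= x" using that unfolding L_def by blast+
 qed
 have \<xi>L: "L t ys (\<xi> t ys)" if "L t ys x" for t ys x
 proof -
  have "(THE x. L t ys x) = x" using that Luniq by blast
  then show ?thesis using that by (auto simp: \<xi>_def)
 qed
 have D\<xi>': "DefB n (%u zs. u = \<xi> t zs)" for t
 proof -
  have eq: "u = \<xi> t zs \<longleftrightarrow> L t zs u | (~ (EX x. L t zs x) & u = 0)" for u zs
   using \<xi>L Luniq by (metis \<xi>_def)
  show ?thesis unfolding DefB_def eq L_def by (intro Def_intros DefF_app[OF Dh] DefV_intros)
 qed
 have D\<xi>: "DefT (%e. \<xi> (t e) (Y e))" if "DefT t" "DefV n Y" for t Y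
 proof -
  have eq: "u = \<xi> t zs \<longleftrightarrow> L t zs u | (~ (EX x. L t zs x) & u = 0)" for u t zs
   using \<xi>L Luniq by (metis \<xi>_def)
  note sY = DefV_shift[OF that(2)]
  note ssY = DefV_shift[OF sY]
  note sssY = DefV_shift[OF ssY]
  note st = DefT_shift[OF that(1)]
  note sst = DefT_shift[OF st]
  note ssst = DefT_shift[OF sst]
  show ?thesis unfolding DefT_def eq L_def
   by (intro Def_intros DefF_app[OF Dh] DefV_Cons sY ssY sssY st sst ssst)
 qed
 have \<xi>: "\<bar>\<xi> t ys - x1\<bar> < s1" "h (\<xi> t ys # ys) = t" if ys: "near c3 r3 ys" and t: "\<bar>t - t0\<bar> < s2 / 2" for ys t
 proof -
  let ?A = "{x. \<bar>x - x1\<bar> < s1 & h (x # ys) = t}"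
  have "finite ?A" using fin c2(3) c3(3) ys by blast
  moreover have "?A ~= {}" using \<Omega>[OF ys t] unfolding \<Omega>_def by auto
  ultimately have "L t ys (Min ?A)" unfolding L_def using Min_in[of ?A] Min_le[of ?A] by auto
  from \<xi>L[OF this] show "\<bar>\<xi> t ys - x1\<bar> < s1" "h (\<xi> t ys # ys) = t" unfolding L_def by auto
 qed
 define \<gamma> where "\<gamma> t ys = rmv i (g (\<xi> t ys # ys))" for t ys
 have \<gamma>len: "length (\<gamma> t ys) = n" if "length ys = n" for t ys
  unfolding \<gamma>_def using len that i(1) by (intro length_rmv) auto
 have D\<gamma>: "DefT (%e. \<gamma> (t e) (Y e) ! k)" if "DefT t" "DefV n Y" "k < n" for t Y k
 proof -
  have "\<gamma> (t e) (Y e) ! k = g (\<xi> (t e) (Y e) # Y e) ! (if k < i then k else Suc k)" for e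
   unfolding \<gamma>_def using len that i(1) by (intro nth_rmv) (auto simp: DefV_def)
  moreover have "DefT (%e. g (\<xi> (t e) (Y e) # Y e) ! (if k < i then k else Suc k))"
   using that i(1) by (intro DefF_app[OF DH] DefV_Cons D\<xi>) auto
  ultimately show ?thesis by simp
 qed
 have g\<gamma>: "g (\<xi> t ys # ys) = ins i t (\<gamma> t ys)" "near c r0 (\<xi> t ys # ys)" if ys: "near c3 r3 ys" and t: "\<bar>t - t0\<bar> < s2 / 2" for ys t
 proof -
  have l: "length (g (\<xi> t ys # ys)) = Suc n" using len near_length[OF ys] c3(1) by simp
  have "g (\<xi> t ys # ys) ! i = t" using \<xi>(2)[OF ys t] by (simp add: h_def)
  then show "g (\<xi> t ys # ys) = ins i t (\<gamma> t ys)" unfolding \<gamma>_def using ins_rmv[of i "g (\<xi> t ys # ys)"] l i(1) by simp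
  show "near c r0 (\<xi> t ys # ys)" using \<xi>(1)[OF ys t] s1(3) c1(3) c2(3) c3(3) ys box by blast
 qed
 \<comment> \<open>On a level \<open>h = t\<close> the other components give a map in
   \<open>n\<close> variables whose fibres obey the same bound, so the induction hypothesis
   applies.\<close>
 have J\<gamma>: "fat n (%ws. EX ys. near c' \<rho> ys & \<gamma> t ys = ws)"
  if c': "length c' = n" "\<rho> > 0" "!!ys. near c' \<rho> ys ==> near c3 r3 ys" and t: "\<bar>t - t0\<bar> < s2 / 2" for c' \<rho> t
 proof -
  have "ALL xs. length xs = n --> length (\<gamma> t xs) = n" using \<gamma>len by blast
  moreover have "ALL k<n. DefF n (%xs. \<gamma> t xs ! k)" unfolding DefF_def by (intro allI impI D\<gamma> DefT_intros DefV_intros)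
  moreover have "finite {ys. near c' \<rho> ys & \<gamma> t ys = ws} & card {ys. near c' \<rho> ys & \<gamma> t ys = ws} <= N" for ws
  proof -
   have "(%ys. \<xi> t ys # ys) ` {ys. near c' \<rho> ys & \<gamma> t ys = ws} \<subseteq> {xs. near c r0 xs & g xs = ins i t ws}"
    using g\<gamma> c'(3) t by blast
   moreover have inj: "inj_on (%ys. \<xi> t ys # ys) {ys. near c' \<rho> ys & \<gamma> t ys = ws}" by (auto simp: inj_on_def)
   moreover have "finite {xs. near c r0 xs & g xs = ins i t ws}" "card {xs. near c r0 xs & g xs = ins i t ws} <= N" using fto by blast+
   ultimately show ?thesis using card_inj_on_le inj_on_finite by (metis (no_types, lifting) order_trans)
  qed
  ultimately show ?thesis using J c'(1,2) unfolding Jprop_def by blast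
 qed
 define S where "S t ws = (EX ys. length ys = n & (near c3 r3 ys & \<gamma> t ys = ws))" for t ws
 have DS: "Def (%e. S (t e) (W e))" if t: "DefT t" and W: "DefV n W" for t W
 proof -
  have t': "DefT (%e. t (%i. e (n + i)))" by (rule DefT_subst[OF t]) (intro DefT_intros)
  have W': "DefT (%e. W (%i. e (n + i)) ! k)" if "k < n" for k
   by (rule DefT_subst[of "%e. W e ! k"]) (use W that in \<open>auto simp: DefV_def intro: DefT_intros\<close>)
  have eq: "(\<gamma> (t e) ys = W e) = (ALL k:{..<n}. \<gamma> (t e) ys ! k = W e ! k)" if "length ys = n" for e ys
   using \<gamma>len[OF that] W unfolding DefV_def by (auto simp: list_eq_iff_nth_eq)
  have "Def (%e. near c3 r3 (map e [0..<n]) & (ALL k:{..<n}. \<gamma> (t (%i. e (n + i))) (map e [0..<n]) ! k = W (%i. e (n + i)) ! k))"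
   by (intro Def_conj Def_near[where n = n] Def_finite_all Def_eq D\<gamma> W' DefV_intros DefT_coord t' c3(1)) auto
  from Def_exL[of "%e ys. near c3 r3 ys & (ALL k:{..<n}. \<gamma> (t e) ys ! k = W e ! k)", OF this]
  show ?thesis unfolding S_def using eq by (simp cong: conj_cong)
 qed
 define Gd where "Gd s t ys = (ALL ws. length ws = n --> near (\<gamma> t ys) s ws --> S t ws)" for s t ys
 have DGd: "Def (%e. Gd (s e) (t e) (Y e))" if s: "DefT s" and t: "DefT t" and Y: "DefV n Y" for s t Y
 proof -
  have s': "DefT (%e. s (%i. e (n + i)))" by (rule DefT_subst[OF s]) (intro DefT_intros)
  have t': "DefT (%e. t (%i. e (n + i)))" by (rule DefT_subst[OF t]) (intro DefT_intros)
  have "DefT (%e. Y (%i. e (n + i)) ! k)" if "k < n" for k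
   by (rule DefT_subst[of "%e. Y e ! k"]) (use Y that in \<open>auto simp: DefV_def intro: DefT_intros\<close>)
  then have Y': "DefV n (%e. Y (%i. e (n + i)))" using Y unfolding DefV_def by blast
  have g': "DefV n (%e. \<gamma> (t (%i. e (n + i))) (Y (%i. e (n + i))))"
   unfolding DefV_def using \<gamma>len Y' D\<gamma>[OF t' Y'] unfolding DefV_def by blast
  show ?thesis unfolding Gd_def
   by (rule Def_allL) (intro Def_imp Def_near[where n = n] DS g' s' t' DefV_intros)
 qed
 have Gd_mono: "Gd s t ys ==> s' <= s ==> Gd s' t ys" for s s' t ys unfolding Gd_def using near_mono by blast

 define T where "T zs \<longleftrightarrow> (\<bar>hd zs - t0\<bar> < s2 / 2 & near c3 r3 (tl zs))" for zs
 define Good where "Good zs \<longleftrightarrow> (EX s>0. Gd s (hd zs) (tl zs))" for zs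
 have hd_tl: "hd (map e [0..<Suc n]) = e 0" "tl (map e [0..<Suc n]) = map (%i. e (Suc i)) [0..<n]" for e :: "nat => 'a"
  by (simp_all add: upt_conv_Cons map_Suc_upt[symmetric] comp_def del: upt_Suc)
 have DT': "DefL (Suc n) T" unfolding DefL_def T_def hd_tl by (intro Def_intros Def_near[where n = n] DefV_intros c3(1))
 have DGood: "DefL (Suc n) Good" unfolding DefL_def Good_def hd_tl by (intro Def_intros DGd DefV_intros)
 have "fat (Suc n) T"
 proof (rule fatI[of "t0 # c3" _ "min (s2 / 2) r3"])
  fix zs assume "near (t0 # c3) (min (s2 / 2) r3) zs"
  then show "T zs" unfolding T_def using near_mono[of c3 "min (s2 / 2) r3" _ r3] by (auto simp: near_Cons_iff)
 qed (use c3 s2 in auto)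
 \<comment> \<open>Points whose image has a box around it within their level fill a box: otherwise
   there is a box without such points, and the induction hypothesis on one of its levels produces
   one.\<close>
 then have "fat (Suc n) (%zs. (T zs & Good zs) | (T zs & ~ Good zs))" by (rule fat_mono) blast
 moreover have "DefL (Suc n) (%zs. T zs & Good zs)" "DefL (Suc n) (%zs. T zs & ~ Good zs)"
  using DT' DGood unfolding DefL_def by (auto intro: Def_conj Def_not)
 ultimately have "fat (Suc n) (%zs. T zs & Good zs) | fat (Suc n) (%zs. T zs & ~ Good zs)"
  using U[OF dps, of "Suc n"] unfolding Uprop_def by blast
 moreover have "~ fat (Suc n) (%zs. T zs & ~ Good zs)"
 proof
  assume bad: "fat (Suc n) (%zs. T zs & ~ Good zs)"
  obtain t1 c' \<rho> where b: "length c' = n" "\<rho> > 0" "!!t ys. \<bar>t - t1\<bar> < \<rho> ==> near c' \<rho> ys ==> T (t # ys) & ~ Good (t # ys)"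
   using fat_SucE[OF bad] by metis
  have t1: "\<bar>t1 - t1\<bar> < \<rho>" using b(2) by simp
  have sub: "near c3 r3 ys" if "near c' \<rho> ys" for ys using b(3)[OF t1 that] by (simp add: T_def)
  have tt: "\<bar>t1 - t0\<bar> < s2 / 2" using b(3)[OF t1 near_refl[OF b(2)]] by (simp add: T_def)
  from J\<gamma>[OF b(1,2) sub tt] obtain w \<sigma> where w: "length w = n" "\<sigma> > 0" "!!ws. near w \<sigma> ws ==> EX ys. near c' \<rho> ys & \<gamma> t1 ys = ws"
   unfolding fat_def by blast
  obtain ys1 where ys1: "near c' \<rho> ys1" "\<gamma> t1 ys1 = w" using w(3)[OF near_refl[OF w(2)]] by blast
  have "Gd \<sigma> t1 ys1" unfolding Gd_def ys1(2) S_def using w(3) sub near_length b(1) by metis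
  then have "Good (t1 # ys1)" unfolding Good_def using w(2) by auto
  then show False using b(3)[OF t1 ys1(1)] by blast
 qed
 ultimately have good: "fat (Suc n) (%zs. T zs & Good zs)" by blast
 obtain t2 y0 r4 where b: "length y0 = n" "r4 > 0" "!!t ys. \<bar>t - t2\<bar> < r4 ==> near y0 r4 ys ==> T (t # ys) & Good (t # ys)"
  using fat_SucE[OF good] by metis
 have y0: "T (t # y0) & Good (t # y0)" if "\<bar>t - t2\<bar> < r4" for t using b(3)[OF that near_refl[OF b(2)]] .
 have Y0: "near c3 r3 y0" using y0[of t2] b(2) by (auto simp: T_def)
 \<comment> \<open>With \<open>ys\<close> fixed at \<open>y0\<close> the radius is made uniform in
   \<open>t\<close>. Then \<open>t\<close> is restricted until \<open>\<gamma> t y0\<close> moves by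
   less than \<open>s3 / 2\<close>, so that the levels together cover a box.\<close>
 have "EX s>0. fat 1 (%ts. \<bar>hd ts - t2\<bar> < r4 & Gd s (hd ts) y0)"
 proof (rule MD[OF dps])
  show "DefB 1 (%s ts. \<bar>hd ts - t2\<bar> < r4 & Gd s (hd ts) y0)"
   unfolding DefB_def by simp (intro Def_intros DGd DefV_intros b(1))
  show "fat 1 (%ts. EX s>0. \<bar>hd ts - t2\<bar> < r4 & Gd s (hd ts) y0)"
  proof (rule fatI[of "[t2]" _ r4])
   fix ts assume "near [t2] r4 ts"
   then have *: "\<bar>hd ts - t2\<bar> < r4" by (auto simp: near_Cons_iff)
   then have "Good (hd ts # y0)" using y0 by blast
   then show "EX s>0. \<bar>hd ts - t2\<bar> < r4 & Gd s (hd ts) y0" unfolding Good_def using * by auto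
  qed (use b in auto)
 qed (use Gd_mono in blast)
 then obtain s3 c4 r5 where s3: "s3 > 0" and c4: "length c4 = 1" "r5 > 0"
  "!!ts. near c4 r5 ts ==> \<bar>hd ts - t2\<bar> < r4 & Gd s3 (hd ts) y0" unfolding fat_def by blast
 have D1: "DefF 1 (%ts. \<gamma> (hd ts) y0 ! k)" if "k < n" for k
  unfolding DefF_def using that by simp (intro D\<gamma> DefT_intros DefV_intros b(1))
 have "s3 / 2 > 0" using s3 by simp
 from small_oscillation_list[where m = n and H = "%k ts. \<gamma> (hd ts) y0 ! k", OF dps D1 c4(1,2) this] obtain c5 r6 where c5: "length c5 = 1" "r6 > 0"
  "!!ts. near c5 r6 ts ==> near c4 r5 ts"
  "!!k ts us. k < n ==> near c5 r6 ts ==> near c5 r6 us ==> \<bar>\<gamma> (hd ts) y0 ! k - \<gamma> (hd us) y0 ! k\<bar> < s3 / 2" by blast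
 obtain t4 where t4: "c5 = [t4]" using c5(1) by (auto simp: length_Suc_conv)
 define w0 where "w0 = \<gamma> t4 y0"
 have w0: "length w0 = n" unfolding w0_def by (rule \<gamma>len[OF b(1)])
 show "fat (Suc n) (%zs. EX xs. near c r0 xs & g xs = zs)"
 proof (rule fatI[of "ins i t4 w0" _ "min r6 (s3 / 2)"])
  show li: "length (ins i t4 w0) = Suc n" using w0 i(1) by (auto simp: ins_def)
  show "min r6 (s3 / 2) > 0" using c5 s3 by simp
  fix zs assume z: "near (ins i t4 w0) (min r6 (s3 / 2)) zs"
  define t where "t = zs ! i"
  have lz: "length zs = Suc n" using near_length[OF z] li by simp
  have "\<bar>t - t4\<bar> < min r6 (s3 / 2)" using z i(1) li nth_ins[OF i(1) w0] unfolding t_def near_conv by auto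
  then have t: "near c5 r6 [t]" by (simp add: t4)
  have "near w0 (min r6 (s3 / 2)) (rmv i zs)" using near_rmv[OF i(1) li z] rmv_ins[OF i(1) w0] by simp
  then have n1: "near w0 (s3 / 2) (rmv i zs)" by (rule near_mono) simp
  have "near (\<gamma> t y0) (s3 / 2) w0"
   unfolding near_conv w0_def using c5(4)[OF _ near_refl[OF c5(2)] t] \<gamma>len[OF b(1)] t4 by auto
  from near_trans[OF n1 this] have n2: "near (\<gamma> t y0) s3 (rmv i zs)" by simp
  have ct: "\<bar>t - t2\<bar> < r4" "Gd s3 t y0" using c4(3)[OF c5(3)[OF t]] by simp_all
  have "S t (rmv i zs)" using ct(2) n2 length_rmv[OF i(1) lz] unfolding Gd_def by blast
  then obtain ys where ys: "near c3 r3 ys" "\<gamma> t ys = rmv i zs" unfolding S_def by blast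
  have tt: "\<bar>t - t0\<bar> < s2 / 2" using y0[OF ct(1)] by (simp add: T_def)
  have "g (\<xi> t ys # ys) = zs" using g\<gamma>(1)[OF ys(1) tt] ys(2) ins_rmv[of i zs] lz i(1) by (simp add: t_def)
  then show "EX xs. near c r0 xs & g xs = zs" using g\<gamma>(2)[OF ys(1) tt] by blast
 qed
qed

theorem finite_to_one_image:
 assumes dps: "dps TYPE('a::linordered_field)"
 shows "Jprop TYPE('a) n"
proof (induction n)
 case 0
 then show ?case by (auto simp: Jprop_def fat_def)
next
 case (Suc n)
 then show ?case by (rule Jstep[OF dps])
qed

section \<open>Polynomials with arbitrarily small values and no root\<close>

definition dense_bad :: "'a::linordered_field poly => 'a => 'a => bool" where
 "dense_bad f a b \<longleftrightarrow> (ALL x. a <= x --> x <= b --> poly f x ~= 0) &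
   (ALL \<epsilon>>0. EX x. a <= x & x <= b & \<bar>poly f x\<bar> < \<epsilon>)"

lemma poly_bounded:
 fixes p :: "'a::linordered_field poly"
 shows "EX B>0. ALL x. a <= x --> x <= b --> \<bar>poly p x\<bar> <= B"
proof (induction p)
 case 0
 then show ?case by (intro exI[of _ 1]) auto
next
 case (pCons c p)
 then obtain B where B: "B > 0" "!!x. a <= x ==> x <= b ==> \<bar>poly p x\<bar> <= B" by blast
 define M where "M = max \<bar>a\<bar> \<bar>b\<bar>"
 show ?case
 proof (intro exI[of _ "\<bar>c\<bar> + M * B + 1"] conjI allI impI)
  have M: "M >= 0" by (auto simp: M_def)
  then show "\<bar>c\<bar> + M * B + 1 > 0" using B(1) by (simp add: add_nonneg_pos)
  fix x assume x: "a <= x" "x <= b"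
  then have "\<bar>x\<bar> <= M" by (auto simp: M_def)
  then have "\<bar>x * poly p x\<bar> <= M * B" unfolding abs_mult using B(2)[OF x] M by (intro mult_mono) auto
  moreover have "\<bar>c + x * poly p x\<bar> <= \<bar>c\<bar> + \<bar>x * poly p x\<bar>" by (rule abs_triangle_ineq)
  ultimately show "\<bar>poly (pCons c p) x\<bar> <= \<bar>c\<bar> + M * B + 1" by simp
 qed
qed

section \<open>Annihilators modulo a polynomial and values in the algebraic closure\<close>

lemma pcompose_monom_eq: "pcompose (monom c j) u = smult c (u ^ j)"
 by (induction j) (auto simp: monom_0 monom_Suc pcompose_pCons)

lemma pcompose_root_factor: "pcompose ([:- y, 1:] * h) u = (u - [:y:]) * pcompose h (u :: 'a::comm_ring_1 poly)"
proof -
 have "pcompose [:- y, 1:] u = u - [:y:]" by (rule poly_eqI) (simp add: pcompose_pCons coeff_pCons split: nat.splits)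
 then show ?thesis unfolding pcompose_mult by (rule arg_cong)
qed

lemma degree_diff_const:
 assumes "0 < degree u" shows "degree (u - [:c:]) = degree (u :: 'a::comm_ring_1 poly)"
proof -
 have "u - [:c:] = u + [:- c:]" by (rule poly_eqI) (simp add: coeff_pCons split: nat.splits)
 moreover have "degree (u + [:- c:]) = degree u" using assms by (intro degree_add_eq_left) simp
 ultimately show ?thesis by argo
qed

text \<open>The powers of \<open>u\<close> up to the \<open>n\<close>-th, reduced modulo
  \<open>f\<close>, lie in the span of \<open>n\<close> monomials. Either two of them coincide or
  they are linearly dependent.\<close>

lemma annihilator_exists:
 fixes f u :: "'a::field poly"
 assumes n: "degree f = n" "n > 0"
 shows "EX h. h ~= 0 & degree h <= n & f dvd pcompose h u"
proof -
 define p where "p j = u ^ j mod f" for j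
 have dp: "f dvd u ^ j - p j" for j unfolding p_def by (metis mod_eq_dvd_iff mod_mod_trivial)
 show ?thesis
 proof (cases "inj_on p {..n}")
  case False
  then obtain i j where ij: "i <= n" "j <= n" "i < j" "p i = p j"
   unfolding inj_on_def by (metis atMost_iff linorder_neqE_nat)
  define h where "h = monom (1 :: 'a) j - monom 1 i"
  have "coeff h j = 1" using ij by (simp add: h_def)
  then have "h ~= 0" by auto
  moreover have "degree h <= n" unfolding h_def using ij by (intro degree_diff_le) (auto intro: order_trans[OF degree_monom_le])
  moreover have "pcompose h u = (u ^ j - p j) - (u ^ i - p i)"
   unfolding h_def by (simp add: pcompose_diff pcompose_monom_eq ij(4))
  then have "f dvd pcompose h u" using dp by simp
  ultimately show ?thesis by blast
 next
  case True
  interpret V: vector_space "smult :: 'a => 'a poly => 'a poly"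
   by unfold_locales (auto simp: smult_add_right smult_add_left)
  define B where "B = (%k. monom (1 :: 'a) k) ` {..<n}"
  have span: "q \<in> V.span B" if "degree q < n" for q
  proof -
   have "q = (\<Sum>i\<le>degree q. monom (coeff q i) i)" by (simp add: poly_as_sum_of_monoms)
   also have "\<dots> = (\<Sum>i\<le>degree q. smult (coeff q i) (monom 1 i))" by (simp add: smult_monom)
   also have "\<dots> \<in> V.span B"
    by (intro V.span_sum V.span_scale V.span_base) (use that in \<open>auto simp: B_def\<close>)
   finally show ?thesis .
  qed
  have degp: "degree (p j) < n" for j
  proof -
   have "f ~= 0" using n by auto
   then have "p j = 0 | degree (p j) < degree f" unfolding p_def by (rule degree_mod_less)
   then show ?thesis using n by auto
  qed
  have "V.dependent (p ` {..n})"
  proof (rule ccontr)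
   assume "~ ?thesis"
   then have "card (p ` {..n}) <= card B"
    using V.independent_span_bound[of B "p ` {..n}"] span degp by (auto simp: B_def image_subset_iff)
   also have "card B <= n" unfolding B_def using card_image_le[of "{..<n}"] by simp
   finally show False using card_image[OF True] by simp
  qed
  then obtain t c where t: "finite t" "t \<subseteq> p ` {..n}" "(\<Sum>v\<in>t. smult (c v) v) = 0" "EX v:t. c v ~= 0"
   unfolding V.dependent_explicit by blast
  define T where "T = {j. j <= n & p j \<in> t}"
  have T: "finite T" "p ` T = t" "inj_on p T" using t(2) True by (auto simp: T_def inj_on_def)
  define h where "h = (\<Sum>j\<in>T. monom (c (p j)) j)"
  obtain j0 where j0: "j0 \<in> T" "c (p j0) ~= 0" using t(4) T(2) by auto
  have "coeff h j0 = (\<Sum>j\<in>T. if j = j0 then c (p j) else 0)" unfolding h_def by (simp add: coeff_sum)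
  also have "\<dots> = c (p j0)" using T(1) j0(1) by simp
  finally have "h ~= 0" using j0(2) by auto
  moreover have "degree h <= n" unfolding h_def
   by (intro degree_sum_le T(1)) (auto simp: T_def intro: order_trans[OF degree_monom_le])
  moreover have "f dvd pcompose h u"
  proof -
   have "pcompose h u = (\<Sum>j\<in>T. smult (c (p j)) (u ^ j))"
    unfolding h_def by (simp add: pcompose_sum pcompose_monom_eq)
   also have "\<dots> = (\<Sum>j\<in>T. smult (c (p j)) (u ^ j - p j)) + (\<Sum>j\<in>T. smult (c (p j)) (p j))"
    by (simp add: sum.distrib[symmetric] smult_add_right[symmetric])
   also have "(\<Sum>j\<in>T. smult (c (p j)) (p j)) = 0"
    using t(3) sum.reindex[OF T(3), of "%v. smult (c v) v"] T(2) by simp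
   finally show ?thesis using dp by (auto intro!: dvd_sum dvd_smult)
  qed
  ultimately show ?thesis by blast
 qed
qed

definition ev :: "'a::field alg_closure => 'a poly => 'a alg_closure" where
 "ev \<alpha> p = poly (map_poly to_ac p) \<alpha>"

lemma ev_pCons: "ev \<alpha> (pCons a p) = to_ac a + \<alpha> * ev \<alpha> p"
 by (simp add: ev_def map_poly_pCons)

lemma ev_0 [simp]: "ev \<alpha> 0 = 0"
 by (simp add: ev_def)

lemma ev_add: "ev \<alpha> (p + q) = ev \<alpha> p + ev \<alpha> q"
proof (induction p arbitrary: q)
 case (pCons a p)
 obtain b q' where q: "q = pCons b q'" by (cases q)
 show ?case unfolding q by (simp add: ev_pCons pCons.IH algebra_simps)
qed simp

lemma ev_smult: "ev \<alpha> (smult c p) = to_ac c * ev \<alpha> p"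
 by (induction p) (auto simp: ev_pCons algebra_simps)

lemma ev_mult: "ev \<alpha> (p * q) = ev \<alpha> p * ev \<alpha> q"
proof (induction p)
 case (pCons a p)
 have "ev \<alpha> (pCons a p * q) = to_ac a * ev \<alpha> q + ev \<alpha> (pCons 0 (p * q))" by (simp add: ev_add ev_smult)
 also have "\<dots> = ev \<alpha> (pCons a p) * ev \<alpha> q" by (simp add: ev_pCons pCons.IH algebra_simps)
 finally show ?case .
qed simp

lemma ev_diff: "ev \<alpha> (p - q) = ev \<alpha> p - ev \<alpha> q"
 using ev_add[of \<alpha> "p - q" q] by simp

lemma ev_pcompose: "ev \<alpha> (pcompose g u) = ev (ev \<alpha> u) g"
 by (induction g) (auto simp: ev_pCons pcompose_pCons ev_add ev_mult)

section \<open>Arithmetic modulo a bad polynomial of least degree\<close>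

locale min_bad =
 fixes f :: "'a::linordered_field poly" and a b :: 'a and n :: nat
 assumes bad: "dense_bad f a b" and deg: "degree f = n"
  and min: "!!p a b. degree p < n ==> ~ dense_bad (p :: 'a poly) a b"
begin

lemma small: "\<epsilon> > 0 ==> EX x. a <= x & x <= b & \<bar>poly f x\<bar> < \<epsilon>"
 and noroot: "a <= x ==> x <= b ==> poly f x ~= 0"
 using bad unfolding dense_bad_def by blast+

text \<open>A polynomial of degree at most one without a root on an interval is smallest in absolute
  value at an end point.\<close>

lemma n2: "n >= 2"
proof (rule ccontr)
 assume "~ n >= 2"
 then have "degree f <= 1" using deg by simp
 then have f: "f = [:coeff f 0, coeff f 1:]"
  by (intro poly_eqI) (auto simp: coeff_pCons coeff_eq_0 split: nat.split)
 define c where "c = coeff f 0"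
 define d where "d = coeff f 1"
 have pf: "poly f x = c + d * x" for x by (subst f) (simp add: c_def d_def)
 obtain x0 where x0: "a <= x0" "x0 <= b" using small[of 1] by auto
 then have ab: "a <= b" by simp
 have "\<bar>poly f x\<bar> >= min \<bar>poly f a\<bar> \<bar>poly f b\<bar>" if x: "a <= x" "x <= b" for x
 proof (cases "d = 0")
  case True then show ?thesis by (simp add: pf)
 next
  case False
  define r where "r = - c / d"
  have p: "poly f y = d * (y - r)" for y using False by (simp add: pf r_def field_simps)
  have "r < a | b < r" using noroot[of r] p[of r] by (metis diff_self mult_zero_right not_le)
  then have "\<bar>x - r\<bar> >= \<bar>a - r\<bar> | \<bar>x - r\<bar> >= \<bar>b - r\<bar>" using x by auto
  then have "\<bar>d\<bar> * \<bar>x - r\<bar> >= \<bar>d\<bar> * \<bar>a - r\<bar> | \<bar>d\<bar> * \<bar>x - r\<bar> >= \<bar>d\<bar> * \<bar>b - r\<bar>"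
   by (auto intro: mult_left_mono)
  then show ?thesis unfolding p abs_mult by (auto simp: min_le_iff_disj)
 qed
 moreover have "min \<bar>poly f a\<bar> \<bar>poly f b\<bar> > 0" using noroot ab by auto
 ultimately show False using small by (meson not_le)
qed

lemma f0: "f ~= 0"
 using n2 deg by auto

text \<open>Where \<open>f\<close> and \<open>r\<close> are both small, so is
  \<open>f mod r\<close>. By induction this remainder is 0, so \<open>r\<close> divides
  \<open>f\<close>, has no root on the interval, and would be a bad polynomial of lower
  degree.\<close>

lemma low_degree_away:
 "r ~= 0 ==> degree r < n ==> EX \<epsilon>>0. EX \<delta>>0. ALL x. a <= x --> x <= b --> \<bar>poly f x\<bar> < \<delta> --> \<epsilon> <= \<bar>poly r x\<bar>"
proof (induction "degree r" arbitrary: r rule: less_induct)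
 case less
 show ?case
 proof (rule ccontr)
  assume no: "~ ?thesis"
  have acc: "EX x. a <= x & x <= b & \<bar>poly f x\<bar> < \<delta> & \<bar>poly r x\<bar> < \<epsilon>" if "\<epsilon> > 0" "\<delta> > 0" for \<epsilon> \<delta>
   using no that by (meson not_le)
  define s where "s = f mod r"
  define q where "q = f div r"
  have fqs: "f = q * r + s" unfolding s_def q_def by simp
  obtain B where B: "B > 0" "!!x. a <= x ==> x <= b ==> \<bar>poly q x\<bar> <= B" using poly_bounded[of a b q] by blast
  have s0: "s = 0"
  proof (rule ccontr)
   assume "s ~= 0"
   then have ds: "degree s < degree r" unfolding s_def using degree_mod_less[OF less.prems(1), of f] by auto
   then obtain \<epsilon> \<delta> where e: "\<epsilon> > 0" "\<delta> > 0" "!!x. a <= x ==> x <= b ==> \<bar>poly f x\<bar> < \<delta> ==> \<epsilon> <= \<bar>poly s x\<bar>"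
    using less.hyps[OF ds \<open>s ~= 0\<close>] less.prems(2) by (meson less_trans)
   obtain x where x: "a <= x" "x <= b" "\<bar>poly f x\<bar> < min \<delta> (\<epsilon> / 2)" "\<bar>poly r x\<bar> < \<epsilon> / (2 * B)"
    using acc[of "\<epsilon> / (2 * B)" "min \<delta> (\<epsilon> / 2)"] e B by auto
   have "poly s x = poly f x - poly q x * poly r x" by (subst fqs) simp
   then have "\<bar>poly s x\<bar> <= \<bar>poly f x\<bar> + \<bar>poly q x\<bar> * \<bar>poly r x\<bar>"
    using abs_triangle_ineq4[of "poly f x" "poly q x * poly r x"] by (simp add: abs_mult)
   also have "\<bar>poly q x\<bar> * \<bar>poly r x\<bar> <= B * (\<epsilon> / (2 * B))"
    using B(2)[OF x(1,2)] x(4) B(1) by (intro mult_mono) auto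
   also have "B * (\<epsilon> / (2 * B)) = \<epsilon> / 2" using B(1) by simp
   finally have "\<bar>poly s x\<bar> < \<epsilon>" using x(3) by simp
   then show False using e(3)[OF x(1,2)] x(3) by simp
  qed
  then have "f = q * r" using fqs by simp
  then have "poly r x ~= 0" if "a <= x" "x <= b" for x using noroot[OF that] by auto
  moreover have "EX x. a <= x & x <= b & \<bar>poly r x\<bar> < \<epsilon>" if "\<epsilon> > 0" for \<epsilon> using acc[OF that zero_less_one] by blast
  ultimately have "dense_bad r a b" unfolding dense_bad_def by blast
  then show False using min[OF less.prems(2)] by blast
 qed
qed

text \<open>With \<open>dvd_small\<close> this makes divisibility by \<open>f\<close> equivalent to
  being small wherever \<open>f\<close> is small.\<close>

lemma away:
 assumes "~ f dvd p"
 shows "EX \<epsilon>>0. EX \<delta>>0. ALL x. a <= x --> x <= b --> \<bar>poly f x\<bar> < \<delta> --> \<epsilon> <= \<bar>poly p x\<bar>"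
proof -
 define r where "r = p mod f"
 define q where "q = p div f"
 have p: "p = q * f + r" unfolding r_def q_def by simp
 have "r ~= 0" using assms unfolding r_def by (simp add: mod_eq_0_iff_dvd)
 moreover have "degree r < n" using degree_mod_less[OF f0, of p] \<open>r ~= 0\<close> deg unfolding r_def by auto
 ultimately obtain \<epsilon> \<delta> where e: "\<epsilon> > 0" "\<delta> > 0" "!!x. a <= x ==> x <= b ==> \<bar>poly f x\<bar> < \<delta> ==> \<epsilon> <= \<bar>poly r x\<bar>"
  using low_degree_away by blast
 obtain B where B: "B > 0" "!!x. a <= x ==> x <= b ==> \<bar>poly q x\<bar> <= B" using poly_bounded[of a b q] by blast
 show ?thesis
 proof (rule exI[of _ "\<epsilon> / 2"], intro conjI exI[of _ "min \<delta> (\<epsilon> / (2 * B))"] allI impI)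
  fix x assume x: "a <= x" "x <= b" "\<bar>poly f x\<bar> < min \<delta> (\<epsilon> / (2 * B))"
  have "\<bar>poly q x\<bar> * \<bar>poly f x\<bar> <= B * (\<epsilon> / (2 * B))"
   using B(2)[OF x(1,2)] x(3) B(1) by (intro mult_mono) auto
  also have "\<dots> = \<epsilon> / 2" using B(1) by simp
  finally have "\<bar>poly q x * poly f x\<bar> <= \<epsilon> / 2" by (simp add: abs_mult)
  moreover have "\<epsilon> <= \<bar>poly r x\<bar>" using e(3)[OF x(1,2)] x(3) by simp
  moreover have "poly p x = poly q x * poly f x + poly r x" by (subst p) simp
  ultimately show "\<epsilon> / 2 <= \<bar>poly p x\<bar>" using abs_triangle_ineq4[of "poly p x" "poly q x * poly f x"] by (simp add: field_simps)
 qed (use e B in auto)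
qed

lemma dvd_small:
 assumes "f dvd p" "\<epsilon> > 0"
 shows "EX \<delta>>0. ALL x. a <= x --> x <= b --> \<bar>poly f x\<bar> < \<delta> --> \<bar>poly p x\<bar> < \<epsilon>"
proof -
 obtain q where q: "p = f * q" using assms by auto
 obtain B where B: "B > 0" "!!x. a <= x ==> x <= b ==> \<bar>poly q x\<bar> <= B" using poly_bounded[of a b q] by blast
 show ?thesis
 proof (intro exI[of _ "\<epsilon> / B"] conjI allI impI)
  fix x assume x: "a <= x" "x <= b" "\<bar>poly f x\<bar> < \<epsilon> / B"
  have "\<bar>poly p x\<bar> = \<bar>poly f x\<bar> * \<bar>poly q x\<bar>" by (simp add: q abs_mult)
  also have "\<dots> <= \<bar>poly f x\<bar> * B" using B(2)[OF x(1,2)] by (intro mult_left_mono) auto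
  also have "\<dots> < \<epsilon>" using x(3) B(1) by (simp add: field_simps)
  finally show "\<bar>poly p x\<bar> < \<epsilon>" .
 qed (use assms B in auto)
qed

text \<open>Two polynomials that stay away from 0 where \<open>f\<close> is small have a product
  that does, whereas a multiple of \<open>f\<close> becomes small there.\<close>

lemma prime:
 assumes "f dvd p * q" shows "f dvd p | f dvd q"
proof (rule ccontr)
 assume "~ ?thesis"
 then obtain \<epsilon> \<delta> \<epsilon>' \<delta>' where e: "\<epsilon> > 0" "\<delta> > 0" "!!x. a <= x ==> x <= b ==> \<bar>poly f x\<bar> < \<delta> ==> \<epsilon> <= \<bar>poly p x\<bar>"
  and e': "\<epsilon>' > 0" "\<delta>' > 0" "!!x. a <= x ==> x <= b ==> \<bar>poly f x\<bar> < \<delta>' ==> \<epsilon>' <= \<bar>poly q x\<bar>"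
  using away[of p] away[of q] by blast
 obtain \<delta>2 where d2: "\<delta>2 > 0" "!!x. a <= x ==> x <= b ==> \<bar>poly f x\<bar> < \<delta>2 ==> \<bar>poly (p * q) x\<bar> < \<epsilon> * \<epsilon>'"
  using dvd_small[OF assms, of "\<epsilon> * \<epsilon>'"] e(1) e'(1) by auto
 obtain x where x: "a <= x" "x <= b" "\<bar>poly f x\<bar> < min (min \<delta> \<delta>') \<delta>2" using small[of "min (min \<delta> \<delta>') \<delta>2"] e e' d2 by auto
 have "\<epsilon> * \<epsilon>' <= \<bar>poly p x\<bar> * \<bar>poly q x\<bar>" using e(3)[OF x(1,2)] e'(3)[OF x(1,2)] x(3) e(1) e'(1) by (intro mult_mono) auto
 then show False using d2(2)[OF x(1,2)] x(3) by (simp add: abs_mult)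
qed

lemma not_dvd_low: "p ~= 0 ==> degree p < n ==> ~ f dvd p"
 using dvd_imp_degree_le[of f p] deg by auto

text \<open>An annihilator \<open>h\<close> of degree below \<open>n\<close> is arbitrarily small at
  the points \<open>u(x)\<close>, which lie in a bounded interval; not being bad, it has a root
  there. By primality \<open>f\<close> divides one of the two factors after substitution of
  \<open>u\<close>; the linear one has too small a degree, so the cofactor annihilates as well, and
  its degree is smaller.\<close>

lemma annihilator_degree:
 assumes u: "0 < degree u" "degree u < n"
 shows "h ~= 0 ==> f dvd pcompose h u ==> n <= degree h"
proof (induction "degree h" arbitrary: h rule: less_induct)
 case less
 show ?case
 proof (rule ccontr)
  assume hn: "~ n <= degree h"
  obtain B where B: "B > 0" "!!x. a <= x ==> x <= b ==> \<bar>poly u x\<bar> <= B" using poly_bounded[of a b u] by blast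
  have "~ dense_bad h (- B) B" using min hn by simp
  moreover have "EX y. - B <= y & y <= B & \<bar>poly h y\<bar> < \<epsilon>" if "\<epsilon> > 0" for \<epsilon>
  proof -
   obtain \<delta> where d: "\<delta> > 0" "!!x. a <= x ==> x <= b ==> \<bar>poly f x\<bar> < \<delta> ==> \<bar>poly (pcompose h u) x\<bar> < \<epsilon>"
    using dvd_small[OF less.prems(2) \<open>\<epsilon> > 0\<close>] by blast
   obtain x where x: "a <= x" "x <= b" "\<bar>poly f x\<bar> < \<delta>" using small[OF d(1)] by blast
   then show ?thesis using d(2)[OF x] B(2)[OF x(1,2)]
    by (intro exI[of _ "poly u x"]) (auto simp: poly_pcompose abs_le_iff)
  qed
  ultimately obtain y0 where "poly h y0 = 0" unfolding dense_bad_def by blast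
  then obtain h1 where h1: "h = [:- y0, 1:] * h1" by (auto simp: poly_eq_0_iff_dvd)
  have h10: "h1 ~= 0" using less.prems(1) h1 by auto
  then have dh: "degree h = Suc (degree h1)" unfolding h1 by (subst degree_mult_eq) auto
  have "pcompose h u = (u - [:y0:]) * pcompose h1 u" unfolding h1 by (rule pcompose_root_factor)
  then have "f dvd (u - [:y0:]) * pcompose h1 u" using less.prems(2) by simp
  moreover have du: "degree (u - [:y0:]) = degree u" by (rule degree_diff_const[OF u(1)])
  then have "~ f dvd u - [:y0:]" using u by (intro not_dvd_low) (metis degree_0 less_irrefl, simp)
  ultimately have "f dvd pcompose h1 u" using prime by blast
  then have "n <= degree h1" using less.hyps[of h1] dh h10 by simp
  then show False using hn dh by simp
 qed
qed

text \<open>A polynomial of least degree vanishing at \<open>\<alpha>\<close>, if of degree below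
  \<open>n\<close>, would be a proper factor of \<open>f\<close>, against primality.\<close>

lemma ev_zero_dvd:
 assumes "ev \<alpha> f = 0" "ev \<alpha> p = 0" shows "f dvd p"
proof (rule ccontr)
 assume nd: "~ f dvd p"
 define r0 where "r0 = p mod f"
 have r0: "r0 ~= 0" "degree r0 < n" "ev \<alpha> r0 = 0"
 proof -
  show "r0 ~= 0" using nd by (simp add: r0_def mod_eq_0_iff_dvd)
  then show "degree r0 < n" using degree_mod_less[OF f0, of p] deg unfolding r0_def by auto
  have "p = p div f * f + r0" by (simp add: r0_def)
  then have "ev \<alpha> p = ev \<alpha> (p div f) * ev \<alpha> f + ev \<alpha> r0" by (metis ev_add ev_mult)
  then show "ev \<alpha> r0 = 0" using assms by simp
 qed
 obtain r where r: "r ~= 0" "ev \<alpha> r = 0" and rmin: "!!s. s ~= 0 ==> ev \<alpha> s = 0 ==> degree r <= degree s"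
  using ex_has_least_nat[of "%r. r ~= 0 & ev \<alpha> r = 0" r0 degree] r0 by blast
 have rn: "degree r < n" using rmin[OF r0(1,3)] r0(2) by simp
 have "ev \<alpha> (f mod r) = 0"
 proof -
  have "f = f div r * r + f mod r" by simp
  then have "ev \<alpha> f = ev \<alpha> (f div r) * ev \<alpha> r + ev \<alpha> (f mod r)" by (metis ev_add ev_mult)
  then show ?thesis using assms r by simp
 qed
 then have "f mod r = 0" using rmin[of "f mod r"] degree_mod_less[OF r(1), of f] by force
 then have fr: "f = f div r * r" by (metis add.right_neutral div_mult_mod_eq)
 define q where "q = f div r"
 have fq: "f = q * r" using fr by (simp add: q_def)
 have q0: "q ~= 0" using f0 fq by auto
 have dr: "degree r > 0"
 proof (rule ccontr)
  assume "~ degree r > 0"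
  then obtain c where "r = [:c:]" using degree_eq_zeroE by blast
  then show False using r by (auto simp: ev_pCons)
 qed
 have "degree q < n" using deg fq degree_mult_eq[OF q0 r(1)] dr by simp
 then have "~ f dvd q" "~ f dvd r" using not_dvd_low q0 r rn by auto
 then show False using prime[of q r] fq by simp
qed

end

lemma poly_Poly_sum: "poly (Poly xs) (t :: 'a::comm_semiring_1) = (\<Sum>i<length xs. xs ! i * t ^ i)"
proof (induction xs)
 case (Cons x xs)
 then show ?case by (simp add: sum.lessThan_Suc_shift sum_distrib_left mult_ac del: sum.lessThan_Suc)
qed simp

lemma DefT_sum: "finite I ==> (!!i. i \<in> I ==> DefT (t i)) ==> DefT (%e. \<Sum>i\<in>I. t i e)"
 by (induction I rule: finite_induct) (simp_all add: DefT_add DefT_coord)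

lemma DefT_Poly:
 assumes "DefV m L" "DefT t" shows "DefT (%e. poly (Poly (L e)) (t e))"
proof -
 have "DefT (%e. \<Sum>i<m. L e ! i * t e ^ i)"
  using assms by (intro DefT_sum DefT_mult DefT_power) (auto simp: DefV_def)
 then show ?thesis using assms by (simp add: poly_Poly_sum DefV_def)
qed

lemma DefT_poly: "DefT t ==> DefT (%e. poly p (t e))"
 using DefT_Poly[of "length (coeffs p)" "%_. coeffs p" t] DefV_const[of "coeffs p"] by simp

lemma Poly_map_coeff: "degree p < m ==> Poly (map (coeff p) [0..<m]) = p"
 by (rule poly_eqI) (auto simp: coeff_Poly_eq nth_default_def coeff_eq_0)

text \<open>\<open>G\<close> takes the coefficients of \<open>u\<close> to those of its monic
  annihilator. It is definable and finite-to-one near \<open>X\<close>, so its image contains a box.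
  Some annihilator in this box has a root in the field, and removing the root leaves an annihilator
  of degree below \<open>n\<close>.\<close>

theorem (in min_bad) contradiction:
 assumes dps: "dps TYPE('a)" shows False
proof -
 \<comment> \<open>Enough coefficients for the cofactor in the divisibility, whose degree is at most
   \<open>n * n\<close>.\<close>
 define M where "M = Suc (n * n)"
 define R where "R us zs \<longleftrightarrow> f dvd pcompose (Poly (zs @ [1])) (Poly us)" for us zs :: "'a list"
 have Pmon: "Poly (zs @ [1]) = Poly zs + monom 1 (length zs)" for zs :: "'a list"
  by (simp add: Poly_append)
 have monic: "coeff (Poly (zs @ [1])) (length zs) = 1" "degree (Poly (zs @ [1])) = length zs" "Poly (zs @ [1]) ~= 0" for zs :: "'a list"
 proof -
  show 1: "coeff (Poly (zs @ [1])) (length zs) = 1" by (simp add: coeff_Poly_eq nth_default_append)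
  have "degree (Poly (zs @ [1])) <= length zs"
   by (rule degree_le) (auto simp: coeff_Poly_eq nth_default_def)
  then show "degree (Poly (zs @ [1])) = length zs" using 1 le_degree[of "Poly (zs @ [1])" "length zs"] by simp
  show "Poly (zs @ [1]) ~= 0" using 1 by (metis coeff_0 zero_neq_one)
 qed
 have dP: "degree (Poly xs) < n" if "length xs = n" for xs :: "'a list"
 proof -
  have "degree (Poly xs) <= n - 1" by (rule degree_le) (use that in \<open>auto simp: coeff_Poly_eq nth_default_def\<close>)
  then show ?thesis using n2 by linarith
 qed
 have du: "0 < degree (Poly us)" "degree (Poly us) < n" if "length us = n" "us ! 1 ~= 0" for us :: "'a list"
 proof -
  have "coeff (Poly us) 1 ~= 0" using that n2 by (simp add: coeff_Poly_eq nth_default_def)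
  then show "0 < degree (Poly us)" using le_degree[of "Poly us" 1] by simp
 qed (use dP that in blast)
 have ex: "EX zs. length zs = n & R us zs" if us: "length us = n" "us ! 1 ~= 0" for us
 proof -
  obtain h where h: "h ~= 0" "degree h <= n" "f dvd pcompose h (Poly us)"
   using annihilator_exists[of f n "Poly us"] deg n2 by auto
  have dh: "degree h = n" using annihilator_degree[OF du[OF us] h(1,3)] h(2) by simp
  define h' where "h' = Polynomial.smult (inverse (lead_coeff h)) h"
  have h': "degree h' = n" "coeff h' n = 1" using h dh by (auto simp: h'_def)
  have "Poly (map (coeff h') [0..<n] @ [1]) = Poly (map (coeff h') [0..<Suc n])" using h'(2) by simp
  also have "\<dots> = h'" by (rule Poly_map_coeff) (simp add: h')
  finally have "R us (map (coeff h') [0..<n])" unfolding R_def using h(3) by (simp add: h'_def pcompose_smult dvd_smult)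
  then show ?thesis by (intro exI[of _ "map (coeff h') [0..<n]"]) simp
 qed
 have uniq: "zs = zs'" if us: "length us = n" "us ! 1 ~= 0" and z: "length zs = n" "R us zs" "length zs' = n" "R us zs'" for us zs zs'
 proof -
  have "f dvd pcompose (Poly (zs @ [1])) (Poly us) - pcompose (Poly (zs' @ [1])) (Poly us)"
   using z unfolding R_def by (intro dvd_diff)
  then have "f dvd pcompose (Poly zs - Poly zs') (Poly us)" unfolding Pmon z by (simp add: pcompose_diff pcompose_add)
  moreover have "degree (Poly zs - Poly zs') < n" using dP z by (intro degree_diff_less) auto
  ultimately have "Poly zs - Poly zs' = 0" using annihilator_degree[OF du[OF us]] by (meson not_le)
  then have "Poly zs = Poly zs'" by simp
  then have "zs ! i = zs' ! i" if "i < n" for i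
   using that z by (metis coeff_Poly_eq nth_default_nth)
  then show ?thesis using z by (intro nth_equalityI) auto
 qed
 \<comment> \<open>The condition \<open>us ! 1 \<noteq> 0\<close> is a simple definable way to make
   \<open>u\<close> non-constant; elsewhere only the length of the value matters.\<close>
 define G where "G us = (if us ! 1 ~= 0 then THE zs. length zs = n & R us zs else replicate n 0)" for us
 have G: "length (G us) = n" "R us (G us)" if us: "length us = n" "us ! 1 ~= 0" for us
 proof -
  have "EX! zs. length zs = n & R us zs" using ex[OF us] uniq[OF us] by blast
  from theI'[OF this] show "length (G us) = n" "R us (G us)" using us by (auto simp: G_def)
 qed
 have lenG: "length (G us) = n" if "length us = n" for us using G[OF that] by (cases "us ! 1 = 0") (auto simp: G_def)
 \<comment> \<open>Divisibility becomes an identity of polynomial functions with a cofactor of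
   bounded length, and hence a formula.\<close>
 have R_iff: "R us zs \<longleftrightarrow> (EX qs. length qs = M & (ALL x. poly (Poly zs) (poly (Poly us) x) + poly (Poly us) x ^ n = poly f x * poly (Poly qs) x))"
  if us: "length us = n" "length zs = n" for us zs
 proof -
  have ev: "poly (pcompose (Poly (zs @ [1])) (Poly us)) x = poly (Poly zs) (poly (Poly us) x) + poly (Poly us) x ^ n" for x
   unfolding Pmon poly_pcompose by (simp add: poly_monom us)
  show ?thesis
  proof
   assume "R us zs"
   then obtain q where q: "pcompose (Poly (zs @ [1])) (Poly us) = f * q" unfolding R_def by auto
   have "degree q < M"
   proof (cases "q = 0")
    case False
    have "degree q <= degree (f * q)" using degree_mult_eq[OF f0 False] by simp
    also have "\<dots> = n * degree (Poly us)" unfolding q[symmetric] by (simp add: degree_pcompose monic us)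
    also have "\<dots> <= n * n" using dP[OF us(1)] by simp
    finally show ?thesis by (simp add: M_def)
   qed (simp add: M_def)
   then have "Poly (map (coeff q) [0..<M]) = q" by (rule Poly_map_coeff)
   then show "EX qs. length qs = M & (ALL x. poly (Poly zs) (poly (Poly us) x) + poly (Poly us) x ^ n = poly f x * poly (Poly qs) x)"
    unfolding ev[symmetric] q by (intro exI[of _ "map (coeff q) [0..<M]"]) simp
  next
   assume "EX qs. length qs = M & (ALL x. poly (Poly zs) (poly (Poly us) x) + poly (Poly us) x ^ n = poly f x * poly (Poly qs) x)"
   then obtain qs where "!!x. poly (pcompose (Poly (zs @ [1])) (Poly us)) x = poly (f * Poly qs) x" unfolding ev by auto
   then have "pcompose (Poly (zs @ [1])) (Poly us) = f * Poly qs" using poly_eq_poly_eq_iff by blast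
   then show "R us zs" unfolding R_def by simp
  qed
 qed
 have D: "DefF n (%us. G us ! k)" if k: "k < n" for k
 proof -
  define U where "U e = map (%i. e (Suc i)) [0..<n]" for e :: "nat => 'a"
  have lU: "length (U e) = n" for e by (simp add: U_def)
  define E where "E = (%(us, zs, qs). ALL x. poly (Poly zs) (poly (Poly us) x) + poly (Poly us) x ^ n = poly f x * poly (Poly qs) x)"
  have DE: "Def (%e. E (us e, zs e, qs e))" if "!!i. i < n ==> DefT (%e. us e ! i)" "!!e. length (us e) = n" "DefV n zs" "DefV M qs" for us zs qs
  proof -
   have u: "DefV n (%e. us (%i. e (Suc i)))" "DefV n (%e. zs (%i. e (Suc i)))" "DefV M (%e. qs (%i. e (Suc i)))"
    using that(1)[THEN DefT_shift] that(2) DefV_shift[OF that(3)] DefV_shift[OF that(4)] by (simp_all add: DefV_def)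
   show ?thesis unfolding E_def case_prod_conv
    by (rule Def_all) (intro Def_eq DefT_add DefT_mult DefT_power DefT_Poly[OF u(1)] DefT_Poly[OF u(2)] DefT_Poly[OF u(3)] DefT_poly DefT_coord)
  qed
  have "Def (%e. (e 2 = 0 --> e 0 = 0) & (e 2 ~= 0 --> (EX zs. length zs = n & (zs ! k = e 0 & (EX qs. length qs = M & E (U e, zs, qs))))))"
  proof (intro Def_conj Def_imp Def_not Def_eq DefT_coord)
   have 1: "Def (%e. EX qs. length qs = M & E (U (%i. e (n + i)), map e [0..<n], qs))"
    by (rule Def_exL, rule DE) (auto simp: U_def DefV_def intro: DefT_coord)
   show "Def (%e. EX zs. length zs = n & (zs ! k = e 0 & (EX qs. length qs = M & E (U e, zs, qs))))"
    by (rule Def_exL) (use k 1 in \<open>auto intro!: Def_conj Def_eq DefT_coord\<close>)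
  qed
  moreover have "(e 0 = G (U e) ! k) \<longleftrightarrow> (e 2 = 0 --> e 0 = 0) & (e 2 ~= 0 --> (EX zs. length zs = n & (zs ! k = e 0 & (EX qs. length qs = M & E (U e, zs, qs)))))" for e
  proof -
   have U1: "U e ! 1 = e 2" using n2 by (simp add: U_def numeral_2_eq_2)
   have ER: "(EX qs. length qs = M & E (U e, zs, qs)) \<longleftrightarrow> R (U e) zs" if "length zs = n" for zs
    unfolding R_iff[OF lU that] E_def by simp
   show ?thesis
   proof (cases "e 2 = 0")
    case True
    then show ?thesis using U1 k by (simp add: G_def)
   next
    case False
    then have u1: "U e ! 1 ~= 0" using U1 by simp
    have "(EX zs. length zs = n & (zs ! k = e 0 & (EX qs. length qs = M & E (U e, zs, qs)))) \<longleftrightarrow> (EX zs. length zs = n & zs ! k = e 0 & R (U e) zs)"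
     using ER by blast
    also have "\<dots> \<longleftrightarrow> e 0 = G (U e) ! k" using G[OF lU u1] uniq[OF lU u1] by metis
    finally show ?thesis using False by blast
   qed
  qed
  ultimately have "Def (%e. e 0 = G (U e) ! k)" by simp
  then show ?thesis unfolding DefF_def DefT_def U_def .
 qed
 \<comment> \<open>The coefficients of \<open>X\<close>; within distance \<open>1/2\<close> the
   linear coefficient stays nonzero.\<close>
 define c where "c = (0::'a) # 1 # replicate (n - 2) 0"
 have c: "length c = n" using n2 by (simp add: c_def)
 have near1: "us ! 1 ~= 0" "length us = n" if "near c (1/2) us" for us
 proof -
  show "length us = n" using near_length[OF that] c by simp
  have "\<bar>us ! 1 - c ! 1\<bar> < 1/2" using that n2 c unfolding near_conv by simp
  then show "us ! 1 ~= 0" by (auto simp: c_def)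
 qed
 have "EX \<alpha>. ev \<alpha> f = 0"
 proof -
  have "degree (map_poly to_ac f) > 0" using deg n2 by (subst degree_map_poly) auto
  from alg_closed_imp_poly_has_root[OF this] show ?thesis by (simp add: ev_def)
 qed
 then obtain \<alpha> where \<alpha>: "ev \<alpha> f = 0" by blast
 have fibre: "finite {us. near c (1/2) us & G us = zs} & card {us. near c (1/2) us & G us = zs} <= n" for zs
 proof (cases "length zs = n")
  case False
  then have E: "{us. near c (1/2) us & G us = zs} = {}" using lenG near1 by blast
  show ?thesis unfolding E by simp
 next
  case True
  let ?A = "{us. near c (1/2) us & G us = zs}" and ?p = "map_poly to_ac (Poly (zs @ [1]))"
  have p: "?p ~= 0" "degree ?p = n"
   using monic[of zs] True by (auto simp: map_poly_eq_0_iff degree_map_poly)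
  \<comment> \<open>\<open>u\<close> is recovered from its value at \<open>\<alpha>\<close>, which
    is one of the at most \<open>n\<close> roots of the annihilator.\<close>
  have inj: "inj_on (%us. ev \<alpha> (Poly us)) ?A"
  proof (rule inj_onI)
   fix us us' assume us: "us \<in> ?A" "us' \<in> ?A" "ev \<alpha> (Poly us) = ev \<alpha> (Poly us')"
   then have l: "length us = n" "length us' = n" using near1 by auto
   have "f dvd Poly us - Poly us'" by (rule ev_zero_dvd[OF \<alpha>]) (simp add: ev_diff us)
   moreover have "degree (Poly us - Poly us') < n" using dP l by (intro degree_diff_less) auto
   ultimately have "Poly us - Poly us' = 0" using not_dvd_low by blast
   then have "Poly us = Poly us'" by simp
   then have "us ! i = us' ! i" if "i < n" for i using that l by (metis coeff_Poly_eq nth_default_nth)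
   then show "us = us'" using l by (intro nth_equalityI) auto
  qed
  have sub: "(%us. ev \<alpha> (Poly us)) ` ?A \<subseteq> {x. poly ?p x = 0}"
  proof safe
   fix us assume us: "near c (1/2) us" "zs = G us"
   have "R us (G us)" using G near1[OF us(1)] by blast
   then obtain q where q: "pcompose (Poly (zs @ [1])) (Poly us) = f * q" unfolding R_def us(2) by auto
   have "ev (ev \<alpha> (Poly us)) (Poly (zs @ [1])) = 0" unfolding ev_pcompose[symmetric] q ev_mult \<alpha> by simp
   then show "poly (map_poly to_ac (Poly (G us @ [1]))) (ev \<alpha> (Poly us)) = 0" using us(2) by (simp add: ev_def)
  qed
  have fin: "finite {x. poly ?p x = 0}" by (rule poly_roots_finite[OF p(1)])
  have "finite ?A" using inj_on_finite[OF inj sub fin] .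
  moreover have "card ?A <= n"
   using card_inj_on_le[OF inj sub fin] card_poly_roots_bound[OF p(1)] p(2) by simp
  ultimately show ?thesis by simp
 qed
 have "Jprop TYPE('a) n" by (rule finite_to_one_image[OF dps])
 note J = this[unfolded Jprop_def, rule_format, of G c "1/2" n]
 have "fat n (%zs. EX us. near c (1/2) us & G us = zs)"
  by (rule J) (use lenG D c fibre in simp_all)
 then obtain zs0 r where W: "length zs0 = n" "r > 0" "!!zs. near zs0 r zs ==> EX us. near c (1/2) us & G us = zs"
  unfolding fat_def by blast
 obtain u0 where u0: "near c (1/2) u0" "G u0 = zs0" using W(3)[OF near_refl[OF W(2)]] by blast
 have "R u0 zs0" using G near1[OF u0(1)] u0(2) by blast
 then obtain \<delta> where \<delta>: "\<delta> > 0" "!!x. a <= x ==> x <= b ==> \<bar>poly f x\<bar> < \<delta> ==> \<bar>poly (pcompose (Poly (zs0 @ [1])) (Poly u0)) x\<bar> < r"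
  using dvd_small[OF _ W(2)] unfolding R_def by blast
 obtain x where x: "a <= x" "x <= b" "\<bar>poly f x\<bar> < \<delta>" using small[OF \<delta>(1)] by blast
 \<comment> \<open>Where \<open>f\<close> is small, so is the value \<open>w\<close> of the
   annihilator of \<open>u0\<close> at \<open>y0\<close>. Lowering the constant term by
   \<open>w\<close> stays in the box and creates the root \<open>y0\<close>.\<close>
 define y0 where "y0 = poly (Poly u0) x"
 obtain z zt where z: "zs0 = z # zt" using W(1) n2 by (cases zs0) auto
 define w where "w = poly (Poly (zs0 @ [1])) y0"
 have w: "\<bar>w\<bar> < r" using \<delta>(2)[OF x] by (simp add: w_def y0_def poly_pcompose)
 have "near zs0 r ((z - w) # zt)" unfolding z using w near_refl[OF W(2)] by simp
 from W(3)[OF this] obtain u1 where u1: "near c (1/2) u1" "G u1 = (z - w) # zt" by blast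
 have R1: "R u1 ((z - w) # zt)" using G near1[OF u1(1)] u1(2) by metis
 define g1 where "g1 = Poly (((z - w) # zt) @ [1])"
 have "g1 = Poly (zs0 @ [1]) - [:w:]" by (simp add: g1_def z)
 then have "poly g1 y0 = 0" by (simp add: w_def)
 then obtain h where h: "g1 = [:- y0, 1:] * h" by (auto simp: poly_eq_0_iff_dvd)
 have dg: "degree g1 = n" "g1 ~= 0" using monic[of "(z - w) # zt"] W(1) z by (simp_all add: g1_def)
 have h0: "h ~= 0" using dg h by auto
 then have dh: "degree g1 = Suc (degree h)" unfolding h by (subst degree_mult_eq) auto
 let ?u = "Poly u1"
 have dU: "0 < degree ?u" "degree ?u < n" using du near1[OF u1(1)] by auto
 have "pcompose g1 ?u = (?u - [:y0:]) * pcompose h ?u" unfolding h by (rule pcompose_root_factor)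
 then have "f dvd (?u - [:y0:]) * pcompose h ?u" using R1 unfolding R_def g1_def by simp
 moreover have "~ f dvd ?u - [:y0:]"
 proof (rule not_dvd_low)
  have "degree (?u - [:y0:]) = degree ?u" by (rule degree_diff_const[OF dU(1)])
  then show "degree (?u - [:y0:]) < n" "?u - [:y0:] ~= 0" using dU by auto
 qed
 ultimately have "f dvd pcompose h ?u" using prime by blast
 then have "n <= degree h" by (rule annihilator_degree[OF dU h0])
 then show False using dh dg by simp
qed

theorem no_dense_bad:
 fixes f :: "'a::linordered_field poly"
 assumes dps: "dps TYPE('a)" shows "~ dense_bad f a b"
proof
 assume "dense_bad f a b"
 then have "EX f. EX a b. dense_bad (f :: 'a poly) a b" by blast
 then obtain g :: "'a poly" where g: "EX a b. dense_bad g a b" "!!q :: 'a poly. EX a b. dense_bad q a b ==> degree g <= degree q"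
  using ex_has_least_nat[of "%g :: 'a poly. EX a b. dense_bad g a b" _ degree] by metis
 obtain a b where "dense_bad g a b" using g(1) by blast
 then interpret min_bad g a b "degree g" by unfold_locales (use g(2) in \<open>auto simp: not_le[symmetric]\<close>)
 show False by (rule contradiction[OF dps])
qed

section \<open>Intermediate values and real closedness\<close>

definition ivt_below :: "'a::linordered_field itself => nat => bool" where
 "ivt_below _ n \<longleftrightarrow> (ALL (p :: 'a poly) a b. degree p < n --> a < b --> poly p a < 0 --> 0 < poly p b -->
   (EX x. a < x & x < b & poly p x = 0))"

lemma ivt_root:
 fixes p :: "'a::linordered_field poly"
 assumes ivt: "ivt_below TYPE('a) n" and p: "degree p < n" "a < b" "poly p a * poly p b < 0"
 shows "EX x. a < x & x < b & poly p x = 0"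
proof (cases "poly p a < 0")
 case True
 then have "0 < poly p b" using p(3) by (simp add: mult_less_0_iff)
 with True show ?thesis using ivt p(1,2) unfolding ivt_below_def by blast
next
 case False
 then have "poly (- p) a < 0" "0 < poly (- p) b" using p(3) by (auto simp: mult_less_0_iff)
 moreover have "degree (- p) < n" using p by simp
 ultimately obtain x where "a < x" "x < b" "poly (- p) x = 0" using ivt p(2) unfolding ivt_below_def by blast
 then show ?thesis by auto
qed

lemma ivt_sgn:
 fixes p :: "'a::linordered_field poly"
 assumes ivt: "ivt_below TYPE('a) n" and p: "degree p < n" "a <= b" and nz: "!!x. a <= x ==> x <= b ==> poly p x ~= 0"
 shows "sgn (poly p a) = sgn (poly p b)"
proof (rule ccontr)
 assume ne: "sgn (poly p a) ~= sgn (poly p b)"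
 then have "a < b" using p(2) by (cases "a = b") auto
 moreover have "poly p a ~= 0" "poly p b ~= 0" using nz p(2) by auto
 then have "poly p a * poly p b < 0" using ne by (auto simp: sgn_if mult_less_0_iff split: if_splits)
 ultimately obtain x where "a < x" "x < b" "poly p x = 0" using ivt_root[OF ivt p(1)] by blast
 then show False using nz[of x] by auto
qed

lemma order_split:
 fixes p :: "'a::field poly"
 assumes "p ~= 0" "poly p x = 0"
 obtains i q where "p = [:- x, 1:] ^ Suc i * q" "poly q x ~= 0"
proof -
 obtain q where q: "p = [:- x, 1:] ^ order x p * q" "~ [:- x, 1:] dvd q"
  using order_decomp[OF assms(1)] by blast
 have "order x p ~= 0" using assms by (simp add: order_root)
 then show thesis using that[of "order x p - 1" q] q by (simp add: poly_eq_0_iff_dvd)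
qed

text \<open>The intermediate value property is assumed only below degree \<open>n\<close>, while
  \<open>p\<close> may have degree \<open>n\<close>. With the powers of the linear factors at two
  consecutive roots removed, the derivative leaves a polynomial of degree below \<open>n\<close>
  with opposite signs at these roots.\<close>

lemma rolle_below:
 fixes p :: "'a::linordered_field poly"
 assumes ivt: "ivt_below TYPE('a) n" and p: "degree p <= n" and xy: "x < y" "poly p x = 0" "poly p y = 0"
 shows "EX z. x < z & z < y & poly (pderiv p) z = 0"
proof (cases "p = 0")
 case True
 then show ?thesis using dense[OF xy(1)] by auto
next
 case False
 define Z where "Z = {r. poly p r = 0 & x < r}"
 have Z: "finite Z" "y \<in> Z" unfolding Z_def using poly_roots_finite[OF False] xy by auto
 define w where "w = Min Z"
 have w: "w \<in> Z" "!!r. r \<in> Z ==> w <= r" unfolding w_def using Min_in[OF Z(1)] Min_le[OF Z(1)] Z(2) by blast+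
 then have w': "x < w" "poly p w = 0" "w <= y" using Z(2) by (auto simp: Z_def)
 have between: "poly p r ~= 0" if "x < r" "r < w" for r using that w(2)[of r] by (auto simp: Z_def)
 obtain i p1 where p1: "p = [:- x, 1:] ^ Suc i * p1" "poly p1 x ~= 0" using order_split[OF False xy(2)] by blast
 have "poly p1 w = 0" using w' p1(1) by simp
 moreover have "p1 ~= 0" using p1 by auto
 ultimately obtain j q where q: "p1 = [:- w, 1:] ^ Suc j * q" "poly q w ~= 0" using order_split by blast
 have pq: "p = [:- x, 1:] ^ Suc i * ([:- w, 1:] ^ Suc j * q)" using p1 q by simp
 have qx: "poly q x ~= 0" using p1(2) q(1) by auto
 have q0: "q ~= 0" using qx by auto
 have dp: "degree p = Suc i + (Suc j + degree q)"
  unfolding pq by (simp add: degree_mult_eq degree_power_eq q0 del: power_Suc)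
 have "sgn (poly q x) = sgn (poly q w)"
 proof (rule ivt_sgn[OF ivt])
  fix r assume "x <= r" "r <= w"
  then show "poly q r ~= 0" using qx q(2) between[of r] unfolding pq by (cases "r = x"; cases "r = w") auto
 qed (use dp p w' in auto)
 then have qq: "poly q x * poly q w > 0" using qx q(2) by (auto simp: sgn_if zero_less_mult_iff split: if_splits)
 \<comment> \<open>What remains of the derivative after division by
   \<open>(X - x)^i * (X - w)^j\<close>.\<close>
 define r where "r = smult (of_nat (Suc i)) ([:- w, 1:] * q) + smult (of_nat (Suc j)) ([:- x, 1:] * q) + [:- x, 1:] * ([:- w, 1:] * pderiv q)"
 have "degree (pderiv q) <= degree q - 1" by (simp add: degree_pderiv)
 moreover have "degree ([:- x, 1:] * ([:- w, 1:] * pderiv q)) <= degree q + 1"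
 proof (cases "pderiv q = 0")
  case False
  then have "degree q ~= 0" by (simp add: pderiv_eq_0_iff)
  then show ?thesis using False by (simp add: degree_mult_eq degree_pderiv del: mult_pCons_left)
 qed simp
 moreover have "degree ([:- w, 1:] * q) <= degree q + 1" "degree ([:- x, 1:] * q) <= degree q + 1"
  using q0 by (simp_all add: degree_mult_eq del: mult_pCons_left)
 ultimately have "degree r <= degree q + 1" unfolding r_def
  by (intro degree_add_le) (auto intro: order_trans[OF degree_smult_le] simp del: mult_pCons_left)
 then have dr: "degree r < n" using dp p by simp
 have "poly r x = of_nat (Suc i) * ((x - w) * poly q x)" "poly r w = of_nat (Suc j) * ((w - x) * poly q w)"
  by (simp_all add: r_def left_diff_distrib del: of_nat_Suc)
 then have "poly r x * poly r w = (of_nat (Suc i) * of_nat (Suc j)) * (((x - w) * (w - x)) * (poly q x * poly q w))"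
  by (simp add: mult_ac del: of_nat_Suc)
 moreover have "(x - w) * (w - x) < 0" using w' by (simp add: mult_less_0_iff)
 ultimately have "poly r x * poly r w < 0" using qq
  by (simp add: mult_less_0_iff zero_less_mult_iff del: of_nat_Suc)
 then obtain z where z: "x < z" "z < w" "poly r z = 0" using ivt_root[OF ivt dr w'(1)] by blast
 have "poly (pderiv p) z = (z - x) ^ i * (z - w) ^ j * poly r z"
 proof -
  have d1: "pderiv [:- x, 1:] = 1" "pderiv [:- w, 1:] = 1" by (simp_all add: pderiv_pCons)
  have "pderiv p = [:- x, 1:] ^ Suc i * ([:- w, 1:] ^ Suc j * pderiv q + q * smult (of_nat (Suc j)) ([:- w, 1:] ^ j)) +
    ([:- w, 1:] ^ Suc j * q) * smult (of_nat (Suc i)) ([:- x, 1:] ^ i)"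
   unfolding pq by (simp only: pderiv_mult pderiv_power_Suc d1 mult_1_right)
  then have 1: "poly (pderiv p) z = (z - x) ^ Suc i * ((z - w) ^ Suc j * poly (pderiv q) z + poly q z * (of_nat (Suc j) * (z - w) ^ j)) +
    ((z - w) ^ Suc j * poly q z) * (of_nat (Suc i) * (z - x) ^ i)" by (simp del: power_Suc of_nat_Suc)
  have 2: "poly r z = of_nat (Suc i) * ((z - w) * poly q z) + of_nat (Suc j) * ((z - x) * poly q z) + (z - x) * ((z - w) * poly (pderiv q) z)"
   unfolding r_def by (simp del: of_nat_Suc mult_pCons_left)
  show ?thesis unfolding 1 2 by (simp add: algebra_simps del: of_nat_Suc)
 qed
 then show ?thesis using z w' by auto
qed

lemma mvt_below:
 fixes p :: "'a::linordered_field poly"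
 assumes ivt: "ivt_below TYPE('a) n" and n: "degree p <= n" "0 < n" and xy: "x < y"
 shows "EX z. x < z & z < y & poly p y - poly p x = (y - x) * poly (pderiv p) z"
proof -
 define s where "s = (poly p y - poly p x) / (y - x)"
 define q where "q = p - [:poly p x - s * x, s:]"
 have "degree q <= n" unfolding q_def using n by (intro degree_diff_le) auto
 moreover have s: "s * (y - x) = poly p y - poly p x" using xy by (simp add: s_def)
 have "poly q x = 0" by (simp add: q_def algebra_simps)
 moreover have "poly q y = 0" using s by (simp add: q_def algebra_simps)
 ultimately obtain z where z: "x < z" "z < y" "poly (pderiv q) z = 0" using rolle_below[OF ivt _ xy] by blast
 have "poly (pderiv p) z = s" using z(3) by (simp add: q_def pderiv_diff pderiv_pCons)
 then show ?thesis using z s by (auto simp: mult.commute)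
qed

lemma poly_at_top:
 fixes p :: "'a::linordered_field poly"
 shows "0 < degree p ==> 0 < lead_coeff p ==> EX M. ALL x>=M. B <= poly p x"
proof (induction p arbitrary: B)
 case (pCons c p)
 have p0: "p ~= 0" using pCons.prems by (auto split: if_splits)
 then have lc: "0 < lead_coeff p" using pCons.prems by simp
 have "EX m M. m > 0 & (ALL x>=M. m <= poly p x)"
 proof (cases "degree p = 0")
  case True
  then obtain d where "p = [:d:]" using degree_eq_zeroE by blast
  then show ?thesis using lc by auto
 next
  case False
  then show ?thesis using pCons.IH[of 1] lc zero_less_one by blast
 qed
 then obtain m M where m: "m > 0" "!!x. x >= M ==> m <= poly p x" by blast
 show ?case
 proof (intro exI[of _ "max (max M 0) ((B - c) / m)"] allI impI)
  fix x assume x: "max (max M 0) ((B - c) / m) <= x"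
  have "B - c = (B - c) / m * m" using m by simp
  also have "\<dots> <= x * m" using x m by (intro mult_right_mono) auto
  also have "\<dots> <= x * poly p x" using x m by (intro mult_left_mono) auto
  finally show "B <= poly (pCons c p) x" by simp
 qed
qed simp

lemma pcompose_reflect:
 fixes p :: "'a::linordered_field poly"
 shows "degree (pcompose p [:0, -1:]) = degree p" "lead_coeff (pcompose p [:0, -1:]) = (-1) ^ degree p * lead_coeff p"
  "poly (pcompose p [:0, -1:]) x = poly p (- x)"
proof -
 show "lead_coeff (pcompose p [:0, -1:]) = (-1) ^ degree p * lead_coeff p"
  by (subst lead_coeff_comp) (simp_all add: mult.commute)
qed (simp_all add: degree_pcompose poly_pcompose)

definition ivt :: "'a::linordered_field itself => bool" where
 "ivt _ \<longleftrightarrow> (ALL n. ivt_below TYPE('a) n)"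

lemma ivt_imp_real_closed:
 assumes ivt: "ivt TYPE('a::linordered_field)" shows "real_closed TYPE('a)"
 unfolding real_closed_def
proof (intro conjI allI impI)
 note root = ivt[unfolded ivt_def, rule_format, THEN ivt_root]
 fix x :: 'a assume x: "0 < x"
 have "x < (x + 1) * (x + 1)" using x by (simp add: algebra_simps add_pos_pos)
 then have "poly [:- x, 0, 1:] 0 * poly [:- x, 0, 1:] (x + 1) < 0" using x by (simp add: mult_neg_pos)
 then obtain y where "poly [:- x, 0, 1:] y = 0" using root[of "[:- x, 0, 1:]" 3 0 "x + 1"] x by auto
 then show "EX y. y * y = x" by auto
next
 note root = ivt[unfolded ivt_def, rule_format, THEN ivt_root]
 have *: "EX x. poly p x = 0" if p: "odd (degree p)" "lead_coeff p > 0" for p :: "'a poly"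
 proof -
  have d: "degree p > 0" using p by (auto intro: gr0I)
  obtain M where M: "!!x. x >= M ==> 1 <= poly p x" using poly_at_top[OF d p(2), of 1] by blast
  define q where "q = - pcompose p [:0, -1:]"
  have q: "degree q = degree p" "lead_coeff q = lead_coeff p" "poly q x = - poly p (- x)" for x
   using pcompose_reflect[of p] p by (simp_all add: q_def)
  obtain M' where M': "!!x. x >= M' ==> 1 <= poly q x" using poly_at_top[of q 1] q d p by auto
  define t where "t = max 1 (max M M')"
  have "1 <= poly p t" "1 <= poly q t" using M M' by (auto simp: t_def)
  then have "poly p (- t) * poly p t < 0" using q(3)[of t] by (intro mult_neg_pos) auto
  moreover have "- t < t" by (auto simp: t_def less_max_iff_disj)
  ultimately show ?thesis using root[of p "Suc (degree p)" "- t" t] by auto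
 qed
 fix p :: "'a poly" assume p: "odd (degree p)"
 then have "lead_coeff p ~= 0" by auto
 then consider "lead_coeff p > 0" | "lead_coeff (- p) > 0" using lead_coeff_minus[of p] by (metis neg_0_less_iff_less linorder_neqE)
 then show "EX x. poly p x = 0"
 proof cases
  case 2
  then show ?thesis using *[of "- p"] p by auto
 qed (use * p in blast)
qed

section \<open>Newton's identities and symmetric functions of the roots\<close>

definition subfield_of :: "'k::field_char_0 set => bool" where
 "subfield_of F \<longleftrightarrow> 1 \<in> F & (ALL x:F. ALL y:F. x + y \<in> F & x - y \<in> F & x * y \<in> F & x / y \<in> F)"

lemma subfield_ofD:
 assumes "subfield_of F"
 shows "1 \<in> F" "0 \<in> F" "x \<in> F ==> y \<in> F ==> x + y \<in> F" "x \<in> F ==> y \<in> F ==> x - y \<in> F"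
  "x \<in> F ==> y \<in> F ==> x * y \<in> F" "x \<in> F ==> y \<in> F ==> x / y \<in> F" "x \<in> F ==> - x \<in> F" "of_nat m \<in> F"
proof -
 note * = assms[unfolded subfield_of_def, THEN conjunct2, rule_format]
 show 1: "1 \<in> F" "x \<in> F ==> y \<in> F ==> x + y \<in> F" "x \<in> F ==> y \<in> F ==> x - y \<in> F"
  "x \<in> F ==> y \<in> F ==> x * y \<in> F" "x \<in> F ==> y \<in> F ==> x / y \<in> F" for x y
  using * assms by (auto simp: subfield_of_def)
 show 0: "0 \<in> F" using 1(3)[OF 1(1) 1(1)] by simp
 show "x \<in> F ==> - x \<in> F" using 1(3)[OF 0, of x] by simp
 show "of_nat m \<in> F" by (induction m) (use 0 1 in auto)
qed

lemma subfield_of_sum: "subfield_of F ==> (!!i. i \<in> I ==> t i \<in> F) ==> sum t I \<in> F"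
 by (induction I rule: infinite_finite_induct) (simp_all add: subfield_ofD)

text \<open>The reversed root polynomial, whose coefficients are the signed elementary symmetric
  functions. As a power series it turns Newton's identities into a logarithmic derivative.\<close>

definition elem_fps :: "'k::field_char_0 list => 'k fps" where
 "elem_fps zs = (\<Prod>z\<leftarrow>zs. 1 - fps_const z * fps_X)"

definition power_sums :: "'k::field_char_0 list => 'k fps" where
 "power_sums zs = Abs_fps (%m. \<Sum>z\<leftarrow>zs. z ^ Suc m)"

lemma newton_fps: "fps_deriv (elem_fps zs) = - elem_fps zs * power_sums zs"
proof (induction zs)
 case Nil
 then show ?case by (simp add: elem_fps_def power_sums_def fps_eq_iff)
next
 case (Cons z zs)
 define A where "A = Abs_fps (%m. z ^ Suc m)"
 define Y where "Y = 1 - fps_const z * fps_X"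
 have "A * Y = A - fps_const z * A * fps_X" by (simp add: Y_def algebra_simps)
 also have "\<dots> = fps_const z"
 proof (rule fps_ext)
  fix m show "(A - fps_const z * A * fps_X) $ m = fps_const z $ m" by (cases m) (simp_all add: A_def)
 qed
 finally have 1: "A * Y = fps_const z" .
 have 2: "power_sums (z # zs) = A + power_sums zs" by (simp add: A_def power_sums_def fps_eq_iff)
 have 3: "elem_fps (z # zs) = Y * elem_fps zs" by (simp add: elem_fps_def Y_def)
 have "fps_deriv Y = - fps_const z" by (simp add: Y_def)
 then have "fps_deriv (elem_fps (z # zs)) = - (A * Y) * elem_fps zs + Y * (- elem_fps zs * power_sums zs)"
  unfolding 1 3 by (simp add: Cons.IH)
 also have "\<dots> = - (Y * elem_fps zs) * (A + power_sums zs)" by (simp add: algebra_simps)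
 finally show ?case unfolding 2 3 .
qed

lemma newton_identity:
 "of_nat (Suc m) * elem_fps zs $ Suc m = - (\<Sum>i\<le>m. elem_fps zs $ i * (\<Sum>z\<leftarrow>zs. z ^ Suc (m - i)))"
proof -
 have "fps_deriv (elem_fps zs) $ m = - (\<Sum>i\<le>m. elem_fps zs $ i * power_sums zs $ (m - i))"
  unfolding newton_fps by (simp add: fps_mult_nth atLeast0AtMost sum_negf)
 then show ?thesis by (simp add: power_sums_def fps_deriv_nth)
qed

lemma elem_fps_0: "elem_fps zs $ 0 = 1"
 by (induction zs) (simp_all add: elem_fps_def)

text \<open>Newton's identities can be solved for the power sums and, dividing by
  \<open>Suc m\<close> in characteristic 0, for the elementary symmetric functions.\<close>

lemma power_sums_in_iff:
 assumes F: "subfield_of F"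
 shows "(ALL m. elem_fps zs $ m \<in> F) \<longleftrightarrow> (ALL m. (\<Sum>z\<leftarrow>zs. z ^ m) \<in> F)"
proof
 assume E: "ALL m. elem_fps zs $ m \<in> F"
 have "(\<Sum>z\<leftarrow>zs. z ^ Suc m) \<in> F" for m
 proof (induction m rule: less_induct)
  case (less m)
  have "(\<Sum>i\<le>m. elem_fps zs $ i * (\<Sum>z\<leftarrow>zs. z ^ Suc (m - i))) =
    (\<Sum>z\<leftarrow>zs. z ^ Suc m) + (\<Sum>i<m. elem_fps zs $ Suc i * (\<Sum>z\<leftarrow>zs. z ^ Suc (m - Suc i)))"
   by (subst lessThan_Suc_atMost[symmetric], subst sum.lessThan_Suc_shift) (simp add: elem_fps_0)
  then have "(\<Sum>z\<leftarrow>zs. z ^ Suc m) = - (of_nat (Suc m) * elem_fps zs $ Suc m) - (\<Sum>i<m. elem_fps zs $ Suc i * (\<Sum>z\<leftarrow>zs. z ^ Suc (m - Suc i)))"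
   unfolding newton_identity by simp
  moreover have "(\<Sum>i<m. elem_fps zs $ Suc i * (\<Sum>z\<leftarrow>zs. z ^ Suc (m - Suc i))) \<in> F"
   using less E by (intro subfield_of_sum[OF F] subfield_ofD(5)[OF F]) auto
  ultimately show ?case using E by (auto intro!: subfield_ofD(4,5,7,8)[OF F] simp del: of_nat_Suc)
 qed
 moreover have "(\<Sum>z\<leftarrow>zs. z ^ 0) = of_nat (length zs)" by (induction zs) simp_all
 ultimately show "ALL m. (\<Sum>z\<leftarrow>zs. z ^ m) \<in> F" using subfield_ofD(8)[OF F] by (metis not0_implies_Suc)
next
 assume P: "ALL m. (\<Sum>z\<leftarrow>zs. z ^ m) \<in> F"
 have "elem_fps zs $ m \<in> F" for m
 proof (induction m rule: less_induct)
  case (less m)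
  show ?case
  proof (cases m)
   case 0
   then show ?thesis by (simp add: elem_fps_0 subfield_ofD[OF F])
  next
   case (Suc k)
   have "elem_fps zs $ Suc k = - (\<Sum>i\<le>k. elem_fps zs $ i * (\<Sum>z\<leftarrow>zs. z ^ Suc (k - i))) / of_nat (Suc k)"
    using newton_identity[of k zs] by (simp add: field_simps del: of_nat_Suc)
   moreover have "(\<Sum>i\<le>k. elem_fps zs $ i * (\<Sum>z\<leftarrow>zs. z ^ Suc (k - i))) \<in> F"
    using less P Suc by (intro subfield_of_sum[OF F] subfield_ofD(5)[OF F]) (auto simp del: power_Suc)
   ultimately show ?thesis unfolding Suc by (auto intro!: subfield_ofD(6,7,8)[OF F] simp del: of_nat_Suc)
  qed
 qed
 then show "ALL m. elem_fps zs $ m \<in> F" by blast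
qed

definition root_poly :: "'k::field_char_0 list => 'k poly" where
 "root_poly zs = (\<Prod>z\<leftarrow>zs. [:- z, 1:])"

lemma root_poly_simps [simp]: "root_poly [] = 1" "root_poly (z # zs) = [:- z, 1:] * root_poly zs"
 by (simp_all add: root_poly_def)

lemma lead_root_poly: "lead_coeff (root_poly zs) = 1"
 by (induction zs) (simp_all add: lead_coeff_mult del: mult_pCons_left)

lemma degree_root_poly [simp]: "degree (root_poly zs) = length zs"
proof (induction zs)
 case (Cons z zs)
 have "root_poly zs ~= 0" using lead_root_poly[of zs] by auto
 then show ?case using Cons by (simp add: degree_mult_eq del: mult_pCons_left)
qed simp

lemma poly_root_poly_0: "poly (root_poly zs) x = 0 \<longleftrightarrow> x \<in> set zs"
 by (induction zs) auto

lemma elem_fps_coeff: "m <= length zs ==> elem_fps zs $ m = coeff (root_poly zs) (length zs - m)"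
 and elem_fps_high: "m > length zs ==> elem_fps zs $ m = 0"
proof -
 have "ALL m. elem_fps zs $ m = (if m <= length zs then coeff (root_poly zs) (length zs - m) else 0)"
 proof (induction zs)
  case Nil
  then show ?case by (auto simp: elem_fps_def)
 next
  case (Cons z zs)
  have 1: "elem_fps (z # zs) $ m = elem_fps zs $ m - (if m = 0 then 0 else z * elem_fps zs $ (m - 1))" for m
   by (simp add: elem_fps_def left_diff_distrib mult.assoc)
  have 2: "coeff (root_poly (z # zs)) k = (if k = 0 then 0 else coeff (root_poly zs) (k - 1)) - z * coeff (root_poly zs) k" for k
   by (cases k) auto
  have hi: "coeff (root_poly zs) (Suc (length zs)) = 0" by (rule coeff_eq_0) simp
  show ?case
  proof
   fix m show "elem_fps (z # zs) $ m = (if m <= length (z # zs) then coeff (root_poly (z # zs)) (length (z # zs) - m) else 0)"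
    unfolding 1 2 using Cons hi by (cases m) (auto simp: Suc_diff_le not_le le_Suc_eq)
  qed
 qed
 then show "m <= length zs ==> elem_fps zs $ m = coeff (root_poly zs) (length zs - m)" "m > length zs ==> elem_fps zs $ m = 0" by auto
qed

lemma root_poly_in_iff:
 assumes F: "subfield_of F"
 shows "(ALL m. coeff (root_poly zs) m \<in> F) \<longleftrightarrow> (ALL m. (\<Sum>z\<leftarrow>zs. z ^ m) \<in> F)"
proof -
 have "(ALL m. coeff (root_poly zs) m \<in> F) \<longleftrightarrow> (ALL m. elem_fps zs $ m \<in> F)"
 proof
  assume "ALL m. coeff (root_poly zs) m \<in> F"
  then show "ALL m. elem_fps zs $ m \<in> F" using elem_fps_coeff[of _ zs] elem_fps_high[of zs] subfield_ofD(2)[OF F]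
   by (metis not_le)
 next
  assume E: "ALL m. elem_fps zs $ m \<in> F"
  show "ALL m. coeff (root_poly zs) m \<in> F"
  proof
   fix m show "coeff (root_poly zs) m \<in> F"
   proof (cases "m <= length zs")
    case True
    then show ?thesis using E elem_fps_coeff[of "length zs - m" zs] by (metis diff_diff_cancel diff_le_self)
   next
    case False
    then show ?thesis using subfield_ofD(2)[OF F] by (simp add: coeff_eq_0)
   qed
  qed
 qed
 then show ?thesis using power_sums_in_iff[OF F] by simp
qed

fun pairs :: "'k list => ('k \<times> 'k) list" where
 "pairs [] = []"
| "pairs (z # zs) = map (Pair z) zs @ pairs zs"

lemma length_pairs: "2 * length (pairs zs) = length zs * (length zs - 1)"
proof (induction zs)
 case (Cons z zs)
 then show ?case by (cases "length zs") (simp_all add: algebra_simps)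
qed simp

lemma set_pairs: "(x, y) \<in> set (pairs zs) ==> x \<in> set zs & y \<in> set zs"
 by (induction zs) auto

lemma sum_pairs:
 fixes h :: "'k => 'k => 'k::field_char_0"
 assumes "!!x y. h x y = h y x"
 shows "(\<Sum>x\<leftarrow>zs. \<Sum>y\<leftarrow>zs. h x y) = 2 * (\<Sum>(x, y)\<leftarrow>pairs zs. h x y) + (\<Sum>x\<leftarrow>zs. h x x)"
proof (induction zs)
 case (Cons z zs)
 have "(\<Sum>x\<leftarrow>zs. h x z) = (\<Sum>x\<leftarrow>zs. h z x)" using assms[of _ z] by simp
 moreover have "(\<Sum>x\<leftarrow>zs. h x z + (\<Sum>y\<leftarrow>zs. h x y)) = (\<Sum>x\<leftarrow>zs. h x z) + (\<Sum>x\<leftarrow>zs. \<Sum>y\<leftarrow>zs. h x y)"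
  by (rule sum_list_addf)
 ultimately show ?case by (simp add: Cons comp_def)
qed simp

text \<open>The functions \<open>h\<close> of two variables whose products with all monomials have their sums over
 all pairs of roots in \<open>F\<close> are closed under multiplication by symmetric polynomials.\<close>

lemma pair_sums:
 assumes F: "subfield_of F" and P: "!!m. (\<Sum>z\<leftarrow>zs. z ^ m) \<in> F" and c: "c \<in> F"
 shows "(\<Sum>x\<leftarrow>zs. \<Sum>y\<leftarrow>zs. (x + y + c * (x * y)) ^ m) \<in> F" "(\<Sum>x\<leftarrow>zs. (x + x + c * (x * x)) ^ m) \<in> F"
proof -
 have "ALL a b. (\<Sum>x\<leftarrow>zs. \<Sum>y\<leftarrow>zs. (x + y + c * (x * y)) ^ m * (x ^ a * y ^ b)) \<in> F"
 proof (induction m)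
  case 0
  have "(\<Sum>x\<leftarrow>zs. \<Sum>y\<leftarrow>zs. x ^ a * y ^ b) = (\<Sum>x\<leftarrow>zs. x ^ a) * (\<Sum>y\<leftarrow>zs. y ^ b)" for a b
   by (simp add: sum_list_const_mult sum_list_mult_const)
  then show ?case using P by (auto intro!: subfield_ofD(5)[OF F])
 next
  case (Suc m)
  have "(x + y + c * (x * y)) ^ Suc m * (x ^ a * y ^ b) = (x + y + c * (x * y)) ^ m * (x ^ Suc a * y ^ b) +
   (x + y + c * (x * y)) ^ m * (x ^ a * y ^ Suc b) + c * ((x + y + c * (x * y)) ^ m * (x ^ Suc a * y ^ Suc b))" for x y :: 'a and a b
   by (simp add: algebra_simps)
  then show ?case using Suc by (simp only: sum_list_addf sum_list_const_mult) (intro allI subfield_ofD(3,5)[OF F] c; blast)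
 qed
 from this[rule_format, of 0 0] show "(\<Sum>x\<leftarrow>zs. \<Sum>y\<leftarrow>zs. (x + y + c * (x * y)) ^ m) \<in> F" by simp
 have "ALL a. (\<Sum>x\<leftarrow>zs. (x + x + c * (x * x)) ^ m * x ^ a) \<in> F"
 proof (induction m)
  case (Suc m)
  have "(x + x + c * (x * x)) ^ Suc m * x ^ a = (x + x + c * (x * x)) ^ m * x ^ Suc a + (x + x + c * (x * x)) ^ m * x ^ Suc a
    + c * ((x + x + c * (x * x)) ^ m * x ^ Suc (Suc a))" for x :: 'a and a by (simp add: algebra_simps)
  then show ?case using Suc by (simp only: sum_list_addf sum_list_const_mult) (intro allI subfield_ofD(3,5)[OF F] c; blast)
 qed (use P in auto)
 from this[rule_format, of 0] show "(\<Sum>x\<leftarrow>zs. (x + x + c * (x * x)) ^ m) \<in> F" by simp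
qed

text \<open>Sums over unordered pairs are half of what remains of the sums over all ordered pairs
  without the diagonal. Working with power sums takes the place of the fundamental theorem on
  symmetric polynomials.\<close>

lemma pairs_root_poly:
 assumes F: "subfield_of F" and P: "ALL m. coeff (root_poly zs) m \<in> F" and c: "c \<in> F"
 shows "ALL m. coeff (root_poly (map (%(x, y). x + y + c * (x * y)) (pairs zs))) m \<in> F"
 unfolding root_poly_in_iff[OF F]
proof
 fix m
 note P' = P[unfolded root_poly_in_iff[OF F], rule_format]
 let ?h = "%x y. (x + y + c * (x * y)) ^ m"
 have "(\<Sum>(x, y)\<leftarrow>pairs zs. ?h x y) = ((\<Sum>x\<leftarrow>zs. \<Sum>y\<leftarrow>zs. ?h x y) - (\<Sum>x\<leftarrow>zs. ?h x x)) / of_nat 2"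
  by (subst sum_pairs) (simp_all add: algebra_simps)
 also have "\<dots> \<in> F" by (intro subfield_ofD(4,6,8)[OF F] pair_sums[OF F P' c])
 finally have "(\<Sum>(x, y)\<leftarrow>pairs zs. ?h x y) \<in> F" .
 moreover have "(\<Sum>z\<leftarrow>map (%(x, y). x + y + c * (x * y)) (pairs zs). z ^ m) = (\<Sum>(x, y)\<leftarrow>pairs zs. ?h x y)"
  by (simp add: comp_def case_prod_unfold)
 ultimately show "(\<Sum>z\<leftarrow>map (%(x, y). x + y + c * (x * y)) (pairs zs). z ^ m) \<in> F" by argo
qed

lemma subfield_of_to_ac: "subfield_of (range (to_ac :: 'a::field_char_0 => 'a alg_closure))"
 unfolding subfield_of_def
 by (auto intro: range_eqI[where x = 1])
  (metis rangeI to_ac_add to_ac_diff to_ac_mult to_ac_divide)+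

lemma lift_poly:
 assumes "!!m. coeff P m \<in> range (to_ac :: 'a::field => _)" shows "EX p. map_poly (to_ac :: 'a => _) p = P"
proof
 have "of_ac (0 :: 'a alg_closure) = 0" by (rule of_ac_eqI) simp
 then show "map_poly to_ac (map_poly of_ac P) = P"
  by (intro poly_eqI) (simp add: coeff_map_poly to_ac_of_ac[OF assms])
qed

lemma ev_to_ac: "ev (to_ac r) p = to_ac (poly p r)"
 by (induction p) (simp_all add: ev_pCons)

section \<open>Complex roots by Laplace's argument\<close>

locale laplace =
 fixes \<i>' :: "'a::linordered_field alg_closure"
 assumes rc: "real_closed TYPE('a)" and i_sq: "\<i>' * \<i>' = -1"
begin

definition cx :: "'a => 'a => 'a alg_closure" where "cx a b = to_ac a + to_ac b * \<i>'"

definition CF :: "'a alg_closure set" where "CF = {cx a b | a b. True}"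

lemma cx_in [simp]: "cx a b \<in> CF"
 by (auto simp: CF_def)

lemma cx_add: "cx a b + cx c d = cx (a + c) (b + d)"
 and cx_diff: "cx a b - cx c d = cx (a - c) (b - d)"
 by (simp_all add: cx_def algebra_simps)

lemma cx_mult: "cx a b * cx c d = cx (a * c - b * d) (a * d + b * c)"
proof -
 have "cx a b * cx c d = to_ac a * to_ac c + to_ac b * to_ac d * (\<i>' * \<i>') + (to_ac a * to_ac d + to_ac b * to_ac c) * \<i>'"
  by (simp add: cx_def algebra_simps)
 then show ?thesis unfolding i_sq by (simp add: cx_def)
qed

lemma CF_closed: "x \<in> CF ==> y \<in> CF ==> x + y \<in> CF" "x \<in> CF ==> y \<in> CF ==> x - y \<in> CF" "x \<in> CF ==> y \<in> CF ==> x * y \<in> CF"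
 "to_ac a \<in> CF"
proof -
 show "to_ac a \<in> CF" using cx_in[of a 0] by (simp add: cx_def)
qed (auto simp: CF_def cx_add cx_diff cx_mult, blast+)

lemma i_notin: "cx a b = 0 ==> a = 0 & b = 0"
proof -
 assume 0: "cx a b = 0"
 have b: "b = 0"
 proof (rule ccontr)
  assume b: "b ~= 0"
  have "to_ac b * \<i>' = to_ac (- a)" using 0 by (simp add: cx_def eq_neg_iff_add_eq_0 add.commute)
  then have "(to_ac b * \<i>') * (to_ac b * \<i>') = to_ac (a * a)" by simp
  then have "to_ac (b * b) * (\<i>' * \<i>') = to_ac (a * a)" by (simp add: mult_ac)
  then have "to_ac (- (b * b)) = to_ac (a * a)" unfolding i_sq by simp
  then have "- (b * b) = a * a" by (simp only: to_ac_eq_iff)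
  moreover have "b * b > 0" using b by (metis not_square_less_zero linorder_neqE mult_eq_0_iff)
  ultimately show False using zero_le_square[of a] by linarith
 qed
 then show ?thesis using 0 by (simp add: cx_def)
qed

lemma sqrt_ex: "x >= 0 ==> EX y>=0. y * y = (x :: 'a)"
proof -
 assume x: "x >= 0"
 then have "x = 0 | (EX y. y * y = x)" using rc unfolding real_closed_def by (auto simp: le_less)
 then obtain y where "y * y = x" using mult_zero_left by blast
 then show ?thesis by (intro exI[of _ "\<bar>y\<bar>"]) simp
qed

text \<open>The classical formula: with \<open>r\<close> the modulus of \<open>a + b i\<close>, a
  square root has real part \<open>sqrt ((r + a) / 2)\<close> and an imaginary part of absolute
  value \<open>sqrt ((r - a) / 2)\<close> with the sign of \<open>b\<close>.\<close>

lemma CF_sqrt: assumes "x * x \<in> CF" shows "x \<in> CF"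
proof -
 obtain a b where ab: "x * x = cx a b" using assms by (auto simp: CF_def)
 obtain r where r: "r >= 0" "r * r = a * a + b * b" using sqrt_ex[of "a * a + b * b"] by auto
 have "\<bar>a\<bar> <= r"
 proof (rule ccontr)
  assume "~ \<bar>a\<bar> <= r"
  then have "r * r < \<bar>a\<bar> * \<bar>a\<bar>" using r(1) by (intro mult_strict_mono) auto
  then show False using r(2) zero_le_square[of b] by simp
 qed
 then have "(r + a) / 2 >= 0" "(r - a) / 2 >= 0" by auto
 then obtain u v where u: "u >= 0" "u * u = (r + a) / 2" and v: "v >= 0" "v * v = (r - a) / 2" using sqrt_ex by metis
 have "(2 * (u * v)) * (2 * (u * v)) = (2 * (u * u)) * (2 * (v * v))" by (simp add: mult_ac)
 also have "\<dots> = (r + a) * (r - a)"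
 proof -
  have "2 * (u * u) = r + a" "2 * (v * v) = r - a" using u v by simp_all
  then show ?thesis by (simp only:)
 qed
 also have "\<dots> = \<bar>b\<bar> * \<bar>b\<bar>" using r(2) by (simp add: algebra_simps)
 finally have sq: "(2 * (u * v)) * (2 * (u * v)) = \<bar>b\<bar> * \<bar>b\<bar>" .
 have uv: "2 * (u * v) = \<bar>b\<bar>"
 proof (rule power2_eq_imp_eq)
  show "(2 * (u * v))\<^sup>2 = \<bar>b\<bar>\<^sup>2" using sq by (simp only: power2_eq_square)
 qed (use u v in simp_all)
 define w where "w = (if b >= 0 then v else - v)"
 have "w * w = v * v" "2 * (u * w) = b" using uv by (auto simp: w_def)
 moreover have "(r + a) / 2 - (r - a) / 2 = a" by (simp add: field_simps)
 ultimately have "u * u - w * w = a" "u * w + w * u = b" using u v by simp_all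
 then have "cx u w * cx u w = x * x" unfolding ab cx_mult by simp
 then have "(x - cx u w) * (x + cx u w) = 0" by (simp add: algebra_simps)
 then have "x = cx u w | x = - cx u w" by (auto simp: eq_neg_iff_add_eq_0)
 moreover have "- cx u w = cx (- u) (- w)" by (simp add: cx_def)
 ultimately have "x = cx u w | x = cx (- u) (- w)" by metis
 then show ?thesis by auto
qed

lemma CF_quadratic: assumes "x + y \<in> CF" "x * y \<in> CF" shows "x \<in> CF"
proof -
 have "(x - y) * (x - y) = (x + y) * (x + y) - to_ac 4 * (x * y)" by (simp add: algebra_simps)
 also have "\<dots> \<in> CF" by (intro CF_closed assms)
 finally have "x - y \<in> CF" by (rule CF_sqrt)
 then have "((x + y) + (x - y)) * to_ac (1 / 2) \<in> CF" by (rule CF_closed(3)[OF CF_closed(1)[OF assms(1)] CF_closed(4)])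
 then show ?thesis by simp
qed

text \<open>Passing from the roots to the values \<open>x + y + c * x * y\<close> on pairs lowers
  the power of 2 in the degree by one. For each natural number \<open>c\<close> some pair has its
  value in \<open>CF\<close>; two different \<open>c\<close> share a pair, so \<open>x + y\<close>
  and \<open>x * y\<close> lie in \<open>CF\<close>, and the quadratic formula gives
  \<open>x\<close>.\<close>

lemma laplace_step:
 "odd q ==> length zs = 2 ^ v * q ==> (!!m. coeff (root_poly zs) m \<in> range to_ac) ==> EX z:set zs. z \<in> CF"
proof (induction v arbitrary: q zs)
 case 0
 obtain p where p: "map_poly to_ac p = root_poly zs" using lift_poly[OF 0(3)] by blast
 have "degree p = length zs" using arg_cong[OF p, of degree] by (simp add: degree_map_poly)
 then obtain x where "poly p x = 0" using rc 0 unfolding real_closed_def by auto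
 then have "poly (root_poly zs) (to_ac x) = 0" unfolding p[symmetric] ev_def[symmetric] ev_to_ac by simp
 then show ?case using CF_closed(4) poly_root_poly_0 by blast
next
 case (Suc v)
 let ?g = "%c. %(x, y). x + y + of_nat c * (x * y)"
 have len: "length (pairs zs) = 2 ^ v * (q * (2 ^ Suc v * q - 1))"
  using length_pairs[of zs] Suc.prems(2) by simp
 have q: "odd (q * (2 ^ Suc v * q - 1))" using Suc.prems(1) by (cases "q = 0") auto
 have "EX w:set (pairs zs). ?g c w \<in> CF" for c
 proof -
  have c: "of_nat c \<in> range (to_ac :: 'a => _)" by (metis rangeI to_ac_of_nat)
  have "coeff (root_poly (map (?g c) (pairs zs))) m \<in> range to_ac" for m
   using pairs_root_poly[OF subfield_of_to_ac _ c] Suc.prems(3) by blast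
  from Suc.IH[OF q _ this] show ?thesis using len by auto
 qed
 then have "ALL c. EX w. w \<in> set (pairs zs) & ?g c w \<in> CF" by blast
 from choice[OF this] obtain w where "ALL c. w c \<in> set (pairs zs) & ?g c (w c) \<in> CF" by (elim exE)
 then have w: "w c \<in> set (pairs zs)" "?g c (w c) \<in> CF" for c by blast+
 have "finite (range w)" by (rule finite_subset[of _ "set (pairs zs)"]) (use w in auto)
 then obtain c0 where "infinite {c. w c = w c0}" using pigeonhole_infinite[of UNIV w] by auto
 then obtain c where c: "w c = w c0" "c ~= c0"
  using finite_subset[of "{c. w c = w c0}" "{c0}"] by auto
 obtain x y where xy: "w c0 = (x, y)" by (cases "w c0")
 have 1: "x + y + of_nat c * (x * y) \<in> CF" "x + y + of_nat c0 * (x * y) \<in> CF" using w(2)[of c] w(2)[of c0] c xy by auto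
 have "(of_nat c - of_nat c0) * (x * y) = (x + y + of_nat c * (x * y)) - (x + y + of_nat c0 * (x * y))" by (simp add: algebra_simps)
 also have "\<dots> \<in> CF" by (intro CF_closed(2) 1)
 finally have "to_ac (1 / (of_nat c - of_nat c0)) * ((of_nat c - of_nat c0) * (x * y)) \<in> CF" by (rule CF_closed(3)[OF CF_closed(4)])
 moreover have "to_ac (1 / (of_nat c - of_nat c0)) * ((of_nat c - of_nat c0) * (x * y)) = x * y" using c(2) by simp
 ultimately have p: "x * y \<in> CF" by simp
 have "x + y = (x + y + of_nat c * (x * y)) - to_ac (of_nat c) * (x * y)" by simp
 also have "\<dots> \<in> CF" by (intro CF_closed 1 p)
 finally have "x \<in> CF" using CF_quadratic p by blast
 moreover have "x \<in> set zs" using w(1)[of c0] xy set_pairs by metis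
 ultimately show ?case by blast
qed

lemma two_power_odd: "d > 0 ==> EX v q. odd q & d = 2 ^ v * (q :: nat)"
proof (induction d rule: less_induct)
 case (less d)
 show ?case
 proof (cases "odd d")
  case True
  then show ?thesis by (intro exI[of _ 0] exI[of _ d]) simp
 next
  case False
  then obtain k where k: "d = 2 * k" by auto
  then obtain v q where "odd q" "k = 2 ^ v * q" using less.IH[of k] less.prems by auto
  then show ?thesis using k by (intro exI[of _ "Suc v"] exI[of _ q]) simp
 qed
qed

lemma complex_root: assumes "degree (p :: 'a poly) > 0" shows "EX a b. ev (cx a b) p = 0"
proof -
 define q where "q = smult (inverse (lead_coeff p)) p"
 have p0: "p ~= 0" using assms by auto
 have q: "lead_coeff q = 1" "degree q = degree p" "q ~= 0" using p0 by (auto simp: q_def)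
 let ?Q = "map_poly to_ac q"
 have Q: "?Q ~= 0" "lead_coeff ?Q = 1" "degree ?Q = degree p" using q by (auto simp: map_poly_eq_0_iff degree_map_poly coeff_map_poly)
 obtain A where A: "size A = degree ?Q" "?Q = smult (lead_coeff ?Q) (\<Prod>x\<in>#A. [:- x, 1:])"
  using alg_closed_imp_factorization[OF Q(1)] by blast
 obtain zs where zs: "mset zs = A" using ex_mset by blast
 have Qz: "?Q = root_poly zs" using A(2) unfolding Q(2) zs[symmetric] root_poly_def by (simp add: mset_map[symmetric] prod_mset_prod_list del: mset_map)
 obtain v k where vk: "odd k" "degree p = 2 ^ v * k" using two_power_odd[OF assms] by blast
 have "EX z:set zs. z \<in> CF"
 proof (rule laplace_step[OF vk(1)])
  show "length zs = 2 ^ v * k" using arg_cong[OF Qz, of degree] Q vk by simp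
  show "coeff (root_poly zs) m \<in> range to_ac" for m unfolding Qz[symmetric] by (simp add: coeff_map_poly)
 qed
 then obtain a b where "cx a b \<in> set zs" by (auto simp: CF_def)
 then have "ev (cx a b) q = 0" unfolding ev_def Qz by (simp add: poly_root_poly_0)
 then show ?thesis using p0 unfolding q_def ev_smult by auto
qed

text \<open>A complex root \<open>r + s i\<close> splits off a factor of constant sign on the
  interval: a linear one if \<open>s = 0\<close>, since \<open>r\<close> lies outside, and otherwise
  the quadratic \<open>(X - r)^2 + s^2\<close>.\<close>

lemma no_root_sgn:
 "a <= b ==> (!!x. a <= x ==> x <= b ==> poly p x ~= 0) ==> poly p a * poly p b > (0 :: 'a)"
proof (induction "degree p" arbitrary: p rule: less_induct)
 case less
 have p0: "p ~= 0" using less.prems(2)[of a] less.prems(1) by auto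
 have step: "poly p a * poly p b > 0" if pq: "p = d * q" and d: "degree d > 0" "poly d a * poly d b > 0" for d q
 proof -
  have "d ~= 0" "q ~= 0" using pq p0 by auto
  then have "degree q < degree p" using d unfolding pq by (simp add: degree_mult_eq)
  then have "poly q a * poly q b > 0" using less.hyps[of q] less.prems unfolding pq by auto
  then have "(poly d a * poly d b) * (poly q a * poly q b) > 0" using d by simp
  then show ?thesis unfolding pq by (simp add: mult_ac)
 qed
 show ?case
 proof (cases "degree p = 0")
  case True
  then obtain c where "p = [:c:]" using degree_eq_zeroE by blast
  then show ?thesis using p0 by (auto simp: zero_less_mult_iff)
 next
  case False
  then obtain r s where rs: "ev (cx r s) p = 0" using complex_root by blast
  show ?thesis
  proof (cases "s = 0")
   case True
   have "poly p r = 0" using rs True by (simp add: cx_def ev_to_ac)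
   then obtain q where q: "p = [:- r, 1:] * q" by (auto simp: poly_eq_0_iff_dvd)
   have "~ (a <= r & r <= b)" using \<open>poly p r = 0\<close> less.prems by auto
   then have "(a - r) * (b - r) > 0" using less.prems(1) by (auto simp: zero_less_mult_iff)
   then show ?thesis by (intro step[OF q]) auto
  next
   case False
   define Q where "Q = [:r * r + s * s, - (r + r), 1:]"
   have evQ: "ev (cx r s) Q = 0"
   proof -
    have "ev (cx r s) Q = cx (r * r + s * s) 0 + cx r s * (cx (- (r + r)) 0 + cx r s)"
     by (simp add: Q_def ev_pCons cx_def)
    also have "\<dots> = cx 0 0" by (simp add: cx_add cx_mult algebra_simps)
    finally show ?thesis by (simp add: cx_def)
   qed
   have Q0: "Q ~= 0" by (simp add: Q_def)
   define c0 where "c0 = coeff (p mod Q) 0"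
   define c1 where "c1 = coeff (p mod Q) 1"
   have m: "p mod Q = [:c0, c1:]"
   proof (rule poly_eqI)
    fix i show "coeff (p mod Q) i = coeff [:c0, c1:] i"
    proof (cases "i < 2")
     case True
     then show ?thesis by (cases i) (auto simp: c0_def c1_def less_Suc_eq numeral_2_eq_2)
    next
     case False
     have "p mod Q = 0 | degree (p mod Q) < 2" using degree_mod_less[OF Q0, of p] by (simp add: Q_def numeral_2_eq_2)
     then have "coeff (p mod Q) i = 0" using False by (auto intro: coeff_eq_0)
     then show ?thesis using False by (auto simp: coeff_pCons split: nat.splits)
    qed
   qed
   have "p = p div Q * Q + p mod Q" by simp
   then have "ev (cx r s) p = ev (cx r s) (p div Q) * ev (cx r s) Q + ev (cx r s) (p mod Q)" by (metis ev_add ev_mult)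
   then have "ev (cx r s) [:c0, c1:] = 0" using rs evQ m by simp
   then have "cx (c0 + r * c1) (s * c1) = 0" by (simp add: ev_pCons cx_def algebra_simps)
   then have "c0 + r * c1 = 0" "s * c1 = 0" using i_notin by blast+
   then have "p mod Q = 0" using m False by simp
   then have pq: "p = Q * (p div Q)" by (metis add.right_neutral div_mult_mod_eq mult.commute)
   have "poly Q x > 0" for x
   proof -
    have "poly Q x = (x - r) * (x - r) + s * s" by (simp add: Q_def algebra_simps)
    moreover have "s * s > 0" using False by (metis not_square_less_zero linorder_neqE mult_eq_0_iff)
    ultimately show ?thesis by (metis add_nonneg_pos zero_le_square)
   qed
   then show ?thesis by (intro step[OF pq]) (auto simp: Q_def)
  qed
 qed
qed

end

lemma real_closed_imp_ivt:
 assumes "real_closed TYPE('a::linordered_field)" shows "ivt TYPE('a)"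
proof -
 obtain i :: "'a alg_closure" where "i ^ 2 = - 1" using nth_root_exists[of 2 "- 1"] by auto
 then interpret laplace i using assms by unfold_locales (simp_all add: power2_eq_square)
 show ?thesis unfolding ivt_def ivt_below_def
 proof (intro allI impI)
  fix p :: "'a poly" and a b assume ab: "a < b" "poly p a < 0" "0 < poly p b"
  then obtain x where x: "a <= x" "x <= b" "poly p x = 0" using no_root_sgn[of a b p] by (force simp: mult_less_0_iff zero_less_mult_iff)
  then show "EX x. a < x & x < b & poly p x = 0" using ab by (metis less_irrefl order.order_iff_strict)
 qed
qed

section \<open>Failure of the intermediate value property\<close>

lemma coeff_pcompose_scale: "coeff (pcompose p [:0, c:]) i = c ^ i * coeff (p :: 'a::comm_ring_1 poly) i"
proof (induction p arbitrary: i)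
 case (pCons a p)
 show ?case by (cases i) (simp_all add: pcompose_pCons pCons.IH)
qed simp

lemma poly_altdef_le: "degree p <= n ==> poly p x = (\<Sum>i\<le>n. coeff p i * (x :: 'a::comm_ring_1) ^ i)"
 unfolding poly_altdef by (intro sum.mono_neutral_left) (auto simp: coeff_eq_0)

lemma poly_abs_le:
 fixes p :: "'a::linordered_field poly"
 assumes "degree p <= n" "!!i. \<bar>coeff p i\<bar> <= B" "\<bar>x\<bar> <= r" "1 <= r"
 shows "\<bar>poly p x\<bar> <= of_nat (Suc n) * (B * r ^ n)"
proof -
 have "\<bar>poly p x\<bar> <= (\<Sum>i\<le>n. \<bar>coeff p i * x ^ i\<bar>)" unfolding poly_altdef_le[OF assms(1)] by (rule sum_abs)
 also have "\<dots> <= (\<Sum>i\<le>n. B * r ^ n)"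
 proof (rule sum_mono)
  fix i assume "i \<in> {..n}"
  have "\<bar>x\<bar> ^ i <= r ^ i" using assms(3) by (intro power_mono) auto
  also have "\<dots> <= r ^ n" using \<open>i \<in> {..n}\<close> assms(4) by (intro power_increasing) auto
  finally show "\<bar>coeff p i * x ^ i\<bar> <= B * r ^ n"
   unfolding abs_mult power_abs using assms(2)[of i] abs_ge_zero[of "coeff p i"] zero_le_power[OF abs_ge_zero[of x], of i] by (intro mult_mono) linarith+
 qed
 finally show ?thesis by simp
qed

text \<open>A Markov-type inequality; \<open>p(t) - 2^(e+1) p(t/2)\<close> has lower degree.\<close>

lemma coeff_bound:
 "EX C::nat. ALL (p :: 'a::linordered_field poly) M. degree p <= e --> (ALL t. 0 <= t --> t <= 1 --> \<bar>poly p t\<bar> <= M) -->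
   (ALL i. \<bar>coeff p i\<bar> <= of_nat C * M)"
proof (induction e)
 case 0
 have "\<bar>coeff p i\<bar> <= of_nat 1 * M" if p: "degree p <= 0" "ALL t. 0 <= t --> t <= 1 --> \<bar>poly p t\<bar> <= M" for p :: "'a poly" and M i
 proof -
  obtain c where c: "p = [:c:]" using p(1) degree_eq_zeroE[of p] by auto
  have "\<bar>c\<bar> <= M" using p(2)[rule_format, of 0] c by simp
  then show ?thesis unfolding c using abs_ge_zero[of c] by (cases i) auto
 qed
 then show ?case by blast
next
 case (Suc e)
 then obtain C :: nat where C: "!!(p :: 'a poly) M i. degree p <= e ==> (!!t. 0 <= t ==> t <= 1 ==> \<bar>poly p t\<bar> <= M) ==> \<bar>coeff p i\<bar> <= of_nat C * M" by blast
 define D where "D = C * (1 + 2 ^ Suc e)"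
 have "\<bar>coeff p i\<bar> <= of_nat (1 + Suc e * D + D) * M"
  if p: "degree p <= Suc e" "ALL t. 0 <= t --> t <= 1 --> \<bar>poly p t\<bar> <= M" for p :: "'a poly" and M i
 proof -
  have M: "0 <= M" using p(2)[rule_format, of 0] abs_ge_zero[of "poly p 0"] by linarith
  \<comment> \<open>Its \<open>i\<close>-th coefficient is that of \<open>p\<close> times
    \<open>1 - 2^(e + 1 - i)\<close>: the top one disappears and the lower ones do not shrink. The
    top coefficient of \<open>p\<close> is then bounded through the value at 1.\<close>
  define r where "r = p - smult (2 ^ Suc e) (pcompose p [:0, 1/2:])"
  have cr: "coeff r i = (1 - 2 ^ Suc e * (1/2) ^ i) * coeff p i" for i
   by (simp add: r_def coeff_pcompose_scale left_diff_distrib)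
  have dr: "degree r <= e"
  proof (rule degree_le, intro allI impI)
   fix i assume "e < i"
   then show "coeff r i = 0" unfolding cr using p(1) by (cases "i = Suc e") (auto simp: coeff_eq_0 power_divide)
  qed
  have "\<bar>poly r t\<bar> <= (1 + 2 ^ Suc e) * M" if t: "0 <= t" "t <= 1" for t
  proof -
   have "poly r t = poly p t - 2 ^ Suc e * poly p (t / 2)" by (simp add: r_def poly_pcompose)
   then have "\<bar>poly r t\<bar> <= \<bar>poly p t\<bar> + 2 ^ Suc e * \<bar>poly p (t / 2)\<bar>"
    using abs_triangle_ineq4[of "poly p t" "2 ^ Suc e * poly p (t / 2)"] by (simp add: abs_mult)
   also have "\<dots> <= M + 2 ^ Suc e * M" using p(2) t by (intro add_mono mult_left_mono) auto
   finally show ?thesis by (simp add: algebra_simps)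
  qed
  from C[OF dr this] have rD: "\<bar>coeff r i\<bar> <= of_nat D * M" for i
   by (simp only: D_def of_nat_mult of_nat_add of_nat_1 of_nat_power of_nat_numeral mult.assoc)
  have low: "\<bar>coeff p i\<bar> <= of_nat D * M" if i: "i <= e" for i
  proof -
   have e: "(2 :: 'a) ^ Suc e * (1/2) ^ i = 2 ^ (Suc e - i)" using i by (simp add: power_divide power_diff)
   have "(2 :: 'a) ^ 1 <= 2 ^ (Suc e - i)" using i by (intro power_increasing) auto
   then have "1 <= \<bar>1 - (2 :: 'a) ^ Suc e * (1/2) ^ i\<bar>" unfolding e by simp
   then have "1 * \<bar>coeff p i\<bar> <= \<bar>coeff r i\<bar>" unfolding cr abs_mult by (intro mult_right_mono) auto
   then show ?thesis using rD[of i] by simp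
  qed
  have DM: "0 <= of_nat D * M" using M by simp
  have top: "\<bar>coeff p (Suc e)\<bar> <= M + of_nat (Suc e) * (of_nat D * M)"
  proof -
   have "coeff p (Suc e) = poly p 1 - (\<Sum>i\<le>e. coeff p i)" unfolding poly_altdef_le[OF p(1)] by simp
   then have "\<bar>coeff p (Suc e)\<bar> <= \<bar>poly p 1\<bar> + \<bar>\<Sum>i\<le>e. coeff p i\<bar>" by simp
   also have "\<bar>\<Sum>i\<le>e. coeff p i\<bar> <= (\<Sum>i\<le>e. \<bar>coeff p i\<bar>)" by (rule sum_abs)
   also have "\<dots> <= (\<Sum>i\<le>e. of_nat D * M)" using low by (intro sum_mono) auto
   also have "\<bar>poly p 1\<bar> <= M" using p(2) by simp
   finally show ?thesis by simp
  qed
  have eq: "of_nat (1 + Suc e * D + D) * M = M + of_nat (Suc e) * (of_nat D * M) + of_nat D * M" by (simp add: algebra_simps)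
  have SM: "0 <= of_nat (Suc e) * (of_nat D * M)" by (rule mult_nonneg_nonneg[OF of_nat_0_le_iff DM])
  consider "i <= e" | "i = Suc e" | "i > Suc e" by linarith
  then show ?thesis
  proof cases
   case 1
   then show ?thesis unfolding eq using low[of i] M DM SM by linarith
  next
   case 2
   then show ?thesis unfolding eq unfolding 2 using top M DM SM by linarith
  next
   case 3
   then have "coeff p i = 0" using p(1) by (intro coeff_eq_0) auto
   then show ?thesis unfolding eq using M DM SM by linarith
  qed
 qed
 then show ?case by blast
qed

lemma sgn_dominant: "\<bar>s\<bar> < \<bar>c\<bar> ==> sgn (c + s) = sgn (c :: 'a::linordered_field)"
 by (auto simp: sgn_if abs_if split: if_splits)

text \<open>Near a cut of the positive elements that is closed under doubling, all crossing points of
 the monomials are far away, so a single monomial dominates.\<close>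

lemma dominance:
 fixes g :: "'a::linordered_field poly"
 assumes roots: "!!m x. 0 < m ==> 0 < x ==> EX y>0. y ^ m = (x :: 'a)"
  and A: "!!d d'. d \<in> A ==> 0 < d' ==> d' <= d ==> d' \<in> A" "!!d. d \<in> A ==> 0 < d" "!!d. d \<in> A ==> 2 * d \<in> A"
  and d0: "d0 \<in> A" and b: "b ~: A" "0 < b" and g: "g ~= 0"
 shows "EX y0 y1. y0 \<in> A & y1 ~: A & 0 < y1 & y1 <= b & sgn (poly g y0) = sgn (poly g y1)"
proof -
 define n where "n = degree g"
 define c where "c = coeff g"
 \<comment> \<open>As \<open>2^K > n\<close>, a term exceeding each of the others by the factor
   \<open>2^K\<close> outweighs their sum.\<close>
 define K where "K = Suc n"
 have A2: "2 ^ k * d \<in> A" if "d \<in> A" for k d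
 proof (induction k)
  case (Suc k)
  then show ?case using A(3)[OF Suc] by (simp add: mult.assoc)
 qed (use that in simp)
 have A3: "d / 2 ^ k ~: A" if "d ~: A" for k d using A2[of "d / 2 ^ k" k] that by auto
 have A4: "d < e" if "d \<in> A" "e ~: A" "0 < e" for d e using A(1)[OF that(1,3)] that(2) by (meson not_le)
 define I where "I = {i. i <= n & c i ~= 0}"
 have I: "finite I" "n \<in> I" using g by (auto simp: I_def c_def n_def)
 \<comment> \<open>The crossing point of the monomials of degrees \<open>i < j\<close>, where their
   absolute values coincide.\<close>
 define Y where "Y i j = (SOME y. 0 < y & y ^ (j - i) = \<bar>c i\<bar> / \<bar>c j\<bar>)" for i j
 have Y: "0 < Y i j" "Y i j ^ (j - i) = \<bar>c i\<bar> / \<bar>c j\<bar>" if "i \<in> I" "j \<in> I" "i < j" for i j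
 proof -
  have "EX y. 0 < y & y ^ (j - i) = \<bar>c i\<bar> / \<bar>c j\<bar>" using roots[of "j - i" "\<bar>c i\<bar> / \<bar>c j\<bar>"] that by (auto simp: I_def)
  from someI_ex[OF this] show "0 < Y i j" "Y i j ^ (j - i) = \<bar>c i\<bar> / \<bar>c j\<bar>" unfolding Y_def by blast+
 qed
 define PA where "PA = {(i, j). i \<in> I & j \<in> I & i < j & Y i j \<in> A}"
 define PB where "PB = {(i, j). i \<in> I & j \<in> I & i < j & Y i j ~: A}"
 have fin: "finite PA" "finite PB"
  by (rule finite_subset[of _ "I \<times> I"]; use I in \<open>auto simp: PA_def PB_def\<close>)+
 define SA where "SA = insert d0 ((%(i, j). 2 ^ K * Y i j) ` PA)"
 define SB where "SB = insert b ((%(i, j). Y i j / 2 ^ K) ` PB)"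
 \<comment> \<open>\<open>y0\<close> in the cut and \<open>y1\<close> outside it keep a factor
   \<open>2^K\<close> from every crossing point and have none between them, so the same monomial
   dominates at both.\<close>
 define y0 where "y0 = Max SA"
 define y1 where "y1 = Min SB"
 have SA: "finite SA" "SA ~= {}" "SA \<subseteq> A" using fin A2 d0 by (auto simp: SA_def PA_def)
 have SB: "finite SB" "SB ~= {}" "SB \<inter> A = {}" "!!x. x \<in> SB ==> 0 < x"
  using fin b Y A3 by (auto simp: SB_def PB_def)
 have y0: "y0 \<in> A" "0 < y0" using Max_in[OF SA(1,2)] SA(3) A(2) by (auto simp: y0_def)
 have y1: "y1 ~: A" "0 < y1" "y1 <= b"
  using Min_in[OF SB(1,2)] SB(3,4) Min_le[OF SB(1), of b] by (auto simp: y1_def SB_def)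
 have near: "(Y i j \<in> A --> 2 ^ K * Y i j <= y) & (Y i j ~: A --> y <= Y i j / 2 ^ K)"
  if ij: "i \<in> I" "j \<in> I" "i < j" and y: "y = y0 | y = y1" for i j y
 proof (cases "Y i j \<in> A")
  case True
  then have "2 ^ K * Y i j \<in> SA" using ij by (force simp: SA_def PA_def)
  then have "2 ^ K * Y i j <= y0" unfolding y0_def using SA(1) by simp
  moreover have "y0 < y1" by (rule A4[OF y0(1) y1(1,2)])
  ultimately show ?thesis using True y by auto
 next
  case False
  then have "Y i j / 2 ^ K \<in> SB" using ij by (force simp: SB_def PB_def)
  then have "y1 <= Y i j / 2 ^ K" unfolding y1_def using SB(1) by simp
  moreover have "y0 < y1" by (rule A4[OF y0(1) y1(1,2)])
  ultimately show ?thesis using False y by auto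
 qed
 define T where "T y i = \<bar>c i\<bar> * y ^ i" for y i
 have Tpos: "0 < T y i" if "i \<in> I" "0 < y" for y i using that by (simp add: T_def I_def)
 have pw: "2 ^ K <= ((2 :: 'a) ^ K) ^ m" if "0 < m" for m using that by (intro self_le_power) auto
 have key: "(Y i j \<in> A --> 2 ^ K * T y i <= T y j) & (Y i j ~: A --> 2 ^ K * T y j <= T y i)"
  if ij: "i \<in> I" "j \<in> I" "i < j" and y: "y = y0 | y = y1" for i j y
 proof -
  have yp: "0 < y" using y y0 y1 by auto
  have yj: "y ^ j = y ^ i * y ^ (j - i)" using ij by (simp flip: power_add)
  have cj: "0 < \<bar>c j\<bar>" using ij by (simp add: I_def)
  have "2 ^ K * T y i <= T y j" if a: "Y i j \<in> A"
  proof -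
   have "(2 ^ K * Y i j) ^ (j - i) <= y ^ (j - i)" using near[OF ij y] a Y[OF ij] by (intro power_mono) auto
   then have "(2 ^ K) ^ (j - i) * (\<bar>c i\<bar> / \<bar>c j\<bar>) <= y ^ (j - i)" by (simp add: power_mult_distrib Y[OF ij])
   moreover have "2 ^ K * (\<bar>c i\<bar> / \<bar>c j\<bar>) <= (2 ^ K) ^ (j - i) * (\<bar>c i\<bar> / \<bar>c j\<bar>)" using pw[of "j - i"] ij by (intro mult_right_mono) auto
   ultimately have "2 ^ K * (\<bar>c i\<bar> / \<bar>c j\<bar>) <= y ^ (j - i)" by (rule order_trans[rotated])
   then have "2 ^ K * \<bar>c i\<bar> <= \<bar>c j\<bar> * y ^ (j - i)" using cj by (simp add: field_simps)
   then have "(2 ^ K * \<bar>c i\<bar>) * y ^ i <= (\<bar>c j\<bar> * y ^ (j - i)) * y ^ i" using yp by (intro mult_right_mono) auto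
   then show ?thesis unfolding T_def yj by (simp add: mult_ac)
  qed
  moreover have "2 ^ K * T y j <= T y i" if a: "Y i j ~: A"
  proof -
   have "2 ^ K * y <= Y i j" using near[OF ij y] a by (simp add: field_simps)
   then have "(2 ^ K * y) ^ (j - i) <= Y i j ^ (j - i)" using yp by (intro power_mono) auto
   then have "(2 ^ K) ^ (j - i) * y ^ (j - i) <= \<bar>c i\<bar> / \<bar>c j\<bar>" by (simp add: power_mult_distrib Y[OF ij])
   moreover have "2 ^ K * y ^ (j - i) <= (2 ^ K) ^ (j - i) * y ^ (j - i)" using pw[of "j - i"] ij yp by (intro mult_right_mono) auto
   ultimately have "2 ^ K * y ^ (j - i) <= \<bar>c i\<bar> / \<bar>c j\<bar>" by (rule order_trans[rotated])
   then have "2 ^ K * y ^ (j - i) * \<bar>c j\<bar> <= \<bar>c i\<bar>" using cj by (simp add: field_simps)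
   then have "(2 ^ K * y ^ (j - i) * \<bar>c j\<bar>) * y ^ i <= \<bar>c i\<bar> * y ^ i" using yp by (intro mult_right_mono) auto
   then show ?thesis unfolding T_def yj by (simp add: mult_ac)
  qed
  ultimately show ?thesis by blast
 qed
 have "Max (T y0 ` I) \<in> T y0 ` I" using I by (intro Max_in) auto
 then obtain k where k: "k \<in> I" "T y0 k = Max (T y0 ` I)" by auto
 have kmax: "T y0 j <= T y0 k" if "j \<in> I" for j unfolding k(2) using I that by (intro Max_ge) auto
 have K2: "x < 2 ^ K * x" if "0 < x" for x :: 'a
 proof -
  have "(2::'a) ^ 1 <= 2 ^ K" by (intro power_increasing) (auto simp: K_def)
  then have "2 * x <= 2 ^ K * x" using that by (intro mult_right_mono) auto
  then show ?thesis using that by linarith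
 qed
 have dom: "2 ^ K * T y j <= T y k" if j: "j \<in> I" "j ~= k" and y: "y = y0 | y = y1" for j y
 proof (cases "k < j")
  case True
  have "~ 2 ^ K * T y0 k <= T y0 j" using K2[OF Tpos[OF k(1) y0(2)]] kmax[OF j(1)] by linarith
  then have "Y k j ~: A" using key[OF k(1) j(1) True, of y0] by blast
  then show ?thesis using key[OF k(1) j(1) True y] by blast
 next
  case False
  then have lt: "j < k" using j by simp
  have "~ 2 ^ K * T y0 k <= T y0 j" using K2[OF Tpos[OF k(1) y0(2)]] kmax[OF j(1)] by linarith
  then have "Y j k \<in> A" using key[OF j(1) k(1) lt, of y0] by blast
  then show ?thesis using key[OF j(1) k(1) lt y] by blast
 qed
 have "sgn (poly g y) = sgn (c k)" if y: "y = y0 | y = y1" for y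
 proof -
  have yp: "0 < y" using y y0 y1 by auto
  have kn: "k \<in> {..n}" using k by (simp add: I_def)
  define s where "s = (\<Sum>j\<in>{..n} - {k}. c j * y ^ j)"
  have "poly g y = (\<Sum>i\<le>n. c i * y ^ i)" unfolding c_def by (rule poly_altdef_le) (simp add: n_def)
  then have gy: "poly g y = c k * y ^ k + s" unfolding s_def by (subst (asm) sum.remove[OF _ kn]) auto
  have "\<bar>s\<bar> <= (\<Sum>j\<in>{..n} - {k}. \<bar>c j * y ^ j\<bar>)" unfolding s_def by (rule sum_abs)
  also have "\<dots> <= (\<Sum>j\<in>{..n} - {k}. T y k / 2 ^ K)"
  proof (rule sum_mono)
   fix j assume j: "j \<in> {..n} - {k}"
   have "\<bar>c j * y ^ j\<bar> = T y j" using yp by (simp add: T_def abs_mult)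
   also have "\<dots> <= T y k / 2 ^ K"
   proof (cases "c j = 0")
    case True
    then show ?thesis using Tpos[OF k(1) yp] by (simp add: T_def)
   next
    case False
    then show ?thesis using dom[of j y] j y by (simp add: field_simps I_def)
   qed
   finally show "\<bar>c j * y ^ j\<bar> <= T y k / 2 ^ K" .
  qed
  also have "\<dots> = of_nat n * (T y k / 2 ^ K)" using kn by simp
  also have "\<dots> < T y k"
  proof -
   have "n < 2 ^ K" using less_exp[of K] by (simp add: K_def)
   then have "(of_nat n :: 'a) < of_nat (2 ^ K)" by (simp only: of_nat_less_iff)
   then have "of_nat n < (2 :: 'a) ^ K" by simp
   then have "of_nat n * T y k < 2 ^ K * T y k" using Tpos[OF k(1) yp] by (rule mult_strict_right_mono)
   then show ?thesis by (simp add: field_simps)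
  qed
  also have "T y k = \<bar>c k * y ^ k\<bar>" using yp by (simp add: T_def abs_mult)
  finally have "sgn (poly g y) = sgn (c k * y ^ k)" unfolding gy by (rule sgn_dominant)
  then show ?thesis using yp by (simp add: sgn_mult)
 qed
 then have "sgn (poly g y0) = sgn (poly g y1)" by metis
 then show ?thesis using y0 y1 by blast
qed

section \<open>Narrow brackets around a sign change\<close>

definition crosses :: "'a::linordered_field poly => 'a => 'a => bool" where
 "crosses f a b \<longleftrightarrow> a < b & poly f a < 0 & 0 < poly f b & (ALL x. a <= x --> x <= b --> poly f x ~= 0) &
   (ALL x y. a <= x --> x < y --> y <= b --> poly f x < poly f y)"

lemma crosses_reflect: "crosses f a b ==> crosses (- pcompose f [:0, -1:]) (- b) (- a)"
proof -
 assume c: "crosses f a b"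
 have r: "poly (- pcompose f [:0, -1:]) x = - poly f (- x)" for x by (simp add: poly_pcompose)
 have nz: "poly f x ~= 0" if "a <= x" "x <= b" for x using c that unfolding crosses_def by blast
 have mono: "poly f x < poly f y" if "a <= x" "x < y" "y <= b" for x y using c that unfolding crosses_def by blast
 show ?thesis unfolding crosses_def r
 proof (intro conjI allI impI)
  fix x assume "- b <= x" "x <= - a"
  then show "- poly f (- x) ~= 0" using nz[of "- x"] by simp
 next
  fix x y assume "- b <= x" "x < y" "y <= - a"
  then show "- poly f (- x) < - poly f (- y)" using mono[of "- y" "- x"] by simp
 qed (use c in \<open>auto simp: crosses_def\<close>)
qed

text \<open>If the distances \<open>d\<close> from \<open>a\<close> with
  \<open>f (a + d) < 0\<close> were closed under doubling, \<open>dominance\<close> would give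
  \<open>f\<close> the same sign on both sides of the cut. So some \<open>d\<close> is in the cut
  while \<open>2 * d\<close> is not, and the bracket between them is no longer than its distance
  from \<open>a\<close>.\<close>

lemma shrink_left:
 fixes f :: "'a::linordered_field poly"
 assumes roots: "!!m x. 0 < m ==> 0 < x ==> EX y>0. y ^ m = (x :: 'a)" and c: "crosses f a b"
 shows "EX x y. a < x & x < y & y <= b & poly f x < 0 & 0 < poly f y & y - x <= x - a"
proof -
 have ab: "a < b" "poly f a < 0" "0 < poly f b" and nz: "!!x. a <= x ==> x <= b ==> poly f x ~= 0"
  and mono: "!!x y. a <= x ==> x < y ==> y <= b ==> poly f x < poly f y" using c unfolding crosses_def by blast+
 define A where "A = {d. 0 < d & d < b - a & poly f (a + d) < 0}"
 define g where "g = pcompose f [:a, 1:]"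
 have gd: "poly g d = poly f (a + d)" for d by (simp add: g_def poly_pcompose)
 have "EX d:A. 2 * d ~: A"
 proof (rule ccontr)
  assume no: "~ ?thesis"
  have down: "d' \<in> A" if "d \<in> A" "0 < d'" "d' <= d" for d d'
   using that mono[of "a + d'" "a + d"] by (cases "d' = d") (auto simp: A_def)
  obtain q where "f - [:poly f a:] = [:- a, 1:] * q" using poly_eq_0_iff_dvd[of "f - [:poly f a:]" a] by auto
  then have "poly (f - [:poly f a:]) x = poly ([:- a, 1:] * q) x" for x by simp
  then have q: "poly f x - poly f a = (x - a) * poly q x" for x
   by (simp del: mult_pCons_left)
  obtain B where B: "B > 0" "!!x. a <= x ==> x <= b ==> \<bar>poly q x\<bar> <= B" using poly_bounded[of a b q] by blast
  \<comment> \<open>A Lipschitz bound for \<open>f\<close> at \<open>a\<close> shows that the cut is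
    not empty.\<close>
  define d0 where "d0 = min ((b - a) / 2) (- poly f a / (2 * B))"
  have d0p: "0 < d0" "d0 < b - a" using ab B(1) divide_neg_pos[of "poly f a" "2 * B"] by (auto simp: d0_def min_less_iff_disj)
  have "d0 * B <= - poly f a / 2"
  proof -
   have "d0 * B <= - poly f a / (2 * B) * B" using B(1) by (intro mult_right_mono) (auto simp: d0_def)
   then show ?thesis using B(1) by simp
  qed
  moreover have "d0 * poly q (a + d0) <= d0 * B" using B(2)[of "a + d0"] d0p by (intro mult_left_mono) auto
  ultimately have "poly f (a + d0) < 0" using q[of "a + d0"] ab(2) by simp
  then have "d0 \<in> A" using d0p by (auto simp: A_def)
  have g0: "g ~= 0" using gd[of 0] ab(2) by auto
  have "EX y0 y1. y0 \<in> A & y1 ~: A & 0 < y1 & y1 <= b - a & sgn (poly g y0) = sgn (poly g y1)"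
   by (rule dominance[OF roots down _ _ \<open>d0 \<in> A\<close> _ _ g0]) (use no ab in \<open>auto simp: A_def\<close>)
  then obtain y0 y1 where y: "y0 \<in> A" "y1 ~: A" "0 < y1" "y1 <= b - a" "sgn (poly f (a + y0)) = sgn (poly f (a + y1))"
   unfolding gd by blast
  then have "poly f (a + y1) < 0" by (auto simp: A_def sgn_if split: if_splits)
  moreover have "y1 = b - a | ~ poly f (a + y1) < 0" using y by (auto simp: A_def)
  ultimately show False using ab(3) by auto
 qed
 then obtain d where d: "d \<in> A" "2 * d ~: A" by blast
 define y where "y = min (a + 2 * d) b"
 have d': "0 < d" "d < b - a" "poly f (a + d) < 0" using d by (auto simp: A_def)
 have "0 < poly f y"
 proof (cases "a + 2 * d < b")
  case True
  then have "~ poly f (a + 2 * d) < 0" using d d' by (auto simp: A_def)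
  then show ?thesis using True nz[of "a + 2 * d"] d' by (simp add: y_def)
 next
  case False
  then show ?thesis using ab by (simp add: y_def min_def not_less)
 qed
 then show ?thesis using d' by (intro exI[of _ "a + d"] exI[of _ y]) (auto simp: y_def)
qed

lemma bisect:
 fixes f :: "'a::linordered_field poly"
 assumes "crosses f a b" "a <= x" "x < y" "y <= b" "poly f x < 0" "0 < poly f y"
 shows "EX x'. x <= x' & x' + (y - x) / 2 ^ k <= y & poly f x' < 0 & 0 < poly f (x' + (y - x) / 2 ^ k)"
proof (induction k)
 case 0
 then show ?case using assms by (intro exI[of _ x]) auto
next
 case (Suc k)
 define d where "d = (y - x) / 2 ^ Suc k"
 have d: "0 < d" "(y - x) / 2 ^ k = 2 * d" using assms(3) by (simp_all add: d_def field_simps)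
 obtain x' where x': "x <= x'" "x' + 2 * d <= y" "poly f x' < 0" "0 < poly f (x' + 2 * d)" using Suc unfolding d(2) by blast
 have "poly f (x' + d) ~= 0" using assms x' d(1) unfolding crosses_def by (auto simp: algebra_simps)
 then consider "poly f (x' + d) < 0" | "0 < poly f (x' + d)" by linarith
 then show ?case unfolding d_def[symmetric]
 proof cases
  case 1
  then show "EX x'>=x. x' + d <= y & poly f x' < 0 & 0 < poly f (x' + d)" using x' d(1) by (intro exI[of _ "x' + d"]) (auto simp: algebra_simps)
 next
  case 2
  then show "EX x'>=x. x' + d <= y & poly f x' < 0 & 0 < poly f (x' + d)" using x' d(1) by (intro exI[of _ x']) auto
 qed
qed

text \<open>Brackets that are short compared with the distance to the left end and, by reflection,
  to the right end are intersected; bisection then makes the result as narrow as desired relative to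
  these distances.\<close>

lemma small_bracket:
 fixes f :: "'a::linordered_field poly"
 assumes roots: "!!m x. 0 < m ==> 0 < x ==> EX y>0. y ^ m = (x :: 'a)" and c: "crosses f a b"
 shows "EX x d. 0 < d & a <= x - 2 ^ k * d & x + 2 ^ k * d <= b & poly f x < 0 & 0 < poly f (x + d)"
proof -
 obtain x1 y1 where 1: "a < x1" "x1 < y1" "y1 <= b" "poly f x1 < 0" "0 < poly f y1" "y1 - x1 <= x1 - a"
  using shrink_left[OF roots c] by blast
 obtain x2 y2 where 2: "- b < x2" "x2 < y2" "y2 <= - a" "0 < poly f (- x2)" "poly f (- y2) < 0" "y2 - x2 <= x2 + b"
  using shrink_left[OF roots crosses_reflect[OF c]] by (auto simp: poly_pcompose)
 have mono: "!!x y. a <= x ==> x < y ==> y <= b ==> poly f x < poly f y" using c unfolding crosses_def by blast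
 have lt: "u < v" if "poly f u < 0" "0 < poly f v" "u <= b" "a <= v" for u v
  using mono[of v u] that by (cases u v rule: linorder_cases) auto
 define x where "x = max x1 (- y2)"
 define y where "y = min y1 (- x2)"
 have f: "poly f x < 0" "0 < poly f y" using 1 2 by (auto simp: x_def y_def max_def min_def)
 have xy: "a <= x" "y <= b" "x <= b" "a <= y" using 1 2 by (auto simp: x_def y_def)
 then have "x < y" using lt f by blast
 have l: "y - x <= x - a" "y - x <= b - y" using 1 2 by (auto simp: x_def y_def max_def min_def split: if_splits)
 define d where "d = (y - x) / 2 ^ Suc k"
 have d: "0 < d" "2 ^ k * d = (y - x) / 2" using \<open>x < y\<close> by (auto simp: d_def)
 obtain x' where x': "x <= x'" "x' + d <= y" "poly f x' < 0" "0 < poly f (x' + d)"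
  using bisect[OF c xy(1) \<open>x < y\<close> xy(2) f, of "Suc k"] unfolding d_def[symmetric] by blast
 have "2 ^ k * d <= y - x" using d(2) \<open>x < y\<close> by simp
 then show ?thesis using x' d(1) l by (intro exI[of _ x'] exI[of _ d]) auto
qed

text \<open>A point of \<open>Z\<close> inside the bracket divides it, and the part that keeps the
  sign change contains fewer points of \<open>Z\<close>.\<close>

lemma avoid_finite:
 fixes f :: "'a::linordered_field poly"
 assumes Z: "finite Z" and f: "a < b" "poly f a < 0" "0 < poly f b" "!!x. a <= x ==> x <= b ==> poly f x ~= 0"
 shows "EX a' b'. a <= a' & a' < b' & b' <= b & poly f a' < 0 & 0 < poly f b' & (ALL x. a' < x --> x < b' --> x ~: Z)"
 using f
proof (induction "card (Z \<inter> {a<..<b})" arbitrary: a b rule: less_induct)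
 case less
 show ?case
 proof (cases "EX z:Z. a < z & z < b")
  case False
  then show ?thesis using less.prems by (intro exI[of _ a] exI[of _ b]) auto
 next
  case True
  then obtain z where z: "z \<in> Z" "a < z" "z < b" by blast
  have card: "card (Z \<inter> {a'<..<b'}) < card (Z \<inter> {a<..<b})" if "a <= a'" "b' <= b" "z ~: {a'<..<b'}" for a' b'
  proof (rule psubset_card_mono)
   show "finite (Z \<inter> {a<..<b})" using Z by simp
   show "Z \<inter> {a'<..<b'} \<subset> Z \<inter> {a<..<b}" using z that by auto
  qed
  have "poly f z ~= 0" using less.prems(4) z by simp
  then consider "poly f z < 0" | "0 < poly f z" by linarith
  then show ?thesis
  proof cases
   case 1
   obtain a' b' where "z <= a'" "a' < b'" "b' <= b" "poly f a' < 0" "0 < poly f b'" "ALL x. a' < x --> x < b' --> x ~: Z"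
    using less.hyps[OF card[of z b]] less.prems z 1 by force
   then show ?thesis using z by (intro exI[of _ a'] exI[of _ b']) auto
  next
   case 2
   obtain a' b' where "a <= a'" "a' < b'" "b' <= z" "poly f a' < 0" "0 < poly f b'" "ALL x. a' < x --> x < b' --> x ~: Z"
    using less.hyps[OF card[of a z]] less.prems z 2 by force
   then show ?thesis using z by (intro exI[of _ a'] exI[of _ b']) auto
  qed
 qed
qed

lemma poly_mono_below:
 fixes p :: "'a::linordered_field poly"
 assumes ivt: "ivt_below TYPE('a) n" "degree p <= n" "0 < n" and xy: "x < y"
  and pos: "!!z. x < z ==> z < y ==> 0 < poly (pderiv p) z"
 shows "poly p x < poly p y"
proof -
 obtain z where "x < z" "z < y" "poly p y - poly p x = (y - x) * poly (pderiv p) z" using mvt_below[OF ivt xy] by blast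
 moreover have "0 < (y - x) * poly (pderiv p) z" using calculation xy pos by simp
 ultimately show ?thesis by simp
qed

text \<open>Away from the roots of the first two derivatives both have constant sign, and the sign
  change of \<open>f\<close> makes the first one positive.\<close>

lemma crossing_piece:
 fixes f :: "'a::linordered_field poly"
 assumes ivt: "ivt_below TYPE('a) n" "degree f <= n" "2 <= n"
  and f: "a < b" "poly f a < 0" "0 < poly f b" "!!x. a <= x ==> x <= b ==> poly f x ~= 0"
  and ne: "pderiv f ~= 0" "pderiv (pderiv f) ~= 0"
 shows "EX a b. crosses f a b & (ALL x. a < x --> x < b --> 0 < poly (pderiv f) x) &
  ((ALL x. a < x --> x < b --> 0 < poly (pderiv (pderiv f)) x) | (ALL x. a < x --> x < b --> poly (pderiv (pderiv f)) x < 0))"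
proof -
 let ?f1 = "pderiv f" and ?f2 = "pderiv (pderiv f)"
 have "finite {x. poly (?f1 * ?f2) x = 0}" by (rule poly_roots_finite) (use ne in simp)
 from avoid_finite[OF this f] obtain a' b' where ab: "a <= a'" "a' < b'" "b' <= b" "poly f a' < 0" "0 < poly f b'"
  and nz: "!!x. a' < x ==> x < b' ==> poly ?f1 x ~= 0" "!!x. a' < x ==> x < b' ==> poly ?f2 x ~= 0" by auto
 have dn: "degree ?f1 < n" "degree ?f2 < n" using ivt(2,3) by (auto simp: degree_pderiv)
 have n0: "0 < n" using ivt(3) by simp
 have same: "sgn (poly p x) = sgn (poly p y)" if "degree p < n" "!!x. a' < x ==> x < b' ==> poly p x ~= 0" "a' < x" "x < b'" "a' < y" "y < b'" for p x y
 proof (cases "x <= y")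
  case True
  then show ?thesis using ivt_sgn[OF ivt(1) that(1) True] that by simp
 next
  case False
  then have "y <= x" by simp
  then show ?thesis using ivt_sgn[OF ivt(1) that(1), of y x] that by simp
 qed
 obtain z where z: "a' < z" "z < b'" "poly f b' - poly f a' = (b' - a') * poly ?f1 z"
  using mvt_below[OF ivt(1,2) n0 ab(2)] by blast
 have "0 < (b' - a') * poly ?f1 z" unfolding z(3)[symmetric] using ab by simp
 then have zp: "0 < poly ?f1 z" using ab by (simp add: zero_less_mult_iff)
 have pos: "0 < poly ?f1 x" if "a' < x" "x < b'" for x
  using same[OF dn(1) nz(1) that z(1,2)] zp by (simp add: sgn_if split: if_splits)
 have "poly f x < poly f y" if "a' <= x" "x < y" "y <= b'" for x y
  by (rule poly_mono_below[OF ivt(1,2) n0 that(2)]) (use pos that in auto)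
 then have "crosses f a' b'" unfolding crosses_def using ab f(4) by auto
 moreover have "(ALL x. a' < x --> x < b' --> 0 < poly ?f2 x) | (ALL x. a' < x --> x < b' --> poly ?f2 x < 0)"
 proof (cases "0 < poly ?f2 z")
  case True
  then have "0 < poly ?f2 x" if "a' < x" "x < b'" for x using same[OF dn(2) nz(2) that z(1,2)] by (simp add: sgn_if split: if_splits)
  then show ?thesis by blast
 next
  case False
  then have "poly ?f2 z < 0" using nz(2)[OF z(1,2)] by simp
  then have "poly ?f2 x < 0" if "a' < x" "x < b'" for x using same[OF dn(2) nz(2) that z(1,2)] by (simp add: sgn_if split: if_splits)
  then show ?thesis by blast
 qed
 ultimately show ?thesis using pos by blast
qed

text \<open>As \<open>f''\<close> has constant sign, \<open>f'\<close> decreases from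
  \<open>x\<close> in one of the two directions and stays between 0 and \<open>f' x\<close> there.
  \<open>coeff_bound\<close> applies in that direction; reversing it changes coefficients only in
  sign.\<close>

lemma deriv_coeff_bound:
 fixes f :: "'a::linordered_field poly"
 assumes ivt: "ivt_below TYPE('a) n" "degree f <= n" "2 <= n"
  and pos: "!!x. a < x ==> x < b ==> 0 < poly (pderiv f) x"
  and f2: "(ALL x. a < x --> x < b --> 0 < poly (pderiv (pderiv f)) x) | (ALL x. a < x --> x < b --> poly (pderiv (pderiv f)) x < 0)"
  and C: "!!(p :: 'a poly) M i. degree p <= n ==> (!!t. 0 <= t ==> t <= 1 ==> \<bar>poly p t\<bar> <= M) ==> \<bar>coeff p i\<bar> <= C * M"
  and x: "0 < \<delta>" "a < x - \<delta>" "x + \<delta> < b"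
 shows "\<bar>coeff (pcompose (pderiv f) [:x, \<delta>:]) i\<bar> <= C * poly (pderiv f) x"
proof -
 let ?g = "pderiv f"
 have dg: "degree ?g <= n" "0 < n" using ivt(2,3) by (auto simp: degree_pderiv)
 from f2 have "EX s. \<bar>s\<bar> = \<delta> & (ALL t. 0 <= t --> t <= 1 --> \<bar>poly (pcompose ?g [:x, s:]) t\<bar> <= poly ?g x)"
 proof
  assume p: "ALL x. a < x --> x < b --> 0 < poly (pderiv ?g) x"
  show ?thesis
  proof (intro exI[of _ "- \<delta>"] conjI allI impI)
   fix t :: 'a assume t: "0 <= t" "t <= 1"
   have t1: "0 <= t * \<delta>" "t * \<delta> <= \<delta>" using t x(1) by (simp_all add: mult_left_le_one_le)
   then have lo: "a < x - t * \<delta>" "x < b" using x by linarith+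
   have "x - t * \<delta> = x | poly ?g (x - t * \<delta>) < poly ?g x"
   proof (cases "t * \<delta> = 0")
    case False
    then have "x - t * \<delta> < x" using t1 by linarith
    then have "poly ?g (x - t * \<delta>) < poly ?g x"
     by (rule poly_mono_below[OF ivt(1) dg]) (use p lo in auto)
    then show ?thesis ..
   qed simp
   moreover have "0 < poly ?g (x - t * \<delta>)" using pos[of "x - t * \<delta>"] t1 x by linarith
   ultimately show "\<bar>poly (pcompose ?g [:x, - \<delta>:]) t\<bar> <= poly ?g x" by (auto simp: poly_pcompose)
  qed (use x in simp)
 next
  assume p: "ALL x. a < x --> x < b --> poly (pderiv ?g) x < 0"
  show ?thesis
  proof (intro exI[of _ "\<delta>"] conjI allI impI)
   fix t :: 'a assume t: "0 <= t" "t <= 1"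
   have t1: "0 <= t * \<delta>" "t * \<delta> <= \<delta>" using t x(1) by (simp_all add: mult_left_le_one_le)
   have lo: "a < x" "x + t * \<delta> < b" using x t1 by linarith+
   have dg': "degree (- ?g) <= n" using dg by simp
   have "x + t * \<delta> = x | poly (- ?g) x < poly (- ?g) (x + t * \<delta>)"
   proof (cases "t * \<delta> = 0")
    case False
    then have "x < x + t * \<delta>" using t1 by linarith
    then have "poly (- ?g) x < poly (- ?g) (x + t * \<delta>)"
     by (rule poly_mono_below[OF ivt(1) dg' dg(2)]) (use p lo in \<open>auto simp: pderiv_minus\<close>)
    then show ?thesis ..
   qed simp
   moreover have "0 < poly ?g (x + t * \<delta>)" using pos[of "x + t * \<delta>"] t1 x by linarith
   ultimately show "\<bar>poly (pcompose ?g [:x, \<delta>:]) t\<bar> <= poly ?g x" by (auto simp: poly_pcompose)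
  qed (use x in simp)
 qed
 then obtain s where s: "\<bar>s\<bar> = \<delta>" "!!t. 0 <= t ==> t <= 1 ==> \<bar>poly (pcompose ?g [:x, s:]) t\<bar> <= poly ?g x" by blast
 have "degree (pcompose ?g [:x, s:]) <= n" using s(1) x(1) dg by (auto simp: degree_pcompose)
 from C[OF this s(2)] have 1: "\<bar>coeff (pcompose ?g [:x, s:]) i\<bar> <= C * poly ?g x" .
 have sc: "coeff (pcompose ?g [:x, r:]) i = r ^ i * coeff (pcompose ?g [:x, 1:]) i" for r
 proof -
  have "pcompose ?g [:x, r:] = pcompose (pcompose ?g [:x, 1:]) [:0, r:]"
   by (subst pcompose_assoc[symmetric]) (simp add: pcompose_pCons)
  then show ?thesis by (simp only: coeff_pcompose_scale)
 qed
 have "\<bar>\<delta>\<bar> = \<bar>s\<bar>" using s(1) x(1) by simp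
 then show ?thesis using 1 unfolding sc[of s] sc[of \<delta>] abs_mult power_abs by simp
qed

definition vmax :: "'a::linordered_field set => bool" where
 "vmax H \<longleftrightarrow> 0 \<in> H & 1 ~: H & (ALL h:H. ALL x. \<bar>x\<bar> <= \<bar>h\<bar> --> x \<in> H) & (ALL h:H. ALL k:H. h + k \<in> H) &
   (ALL x y. x ~: H --> y ~: H --> x * y ~: H)"

text \<open>Values are controlled up to 2 but small ones are found up to \<open>3/2\<close>, since a
  residue in \<open>[-3/2, 3/2]\<close> can have a representative slightly outside. The first
  condition puts the coefficients into the valuation ring.\<close>

definition resid_bad :: "'a::linordered_field set => 'a poly => bool" where
 "resid_bad H p \<longleftrightarrow> (ALL i. \<bar>coeff p i\<bar> <= 2) & (ALL y. \<bar>y\<bar> <= 2 --> poly p y ~: H) &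
   (ALL \<epsilon>. \<epsilon> ~: H --> (EX y. \<bar>y\<bar> <= 3 / 2 & \<bar>poly p y\<bar> <= \<bar>\<epsilon>\<bar>))"

text \<open>\<open>p\<close> is a small perturbation of \<open>y + p(0)\<close>. Newton's method squares its values, so the bound
 set \<open>H\<close> of the values of \<open>p\<close> is a prime, hence maximal, ideal of a convex valuation ring.\<close>

lemma newton_ideal:
 fixes p :: "'a::linordered_field poly"
 assumes ivt: "ivt_below TYPE('a) n" and p: "degree p <= n" "0 < n"
  and q: "coeff (pderiv p) 0 = 1" "!!i. 1 <= i ==> \<bar>coeff (pderiv p) i\<bar> <= \<eta>"
  and \<eta>: "0 <= \<eta>" "\<eta> * (4 * (of_nat (Suc n) * of_nat (Suc n)) * 2 ^ n) <= 1"
  and cr: "poly p 0 < 0" "0 < poly p 1" and nz: "!!y. \<bar>y\<bar> <= 2 ==> poly p y ~= 0"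
 shows "EX H. vmax H & Def (%e. e 0 \<in> H) & resid_bad H p"
proof -
 let ?q = "pderiv p"
 define N where "N = (of_nat (Suc n) :: 'a)"
 have N1: "1 <= N" "of_nat n <= N" by (simp_all add: N_def)
 \<comment> \<open>On \<open>|y| <= 2\<close> both \<open>|p' - 1| <= N * \<eta> * 2^n\<close> and
   \<open>|p''| <= N^2 * \<eta> * 2^n\<close> become at most \<open>1/4\<close>.\<close>
 have \<eta>N: "4 * (N * (\<eta> * 2 ^ n)) * N <= 1" using \<eta>(2) unfolding N_def by (simp add: mult_ac del: of_nat_Suc)
 have X0: "0 <= N * (\<eta> * 2 ^ n)" using N1 \<eta>(1) by simp
 then have \<eta>1: "N * (\<eta> * 2 ^ n) <= 1 / 4" using \<eta>N mult_left_mono[OF N1(1) X0] by (simp add: mult_ac)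
 have "1 * (\<eta> * 1) <= N * (\<eta> * 2 ^ n)" using N1 \<eta>(1) by (intro mult_mono) auto
 then have \<eta>le: "\<eta> <= 1 / 4" using \<eta>1 by simp
 have dq: "degree ?q <= n" using p by (simp add: degree_pderiv)
 have q1: "\<bar>poly ?q y - 1\<bar> <= 1 / 4" if "\<bar>y\<bar> <= 2" for y
 proof -
  have "\<bar>coeff (?q - 1) i\<bar> <= \<eta>" for i using q \<eta>(1) by (cases i) auto
  moreover have "degree (?q - 1) <= n" by (rule degree_diff_le) (use dq in auto)
  ultimately have "\<bar>poly (?q - 1) y\<bar> <= N * (\<eta> * 2 ^ n)" unfolding N_def using that by (intro poly_abs_le) auto
  then show ?thesis using \<eta>1 by simp
 qed
 have q2: "\<bar>poly (pderiv ?q) y\<bar> <= 1 / 4" if "\<bar>y\<bar> <= 2" for y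
 proof -
  have "\<bar>coeff (pderiv ?q) i\<bar> <= N * \<eta>" for i
  proof (cases "Suc i <= n")
   case True
   then have "(of_nat (Suc i) :: 'a) <= N" unfolding N_def by (simp only: of_nat_le_iff)
   moreover have "\<bar>coeff ?q (Suc i)\<bar> <= \<eta>" by (rule q(2)) simp
   ultimately have "of_nat (Suc i) * \<bar>coeff ?q (Suc i)\<bar> <= N * \<eta>" using N1 by (intro mult_mono) auto
   moreover have "coeff (pderiv ?q) i = of_nat (Suc i) * coeff ?q (Suc i)" by (rule coeff_pderiv)
   ultimately show ?thesis by (simp only: abs_mult abs_of_nat)
  next
   case False
   then have "coeff ?q (Suc i) = 0" using dq by (intro coeff_eq_0) auto
   then show ?thesis unfolding coeff_pderiv[of ?q i] using N1 \<eta>(1) by (simp del: coeff_pderiv)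
  qed
  moreover have "degree (pderiv ?q) <= n" using dq by (simp add: degree_pderiv)
  ultimately have "\<bar>poly (pderiv ?q) y\<bar> <= N * (N * \<eta> * 2 ^ n)" unfolding N_def using that by (intro poly_abs_le) auto
  then show ?thesis using \<eta>N by (simp add: mult_ac)
 qed
 have qb: "3 / 4 <= poly ?q y" "poly ?q y <= 5 / 4" if "\<bar>y\<bar> <= 2" for y using q1[OF that] unfolding abs_le_iff by linarith+
 have mv: "EX z. \<bar>z\<bar> <= 2 & \<bar>z - u\<bar> <= \<bar>v - u\<bar> & poly r v - poly r u = (v - u) * poly (pderiv r) z"
  if r: "degree r <= n" and uv: "\<bar>u\<bar> <= 2" "\<bar>v\<bar> <= 2" for r :: "'a poly" and u v
 proof -
  consider "u < v" | "u = v" | "v < u" by linarith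
  then show ?thesis
  proof cases
   case 1
   then obtain z where "u < z" "z < v" "poly r v - poly r u = (v - u) * poly (pderiv r) z" using mvt_below[OF ivt r p(2)] by blast
   then show ?thesis using uv by (intro exI[of _ z]) (auto simp: abs_le_iff)
  next
   case 2
   then show ?thesis using uv by (intro exI[of _ u]) auto
  next
   case 3
   then obtain z where z: "v < z" "z < u" "poly r u - poly r v = (u - v) * poly (pderiv r) z" using mvt_below[OF ivt r p(2)] by blast
   then have "poly r v - poly r u = (v - u) * poly (pderiv r) z" by (simp add: algebra_simps)
   then show ?thesis using uv z by (intro exI[of _ z]) (auto simp: abs_le_iff)
  qed
 qed
 have slope: "3 / 4 * (v - u) <= poly p v - poly p u" "poly p v - poly p u <= 5 / 4 * (v - u)" if "- 2 <= u" "u <= v" "v <= 2" for u v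
 proof -
  have "\<bar>u\<bar> <= 2" "\<bar>v\<bar> <= 2" using that by auto
  then obtain z where z: "\<bar>z\<bar> <= 2" "poly p v - poly p u = (v - u) * poly ?q z" using mv[OF p(1)] by blast
  have "(v - u) * (3 / 4) <= (v - u) * poly ?q z" "(v - u) * poly ?q z <= (v - u) * (5 / 4)"
   by (rule mult_left_mono[OF qb(1)[OF z(1)]], use that in simp) (rule mult_left_mono[OF qb(2)[OF z(1)]], use that in simp)
  then show "3 / 4 * (v - u) <= poly p v - poly p u" "poly p v - poly p u <= 5 / 4 * (v - u)" unfolding z(2) by (simp_all add: mult.commute)
 qed
 \<comment> \<open>A Newton step from such a point has length at most \<open>1/6\<close>, so it
   stays within \<open>|y| <= 2\<close>.\<close>
 have loc: "\<bar>y\<bar> <= 5 / 4" if "\<bar>y\<bar> <= 2" "\<bar>poly p y\<bar> <= 1 / 8" for y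
 proof -
  have "- 1 <= y"
  proof (rule ccontr)
   assume "~ - 1 <= y"
   then have "3 / 4 * (0 - y) <= poly p 0 - poly p y" "y < - 1" using slope(1)[of y 0] that by auto
   moreover have "- poly p y <= 1 / 8" using that(2) by (simp add: abs_le_iff)
   ultimately show False using cr(1) by simp
  qed
  moreover have "y <= 5 / 4"
  proof (rule ccontr)
   assume "~ y <= 5 / 4"
   then have "3 / 4 * (y - 1) <= poly p y - poly p 1" "5 / 4 < y" using slope(1)[of 1 y] that by auto
   moreover have "poly p y <= 1 / 8" using that(2) by (simp add: abs_le_iff)
   ultimately show False using cr(2) by simp
  qed
  ultimately show ?thesis by simp
 qed
 \<comment> \<open>By the mean value theorem, twice, the new value is at most
   \<open>|s|^2 / 4\<close>; with \<open>|s| <= 4/3 * |p y|\<close> this is \<open>4/9\<close> of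
   the square of the old value.\<close>
 have step: "EX y'. \<bar>y'\<bar> <= 2 & \<bar>poly p y'\<bar> <= \<bar>poly p y\<bar> * \<bar>poly p y\<bar>" if y: "\<bar>y\<bar> <= 2" "\<bar>poly p y\<bar> <= 1 / 8" for y
 proof -
  define s where "s = poly p y / poly ?q y"
  have qy: "3 / 4 <= poly ?q y" using qb[OF y(1)] by simp
  then have q0: "0 < poly ?q y" by linarith
  have sq: "s * poly ?q y = poly p y" using q0 by (simp add: s_def)
  have "\<bar>s\<bar> * (3 / 4) <= \<bar>s\<bar> * poly ?q y" using qy by (intro mult_left_mono) auto
  also have "\<dots> = \<bar>poly p y\<bar>" unfolding sq[symmetric] abs_mult using q0 by simp
  finally have s: "\<bar>s\<bar> <= 4 / 3 * \<bar>poly p y\<bar>" by simp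
  have y': "\<bar>y - s\<bar> <= 2" using loc[OF y] s y(2) by linarith
  obtain z where z: "\<bar>z\<bar> <= 2" "\<bar>z - y\<bar> <= \<bar>(y - s) - y\<bar>" "poly p (y - s) - poly p y = ((y - s) - y) * poly ?q z"
   using mv[OF p(1) y(1) y'] by blast
  obtain w where w: "\<bar>w\<bar> <= 2" "poly ?q z - poly ?q y = (z - y) * poly (pderiv ?q) w" using mv[OF dq y(1) z(1)] by blast
  have "poly p (y - s) = s * (poly ?q y - poly ?q z)" using z(3) sq by (simp add: algebra_simps)
  then have "\<bar>poly p (y - s)\<bar> = \<bar>s\<bar> * \<bar>poly ?q z - poly ?q y\<bar>" by (simp add: abs_mult abs_minus_commute)
  also have "\<dots> = \<bar>s\<bar> * (\<bar>z - y\<bar> * \<bar>poly (pderiv ?q) w\<bar>)" by (simp add: w(2) abs_mult)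
  also have "\<dots> <= \<bar>s\<bar> * (\<bar>s\<bar> * (1 / 4))" using z(2) q2[OF w(1)] by (intro mult_left_mono mult_mono) auto
  also have "\<dots> <= (4 / 3 * \<bar>poly p y\<bar>) * ((4 / 3 * \<bar>poly p y\<bar>) * (1 / 4))" using s by (intro mult_mono) auto
  also have "\<dots> = 4 / 9 * (\<bar>poly p y\<bar> * \<bar>poly p y\<bar>)" by simp
  also have "\<dots> <= 1 * (\<bar>poly p y\<bar> * \<bar>poly p y\<bar>)" by (intro mult_right_mono) auto
  finally show ?thesis using y' by auto
 qed
 \<comment> \<open>Four bisections of \<open>[0, 1]\<close> leave a bracket of length
   \<open>1/16\<close>, across which \<open>p\<close> rises by at most \<open>5/64\<close>.\<close>
 have start: "EX y. \<bar>y\<bar> <= 1 & \<bar>poly p y\<bar> <= 1 / 8"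
 proof -
  have "poly p x < poly p y" if "0 <= x" "x < y" "y <= 1" for x y
   using slope(1)[of x y] that by (simp add: field_simps)
  then have "crosses p 0 1" unfolding crosses_def using cr nz by auto
  from bisect[OF this, of 0 1 4] cr obtain x where x: "0 <= x" "x + 1 / 2 ^ 4 <= 1" "poly p x < 0" "0 < poly p (x + 1 / 2 ^ 4)" by auto
  have "poly p (x + 1 / 2 ^ 4) - poly p x <= 5 / 4 * (1 / 2 ^ 4)" using slope(2)[of x "x + 1 / 2 ^ 4"] x by simp
  then have "\<bar>poly p x\<bar> <= 1 / 8" using x(3,4) by simp
  then show ?thesis using x by (intro exI[of _ x]) auto
 qed
 define H where "H = {h. ALL y. \<bar>y\<bar> <= 2 --> \<bar>h\<bar> < \<bar>poly p y\<bar>}"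
 have H: "x ~: H \<longleftrightarrow> (EX y. \<bar>y\<bar> <= 2 & \<bar>poly p y\<bar> <= \<bar>x\<bar>)" for x by (auto simp: H_def not_less)
 have up: "y ~: H" if "x ~: H" "\<bar>x\<bar> <= \<bar>y\<bar>" for x y using that unfolding H by (meson order_trans)
 have big: "x ~: H" if "1 / 8 <= \<bar>x\<bar>" for x
 proof -
  obtain y where y: "\<bar>y\<bar> <= 1" "\<bar>poly p y\<bar> <= 1 / 8" using start by blast
  then have "\<bar>y\<bar> <= 2" "\<bar>poly p y\<bar> <= \<bar>x\<bar>" using that by linarith+
  then show ?thesis unfolding H by blast
 qed
 have sqr: "x * x ~: H" if x: "x ~: H" "\<bar>x\<bar> <= 1 / 8" for x
 proof -
  obtain y where y: "\<bar>y\<bar> <= 2" "\<bar>poly p y\<bar> <= \<bar>x\<bar>" using x(1) unfolding H by blast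
  then obtain y' where y': "\<bar>y'\<bar> <= 2" "\<bar>poly p y'\<bar> <= \<bar>poly p y\<bar> * \<bar>poly p y\<bar>" using step[of y] x(2) by (meson order_trans)
  have "\<bar>poly p y\<bar> * \<bar>poly p y\<bar> <= \<bar>x\<bar> * \<bar>x\<bar>" using y by (intro mult_mono) auto
  then have "\<bar>poly p y'\<bar> <= \<bar>x * x\<bar>" using y' by (simp add: abs_mult)
  then show ?thesis unfolding H using y' by blast
 qed
 have big2: "x ~: H" if "1 / 64 <= \<bar>x\<bar>" for x
 proof -
  have "(1 / 8) * (1 / 8) ~: H" by (rule sqr[OF big]) auto
  then show ?thesis by (rule up) (use that in auto)
 qed
 \<comment> \<open>For \<open>|x| <= 1/8\<close> the square of \<open>x\<close> is already smaller
   than its half.\<close>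
 have half: "x / 2 ~: H" if x: "x ~: H" for x
 proof (cases "\<bar>x\<bar> <= 1 / 8")
  case True
  have "\<bar>x\<bar> * \<bar>x\<bar> <= \<bar>x\<bar> * (1 / 8)" using True by (intro mult_left_mono) auto
  then have "\<bar>x * x\<bar> <= \<bar>x / 2\<bar>" unfolding abs_mult by simp
  then show ?thesis by (rule up[OF sqr[OF x True]])
 next
  case False
  then show ?thesis by (intro big2) simp
 qed
 have "vmax H"
  unfolding vmax_def
 proof (intro conjI ballI allI impI)
  show "0 \<in> H" using nz by (simp add: H_def)
  show "1 ~: H" by (rule big) simp
  show "x \<in> H" if "h \<in> H" "\<bar>x\<bar> <= \<bar>h\<bar>" for h x using up that by blast
  show "h + k \<in> H" if hk: "h \<in> H" "k \<in> H" for h k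
  proof (rule ccontr)
   assume "h + k ~: H"
   then have *: "(h + k) / 2 ~: H" by (rule half)
   have "\<bar>h + k\<bar> <= \<bar>h\<bar> + \<bar>k\<bar>" by (rule abs_triangle_ineq)
   then have "\<bar>(h + k) / 2\<bar> <= \<bar>h\<bar> | \<bar>(h + k) / 2\<bar> <= \<bar>k\<bar>" by simp linarith
   then show False using up[OF *] hk by blast
  qed
  fix x y assume x: "x ~: H" and y: "y ~: H"
  have le: "u * v ~: H" if "u ~: H" "v ~: H" "\<bar>u\<bar> <= \<bar>v\<bar>" for u v
  proof (cases "\<bar>u\<bar> <= 1 / 8")
   case True
   have "\<bar>u * u\<bar> <= \<bar>u * v\<bar>" unfolding abs_mult using that by (intro mult_left_mono) auto
   then show ?thesis by (rule up[OF sqr[OF that(1) True]])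
  next
   case False
   then have "(1 / 8) * (1 / 8) <= \<bar>u\<bar> * \<bar>v\<bar>" using that by (intro mult_mono) auto
   then show ?thesis by (intro big2) (simp add: abs_mult)
  qed
  show "x * y ~: H" using le[of x y] le[of y x] x y by (cases "\<bar>x\<bar> <= \<bar>y\<bar>") (auto simp: mult.commute)
 qed
 moreover have "Def (%e. e 0 \<in> H)" unfolding H_def mem_Collect_eq by (intro Def_intros DefT_poly)
 moreover have "resid_bad H p"
  unfolding resid_bad_def
 proof (intro conjI allI impI)
  fix i show "\<bar>coeff p i\<bar> <= 2"
  proof (cases i)
   case 0
   have "poly p 1 - poly p 0 <= 5 / 4" using slope(2)[of 0 1] by simp
   then show ?thesis using cr unfolding 0 by (simp add: poly_0_coeff_0)
  next
   case (Suc j)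
   have "\<bar>coeff ?q j\<bar> <= 1"
   proof (cases "j = 0")
    case False
    then have "\<bar>coeff ?q j\<bar> <= \<eta>" by (intro q(2)) simp
    then show ?thesis using \<eta>le by linarith
   qed (simp add: q(1))
   then have "of_nat (Suc j) * \<bar>coeff p i\<bar> <= 1" unfolding Suc coeff_pderiv abs_mult by simp
   moreover have "1 * \<bar>coeff p i\<bar> <= of_nat (Suc j) * \<bar>coeff p i\<bar>" by (intro mult_right_mono) auto
   ultimately show ?thesis by linarith
  qed
 next
  show "poly p y ~: H" if "\<bar>y\<bar> <= 2" for y using that unfolding H by blast
 next
  fix \<epsilon> assume \<epsilon>: "\<epsilon> ~: H"
  show "EX y. \<bar>y\<bar> <= 3 / 2 & \<bar>poly p y\<bar> <= \<bar>\<epsilon>\<bar>"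
  proof (cases "\<bar>\<epsilon>\<bar> <= 1 / 8")
   case True
   obtain y where y: "\<bar>y\<bar> <= 2" "\<bar>poly p y\<bar> <= \<bar>\<epsilon>\<bar>" using \<epsilon> unfolding H by blast
   then have "\<bar>y\<bar> <= 5 / 4" using loc True by (meson order_trans)
   then show ?thesis using y by (intro exI[of _ y]) auto
  next
   case False
   obtain y where "\<bar>y\<bar> <= 1" "\<bar>poly p y\<bar> <= 1 / 8" using start by blast
   then show ?thesis using False by (intro exI[of _ y]) auto
  qed
 qed
 ultimately show ?thesis by blast
qed

text \<open>In the least degree where the property fails it is available for derivatives. A bracket
  \<open>[x, x + d]\<close> very short compared with its surroundings is rescaled to
  \<open>[0, 1]\<close>; dividing by \<open>f' x * d\<close> gives slope 1 at 0 and makes all other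
  coefficients of the derivative tiny.\<close>

theorem ivt_failure_ideal:
 assumes roots: "!!m x. 0 < m ==> 0 < x ==> EX y>0. y ^ m = (x :: 'a::linordered_field)"
  and no: "~ ivt TYPE('a)"
 shows "EX (H :: 'a set) p. vmax H & Def (%e. e 0 \<in> H) & resid_bad H p"
proof -
 have ex: "EX n. ~ ivt_below TYPE('a) n" using no by (simp add: ivt_def)
 define n' where "n' = (LEAST n. ~ ivt_below TYPE('a) n)"
 have n': "~ ivt_below TYPE('a) n'" unfolding n'_def by (rule LeastI_ex[OF ex])
 then have "n' ~= 0" by (auto simp: ivt_below_def)
 then obtain n where n: "n' = Suc n" using not0_implies_Suc by blast
 have ivt: "ivt_below TYPE('a) n" using not_less_Least[of n "%n. ~ ivt_below TYPE('a) n"] n unfolding n'_def by auto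
 obtain f :: "'a poly" and a b where f: "degree f <= n" "a < b" "poly f a < 0" "0 < poly f b"
  and noroot: "~ (EX x. a < x & x < b & poly f x = 0)" using n' unfolding n ivt_below_def by (auto simp: less_Suc_eq_le)
 have nz: "poly f x ~= 0" if "a <= x" "x <= b" for x
  using f noroot that by (metis less_irrefl order.not_eq_order_implies_strict)
 have df: "2 <= degree f"
 proof (rule ccontr)
  assume "~ 2 <= degree f"
  then have f2: "f = [:coeff f 0, coeff f 1:]"
   by (intro poly_eqI) (auto simp: coeff_pCons coeff_eq_0 split: nat.splits)
  obtain c d where cd: "f = [:c, d:]" using f2 by blast
  have d: "d * (b - a) > 0" using f by (simp add: cd algebra_simps)
  then have d0: "0 < d" using f(2) by (simp add: zero_less_mult_iff)
  have "a < - c / d" "- c / d < b" "poly f (- c / d) = 0" using f d0 by (simp_all add: cd field_simps)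
  then show False using noroot by blast
 qed
 then have n2: "2 <= n" using f by simp
 have ne: "pderiv f ~= 0" "pderiv (pderiv f) ~= 0" using df by (auto simp: pderiv_eq_0_iff degree_pderiv)
 obtain a b where cr: "crosses f a b" and pos: "!!x. a < x ==> x < b ==> 0 < poly (pderiv f) x"
  and f2: "(ALL x. a < x --> x < b --> 0 < poly (pderiv (pderiv f)) x) | (ALL x. a < x --> x < b --> poly (pderiv (pderiv f)) x < 0)"
  using crossing_piece[OF ivt f(1) n2 f(2-4) nz ne] by blast
 obtain C :: nat where C: "!!(p :: 'a poly) M i. degree p <= n ==> (!!t. 0 <= t ==> t <= 1 ==> \<bar>poly p t\<bar> <= M) ==> \<bar>coeff p i\<bar> <= of_nat C * M"
  using coeff_bound[of n, where ?'a = 'a] by blast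
 \<comment> \<open>\<open>K < 2^K\<close> makes \<open>\<eta> = C / 2^K\<close> meet the bound in
   \<open>newton_ideal\<close>.\<close>
 define K where "K = C * (4 * (Suc n * Suc n) * 2 ^ n)"
 have "K < 2 ^ K" by (rule less_exp)
 then have "(of_nat K :: 'a) < of_nat (2 ^ K)" by (simp only: of_nat_less_iff)
 moreover have "(of_nat K :: 'a) = of_nat C * (4 * (of_nat (Suc n) * of_nat (Suc n)) * 2 ^ n)"
  unfolding K_def by (simp only: of_nat_mult of_nat_power of_nat_numeral)
 ultimately have K: "of_nat C * (4 * (of_nat (Suc n) * of_nat (Suc n)) * 2 ^ n) <= (2 :: 'a) ^ K"
  by (simp only: of_nat_power of_nat_numeral less_imp_le)
 obtain x d where x: "0 < d" "a <= x - 2 ^ Suc K * d" "x + 2 ^ Suc K * d <= b" "poly f x < 0" "0 < poly f (x + d)"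
  using small_bracket[OF roots cr, of "Suc K"] by blast
 define \<delta> where "\<delta> = 2 ^ K * d"
 have \<delta>: "0 < \<delta>" "2 ^ Suc K * d = 2 * \<delta>" using x(1) by (simp_all add: \<delta>_def)
 have x': "a < x - \<delta>" "x + \<delta> < b" using x(2,3) \<delta> by linarith+
 have fx: "0 < poly (pderiv f) x" using pos[of x] x' \<delta>(1) by simp
 define p where "p = smult (1 / (poly (pderiv f) x * d)) (pcompose f [:x, d:])"
 have py: "poly p y = poly f (x + d * y) / (poly (pderiv f) x * d)" for y by (simp add: p_def poly_pcompose mult.commute)
 have q: "pderiv p = smult (1 / poly (pderiv f) x) (pcompose (pderiv f) [:x, d:])"
  unfolding p_def pderiv_smult pderiv_pcompose using x(1) by (simp add: pderiv_pCons mult.commute)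
 \<comment> \<open>Coefficients are bounded at the scale \<open>\<delta> = 2^K * d\<close>; going
   down to scale \<open>d\<close> gains at least a factor \<open>2^K\<close> from the first
   coefficient on.\<close>
 have "pcompose (pderiv f) [:x, d:] = pcompose (pcompose (pderiv f) [:x, \<delta>:]) [:0, 1 / 2 ^ K:]"
  by (subst pcompose_assoc[symmetric]) (simp add: pcompose_pCons \<delta>_def)
 then have cq: "coeff (pderiv p) i = (1 / 2 ^ K) ^ i * coeff (pcompose (pderiv f) [:x, \<delta>:]) i / poly (pderiv f) x" for i
  unfolding q by (simp add: coeff_pcompose_scale)
 have "EX H. vmax H & Def (%e. e 0 \<in> H) & resid_bad H p"
 proof (rule newton_ideal[OF ivt, where \<eta> = "of_nat C / 2 ^ K"])
  have fd: "0 < poly (pderiv f) x * d" using fx x(1) by simp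
  show "degree p <= n" unfolding p_def using f(1) x(1) by (auto simp: degree_pcompose)
  show "0 < n" using n2 by simp
  show "coeff (pderiv p) 0 = 1" unfolding q using fx by (simp add: poly_0_coeff_0[symmetric] poly_pcompose)
  show "0 <= (of_nat C / 2 ^ K :: 'a)" by simp
  show "of_nat C / 2 ^ K * (4 * (of_nat (Suc n) * of_nat (Suc n)) * 2 ^ n) <= (1 :: 'a)" using K by (simp add: field_simps del: of_nat_Suc)
  show "poly p 0 < 0" "0 < poly p 1" unfolding py using x fd by (simp_all add: divide_neg_pos)
  show "\<bar>coeff (pderiv p) i\<bar> <= of_nat C / 2 ^ K" if i: "1 <= i" for i
  proof -
   have "\<bar>coeff (pcompose (pderiv f) [:x, \<delta>:]) i\<bar> <= of_nat C * poly (pderiv f) x"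
    by (rule deriv_coeff_bound[OF ivt f(1) n2 pos f2 C \<delta>(1) x'])
   then have 1: "\<bar>coeff (pcompose (pderiv f) [:x, \<delta>:]) i\<bar> / poly (pderiv f) x <= of_nat C" using fx by (simp add: field_simps)
   have "(1 / 2 ^ K :: 'a) ^ i <= (1 / 2 ^ K) ^ 1" using i by (intro power_decreasing) auto
   then have 2: "(1 / 2 ^ K :: 'a) ^ i <= 1 / 2 ^ K" by simp
   have "\<bar>coeff (pderiv p) i\<bar> = (1 / 2 ^ K) ^ i * (\<bar>coeff (pcompose (pderiv f) [:x, \<delta>:]) i\<bar> / poly (pderiv f) x)"
    unfolding cq using fx by (simp add: abs_mult)
   also have "\<dots> <= 1 / 2 ^ K * of_nat C" using 1 2 fx by (intro mult_mono) auto
   finally show ?thesis by simp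
  qed
  show "poly p y ~= 0" if y: "\<bar>y\<bar> <= 2" for y
  proof -
   have "\<bar>d * y\<bar> <= d * 2" unfolding abs_mult using y x(1) by (intro mult_mono) auto
   moreover have "d * 2 <= 2 * \<delta>" using x(1) by (simp add: \<delta>_def)
   ultimately have "\<bar>d * y\<bar> <= 2 * \<delta>" by linarith
   then have "a <= x + d * y" "x + d * y <= b" using x(2,3) unfolding \<delta>(2) by linarith+
   then show ?thesis unfolding py using cr fd unfolding crosses_def by auto
  qed
 qed
 then show ?thesis by blast
qed

section \<open>The residue field\<close>

text \<open>The valuation ring is not extra data: it is the stabiliser of its maximal ideal, and so
  is definable when \<open>H\<close> is.\<close>

definition val_ring :: "'a::linordered_field set => 'a set" where
 "val_ring H = {x. ALL h. h \<in> H --> x * h \<in> H}"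

lemma vmaxD:
 assumes H: "vmax H"
 shows "0 \<in> H" "1 ~: H" "h \<in> H ==> \<bar>x\<bar> <= \<bar>h\<bar> ==> x \<in> H" "h \<in> H ==> k \<in> H ==> h + k \<in> H"
  "x * y \<in> H ==> x \<in> H | y \<in> H" "h \<in> H ==> - h \<in> H" "h \<in> H ==> k \<in> H ==> h - k \<in> H"
proof -
 show 1: "0 \<in> H" "1 ~: H" "h \<in> H ==> \<bar>x\<bar> <= \<bar>h\<bar> ==> x \<in> H" "h \<in> H ==> k \<in> H ==> h + k \<in> H"
  "x * y \<in> H ==> x \<in> H | y \<in> H" for h k x y using H unfolding vmax_def by blast+
 show 2: "h \<in> H ==> - h \<in> H" for h using 1(3)[of h "- h"] by simp
 show "h \<in> H ==> k \<in> H ==> h - k \<in> H" using 1(4)[of h "- k"] 2 by simp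
qed

lemma val_ring:
 assumes H: "vmax H"
 shows "x \<in> val_ring H ==> h \<in> H ==> x * h \<in> H" "x \<in> val_ring H ==> h \<in> H ==> h * x \<in> H" "\<bar>x\<bar> <= 1 ==> x \<in> val_ring H" "h \<in> H ==> \<bar>h\<bar> < 1"
  "h \<in> H ==> h \<in> val_ring H" "x \<in> val_ring H ==> y \<in> val_ring H ==> x + y \<in> val_ring H"
  "x \<in> val_ring H ==> y \<in> val_ring H ==> x - y \<in> val_ring H" "x \<in> val_ring H ==> - x \<in> val_ring H"
  "x \<in> val_ring H ==> y \<in> val_ring H ==> x * y \<in> val_ring H" "x ~: H ==> inverse x \<in> val_ring H"
  "0 \<in> val_ring H" "1 \<in> val_ring H"
proof -
 note D = vmaxD[OF H]
 show 1: "x \<in> val_ring H ==> h \<in> H ==> x * h \<in> H" for x h by (auto simp: val_ring_def)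
 show "x \<in> val_ring H ==> h \<in> H ==> h * x \<in> H" using 1[of x h] by (simp add: mult.commute)
 show 2: "\<bar>x\<bar> <= 1 ==> x \<in> val_ring H" for x
 proof -
  assume x: "\<bar>x\<bar> <= 1"
  have "x * h \<in> H" if h: "h \<in> H" for h
   by (rule D(3)[OF h]) (use x in \<open>simp add: abs_mult mult_left_le_one_le\<close>)
  then show ?thesis by (simp add: val_ring_def)
 qed
 show 3: "h \<in> H ==> \<bar>h\<bar> < 1" for h using D(2) D(3)[of h 1] by (auto simp: not_less[symmetric])
 show "h \<in> H ==> h \<in> val_ring H" using 2 3 by (simp add: less_imp_le)
 show "x \<in> val_ring H ==> y \<in> val_ring H ==> x + y \<in> val_ring H" using D by (simp add: val_ring_def algebra_simps)
 show "x \<in> val_ring H ==> y \<in> val_ring H ==> x - y \<in> val_ring H" using D by (simp add: val_ring_def algebra_simps)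
 show "x \<in> val_ring H ==> - x \<in> val_ring H" using D(6) by (simp add: val_ring_def)
 show "x \<in> val_ring H ==> y \<in> val_ring H ==> x * y \<in> val_ring H" by (simp add: val_ring_def mult.assoc)
 show "x ~: H ==> inverse x \<in> val_ring H"
 proof -
  assume x: "x ~: H"
  then have x0: "x ~= 0" using D(1) by auto
  have "inverse x * h \<in> H" if h: "h \<in> H" for h
   using D(5)[of x "inverse x * h"] x x0 h by (simp add: mult.assoc[symmetric])
  then show ?thesis by (simp add: val_ring_def)
 qed
 show "0 \<in> val_ring H" "1 \<in> val_ring H" by (auto intro: 2)
qed

text \<open>A difference outside \<open>H\<close> is larger in absolute value than every element of
  \<open>H\<close>, so changes within \<open>H\<close> cannot reverse it.\<close>

lemma vmax_less_cong:
 assumes H: "vmax H" and x: "x < y" "y - x ~: H" "x' - x \<in> H" "y' - y \<in> H"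
 shows "x' < y'" "y' - x' ~: H"
proof -
 note D = vmaxD[OF H]
 have h: "(y' - y) - (x' - x) \<in> H" using x D(7) by blast
 have eq: "y' - x' = (y - x) + ((y' - y) - (x' - x))" by simp
 have "\<bar>(y' - y) - (x' - x)\<bar> < \<bar>y - x\<bar>" using D(3)[OF h, of "y - x"] x(2) by (auto simp: not_less[symmetric])
 then show "x' < y'" using x(1) by (simp add: abs_if split: if_splits)
 show "y' - x' ~: H"
 proof
  assume "y' - x' \<in> H"
  from D(7)[OF this h] show False using x(2) by simp
 qed
qed

text \<open>The residue field is a type depending only on the field type, so the ideal is fixed by choice.\<close>

definition resid_ideal :: "'a::linordered_field set" where
 "resid_ideal = (if EX H :: 'a set. EX p. vmax H & Def (%e. e 0 \<in> H) & resid_bad H p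
   then SOME H. EX p. vmax H & Def (%e. e 0 \<in> H) & resid_bad H p else {0})"

lemma vmax_resid [simp]: "vmax (resid_ideal :: 'a::linordered_field set)"
 and Def_resid: "Def (%e. e 0 \<in> (resid_ideal :: 'a::linordered_field set))"
proof -
 have "vmax (resid_ideal :: 'a set) & Def (%e. e 0 \<in> (resid_ideal :: 'a set))"
 proof (cases "EX H :: 'a set. EX p. vmax H & Def (%e. e 0 \<in> H) & resid_bad H p")
  case True
  from someI_ex[OF this] show ?thesis unfolding resid_ideal_def if_P[OF True] by blast
 next
  case False
  have "vmax {0 :: 'a}" by (auto simp: vmax_def)
  moreover have "Def (%e. e 0 = (0 :: 'a))" by (intro Def_intros)
  ultimately show ?thesis unfolding resid_ideal_def if_not_P[OF False] by simp
 qed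
 then show "vmax (resid_ideal :: 'a set)" "Def (%e. e 0 \<in> (resid_ideal :: 'a set))" by blast+
qed

definition resid_rel :: "'a::linordered_field => 'a => bool" where
 "resid_rel x y \<longleftrightarrow> x \<in> val_ring resid_ideal & y \<in> val_ring resid_ideal & x - y \<in> resid_ideal"

abbreviation VR :: "'a::linordered_field set" where "VR \<equiv> val_ring resid_ideal"

lemmas rD = vmaxD[OF vmax_resid] and rV = val_ring[OF vmax_resid]

lemma part_equivp_resid: "part_equivp (resid_rel :: 'a::linordered_field => _)"
proof (rule part_equivpI)
 show "EX x :: 'a. resid_rel x x" by (rule exI[of _ 0]) (simp add: resid_rel_def rD rV)
 show "symp (resid_rel :: 'a => _)"
 proof (rule sympI)
  fix x y :: 'a assume r: "resid_rel x y"
  then have "- (x - y) \<in> resid_ideal" unfolding resid_rel_def using rD(6) by blast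
  then show "resid_rel y x" using r by (simp add: resid_rel_def)
 qed
 show "transp (resid_rel :: 'a => _)"
 proof (rule transpI)
  fix x y z :: 'a assume "resid_rel x y" "resid_rel y z"
  then show "resid_rel x z" using rD(4)[of "x - y" "y - z"] by (simp add: resid_rel_def)
 qed
qed

quotient_type (overloaded) 'a resid = "'a::linordered_field" / partial: resid_rel
 by (rule part_equivp_resid)

instantiation resid :: (linordered_field) linordered_field
begin

lift_definition zero_resid :: "'a resid" is 0 by (simp add: resid_rel_def rV rD)
lift_definition one_resid :: "'a resid" is 1 by (simp add: resid_rel_def rV rD)
lift_definition plus_resid :: "'a resid => 'a resid => 'a resid" is "(+)"
proof -
 fix x x' y y' :: 'a assume "resid_rel x x'" "resid_rel y y'"
 then show "resid_rel (x + y) (x' + y')" using rD(4)[of "x - x'" "y - y'"] by (simp add: resid_rel_def rV algebra_simps)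
qed
lift_definition minus_resid :: "'a resid => 'a resid => 'a resid" is "(-)"
proof -
 fix x x' y y' :: 'a assume "resid_rel x x'" "resid_rel y y'"
 then show "resid_rel (x - y) (x' - y')" using rD(7)[of "x - x'" "y - y'"] by (simp add: resid_rel_def rV algebra_simps)
qed
lift_definition uminus_resid :: "'a resid => 'a resid" is "uminus"
proof -
 fix x x' :: 'a assume "resid_rel x x'"
 then show "resid_rel (- x) (- x')" using rD(6)[of "x - x'"] by (simp add: resid_rel_def rV)
qed
lift_definition times_resid :: "'a resid => 'a resid => 'a resid" is "(*)"
proof -
 fix x x' y y' :: 'a assume r: "resid_rel x x'" "resid_rel y y'"
 then have "x * (y - y') \<in> resid_ideal" "(x - x') * y' \<in> resid_ideal" unfolding resid_rel_def using rV(1,2) by blast+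
 from rD(4)[OF this] have "x * y - x' * y' \<in> resid_ideal" by (simp add: algebra_simps)
 then show "resid_rel (x * y) (x' * y')" using r by (simp add: resid_rel_def rV)
qed
lift_definition inverse_resid :: "'a resid => 'a resid" is "%x. if x \<in> resid_ideal then 0 else inverse x"
proof -
 fix x x' :: 'a assume r: "resid_rel x x'"
 have iff: "x \<in> resid_ideal \<longleftrightarrow> x' \<in> resid_ideal"
  using r rD(7)[of x "x - x'"] rD(4)[of "x - x'" x'] by (auto simp: resid_rel_def)
 show "resid_rel (if x \<in> resid_ideal then 0 else inverse x) (if x' \<in> resid_ideal then 0 else inverse x')"
 proof (cases "x \<in> resid_ideal")
  case True
  then show ?thesis using iff by (simp add: resid_rel_def rV rD)
 next
  case False
  then have n: "x ~: resid_ideal" "x' ~: resid_ideal" using iff by auto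
  then have "x ~= 0" "x' ~= 0" using rD(1) by auto
  then have "inverse x - inverse x' = (inverse x * inverse x') * - (x - x')" by (simp add: field_simps)
  moreover have "\<dots> \<in> resid_ideal" using r n unfolding resid_rel_def by (intro rV(1,9,10) rD(6)) auto
  ultimately show ?thesis using n by (simp add: resid_rel_def rV)
 qed
qed
definition divide_resid :: "'a resid => 'a resid => 'a resid" where "divide_resid x y = x * inverse y"
lift_definition less_resid :: "'a resid => 'a resid => bool" is "%x y. x < y & y - x ~: resid_ideal"
proof -
 fix x x' y y' :: 'a assume r: "resid_rel x x'" "resid_rel y y'"
 have s: "x - x' \<in> resid_ideal" "x' - x \<in> resid_ideal" "y - y' \<in> resid_ideal" "y' - y \<in> resid_ideal"
  using r rD(6)[of "x - x'"] rD(6)[of "y - y'"] by (simp_all add: resid_rel_def)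
 show "(x < y & y - x ~: resid_ideal) \<longleftrightarrow> (x' < y' & y' - x' ~: resid_ideal)"
  using vmax_less_cong[OF vmax_resid, of x y x' y'] vmax_less_cong[OF vmax_resid, of x' y' x y] s by blast
qed
definition less_eq_resid :: "'a resid => 'a resid => bool" where "less_eq_resid x y \<longleftrightarrow> x < y | x = y"
definition abs_resid_inst: "\<bar>x :: 'a resid\<bar> = (if x < 0 then - x else x)"
definition sgn_resid :: "'a resid => 'a resid" where "sgn_resid x = (if x = 0 then 0 else if 0 < x then 1 else - 1)"

instance
proof
 fix a b c :: "'a resid"
 show "a + b + c = a + (b + c)" by transfer (simp add: resid_rel_def rV rD algebra_simps)
 show "a + b - a = b" by transfer (simp add: resid_rel_def rV rD)
 show "a - b - c = a - (b + c)" by transfer (simp add: resid_rel_def rV rD algebra_simps)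
 show "0 * a = 0" "a * 0 = 0" by (transfer, simp add: resid_rel_def rV rD)+
 show "a + b = b + a" by transfer (simp add: resid_rel_def rV rD)
 show "0 + a = a" by transfer (simp add: resid_rel_def rV rD)
 show "- a + a = 0" by transfer (simp add: resid_rel_def rV rD)
 show "a - b = a + - b" by transfer (simp add: resid_rel_def rV rD)
 show "a * b * c = a * (b * c)" by transfer (simp add: resid_rel_def rV rD algebra_simps)
 show "a * b = b * a" by transfer (simp add: resid_rel_def rV rD algebra_simps)
 show "1 * a = a" by transfer (simp add: resid_rel_def rV rD)
 show "(a + b) * c = a * c + b * c" by transfer (simp add: resid_rel_def rV rD algebra_simps)
 show "(0 :: 'a resid) ~= 1" by transfer (use rD(2) rD(6)[of "-1"] in \<open>auto simp: resid_rel_def\<close>)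
 show "a ~= 0 ==> inverse a * a = 1"
 proof transfer
  fix a :: 'a assume a: "resid_rel a a" "~ resid_rel a 0"
  then have "a ~: resid_ideal" "a ~= 0" using rV(11) rD(1) by (auto simp: resid_rel_def)
  then show "resid_rel ((if a \<in> resid_ideal then 0 else inverse a) * a) 1" by (simp add: resid_rel_def rV rD)
 qed
 show "a div b = a * inverse b" by (rule divide_resid_def)
 show "inverse (0 :: 'a resid) = 0" by transfer (simp add: resid_rel_def rV rD)
 have irr: "~ x < x" for x :: "'a resid" by transfer simp
 have tr: "x < y ==> y < z ==> x < z" for x y z :: "'a resid"
 proof transfer
  fix x y z :: 'a assume *: "x < y & y - x ~: resid_ideal" "y < z & z - y ~: resid_ideal"
  have "z - x ~: resid_ideal"
  proof
   assume "z - x \<in> resid_ideal"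
   then have "y - x \<in> resid_ideal" by (rule rD(3)) (use * in auto)
   then show False using * by simp
  qed
  then show "x < z & z - x ~: resid_ideal" using * by auto
 qed
 have lin: "x < y | x = y | y < x" for x y :: "'a resid"
 proof transfer
  fix x y :: 'a assume *: "resid_rel x x" "resid_rel y y"
  show "(x < y & y - x ~: resid_ideal) | resid_rel x y | (y < x & x - y ~: resid_ideal)"
  proof (cases "x - y \<in> resid_ideal")
   case False
   then have "y - x ~: resid_ideal" using rD(6)[of "y - x"] by auto
   then show ?thesis using False rD(1) by (cases x y rule: linorder_cases) auto
  qed (use * in \<open>simp add: resid_rel_def\<close>)
 qed
 show "(a < b) = (a <= b & ~ b <= a)" unfolding less_eq_resid_def using irr tr by metis
 show "a <= a" unfolding less_eq_resid_def by simp
 show "a <= b ==> b <= c ==> a <= c" unfolding less_eq_resid_def using tr by blast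
 show "a <= b ==> b <= a ==> a = b" unfolding less_eq_resid_def using irr tr by metis
 show "a <= b | b <= a" unfolding less_eq_resid_def using lin by blast
 have ad: "x < y ==> z + x < z + y" for x y z :: "'a resid" by transfer simp
 then show "a <= b ==> c + a <= c + b" unfolding less_eq_resid_def by auto
 show "a < b ==> 0 < c ==> c * a < c * b"
 proof transfer
  fix a b c :: 'a assume *: "a < b & b - a ~: resid_ideal" "0 < c & c - 0 ~: resid_ideal"
  have "c * (b - a) ~: resid_ideal" using rD(5)[of c "b - a"] * by auto
  then show "c * a < c * b & c * b - c * a ~: resid_ideal" using * by (simp add: algebra_simps)
 qed
 show "\<bar>a\<bar> = (if a < 0 then - a else a)" by (rule abs_resid_inst)
 show "sgn a = (if a = 0 then 0 else if 0 < a then 1 else - 1)" by (rule sgn_resid_def)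
qed

end

text \<open>Made total by a default, so that assignments over the field can be mapped
  coordinatewise.\<close>

definition rs :: "'a::linordered_field => 'a resid" where
 "rs x = abs_resid (if x \<in> val_ring resid_ideal then x else 0)"

lemma rs_rel: "x \<in> VR ==> resid_rel x x"
 by (simp add: resid_rel_def rD)

lemma rs_simps:
 fixes x y :: "'a::linordered_field"
 shows "rs (0 :: 'a) = 0" "rs (1 :: 'a) = 1" "x \<in> VR ==> y \<in> VR ==> rs (x + y) = rs x + rs y" "x \<in> VR ==> y \<in> VR ==> rs (x * y) = rs x * rs y"
 "x \<in> VR ==> y \<in> VR ==> rs x = rs y \<longleftrightarrow> x - y \<in> resid_ideal" "x \<in> VR ==> y \<in> VR ==> rs x < rs y \<longleftrightarrow> x < y & y - x ~: resid_ideal"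
proof -
 have V: "x \<in> VR ==> rs x = abs_resid x" for x :: 'a by (simp add: rs_def)
 show "rs 0 = (0 :: 'a resid)" by (simp add: rs_def zero_resid_def)
 show "rs 1 = (1 :: 'a resid)" by (simp add: rs_def one_resid_def rV)
 show "x \<in> VR ==> y \<in> VR ==> rs (x + y) = rs x + rs y" by (simp add: V rV plus_resid.abs_eq rs_rel)
 show "x \<in> VR ==> y \<in> VR ==> rs (x * y) = rs x * rs y" by (simp add: V rV times_resid.abs_eq rs_rel)
 show "x \<in> VR ==> y \<in> VR ==> rs x = rs y \<longleftrightarrow> x - y \<in> resid_ideal"
  using Quotient3_rel[OF Quotient3_resid, of x y] by (simp add: V rs_rel) (simp add: resid_rel_def)
 show "x \<in> VR ==> y \<in> VR ==> rs x < rs y \<longleftrightarrow> x < y & y - x ~: resid_ideal" by (simp add: V less_resid.abs_eq rs_rel)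
qed

lemma rs_surj: "EX x:VR. rs x = a"
proof -
 obtain x where "a = abs_resid x" "resid_rel x x" using Quotient3_abs_rep[OF Quotient3_resid, of a] Quotient3_rep_reflp[OF Quotient3_resid, of a] by metis
 then show ?thesis by (intro bexI[of _ x]) (auto simp: rs_def resid_rel_def)
qed

lemma rs_clip: "rs (if x \<in> VR then x else 0) = rs x"
 by (auto simp: rs_def)

section \<open>Interpretation of the residue field in the field\<close>

lemma Def_in_ideal: "DefT t ==> Def (%e. t e \<in> (resid_ideal :: 'a::linordered_field set))"
 by (rule Def_mem[OF Def_resid])

lemma Def_in_VR: "DefT t ==> Def (%e. t e \<in> (VR :: 'a::linordered_field set))"
proof (rule Def_mem)
 show "Def (%e. e 0 \<in> (VR :: 'a set))" unfolding val_ring_def mem_Collect_eq by (intro Def_intros Def_in_ideal)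
qed

text \<open>Terms lift to the valuation ring once variables outside it are read as 0, in agreement
  with the default of \<open>rs\<close>.\<close>

lemma evalt_resid: "EX T. DefT T & (ALL e :: nat => 'a::linordered_field. T e \<in> VR & evalt ofield (%i. rs (e i)) t = rs (T e))"
proof (induction t)
 case (Var n)
 show ?case
  by (intro exI[of _ "%e. if e n \<in> VR then e n else 0"] conjI DefT_if Def_in_VR DefT_coord) (auto simp: rs_clip rV rs_def)
next
 case (Add s t)
 then obtain S T where "DefT S" "DefT T" "!!e :: nat => 'a. S e \<in> VR & evalt ofield (%i. rs (e i)) s = rs (S e)"
  "!!e :: nat => 'a. T e \<in> VR & evalt ofield (%i. rs (e i)) t = rs (T e)" by blast
 then show ?case by (intro exI[of _ "%e. S e + T e"] conjI DefT_add) (auto simp: rs_simps rV)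
next
 case (Mul s t)
 then obtain S T where "DefT S" "DefT T" "!!e :: nat => 'a. S e \<in> VR & evalt ofield (%i. rs (e i)) s = rs (S e)"
  "!!e :: nat => 'a. T e \<in> VR & evalt ofield (%i. rs (e i)) t = rs (T e)" by blast
 then show ?case by (intro exI[of _ "%e. S e * T e"] conjI DefT_mult) (auto simp: rs_simps rV)
qed

text \<open>Equality and order of residues are expressed through the ideal, and surjectivity of
  \<open>rs\<close> turns quantifiers over residues into quantifiers over the field.\<close>

lemma Def_sat_resid: "Def (%e :: nat => 'a::linordered_field. sat ofield (%i. rs (e i)) \<phi>)"
proof (induction \<phi>)
 case (Eq s t)
 obtain S T where ST: "DefT S" "DefT T" "!!e :: nat => 'a. S e \<in> VR" "!!e :: nat => 'a. evalt ofield (%i. rs (e i)) s = rs (S e)"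
  "!!e :: nat => 'a. T e \<in> VR" "!!e :: nat => 'a. evalt ofield (%i. rs (e i)) t = rs (T e)" using evalt_resid by metis
 show ?case using ST by (simp add: rs_simps) (intro Def_in_ideal DefT_diff)
next
 case (Lt s t)
 obtain S T where ST: "DefT S" "DefT T" "!!e :: nat => 'a. S e \<in> VR" "!!e :: nat => 'a. evalt ofield (%i. rs (e i)) s = rs (S e)"
  "!!e :: nat => 'a. T e \<in> VR" "!!e :: nat => 'a. evalt ofield (%i. rs (e i)) t = rs (T e)" using evalt_resid by metis
 show ?case using ST by (simp add: rs_simps) (intro Def_conj Def_less Def_not Def_in_ideal DefT_diff)
next
 case (Neg p)
 then show ?case by (simp add: Def_not)
next
 case (Conj p q)
 then show ?case by (simp add: Def_conj)
next
 case (Ex n p)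
 have T: "DefT (%e :: nat => 'a. if j = n then e 0 else e (Suc j))" for j by (cases "j = n") (simp_all add: DefT_coord)
 have "Def (%e :: nat => 'a. sat ofield (%i. rs (if i = n then e 0 else e (Suc i))) p)"
  using Def_subst[OF Ex.IH, of "%e j. if j = n then e 0 else e (Suc j)", OF T] by simp
 from Def_ex[of "%e x. sat ofield (%i. rs (if i = n then x else e i)) p", OF this]
 have "Def (%e :: nat => 'a. EX x. sat ofield (%i. rs (if i = n then x else e i)) p)" .
 moreover have "sat ofield (%i. rs (e i)) (Ex n p) \<longleftrightarrow> (EX x. sat ofield (%i. rs (if i = n then x else e i)) p)" for e :: "nat => 'a"
 proof -
  have upd: "(%i. rs (e i))(n := rs x) = (%i. rs (if i = n then x else e i))" for x by auto
  have "sat ofield (%i. rs (e i)) (Ex n p) \<longleftrightarrow> (EX a. sat ofield ((%i. rs (e i))(n := a)) p)" by simp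
  also have "\<dots> \<longleftrightarrow> (EX x. sat ofield ((%i. rs (e i))(n := rs x)) p)" using rs_surj by metis
  finally show ?thesis unfolding upd .
 qed
 ultimately show ?case by simp
qed

lemma Def_rs:
 fixes P :: "(nat => 'a::linordered_field resid) => bool"
 assumes "Def P" shows "Def (%e. P (%i. rs (e i)))"
proof -
 obtain v \<phi> where v: "!!i. proj (v i)" "!!e. P e = sat ofield (%i. v i e) \<phi>" using assms unfolding Def_def by blast
 have "EX w. DefT w & (ALL e. v i (%k. rs (e k)) = rs (w e))" for i
 proof -
  consider k where "v i = (%e. e k)" | c where "v i = (%_. c)" using v(1)[of i] unfolding proj_def by blast
  then show ?thesis
  proof cases
   case 1
   then show ?thesis by (intro exI[of _ "%e. e k"]) (simp add: DefT_coord)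
  next
   case 2
   obtain x where "rs x = c" using rs_surj by blast
   then show ?thesis using 2 by (intro exI[of _ "%e. x"]) (simp add: DefT_coord)
  qed
 qed
 then obtain w where w: "!!i. DefT (w i)" "!!i e. v i (%k. rs (e k)) = rs (w i e)" by metis
 have "Def (%e. sat ofield (%i. rs (w i e)) \<phi>)"
  using Def_subst[OF Def_sat_resid[of \<phi>], of "%e i. w i e", OF w(1)] .
 then show ?thesis unfolding v(2) w(2) .
qed

text \<open>Formulas pull back along \<open>rs\<close>, and points and parameters of an array lift
  to representatives.\<close>

lemma dps_resid:
 assumes dps: "dps TYPE('a::linordered_field)" shows "dps TYPE('a resid)"
 unfolding dps_def
proof
 assume "EX (\<Phi> :: nat => 'a resid => (nat => 'a resid) => bool) \<Psi>. (ALL i. Def1 (\<Phi> i)) & Def1 \<Psi> &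
   (ALL n. EX c b. array n (%i x. \<Phi> i x (c i)) (%j x. \<Psi> x (b j)))"
 then obtain \<Phi> :: "nat => 'a resid => (nat => 'a resid) => bool" and \<Psi> where D: "!!i. Def1 (\<Phi> i)" "Def1 \<Psi>"
  and arr: "ALL n. EX c b. array n (%i x. \<Phi> i x (c i)) (%j x. \<Psi> x (b j))" by blast
 have D1: "Def1 (%x e. W (rs x) (%k. rs (e k)))" if "Def1 W" for W :: "'a resid => (nat => 'a resid) => bool"
  using Def_rs[OF that[unfolded Def1_def]] unfolding Def1_def .
 obtain n where n: "!!c b. ~ array n (%i x. \<Phi> i (rs x) (%k. rs (c i k))) (%j x. \<Psi> (rs x) (%k. rs (b j k)))"
  using dpsD[where \<Phi> = "%i x e. \<Phi> i (rs x) (%k. rs (e k))", OF dps D1[OF D(1)] D1[OF D(2)]] by blast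
 obtain c b where cb: "array n (%i x. \<Phi> i x (c i)) (%j x. \<Psi> x (b j))" using arr by blast
 define rp where "rp a = (SOME x. rs x = a)" for a :: "'a resid"
 have rp: "rs (rp a) = a" for a
 proof -
  have "EX x. rs x = a" using rs_surj by blast
  then show ?thesis unfolding rp_def by (rule someI_ex)
 qed
 have "array n (%i x. \<Phi> i (rs x) (%k. rs (rp (c i k)))) (%j x. \<Psi> (rs x) (%k. rs (rp (b j k))))"
  unfolding array_def rp
 proof (intro allI impI)
  fix i0 j0 assume "i0 < n" "j0 < n"
  from cb[unfolded array_def, rule_format, OF this]
  obtain a where "(ALL i<n. \<Phi> i a (c i) \<longleftrightarrow> i = i0) & (ALL j<n. \<Psi> a (b j) \<longleftrightarrow> j = j0)" by (elim exE)
  then show "EX x. (ALL i<n. \<Phi> i (rs x) (c i) \<longleftrightarrow> i = i0) & (ALL j<n. \<Psi> (rs x) (b j) \<longleftrightarrow> j = j0)"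
   by (intro exI[of _ "rp a"]) (simp add: rp)
 qed
 then show False using n[of "%i k. rp (c i k)" "%j k. rp (b j k)"] by (rule notE[rotated])
qed

lemma poly_resid:
 assumes "!!i. coeff p i \<in> VR" "y \<in> VR"
 shows "poly p y \<in> VR & poly (map_poly rs p) (rs y) = rs (poly p y)"
 using assms
proof (induction p)
 case (pCons c p)
 have c: "c \<in> VR" using pCons.prems(1)[of 0] by simp
 have "coeff p i \<in> VR" for i using pCons.prems(1)[of "Suc i"] by simp
 then have IH: "poly p y \<in> VR" "poly (map_poly rs p) (rs y) = rs (poly p y)" using pCons.IH pCons.prems by blast+
 have "map_poly rs (pCons c p) = pCons (rs c) (map_poly rs p)" by (rule poly_eqI) (simp add: coeff_map_poly rs_simps coeff_pCons split: nat.splits)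
 then show ?case using IH c pCons.prems(2) by (simp add: rs_simps rV)
qed (simp add: rV rs_simps)

text \<open>The positive elements form a definable divisible group, so all roots needed by
  \<open>ivt_failure_ideal\<close> exist. Modulo the ideal obtained from it the polynomial has no
  root on \<open>[-3/2, 3/2]\<close> but arbitrarily small values, which \<open>no_dense_bad\<close>
  excludes over the residue field.\<close>

theorem dps_imp_ivt:
 assumes dps: "dps TYPE('a::linordered_field)" shows "ivt TYPE('a)"
proof (rule ccontr)
 assume no: "~ ivt TYPE('a)"
 have "EX y>0. y ^ m = x" if "0 < m" "0 < x" for m and x :: 'a
 proof -
  have "Def (%e. e 0 \<in> {x :: 'a. 0 < x})" unfolding mem_Collect_eq by (intro Def_intros)
  moreover have "subgrp {x :: 'a. 0 < x}" by (auto simp: subgrp_def)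
  ultimately show ?thesis using subgrp_divisible[OF dps _ _ that(1), of "{x. 0 < x}" x] that(2) by auto
 qed
 from ivt_failure_ideal[OF this no] have ex: "EX H :: 'a set. EX p. vmax H & Def (%e. e 0 \<in> H) & resid_bad H p" by simp
 from someI_ex[OF this] obtain p :: "'a poly" where p: "resid_bad resid_ideal p" unfolding resid_ideal_def if_P[OF ex] by blast
 have two: "x \<in> VR" if "\<bar>x\<bar> <= 2" for x :: 'a
 proof -
  have "x / 2 + x / 2 \<in> VR" using that by (intro rV(6) rV(3)) auto
  then show ?thesis by simp
 qed
 have pV: "coeff p i \<in> VR" for i using p two unfolding resid_bad_def by blast
 have half: "h \<in> resid_ideal ==> \<bar>h\<bar> < 1 / 2" for h :: 'a using rV(4)[OF rD(4), of h h] by (simp add: abs_if split: if_splits)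
 define B where "B = rs (3 / 2 :: 'a)"
 have "dense_bad (map_poly rs p) (- B) B"
  unfolding dense_bad_def
 proof (intro conjI allI impI)
  fix a assume a: "- B <= a" "a <= B"
  obtain y where y: "y \<in> VR" "rs y = a" using rs_surj by blast
  have m: "- B = rs (- (3 / 2))"
  proof -
   have "rs (3 / 2 :: 'a) + rs (- (3 / 2)) = 0" using rs_simps(3)[of "3 / 2 :: 'a" "- (3 / 2)"] two by (simp add: rs_simps)
   then show ?thesis unfolding B_def by (simp add: eq_neg_iff_add_eq_0 add.commute minus_equation_iff)
  qed
  have "~ rs (3 / 2) < rs y" "~ rs y < rs (- (3 / 2))" using a y m by (auto simp: B_def not_less)
  \<comment> \<open>The representative may exceed the interval by an element of the ideal; this is
    less than \<open>1/2\<close>, so \<open>|y| <= 2\<close> still holds.\<close>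
  then have "y <= 3 / 2 | y - 3 / 2 \<in> resid_ideal" "- (3 / 2) <= y | - (3 / 2) - y \<in> resid_ideal"
   using rs_simps(6)[OF two y(1), of "3 / 2"] rs_simps(6)[OF y(1) two, of "- (3 / 2)"] by auto
  moreover have "y <= 2" if "y - 3 / 2 \<in> resid_ideal" using half[OF that] unfolding abs_less_iff by linarith
  moreover have "- 2 <= y" if "- (3 / 2) - y \<in> resid_ideal" using half[OF that] unfolding abs_less_iff by linarith
  ultimately have "\<bar>y\<bar> <= 2" by (auto simp: abs_le_iff)
  then have "poly p y ~: resid_ideal" using p unfolding resid_bad_def by blast
  then have "rs (poly p y) ~= rs 0" using rs_simps(5)[of "poly p y" 0] poly_resid[OF pV y(1)] rV(11) by simp
  then show "poly (map_poly rs p) a ~= 0" using poly_resid[OF pV y(1)] y by (simp add: rs_simps)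
 next
  fix \<epsilon> :: "'a resid" assume "0 < \<epsilon>"
  obtain t where t: "t \<in> VR" "rs t = \<epsilon>" using rs_surj by blast
  have t0: "0 < t" "t ~: resid_ideal" using \<open>0 < \<epsilon>\<close> rs_simps(6)[OF rV(11) t(1)] t(2) by (auto simp: rs_simps)
  \<comment> \<open>Half of \<open>t\<close> is used because the bound for residues has to be
    strict.\<close>
  then have t2: "t / 2 ~: resid_ideal" using rD(4)[of "t / 2" "t / 2"] by auto
  then obtain y where y: "\<bar>y\<bar> <= 3 / 2" "\<bar>poly p y\<bar> <= t / 2" using p t0 unfolding resid_bad_def by (metis abs_of_pos half_gt_zero)
  have yV: "y \<in> VR" using two y by auto
  have pyV: "poly p y \<in> VR" and py: "poly (map_poly rs p) (rs y) = rs (poly p y)" using poly_resid[OF pV yV] by auto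
  have lt: "rs u < \<epsilon>" if "u \<in> VR" "\<bar>u\<bar> <= t / 2" for u
  proof -
   have "u < t" using that t0 by (auto simp: abs_le_iff)
   moreover have "t - u ~: resid_ideal"
   proof
    assume "t - u \<in> resid_ideal"
    then have "t / 2 \<in> resid_ideal" by (rule rD(3)) (use that t0 in \<open>auto simp: abs_if split: if_splits\<close>)
    then show False using t2 by simp
   qed
   ultimately show ?thesis using rs_simps(6)[OF that(1) t(1)] t(2) by simp
  qed
  have neg: "rs (- u) = - rs u" if "u \<in> VR" for u :: 'a
   using rs_simps(3)[of u "- u"] that rV(8)[of u] by (simp add: rs_simps eq_neg_iff_add_eq_0 add.commute)
  have le: "rs u <= rs v" if "u \<in> VR" "v \<in> VR" "u <= v" for u v :: 'a
   using rs_simps(6)[OF that(2,1)] that(3) by (auto simp: not_less[symmetric])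
  show "EX x. - B <= x & x <= B & \<bar>poly (map_poly rs p) x\<bar> < \<epsilon>"
  proof (intro exI[of _ "rs y"] conjI)
   show "rs y <= B" unfolding B_def using y by (intro le yV two) auto
   show "- B <= rs y" unfolding B_def neg[OF two, of "3 / 2", simplified, symmetric] using y by (intro le yV two) auto
   have "rs (poly p y) < \<epsilon>" by (rule lt[OF pyV y(2)])
   moreover have "rs (- poly p y) < \<epsilon>" by (rule lt) (use pyV y in \<open>auto intro: rV\<close>)
   ultimately show "\<bar>poly (map_poly rs p) (rs y)\<bar> < \<epsilon>" unfolding py neg[OF pyV] by (simp add: abs_less_iff minus_less_iff)
  qed
 qed
 then show False using no_dense_bad[OF dps_resid[OF dps]] by blast
qed

section \<open>Quantifier elimination and o-minimality\<close>

definition same_gap :: "'a::linordered_field set => 'a => 'a => bool" where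
 "same_gap Z x y \<longleftrightarrow> x ~: Z & y ~: Z & (ALL z:Z. z < x \<longleftrightarrow> z < y)"

lemma same_gap_refl: "x ~: Z ==> same_gap Z x x"
 by (simp add: same_gap_def)

lemma same_gap_sym: "same_gap Z x y ==> same_gap Z y x"
 by (auto simp: same_gap_def)

lemma same_gap_trans: "same_gap Z x y ==> same_gap Z y z ==> same_gap Z x z"
 by (auto simp: same_gap_def)

lemma same_gap_between: "same_gap Z x y ==> x <= t ==> t <= y ==> same_gap Z x t"
 unfolding same_gap_def by (metis leD le_less_linear order.not_eq_order_implies_strict order_trans not_le)

lemma strict_mono_less_iff: "strict_mono h ==> h x < h y \<longleftrightarrow> x < (y :: 'a::linordered_field)"
 by (simp add: strict_mono_less)

lemma same_gap_image:
 assumes "strict_mono h" shows "same_gap (h ` Z) (h x) (h y) \<longleftrightarrow> same_gap Z x y"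
 using strict_mono_less_iff[OF assms] strict_mono_eq[OF assms] by (auto simp: same_gap_def image_iff)

lemma finite_Max_below:
 fixes x :: "'a::linordered_field"
 assumes "finite Z" "EX z:Z. z < x"
 obtains l where "l \<in> Z" "l < x" "!!z. z \<in> Z ==> z < x ==> z <= l"
proof -
 let ?L = "{z \<in> Z. z < x}"
 have "finite ?L" "?L ~= {}" using assms by auto
 then have "Max ?L \<in> ?L" "!!z. z \<in> ?L ==> z <= Max ?L" using Max_in by auto
 then show thesis using that by auto
qed

text \<open>For finite \<open>Z\<close> this says that \<open>p\<close> is negative at the lower end
  of the gap of \<open>x\<close>. It is vacuously true for a gap unbounded below, as is right for an
  increasing polynomial.\<close>

definition low_neg :: "'a::linordered_field poly => 'a set => 'a => bool" where
 "low_neg p Z x \<longleftrightarrow> (ALL z:Z. z < x --> (EX z':Z. z <= z' & z' < x & poly p z' < 0))"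

definition up_pos :: "'a::linordered_field poly => 'a set => 'a => bool" where
 "up_pos p Z x \<longleftrightarrow> (ALL z:Z. x < z --> (EX z':Z. z' <= z & x < z' & 0 < poly p z'))"

definition gap_root :: "'a::linordered_field poly => 'a set => 'a => bool" where
 "gap_root p Z x \<longleftrightarrow> (EX \<rho>. same_gap Z x \<rho> & poly p \<rho> = 0)"

lemma ivt_mono_on:
 fixes p :: "'a::linordered_field poly"
 assumes ivt: "ivt TYPE('a)" and "x < y" "!!t. x < t ==> t < y ==> 0 < poly (pderiv p) t"
 shows "poly p x < poly p y"
 by (rule poly_mono_below[of "Suc (degree p)"]) (use assms in \<open>auto simp: ivt_def\<close>)

text \<open>A positive derivative makes \<open>p\<close> non-constant, so \<open>p\<close> is
  unbounded towards the left, and monotonicity excludes large positive values.\<close>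

lemma unbounded_left:
 fixes p :: "'a::linordered_field poly"
 assumes ivt: "ivt TYPE('a)" and pos: "!!t. t <= x ==> 0 < poly (pderiv p) t"
 shows "EX w<x. poly p w < 0"
proof -
 define q where "q = pcompose p [:0, -1:]"
 have q: "degree q = degree p" "poly q t = poly p (- t)" for t using pcompose_reflect[of p] by (simp_all add: q_def)
 have "pderiv p ~= 0" using pos[of x] by auto
 then have d: "0 < degree q" using q by (simp add: pderiv_eq_0_iff)
 then have "lead_coeff q ~= 0" by auto
 then consider "0 < lead_coeff q" | "0 < lead_coeff (- q)" using lead_coeff_minus[of q] by (metis neg_0_less_iff_less linorder_neqE)
 then show ?thesis
 proof cases
  case 1
  obtain M where M: "!!t. M <= t ==> poly p x + 1 <= poly q t" using poly_at_top[OF d 1, of "poly p x + 1"] by blast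
  define t where "t = max M (1 - x)"
  have "1 - x <= t" by (simp add: t_def)
  then have "- t < x" by linarith
  then have "poly p (- t) < poly p x" by (rule ivt_mono_on[OF ivt]) (use pos in auto)
  then show ?thesis using M[of t] unfolding q by (simp add: t_def)
 next
  case 2
  have d': "0 < degree (- q)" using d by simp
  obtain M where M: "!!t. M <= t ==> 1 <= poly (- q) t" using poly_at_top[OF d' 2, of 1] by blast
  define t where "t = max M (1 - x)"
  have "1 - x <= t" "M <= t" by (simp_all add: t_def)
  then have "- t < x" "poly p (- t) < 0" using M[of t] by (auto simp: q)
  then show ?thesis by blast
 qed
qed

lemma low_facts:
 fixes p :: "'a::linordered_field poly"
 assumes ivt: "ivt TYPE('a)" and Z: "finite Z" "x ~: Z" and D0: "ALL t. same_gap Z x t --> 0 < poly (pderiv p) t"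
 shows "low_neg p Z x ==> EX w<x. (ALL z:Z. z < x --> z <= w) & poly p w < 0"
  "gap_root p Z x ==> low_neg p Z x" "~ low_neg p Z x ==> 0 < poly p x"
proof -
 note D = D0[rule_format]
 have inc: "poly p l < poly p t" if l: "l \<in> Z" "l < x" "!!z. z \<in> Z ==> z < x ==> z <= l" and t: "same_gap Z x t" for l t
 proof (rule ivt_mono_on[OF ivt])
  show "l < t" using l(1,2) t by (auto simp: same_gap_def)
  fix s assume s: "l < s" "s < t"
  have "same_gap Z x s" unfolding same_gap_def
  proof (intro conjI ballI)
   have gt: "t <= z" if "z \<in> Z" "~ z < x" for z using t that by (auto simp: same_gap_def)
   show "z < x \<longleftrightarrow> z < s" if "z \<in> Z" for z using that l(3)[of z] s gt[of z] by (cases "z < x") auto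
   show "s ~: Z" using l(3)[of s] s gt[of s] by (cases "s < x") auto
  qed (rule Z)
  then show "0 < poly (pderiv p) s" by (rule D)
 qed
 show "EX w<x. (ALL z:Z. z < x --> z <= w) & poly p w < 0" if low: "low_neg p Z x"
 proof (cases "EX z:Z. z < x")
  case True
  obtain l where l: "l \<in> Z" "l < x" "!!z. z \<in> Z ==> z < x ==> z <= l" using finite_Max_below[OF Z(1) True] by blast
  obtain z' where "z' \<in> Z" "l <= z'" "z' < x" "poly p z' < 0" using low l unfolding low_neg_def by blast
  then have "poly p l < 0" using l(3)[of z'] by auto
  then show ?thesis using l by blast
 next
  case False
  have "0 < poly (pderiv p) t" if "t <= x" for t
  proof (rule D)
   show "same_gap Z x t" using False Z(2) that by (auto simp: same_gap_def)
  qed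
  from unbounded_left[OF ivt this] show ?thesis using False by blast
 qed
 show "low_neg p Z x" if r: "gap_root p Z x"
  unfolding low_neg_def
 proof (intro ballI impI)
  fix z assume z: "z \<in> Z" "z < x"
  then obtain l where l: "l \<in> Z" "l < x" "!!z. z \<in> Z ==> z < x ==> z <= l" using finite_Max_below[OF Z(1), of x] by blast
  obtain \<rho> where "same_gap Z x \<rho>" "poly p \<rho> = 0" using r unfolding gap_root_def by blast
  then have "poly p l < 0" using inc[OF l] by metis
  then show "EX z':Z. z <= z' & z' < x & poly p z' < 0" using l z by blast
 qed
 show "0 < poly p x" if "~ low_neg p Z x"
 proof -
  obtain z where z: "z \<in> Z" "z < x" "!!z'. z' \<in> Z ==> z <= z' ==> z' < x ==> ~ poly p z' < 0" using \<open>~ low_neg p Z x\<close> unfolding low_neg_def by blast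
  then obtain l where l: "l \<in> Z" "l < x" "!!z. z \<in> Z ==> z < x ==> z <= l" using finite_Max_below[OF Z(1), of x] by blast
  have "0 <= poly p l" using z(3)[OF l(1) l(3)[OF z(1,2)] l(2)] by simp
  then show ?thesis using inc[OF l same_gap_refl[OF Z(2)]] by simp
 qed
qed

lemma up_facts:
 fixes p :: "'a::linordered_field poly"
 assumes ivt: "ivt TYPE('a)" and Z: "finite Z" "x ~: Z" and D0: "ALL t. same_gap Z x t --> 0 < poly (pderiv p) t"
 shows "up_pos p Z x ==> EX w>x. (ALL z:Z. x < z --> w <= z) & 0 < poly p w"
  "gap_root p Z x ==> up_pos p Z x" "~ up_pos p Z x ==> poly p x < 0"
proof -
 define q where "q = - pcompose p [:0, -1:]"
 define Y where "Y = uminus ` Z"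
 have q: "poly q t = - poly p (- t)" for t by (simp add: q_def poly_pcompose)
 have dq: "poly (pderiv q) t = poly (pderiv p) (- t)" for t
  by (simp add: q_def pderiv_minus pderiv_pcompose pderiv_pCons poly_pcompose)
 have Y: "t \<in> Y \<longleftrightarrow> - t \<in> Z" for t unfolding Y_def by (metis image_iff minus_minus)
 have Yf: "finite Y" "- x ~: Y" using Z by (auto simp: Y_def)
 have gap: "same_gap Y (- x) t \<longleftrightarrow> same_gap Z x (- t)" for t
 proof -
  have "(ALL z:Y. z < - x \<longleftrightarrow> z < t) \<longleftrightarrow> (ALL z:Z. x < z \<longleftrightarrow> - t < z)"
   unfolding Y_def by (auto simp: less_minus_iff minus_less_iff)
  then show ?thesis unfolding same_gap_def Y by (auto; metis linorder_neqE not_less_iff_gr_or_eq)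
 qed
 have Dq: "ALL t. same_gap Y (- x) t --> 0 < poly (pderiv q) t" unfolding dq gap using D0 by blast
 note L = low_facts[OF ivt Yf Dq]
 have up: "up_pos p Z x \<longleftrightarrow> low_neg q Y (- x)"
  unfolding up_pos_def low_neg_def Y_def q by auto
 have gr: "gap_root q Y (- x) \<longleftrightarrow> gap_root p Z x"
  unfolding gap_root_def gap q by (metis minus_minus neg_equal_0_iff_equal)
 show "EX w>x. (ALL z:Z. x < z --> w <= z) & 0 < poly p w" if U: "up_pos p Z x"
 proof -
  obtain w where w: "w < - x" "ALL z:Y. z < - x --> z <= w" "poly q w < 0" using L(1) U up by blast
  have "- w <= z" if "z \<in> Z" "x < z" for z using w(2)[rule_format, of "- z"] that by (simp add: Y)
  then show ?thesis using w by (intro exI[of _ "- w"]) (auto simp: q less_minus_iff)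
 qed
 show "gap_root p Z x ==> up_pos p Z x" using L(2) up gr by blast
 show "~ up_pos p Z x ==> poly p x < 0" using L(3) up by (simp add: q)
qed

text \<open>\<open>p\<close> increases on the gap, so it has a root there just when it is negative
  at the lower end and positive at the upper one; both conditions are read off from signs on
  \<open>Z\<close>.\<close>

lemma gap_root_iff:
 fixes p :: "'a::linordered_field poly"
 assumes ivt: "ivt TYPE('a)" and Z: "finite Z" "x ~: Z" and D0: "ALL t. same_gap Z x t --> 0 < poly (pderiv p) t"
 shows "gap_root p Z x \<longleftrightarrow> low_neg p Z x & up_pos p Z x"
proof
 assume "low_neg p Z x & up_pos p Z x"
 then obtain w v where w: "w < x" "ALL z:Z. z < x --> z <= w" "poly p w < 0" and v: "x < v" "ALL z:Z. x < z --> v <= z" "0 < poly p v"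
  using low_facts(1)[OF ivt Z D0] up_facts(1)[OF ivt Z D0] by blast
 have "w < v" "poly p w * poly p v < 0" using w v by (auto simp: mult_neg_pos)
 then obtain \<rho> where \<rho>: "w < \<rho>" "\<rho> < v" "poly p \<rho> = 0"
  using ivt_root[OF ivt[unfolded ivt_def, rule_format, of "Suc (degree p)"]] by blast
 have "same_gap Z x \<rho>" unfolding same_gap_def
 proof (intro conjI ballI)
  have *: "z <= w | v <= z" if "z \<in> Z" for z using that w(2) v(2) Z(2) by (cases z x rule: linorder_cases) auto
  show "\<rho> ~: Z" using *[of \<rho>] \<rho> by auto
  show "z < x \<longleftrightarrow> z < \<rho>" if "z \<in> Z" for z using *[OF that] \<rho> w(1) v(1) by auto
 qed (rule Z)
 then show "gap_root p Z x" using \<rho> unfolding gap_root_def by blast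
qed (use low_facts(2)[OF ivt Z D0] up_facts(2)[OF ivt Z D0] in blast)

lemma gap_sgn:
 fixes p :: "'a::linordered_field poly"
 assumes ivt: "ivt TYPE('a)" and g: "same_gap Z x \<rho>" "poly p \<rho> = 0" and D0: "ALL t. same_gap Z x t --> 0 < poly (pderiv p) t"
 shows "sgn (poly p x) = sgn (x - \<rho>)"
proof (cases x \<rho> rule: linorder_cases)
 case less
 have "poly p x < poly p \<rho>"
  by (rule ivt_mono_on[OF ivt less]) (use same_gap_between[OF g(1)] D0 in auto)
 then show ?thesis using less g by simp
next
 case greater
 have "poly p \<rho> < poly p x"
  by (rule ivt_mono_on[OF ivt greater]) (use same_gap_trans[OF g(1)] same_gap_between[OF same_gap_sym[OF g(1)]] D0 in auto)
 then show ?thesis using greater g by simp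
qed (use g in simp)

lemma gap_transfer:
 fixes p p' :: "'a::linordered_field poly"
 assumes ivt: "ivt TYPE('a)" and Z: "finite Z" "x ~: Z" and h: "strict_mono h" "surj h"
  and sZ: "!!z. z \<in> Z ==> sgn (poly p z) = sgn (poly p' (h z))"
  and D0: "ALL t. same_gap Z x t --> 0 < poly (pderiv p) t" "ALL t. same_gap Z x t --> 0 < poly (pderiv p') (h t)"
 shows "gap_root p Z x \<longleftrightarrow> gap_root p' (h ` Z) (h x)"
  "~ gap_root p Z x ==> same_gap (h ` Z) (h x) y ==> sgn (poly p x) = sgn (poly p' y)"
  "same_gap Z x \<rho> ==> poly p \<rho> = 0 ==> same_gap (h ` Z) (h x) \<rho>' ==> poly p' \<rho>' = 0 ==> same_gap (h ` Z) (h x) y ==>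
   sgn (x - \<rho>) = sgn (y - \<rho>') ==> sgn (poly p x) = sgn (poly p' y)"
proof -
 have fin: "finite (h ` Z)" "h x ~: h ` Z" using Z strict_mono_eq[OF h(1)] by auto
 have D': "ALL t. same_gap (h ` Z) (h x) t --> 0 < poly (pderiv p') t"
 proof (intro allI impI)
  fix t assume g: "same_gap (h ` Z) (h x) t"
  obtain s where s: "t = h s" using h(2) by (metis surjD)
  then show "0 < poly (pderiv p') t" using g D0(2) same_gap_image[OF h(1)] by metis
 qed
 have neg: "poly p z < 0 \<longleftrightarrow> poly p' (h z) < 0" "0 < poly p z \<longleftrightarrow> 0 < poly p' (h z)" if "z \<in> Z" for z
  using sZ[OF that] by (auto simp: sgn_if split: if_splits)
 have low: "low_neg p Z x \<longleftrightarrow> low_neg p' (h ` Z) (h x)"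
  unfolding low_neg_def using neg strict_mono_less_iff[OF h(1)] strict_mono_less_eq[OF h(1)] by auto
 have up: "up_pos p Z x \<longleftrightarrow> up_pos p' (h ` Z) (h x)"
  unfolding up_pos_def using neg strict_mono_less_iff[OF h(1)] strict_mono_less_eq[OF h(1)] by auto
 show "gap_root p Z x \<longleftrightarrow> gap_root p' (h ` Z) (h x)"
  unfolding gap_root_iff[OF ivt Z D0(1)] gap_root_iff[OF ivt fin D'] low up ..
 have Dy: "ALL t. same_gap (h ` Z) y t --> 0 < poly (pderiv p') t" if "same_gap (h ` Z) (h x) y" for y
  using D' same_gap_trans that by blast
 show "sgn (poly p x) = sgn (poly p' y)" if nr: "~ gap_root p Z x" and gy: "same_gap (h ` Z) (h x) y"
 proof -
  have y: "y ~: h ` Z" using gy by (simp add: same_gap_def)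
  have ly: "low_neg p' (h ` Z) y \<longleftrightarrow> low_neg p' (h ` Z) (h x)" "up_pos p' (h ` Z) y \<longleftrightarrow> up_pos p' (h ` Z) (h x)"
  proof -
   have lt: "z < y \<longleftrightarrow> z < h x" "y < z \<longleftrightarrow> h x < z" if "z \<in> h ` Z" for z
    using \<open>same_gap (h ` Z) (h x) y\<close> that unfolding same_gap_def by (auto; metis linorder_neqE not_less_iff_gr_or_eq)+
   show "low_neg p' (h ` Z) y \<longleftrightarrow> low_neg p' (h ` Z) (h x)" unfolding low_neg_def using lt(1) by blast
   show "up_pos p' (h ` Z) y \<longleftrightarrow> up_pos p' (h ` Z) (h x)" unfolding up_pos_def using lt(2) by blast
  qed
  consider "~ low_neg p Z x" | "~ up_pos p Z x" using nr gap_root_iff[OF ivt Z D0(1)] by blast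
  then show ?thesis
  proof cases
   case 1
   then have "0 < poly p x" "0 < poly p' y" using low_facts(3)[OF ivt Z D0(1)] low_facts(3)[OF ivt fin(1) y Dy[OF gy]] ly low by blast+
   then show ?thesis by simp
  next
   case 2
   then have "poly p x < 0" "poly p' y < 0" using up_facts(3)[OF ivt Z D0(1)] up_facts(3)[OF ivt fin(1) y Dy[OF gy]] ly up by blast+
   then show ?thesis by simp
  qed
 qed
 show "sgn (poly p x) = sgn (poly p' y)" if "same_gap Z x \<rho>" "poly p \<rho> = 0" "same_gap (h ` Z) (h x) \<rho>'" "poly p' \<rho>' = 0"
  "same_gap (h ` Z) (h x) y" "sgn (x - \<rho>) = sgn (y - \<rho>')"
 proof -
  have "same_gap (h ` Z) y \<rho>'" using that(3,5) same_gap_sym same_gap_trans by blast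
  then have "sgn (poly p' y) = sgn (y - \<rho>')" using gap_sgn[OF ivt _ that(4) Dy[OF that(5)]] by blast
  then show ?thesis using gap_sgn[OF ivt that(1,2) D0(1)] that(6) by simp
 qed
qed

text \<open>A piecewise linear map, different from the identity only on a window
  \<open>(u, v)\<close> inside the gap, moves \<open>a\<close> to \<open>b\<close>.\<close>

lemma slide:
 fixes a b :: "'a::linordered_field"
 assumes Z: "finite Z" and ab: "same_gap Z a b"
 shows "EX t. strict_mono t & surj t & t a = b & (ALL x. x \<in> Z | ~ same_gap Z a x --> t x = x)"
proof -
 have *: "EX u<m. ALL z:Z. z < m --> z < u" for m
 proof (cases "EX z:Z. z < m")
  case True
  obtain l where l: "l \<in> Z" "l < m" "!!z. z \<in> Z ==> z < m ==> z <= l" using finite_Max_below[OF Z True] by blast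
  obtain u where "l < u" "u < m" using dense[OF l(2)] by blast
  then show ?thesis using l(3) by (meson le_less_trans)
 next
  case False
  then show ?thesis using lt_ex by blast
 qed
 have Zu: "finite (uminus ` Z)" using Z by simp
 have **: "EX u<m. ALL z:uminus ` Z. z < m --> z < u" for m
 proof (cases "EX z:uminus ` Z. z < m")
  case True
  obtain l where l: "l \<in> uminus ` Z" "l < m" "!!z. z \<in> uminus ` Z ==> z < m ==> z <= l" using finite_Max_below[OF Zu True] by blast
  obtain u where "l < u" "u < m" using dense[OF l(2)] by blast
  then show ?thesis using l(3) by (meson le_less_trans)
 next
  case False
  then show ?thesis using lt_ex by blast
 qed
 obtain u where u: "u < min a b" "!!z. z \<in> Z ==> z < min a b ==> z < u" using * by blast
 obtain v' where v': "v' < - max a b" "!!z. z \<in> Z ==> - z < - max a b ==> - z < v'" using **[of "- max a b"] by blast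
 define v where "v = - v'"
 have v: "max a b < v" "!!z. z \<in> Z ==> max a b < z ==> v < z" using v' by (auto simp: v_def minus_less_iff less_minus_iff)
 have noZ: "~ (u < z & z < v)" if "z \<in> Z" for z
 proof -
  have "z < a \<longleftrightarrow> z < b" "z ~= a" "z ~= b" using ab that by (auto simp: same_gap_def)
  then have "z < min a b | max a b < z" by auto
  then show ?thesis using u(2)[OF that] v(2)[OF that] by auto
 qed
 have uv: "u < a" "u < b" "a < v" "b < v" using u v by auto
 define k1 where "k1 = (b - u) / (a - u)"
 define k2 where "k2 = (v - b) / (v - a)"
 have k: "0 < k1" "0 < k2" "k1 * (a - u) = b - u" "k2 * (v - a) = v - b" using uv by (auto simp: k1_def k2_def)
 define t where "t x = (if x <= u | v <= x then x else if x <= a then u + k1 * (x - u) else v - k2 * (v - x))" for x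
 have p1: "u < t x & t x <= b" "t x = u + k1 * (x - u)" if "u < x" "x <= a" for x
 proof -
  show e: "t x = u + k1 * (x - u)" using that uv by (simp add: t_def)
  have "0 < k1 * (x - u)" "k1 * (x - u) <= k1 * (a - u)" using that k(1) by (auto intro: mult_left_mono)
  then show "u < t x & t x <= b" unfolding e using k by simp
 qed
 have p2: "b < t x & t x < v" "t x = v - k2 * (v - x)" if "a < x" "x < v" for x
 proof -
  show e: "t x = v - k2 * (v - x)" using that uv by (simp add: t_def)
  have "0 < k2 * (v - x)" "k2 * (v - x) < k2 * (v - a)" using that k(2) by (auto intro: mult_strict_left_mono)
  then show "b < t x & t x < v" unfolding e using k by simp
 qed
 have p0: "t x = x" if "x <= u | v <= x" for x using that by (simp add: t_def)
 have "strict_mono t"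
 proof (rule strict_monoI)
  fix x y :: 'a assume xy: "x < y"
  consider "x <= u" | "v <= x" | "u < x" "x <= a" | "a < x" "x < v" by linarith
  note cx = this
  consider "y <= u" | "v <= y" | "u < y" "y <= a" | "a < y" "y < v" by linarith
  note cy = this
  show "t x < t y"
  proof (cases rule: cx)
   case 1
   show ?thesis by (cases rule: cy) (use 1 xy uv p0[of x] p0[of y] p1(1)[of y] p2(1)[of y] in auto)
  next
   case 2
   then show ?thesis using p0[of x] p0[of y] xy by auto
  next
   case 3
   show ?thesis
   proof (cases rule: cy)
    case 3
    have "k1 * (x - u) < k1 * (y - u)" using xy k by simp
    then show ?thesis using p1(2)[of x] p1(2)[of y] 3 \<open>u < x\<close> \<open>x <= a\<close> by simp
   qed (use 3 xy uv p0[of y] p1(1)[of x] p2(1)[of y] in auto)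
  next
   case 4
   show ?thesis
   proof (cases rule: cy)
    case 4
    have "k2 * (v - y) < k2 * (v - x)" using xy k by simp
    then show ?thesis using p2(2)[of x] p2(2)[of y] 4 \<open>a < x\<close> \<open>x < v\<close> by simp
   qed (use 4 xy uv p0[of y] p2(1)[of x] in auto)
  qed
 qed
 moreover have "surj t"
 proof (rule surjI)
  define r where "r y = (if y <= u | v <= y then y else if y <= b then u + (y - u) / k1 else v - (v - y) / k2)" for y
  fix y
  consider "y <= u | v <= y" | "u < y" "y <= b" | "b < y" "y < v" by linarith
  then show "t (r y) = y"
  proof cases
   case 1
   then show ?thesis by (simp add: r_def p0)
  next
   case 2
   have "0 < (y - u) / k1" using 2 k by simp
   moreover have "(y - u) / k1 <= a - u" using 2 k by (simp add: pos_divide_le_eq mult.commute)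
   ultimately have "u < r y" "r y <= a" "r y = u + (y - u) / k1" using 2 uv by (auto simp: r_def)
   then show ?thesis using p1(2)[of "r y"] k by simp
  next
   case 3
   have "0 < (v - y) / k2" using 3 k by simp
   moreover have "(v - y) / k2 < v - a" using 3 k by (simp add: pos_divide_less_eq mult.commute)
   ultimately have "a < r y" "r y < v" "r y = v - (v - y) / k2" using 3 uv by (auto simp: r_def)
   then show ?thesis using p2(2)[of "r y"] k by simp
  qed
 qed
 moreover have "t a = b" using p1(2)[of a] uv k by simp
 moreover have "t x = x" if "x \<in> Z | ~ same_gap Z a x" for x
 proof (rule p0, rule ccontr)
  assume x: "~ (x <= u | v <= x)"
  then have "x ~: Z" using noZ[of x] by auto
  moreover have "z < a \<longleftrightarrow> z < x" if "z \<in> Z" for z using noZ[OF that] x uv ab by (auto simp: not_less)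
  ultimately show False using that ab by (auto simp: same_gap_def)
 qed
 ultimately show ?thesis by blast
qed

lemma slides:
 fixes Z :: "'a::linordered_field set"
 assumes Z: "finite Z" and Y: "finite Y"
 shows "(!!y. y \<in> Y ==> same_gap Z y (r y)) ==> (!!y y'. y \<in> Y ==> y' \<in> Y ==> same_gap Z y y' ==> y = y') ==>
  EX s. strict_mono s & surj s & (ALL z:Z. s z = z) & (ALL y:Y. s y = r y)"
 using Y
proof (induction Y rule: finite_induct)
 case empty
 show ?case by (intro exI[of _ id]) (auto simp: strict_mono_def)
next
 case (insert y Y)
 obtain s where s: "strict_mono s" "surj s" "!!z. z \<in> Z ==> s z = z" "!!y. y \<in> Y ==> s y = r y"
  using insert.IH insert.prems by auto
 have img: "s ` Z = Z" using s(3) by (simp add: image_def)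
 have yr: "same_gap Z y (r y)" using insert.prems(1) by blast
 have "same_gap Z y (s y)"
  using yr s(3) strict_mono_less_iff[OF s(1)] strict_mono_eq[OF s(1)] unfolding same_gap_def by metis
 then have "same_gap Z (s y) (r y)" using yr same_gap_sym same_gap_trans by blast
 from slide[OF Z this] obtain t where t: "strict_mono t" "surj t" "t (s y) = r y" "!!x. x \<in> Z | ~ same_gap Z (s y) x ==> t x = x" by blast
 have "t (s y') = r y'" if y': "y' \<in> Y" for y'
 proof -
  have "~ same_gap Z (s y) (r y')"
  proof
   assume "same_gap Z (s y) (r y')"
   then have "same_gap Z y y'" using \<open>same_gap Z y (s y)\<close> insert.prems(1)[of y'] y' same_gap_trans same_gap_sym by blast
   then show False using insert.prems(2)[of y y'] insert.hyps(2) y' by auto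
  qed
  then show ?thesis using t(4) s(4)[OF y'] by simp
 qed
 moreover have "t (s z) = z" if "z \<in> Z" for z using s(3) t(4) that by simp
 moreover have "strict_mono (t \<circ> s)" using s(1) t(1) by (simp add: strict_mono_def)
 moreover have "surj (t \<circ> s)" using s(2) t(2) by (rule comp_surj)
 ultimately show ?case using t(3) by (intro exI[of _ "t \<circ> s"] conjI) (assumption | simp)+
qed

text \<open>Both polynomials are strictly monotone on corresponding gaps, so each gap holds at most
  one root of each, and the signs on \<open>Z\<close> decide whether it does. Sliding the values of
  \<open>h\<close> within gaps puts roots over roots, and all other signs follow.\<close>

lemma match_step:
 fixes p p' :: "'a::linordered_field poly"
 assumes ivt: "ivt TYPE('a)" and Z: "finite Z" and h: "strict_mono h" "surj h"
  and sZ: "!!z. z \<in> Z ==> sgn (poly p z) = sgn (poly p' (h z))"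
  and ds: "!!x. sgn (poly (pderiv p) x) = sgn (poly (pderiv p') (h x))"
  and dz: "!!x. x ~: Z ==> poly (pderiv p) x ~= 0"
 shows "EX s. strict_mono s & surj s & (ALL z:h ` Z. s z = z) & (ALL x. sgn (poly p x) = sgn (poly p' (s (h x))))"
proof -
 have neg: "sgn (poly (- p) x) = - sgn (poly p x)" for p :: "'a poly" and x by (simp add: sgn_minus)
 have sign: "(ALL t. same_gap Z x t --> 0 < poly (pderiv p) t & 0 < poly (pderiv p') (h t)) |
   (ALL t. same_gap Z x t --> 0 < poly (pderiv (- p)) t & 0 < poly (pderiv (- p')) (h t))" if x: "x ~: Z" for x
 proof -
  have const: "sgn (poly (pderiv p) t) = sgn (poly (pderiv p) x)" if t: "same_gap Z x t" for t
  proof (cases "x <= t")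
   case True
   show ?thesis using ivt_sgn[OF ivt[unfolded ivt_def, rule_format, of "Suc (degree (pderiv p))"] _ True, of "pderiv p"]
     same_gap_between[OF t] dz unfolding same_gap_def by force
  next
   case False
   then have "t <= x" by simp
   then show ?thesis using ivt_sgn[OF ivt[unfolded ivt_def, rule_format, of "Suc (degree (pderiv p))"] _ \<open>t <= x\<close>, of "pderiv p"]
     same_gap_between[OF same_gap_sym[OF t]] dz unfolding same_gap_def by force
  qed
  show ?thesis
  proof (cases "0 < poly (pderiv p) x")
   case True
   then have "0 < poly (pderiv p) t & 0 < poly (pderiv p') (h t)" if "same_gap Z x t" for t
    using const[OF that] ds[of t] by (auto simp: sgn_if split: if_splits)
   then show ?thesis by blast
  next
   case False
   then have "poly (pderiv p) x < 0" using dz[OF x] by simp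
   then have "0 < poly (pderiv (- p)) t & 0 < poly (pderiv (- p')) (h t)" if "same_gap Z x t" for t
    using const[OF that] ds[of t] by (auto simp: pderiv_minus sgn_if split: if_splits)
   then show ?thesis by blast
  qed
 qed
 have gr: "gap_root (- p) Z x = gap_root p Z x" for p :: "'a poly" and Z x by (simp add: gap_root_def)
 have sZ': "sgn (poly (- p) z) = sgn (poly (- p') (h z))" if "z \<in> Z" for z using sZ[OF that] by (simp add: sgn_minus)
 have tr1: "gap_root p Z x \<longleftrightarrow> gap_root p' (h ` Z) (h x)" if x: "x ~: Z" for x
  using sign[OF x]
 proof
  assume d: "ALL t. same_gap Z x t --> 0 < poly (pderiv p) t & 0 < poly (pderiv p') (h t)"
  show ?thesis by (rule gap_transfer(1)[OF ivt Z x h sZ]) (use d in blast)+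
 next
  assume d: "ALL t. same_gap Z x t --> 0 < poly (pderiv (- p)) t & 0 < poly (pderiv (- p')) (h t)"
  have "gap_root (- p) Z x \<longleftrightarrow> gap_root (- p') (h ` Z) (h x)" by (rule gap_transfer(1)[OF ivt Z x h sZ']) (use d in blast)+
  then show ?thesis by (simp add: gr)
 qed
 have tr2: "sgn (poly p x) = sgn (poly p' y)" if x: "x ~: Z" and nr: "~ gap_root p Z x" and y: "same_gap (h ` Z) (h x) y" for x y
  using sign[OF x]
 proof
  assume d: "ALL t. same_gap Z x t --> 0 < poly (pderiv p) t & 0 < poly (pderiv p') (h t)"
  show ?thesis by (rule gap_transfer(2)[OF ivt Z x h sZ _ _ nr y]) (use d in blast)+
 next
  assume d: "ALL t. same_gap Z x t --> 0 < poly (pderiv (- p)) t & 0 < poly (pderiv (- p')) (h t)"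
  have "sgn (poly (- p) x) = sgn (poly (- p') y)" by (rule gap_transfer(2)[OF ivt Z x h sZ' _ _ _ y]) (use d nr gr in blast)+
  then show ?thesis unfolding neg by simp
 qed
 have tr3: "sgn (poly p x) = sgn (poly p' y)" if x: "x ~: Z" and r: "same_gap Z x \<rho>" "poly p \<rho> = 0" "same_gap (h ` Z) (h x) \<rho>'" "poly p' \<rho>' = 0"
  and y: "same_gap (h ` Z) (h x) y" "sgn (x - \<rho>) = sgn (y - \<rho>')" for x y \<rho> \<rho>'
  using sign[OF x]
 proof
  assume d: "ALL t. same_gap Z x t --> 0 < poly (pderiv p) t & 0 < poly (pderiv p') (h t)"
  show ?thesis by (rule gap_transfer(3)[OF ivt Z x h sZ _ _ r y]) (use d in blast)+
 next
  assume d: "ALL t. same_gap Z x t --> 0 < poly (pderiv (- p)) t & 0 < poly (pderiv (- p')) (h t)"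
  have "sgn (poly (- p) x) = sgn (poly (- p') y)" by (rule gap_transfer(3)[OF ivt Z x h sZ' _ _ r(1) _ r(3) _ y]) (use d r in \<open>simp_all\<close>)
  then show ?thesis unfolding neg by simp
 qed
 have uniq: "\<rho>1 = \<rho>2" if g: "same_gap Z \<rho>1 \<rho>2" "poly p \<rho>1 = 0" "poly p \<rho>2 = 0" for \<rho>1 \<rho>2
 proof -
  have x: "\<rho>1 ~: Z" using g by (simp add: same_gap_def)
  from sign[OF x] have "sgn (poly p \<rho>1) = sgn (\<rho>1 - \<rho>2) | sgn (poly (- p) \<rho>1) = sgn (\<rho>1 - \<rho>2)"
   using gap_sgn[OF ivt g(1), of p] gap_sgn[OF ivt g(1), of "- p"] g(3) by (simp del: pderiv_minus) blast
  then show ?thesis using g(2) by (auto simp: sgn_if split: if_splits)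
 qed
 have pne: "p ~= 0"
 proof
  assume "p = 0"
  moreover obtain x where "x ~: Z" using ex_new_if_finite[OF infinite_UNIV_char_0 Z] by blast
  ultimately show False using dz by auto
 qed
 define A where "A = {x. poly p x = 0 & x ~: Z}"
 have A: "finite A" unfolding A_def using poly_roots_finite[OF pne] by simp
 have "EX \<rho>'. same_gap (h ` Z) (h x) \<rho>' & poly p' \<rho>' = 0" if "x \<in> A" for x
 proof -
  have "gap_root p Z x" unfolding gap_root_def using that same_gap_refl by (auto simp: A_def)
  then show ?thesis using tr1[of x] that unfolding gap_root_def A_def by blast
 qed
 then obtain R where R: "!!x. x \<in> A ==> same_gap (h ` Z) (h x) (R x) & poly p' (R x) = 0" by metis
 define r where "r y = R (inv_into UNIV h y)" for y
 have rh: "r (h x) = R x" for x unfolding r_def using strict_mono_imp_inj_on[OF h(1)] by (simp add: inv_f_f)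
 have "EX s. strict_mono s & surj s & (ALL z:h ` Z. s z = z) & (ALL y:h ` A. s y = r y)"
 proof (rule slides)
  show "same_gap (h ` Z) y (r y)" if "y \<in> h ` A" for y using that R rh by auto
  show "y = y'" if "y \<in> h ` A" "y' \<in> h ` A" "same_gap (h ` Z) y y'" for y y'
   using that same_gap_image[OF h(1)] uniq unfolding A_def by blast
 qed (use Z A in auto)
 then obtain s where s: "strict_mono s" "surj s" "!!z. z \<in> Z ==> s (h z) = h z" "!!x. x \<in> A ==> s (h x) = R x"
  unfolding ball_simps rh by blast
 have gs: "same_gap (h ` Z) (h x) (s (h x))" if "x ~: Z" for x
  unfolding same_gap_def
 proof (intro conjI ballI)
  show "h x ~: h ` Z" using that strict_mono_eq[OF h(1)] by auto
  show "s (h x) ~: h ` Z" using that strict_mono_eq[OF h(1)] strict_mono_eq[OF s(1)] s(3) by (metis imageE)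
  show "z < h x \<longleftrightarrow> z < s (h x)" if "z \<in> h ` Z" for z using that s(3) strict_mono_less_iff[OF s(1)] by (metis imageE)
 qed
 have "sgn (poly p x) = sgn (poly p' (s (h x)))" for x
 proof (cases "x \<in> Z")
  case True
  then show ?thesis using sZ s(3) by simp
 next
  case False
  show ?thesis
  proof (cases "gap_root p Z x")
   case True
   then obtain \<rho> where \<rho>: "same_gap Z x \<rho>" "poly p \<rho> = 0" unfolding gap_root_def by blast
   then have "\<rho> \<in> A" by (auto simp: A_def same_gap_def)
   then have R\<rho>: "s (h \<rho>) = R \<rho>" "same_gap (h ` Z) (h \<rho>) (R \<rho>)" "poly p' (R \<rho>) = 0" using s(4) R by auto
   have "same_gap (h ` Z) (h x) (R \<rho>)" using R\<rho>(2) \<rho>(1) same_gap_image[OF h(1)] same_gap_trans by blast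
   moreover have "sgn (x - \<rho>) = sgn (s (h x) - R \<rho>)"
    unfolding R\<rho>(1)[symmetric] using strict_mono_less_iff[OF h(1)] strict_mono_less_iff[OF s(1)]
    strict_mono_eq[OF h(1)] strict_mono_eq[OF s(1)]
    by (cases x \<rho> rule: linorder_cases) (auto simp: sgn_if)
   ultimately show ?thesis using tr3[OF False \<rho> _ R\<rho>(3) gs[OF False]] by blast
  next
   case nr: False
   show ?thesis by (rule tr2[OF False nr gs[OF False]])
  qed
 qed
 then show ?thesis using s by (intro exI[of _ s]) auto
qed

section \<open>Sign matrices of polynomials with parameters\<close>

definition fun_ring :: "('e => 'a::linordered_field) set => bool" where
 "fun_ring K \<longleftrightarrow> (ALL c. (%e. c) \<in> K) &
   (ALL f:K. ALL g:K. (%e. f e + g e) \<in> K & (%e. f e - g e) \<in> K & (%e. f e * g e) \<in> K)"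

lemma fun_ringD:
 assumes "fun_ring K"
 shows "(%e. c) \<in> K" "f \<in> K ==> g \<in> K ==> (%e. f e + g e) \<in> K" "f \<in> K ==> g \<in> K ==> (%e. f e - g e) \<in> K"
  "f \<in> K ==> g \<in> K ==> (%e. f e * g e) \<in> K"
 using assms unfolding fun_ring_def by blast+

lemma fun_ring_sum:
 assumes K: "fun_ring K" and "finite I" and "!!i. i \<in> I ==> f i \<in> K"
 shows "(%e. \<Sum>i\<in>I. f i e) \<in> K"
 using assms(2,3)
proof (induction I rule: finite_induct)
 case (insert i I)
 then show ?case using fun_ringD(2)[OF K, of "f i" "%e. \<Sum>i\<in>I. f i e"] by simp
qed (simp add: fun_ringD[OF K])

definition fpoly :: "('e => 'a::linordered_field) list => 'e => 'a poly" where
 "fpoly L e = Poly (map (%g. g e) L)"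

definition cf :: "('e => 'a::linordered_field) list => nat => 'e => 'a" where
 "cf L i = (if i < length L then L ! i else (%e. 0))"

lemma coeff_fpoly: "coeff (fpoly L e) i = cf L i e"
 by (simp add: fpoly_def cf_def coeff_Poly_eq nth_default_def)

lemma cf_in: "fun_ring K ==> set L \<subseteq> K ==> cf L i \<in> K"
 by (auto simp: cf_def fun_ringD)

lemma cf_map: "cf (map f [0..<n]) i = (if i < n then f i else (%e. 0))"
 by (simp add: cf_def)

lemma cf_append: "cf (M @ [c]) i = (if i < length M then cf M i else if i = length M then c else (%e. 0))"
 by (auto simp: cf_def nth_append)

lemma degree_fpoly: "degree (fpoly L e) <= length L - 1"
 by (rule degree_le) (auto simp: coeff_fpoly cf_def)

definition ld :: "('e => 'a::linordered_field) list => ('e => 'a) list" where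
 "ld L = map (%i e. of_nat (Suc i) * cf L (Suc i) e) [0..<length L - 1]"

lemma ld: "pderiv (fpoly L e) = fpoly (ld L) e" "length (ld L) = length L - 1" "fun_ring K ==> set L \<subseteq> K ==> set (ld L) \<subseteq> K"
proof -
 show "pderiv (fpoly L e) = fpoly (ld L) e"
  by (rule poly_eqI) (auto simp: coeff_pderiv coeff_fpoly ld_def cf_map cf_def)
 show "fun_ring K ==> set L \<subseteq> K ==> set (ld L) \<subseteq> K" by (auto simp: ld_def intro!: fun_ringD(1,4) cf_in)
qed (simp add: ld_def)

text \<open>A pseudo-remainder; scaling by the square of the leading coefficient preserves signs.\<close>

lemma pseudo_remainder:
 assumes K: "fun_ring K" and M: "set M \<subseteq> K" "c \<in> K"
 shows "set L \<subseteq> K ==> EX R. set R \<subseteq> K & length R <= length M &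
  (ALL e x. c e ~= 0 --> poly (fpoly (M @ [c]) e) x = 0 --> sgn (poly (fpoly R e) x) = sgn (poly (fpoly L e) x))"
proof (induction "length L" arbitrary: L rule: less_induct)
 case less
 show ?case
 proof (cases "length L <= length M")
  case True
  then show ?thesis using less.prems by blast
 next
  case False
  then obtain L' a where L: "L = L' @ [a]" by (cases L rule: rev_cases) auto
  have aL: "a \<in> K" "set L' \<subseteq> K" using less.prems L by auto
  define k where "k = length L' - length M"
  have kl: "length L' = k + length M" using False L by (simp add: k_def)
  define L1 where "L1 = map (%i e. (c e * c e) * cf L' i e - (a e * c e) * cf (replicate k (%e. 0) @ M) i e) [0..<length L']"
  have rM: "set (replicate k (%e. 0) @ M) \<subseteq> K" using M fun_ringD(1)[OF K] by auto
  have cfr: "cf (replicate k (%e. 0) @ M) i \<in> K" for i by (rule cf_in[OF K rM])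
  have L1K: "set L1 \<subseteq> K" unfolding L1_def by (auto intro!: fun_ringD(3,4)[OF K] cfr cf_in[OF K aL(2)] M(2) aL(1))
  have eq: "fpoly L1 e = smult (c e * c e) (fpoly L e) - monom (a e * c e) k * fpoly (M @ [c]) e" for e
  proof (rule poly_eqI)
   fix i
   have r: "cf (replicate k (%e. 0) @ M) i e = (if k <= i then cf M (i - k) e else 0)"
    by (auto simp: cf_def nth_append)
   show "coeff (fpoly L1 e) i = coeff (smult (c e * c e) (fpoly L e) - monom (a e * c e) k * fpoly (M @ [c]) e) i"
    unfolding coeff_diff coeff_smult coeff_monom_mult coeff_fpoly L1_def cf_map L cf_append
    using r kl by (auto simp: algebra_simps)
  qed
  have "length L1 < length L" by (simp add: L1_def L)
  from less.hyps[OF this L1K] obtain R where R: "set R \<subseteq> K" "length R <= length M"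
   "!!e x. c e ~= 0 ==> poly (fpoly (M @ [c]) e) x = 0 ==> sgn (poly (fpoly R e) x) = sgn (poly (fpoly L1 e) x)" by blast
  have "sgn (poly (fpoly L1 e) x) = sgn (poly (fpoly L e) x)" if c: "c e ~= 0" and z: "poly (fpoly (M @ [c]) e) x = 0" for e x
  proof -
   have "poly (fpoly L1 e) x = (c e * c e) * poly (fpoly L e) x" unfolding eq using z by (simp add: poly_monom)
   moreover have "0 < c e * c e" using c by (metis not_square_less_zero linorder_neqE mult_eq_0_iff)
   then have "sgn (c e * c e) = 1" by simp
   ultimately show ?thesis by (simp add: sgn_mult)
  qed
  then show ?thesis using R by (intro exI[of _ R]) auto
 qed
qed

definition matched :: "('e => 'a::linordered_field) list set => 'e => 'e => ('a => 'a) => bool" where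
 "matched S e e' h \<longleftrightarrow> strict_mono h & surj h & (ALL L:S. ALL x. sgn (poly (fpoly L e) x) = sgn (poly (fpoly L e') (h x)))"

text \<open>Order automorphisms replace the comparison of sign matrices: signs of finitely many
  coefficients fix the sign patterns of \<open>S\<close> along the line up to such an
  automorphism.\<close>

definition sign_controlled :: "('e => 'a::linordered_field) set => ('e => 'a) list set => bool" where
 "sign_controlled K S \<longleftrightarrow> (EX C. finite C & C \<subseteq> K & (ALL e e'. (ALL c:C. sgn (c e) = sgn (c e')) --> (EX h. matched S e e' h)))"

text \<open>The Cohen-Hoermander step: \<open>p\<close>, of greatest length, gives way to its
  derivative, its pseudo-remainders and \<open>butlast p\<close>, all shorter. If the top
  coefficient vanishes, \<open>butlast p\<close> represents \<open>p\<close>; otherwise remainders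
  give the signs of \<open>p\<close> at the roots of the others, and \<open>match_step\<close>
  applies.\<close>

lemma sign_controlled_step:
 fixes K :: "('e => 'a::linordered_field) set"
 assumes ivt: "ivt TYPE('a)" and K: "fun_ring K" and S: "finite S" "!!L. L \<in> S ==> set L \<subseteq> K" "!!L. L \<in> S ==> length L <= N"
  and p: "p \<in> S" "length p = N" "2 <= N"
  and IH: "!!T. finite T ==> (!!L. L \<in> T ==> set L \<subseteq> K) ==> (!!L. L \<in> T - (S - {p}) ==> length L < N) ==> S - {p} \<subseteq> T ==> sign_controlled K T"
 shows "sign_controlled K S"
proof -
 define S0 where "S0 = S - {p}"
 define Q where "Q = insert (ld p) S0"
 have pK: "set p \<subseteq> K" using S p by blast
 have Q: "finite Q" "!!q. q \<in> Q ==> set q \<subseteq> K" "!!q. q \<in> Q ==> length q <= N"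
  using S ld(3)[OF K pK] ld(2)[of p] p by (auto simp: Q_def S0_def)
 \<comment> \<open>One remainder for each \<open>q\<close> and each possible degree
   \<open>d\<close>, because the degree of \<open>q\<close> depends on the parameters.\<close>
 have "EX R. set R \<subseteq> K & length R <= d & (ALL e x. (q ! d) e ~= 0 --> poly (fpoly (take (Suc d) q) e) x = 0 -->
   sgn (poly (fpoly R e) x) = sgn (poly (fpoly p e) x))" if q: "q \<in> Q" "d < length q" for q d
 proof -
  have sub: "set (take d q) \<subseteq> K" "q ! d \<in> K" using Q(2)[OF q(1)] q(2) set_take_subset[of d q] by auto
  show ?thesis using pseudo_remainder[OF K sub pK] q(2) unfolding take_Suc_conv_app_nth[OF q(2)] by simp
 qed
 then have "ALL qd. EX R. fst qd \<in> Q --> snd qd < length (fst qd) --> set R \<subseteq> K & length R <= snd qd &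
   (ALL e x. (fst qd ! snd qd) e ~= 0 --> poly (fpoly (take (Suc (snd qd)) (fst qd)) e) x = 0 -->
   sgn (poly (fpoly R e) x) = sgn (poly (fpoly p e) x))" by blast
 from choice[OF this] obtain R where R0: "ALL qd. fst qd \<in> Q --> snd qd < length (fst qd) --> set (R qd) \<subseteq> K & length (R qd) <= snd qd &
   (ALL e x. (fst qd ! snd qd) e ~= 0 --> poly (fpoly (take (Suc (snd qd)) (fst qd)) e) x = 0 -->
   sgn (poly (fpoly (R qd) e) x) = sgn (poly (fpoly p e) x))" by (elim exE)
 have R: "set (R (q, d)) \<subseteq> K" "length (R (q, d)) <= d"
  "(q ! d) e ~= 0 ==> poly (fpoly (take (Suc d) q) e) x = 0 ==> sgn (poly (fpoly (R (q, d)) e) x) = sgn (poly (fpoly p e) x)"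
  if "q \<in> Q" "d < length q" for q d e x
  using R0[rule_format, of "(q, d)"] that by simp_all
 define I where "I = (SIGMA q:Q. {..<length q})"
 have I: "finite I" unfolding I_def using Q(1) by auto
 define T where "T = S0 \<union> {butlast p, ld p} \<union> R ` I"
 have TC: "sign_controlled K T"
 proof (rule IH)
  show "finite T" using S I by (auto simp: T_def S0_def)
  have bp: "set (butlast p) \<subseteq> K" using pK in_set_butlastD by fastforce
  show "set L \<subseteq> K" if "L \<in> T" for L
  proof -
   have "L \<in> S | L = butlast p | L = ld p | L \<in> R ` I" using that unfolding T_def S0_def by blast
   then show ?thesis
   proof (elim disjE)
    assume "L \<in> R ` I"
    then obtain q d where qd: "L = R (q, d)" "q \<in> Q" "d < length q" unfolding I_def by auto
    show ?thesis unfolding qd(1) by (rule R(1)[OF qd(2,3)])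
   qed (use bp S(2) Q(2)[of "ld p"] in \<open>auto simp: Q_def\<close>)
  qed
  show "length L < N" if L: "L \<in> T - (S - {p})" for L
  proof -
   have "L = butlast p | L = ld p | L \<in> R ` I" using L unfolding T_def S0_def by blast
   then show ?thesis
   proof (elim disjE)
    assume "L \<in> R ` I"
    then obtain q d where qd: "L = R (q, d)" "q \<in> Q" "d < length q" unfolding I_def by auto
    have "length L <= d" unfolding qd(1) by (rule R(2)[OF qd(2,3)])
    then show ?thesis using qd(3) Q(3)[OF qd(2)] by linarith
   qed (use p ld(2)[of p] in auto)
  qed
  show "S - {p} \<subseteq> T" by (auto simp: T_def S0_def)
 qed
 then obtain CT where CT: "finite CT" "CT \<subseteq> K" "!!e e'. (ALL c:CT. sgn (c e) = sgn (c e')) ==> EX h. matched T e e' h"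
  unfolding sign_controlled_def by blast
 define C where "C = CT \<union> (\<Union>q\<in>insert p Q. set q)"
 show ?thesis unfolding sign_controlled_def
 proof (intro exI[of _ C] conjI allI impI)
  show "finite C" using CT(1) Q(1) by (auto simp: C_def)
  show "C \<subseteq> K" using CT(2) Q(2) pK by (auto simp: C_def)
  fix e e' assume agree: "ALL c:C. sgn (c e) = sgn (c e')"
  obtain h where h: "strict_mono h" "surj h" and hT: "!!L x. L \<in> T ==> sgn (poly (fpoly L e) x) = sgn (poly (fpoly L e') (h x))"
   using CT(3)[of e e'] agree unfolding matched_def C_def by blast
  have cz: "cf q i e = 0 \<longleftrightarrow> cf q i e' = 0" if "q \<in> insert p Q" for q i
  proof (cases "i < length q")
   case True
   then have "q ! i \<in> C" using that unfolding C_def by (metis UN_I UnI2 nth_mem)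
   then have "sgn ((q ! i) e) = sgn ((q ! i) e')" using agree by blast
   then show ?thesis using True by (auto simp: cf_def sgn_if split: if_splits)
  qed (simp add: cf_def)
  have pz: "fpoly q e = 0 \<longleftrightarrow> fpoly q e' = 0" if "q \<in> insert p Q" for q
   using cz[OF that] by (simp add: poly_eq_iff coeff_fpoly)
  show "EX h. matched S e e' h"
  proof (cases "cf p (N - 1) e = 0")
   case True
   then have "cf p (N - 1) e' = 0" using cz by blast
   moreover have "cf (butlast p) i = (if i < N - 1 then cf p i else (%e. 0))" for i
    using p by (auto simp: cf_def nth_butlast)
   then have "cf p i f = cf (butlast p) i f" if "cf p (N - 1) f = 0" for i f
    using that p by (cases "i = N - 1") (auto simp: cf_def)
   ultimately have bl: "fpoly p e = fpoly (butlast p) e" "fpoly p e' = fpoly (butlast p) e'"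
    using True by (simp_all add: poly_eq_iff coeff_fpoly)
   have "sgn (poly (fpoly L e) x) = sgn (poly (fpoly L e') (h x))" if "L \<in> S" for L x
    using hT[of L x] hT[of "butlast p" x] bl that by (cases "L = p") (auto simp: T_def S0_def)
   then show ?thesis using h unfolding matched_def by blast
  next
   case False
   define Z where "Z = {z. EX q:Q. fpoly q e ~= 0 & poly (fpoly q e) z = 0}"
   have Zf: "finite Z"
   proof -
    have "Z = (\<Union>q\<in>{q \<in> Q. fpoly q e ~= 0}. {z. poly (fpoly q e) z = 0})" by (auto simp: Z_def)
    then show ?thesis using Q(1) by (auto intro: poly_roots_finite)
   qed
   have QT: "Q \<subseteq> T" by (auto simp: Q_def T_def)
   have dnz: "fpoly (ld p) e ~= 0"
   proof
    assume "fpoly (ld p) e = 0"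
    then have "coeff (fpoly (ld p) e) (N - 2) = 0" by simp
    moreover have N2: "Suc (N - 2) = N - 1" "N - 2 < length p - 1" using p by auto
    have "coeff (fpoly (ld p) e) (N - 2) = of_nat (Suc (N - 2)) * cf p (Suc (N - 2)) e"
     using N2(2) by (simp add: coeff_fpoly ld_def cf_map)
    ultimately have "of_nat (Suc (N - 2)) * cf p (Suc (N - 2)) e = 0" by argo
    then have "cf p (Suc (N - 2)) e = 0" using of_nat_neq_0 by (metis mult_eq_0_iff)
    then show False using False unfolding N2(1) by blast
   qed
   have "EX s. strict_mono s & surj s & (ALL z:h ` Z. s z = z) & (ALL x. sgn (poly (fpoly p e) x) = sgn (poly (fpoly p e') (s (h x))))"
   proof (rule match_step[OF ivt Zf h])
    show "sgn (poly (pderiv (fpoly p e)) x) = sgn (poly (pderiv (fpoly p e')) (h x))" for x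
     unfolding ld(1) by (rule hT) (simp add: T_def)
    show "poly (pderiv (fpoly p e)) x ~= 0" if "x ~: Z" for x
     using that dnz unfolding ld(1) Z_def Q_def by blast
    show "sgn (poly (fpoly p e) z) = sgn (poly (fpoly p e') (h z))" if zZ: "z \<in> Z" for z
    proof -
     obtain q where q: "q \<in> Q" "fpoly q e ~= 0" "poly (fpoly q e) z = 0" using zZ unfolding Z_def by blast
     define d where "d = degree (fpoly q e)"
     have cd: "cf q d e ~= 0" "!!i. d < i ==> cf q i e = 0"
      using q(2) coeff_eq_0[of "fpoly q e"] unfolding d_def coeff_fpoly[symmetric] by auto
     have dl: "d < length q" using cd(1) by (auto simp: cf_def split: if_splits)
     have cd': "cf q d e' ~= 0" "!!i. d < i ==> cf q i e' = 0" using cd cz[of q] q(1) by auto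
     have take: "fpoly (take (Suc d) q) e = fpoly q e" "fpoly (take (Suc d) q) e' = fpoly q e'"
     proof -
      have "cf (take (Suc d) q) i = (if i <= d then cf q i else (%e. 0))" for i using dl by (auto simp: cf_def)
      then show "fpoly (take (Suc d) q) e = fpoly q e" "fpoly (take (Suc d) q) e' = fpoly q e'"
       using cd(2) cd'(2) by (auto simp: poly_eq_iff coeff_fpoly)
     qed
     have z': "poly (fpoly q e') (h z) = 0" using hT[of q z] q QT by (auto simp: sgn_if split: if_splits)
     have qd: "(q ! d) e ~= 0" "(q ! d) e' ~= 0" using cd cd' dl by (auto simp: cf_def)
     have "sgn (poly (fpoly p e) z) = sgn (poly (fpoly (R (q, d)) e) z)"
      using R(3)[OF q(1) dl qd(1)] take(1) q(3) by simp
     also have "\<dots> = sgn (poly (fpoly (R (q, d)) e') (h z))"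
      by (rule hT) (use q(1) dl in \<open>auto simp: T_def I_def\<close>)
     also have "\<dots> = sgn (poly (fpoly p e') (h z))"
      using R(3)[OF q(1) dl qd(2)] take(2) z' by simp
     finally show ?thesis .
    qed
   qed
   then obtain s where s: "strict_mono s" "surj s" "!!z. z \<in> h ` Z ==> s z = z"
    "!!x. sgn (poly (fpoly p e) x) = sgn (poly (fpoly p e') (s (h x)))" by blast
   have "sgn (poly (fpoly L e) x) = sgn (poly (fpoly L e') (s (h x)))" if L: "L \<in> S" for L x
   proof (cases "L = p")
    case True
    then show ?thesis using s(4) by simp
   next
    case False
    then have LQ: "L \<in> Q" using L by (simp add: Q_def S0_def)
    have eq: "sgn (poly (fpoly L e) x) = sgn (poly (fpoly L e') (h x))" for x using hT LQ QT by blast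
    \<comment> \<open>\<open>s\<close> fixes all roots of this polynomial, so none of them lies
      between \<open>y\<close> and \<open>s y\<close>.\<close>
    have "sgn (poly (fpoly L e') y) = sgn (poly (fpoly L e') (s y))" for y
    proof (cases "y \<in> h ` Z | fpoly L e' = 0")
     case True
     then show ?thesis using s(3) by auto
    next
     case nz: False
     have root: "t \<in> h ` Z" if tz: "poly (fpoly L e') t = 0" for t
     proof -
      obtain w where w: "t = h w" using h(2) by (metis surjD)
      then have "poly (fpoly L e) w = 0" using eq[of w] tz by (auto simp: sgn_if split: if_splits)
      then show ?thesis using w LQ nz pz[of L] unfolding Z_def by blast
     qed
     have noz: "~ (y <= t & t <= s y | s y <= t & t <= y)" if t: "t \<in> h ` Z" for t
     proof -
      have st: "s t = t" using s(3) t .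
      have "t ~= y" using t nz by auto
      then consider "t < y" | "y < t" by linarith
      then show ?thesis
      proof cases
       case 1
       then have "s t < s y" using s(1) by (simp add: strict_mono_def)
       then show ?thesis using 1 st by auto
      next
       case 2
       then have "s y < s t" using s(1) by (simp add: strict_mono_def)
       then show ?thesis using 2 st by auto
      qed
     qed
     note iv = ivt_sgn[OF ivt[unfolded ivt_def, rule_format, of "Suc (degree (fpoly L e'))"], of "fpoly L e'"]
     show ?thesis
     proof (cases "y <= s y")
      case True
      show ?thesis by (rule iv) (use True root noz in auto)
     next
      case False
      have "sgn (poly (fpoly L e') (s y)) = sgn (poly (fpoly L e') y)" by (rule iv) (use False root noz in auto)
      then show ?thesis by simp
     qed
    qed
    then show ?thesis using eq by simp
   qed
   moreover have "strict_mono (s \<circ> h)" using s(1) h(1) by (simp add: strict_mono_def)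
   moreover have "surj (s \<circ> h)" using h(2) s(2) by (rule comp_surj)
   ultimately show ?thesis unfolding matched_def by (intro exI[of _ "s \<circ> h"]) (metis comp_apply)
  qed
 qed
qed

text \<open>Induction on the greatest length and, within it, on the number of lists attaining it:
  each step removes one such list and adds only shorter ones.\<close>

lemma sign_controlled:
 fixes K :: "('e => 'a::linordered_field) set"
 assumes ivt: "ivt TYPE('a)" and K: "fun_ring K"
 shows "finite S ==> (!!L. L \<in> S ==> set L \<subseteq> K) ==> (!!L. L \<in> S ==> length L <= N) ==> sign_controlled K S"
proof (induction N arbitrary: S rule: less_induct)
 case (less N)
 show ?case
 proof (cases "N <= 1")
  case True
  define C where "C = (\<Union>L\<in>S. set L)"
  have "EX h. matched S e e' h" if agree: "ALL c:C. sgn (c e) = sgn (c e')" for e e'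
  proof -
   have "sgn (poly (fpoly L e) x) = sgn (poly (fpoly L e') x)" if L: "L \<in> S" for L x
   proof -
    have "length L <= 1" using less.prems(3)[OF L] True by simp
    then consider "L = []" | g where "L = [g]" by (cases L) auto
    then show ?thesis
    proof cases
     case 2
     then have "sgn (g e) = sgn (g e')" using agree L by (auto simp: C_def)
     then show ?thesis using 2 by (simp add: fpoly_def)
    qed (simp add: fpoly_def)
   qed
   then show ?thesis unfolding matched_def by (intro exI[of _ "%x. x"]) (auto simp: strict_mono_def)
  qed
  then show ?thesis unfolding sign_controlled_def using less.prems by (intro exI[of _ C]) (auto simp: C_def)
 next
  case False
  have "card {L \<in> S. length L = N} = k ==> sign_controlled K S"
   if "finite S" "!!L. L \<in> S ==> set L \<subseteq> K" "!!L. L \<in> S ==> length L <= N" for k S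
   using that
  proof (induction k arbitrary: S)
   case 0
   then have "{L \<in> S. length L = N} = {}" by simp
   then have "length L <= N - 1" if "L \<in> S" for L using 0(4)[OF that] that by fastforce
   then show ?case using less.IH[of "N - 1" S] 0 False by simp
  next
   case (Suc k)
   then obtain p where p: "p \<in> S" "length p = N" by (metis (mono_tags, lifting) card.empty empty_Collect_eq nat.distinct(1))
   show ?case
   proof (rule sign_controlled_step[OF ivt K Suc.prems(2-4) p])
    show "2 <= N" using False by simp
    fix T assume T: "finite T" "!!L. L \<in> T ==> set L \<subseteq> K" "!!L. L \<in> T - (S - {p}) ==> length L < N" "S - {p} \<subseteq> T"
    have "{L \<in> T. length L = N} = {L \<in> S. length L = N} - {p}" using T(3,4) by fastforce
    then have "card {L \<in> T. length L = N} = k" using Suc.prems(1,2) p by simp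
    moreover have "length L <= N" if "L \<in> T" for L using T(3)[of L] Suc.prems(4)[of L] that by fastforce
    ultimately show "sign_controlled K T" using Suc.IH T(1,2) by blast
   qed
  qed
  then show ?thesis using less.prems by blast
 qed
qed

section \<open>Quantifier elimination\<close>

inductive_set term_funs :: "((nat => 'a::linordered_field) => 'a) set" where
 coord: "(%e. e k) \<in> term_funs"
| const: "(%e. c) \<in> term_funs"
| add: "f \<in> term_funs ==> g \<in> term_funs ==> (%e. f e + g e) \<in> term_funs"
| diff: "f \<in> term_funs ==> g \<in> term_funs ==> (%e. f e - g e) \<in> term_funs"
| mult: "f \<in> term_funs ==> g \<in> term_funs ==> (%e. f e * g e) \<in> term_funs"

lemma evalt_term_funs: "(%e. evalt ofield e t) \<in> term_funs"
 by (induction t) (auto intro: term_funs.intros)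

definition free_funs :: "nat => ((nat => 'a::linordered_field) => 'a) set" where
 "free_funs n = {f \<in> term_funs. ALL e x. f (e(n := x)) = f e}"

lemma fun_ring_free: "fun_ring (free_funs n)"
 by (auto simp: fun_ring_def free_funs_def intro: term_funs.intros)

lemma term_funs_poly:
 "c \<in> term_funs ==> EX L. set L \<subseteq> free_funs n & (ALL e. c e = poly (fpoly L e) (e n))"
proof (induction rule: term_funs.induct)
 case (coord k)
 show ?case
 proof (cases "k = n")
  case True
  have "set [%e. 0, %e. 1] \<subseteq> free_funs n" using fun_ringD(1)[OF fun_ring_free] by auto
  moreover have "e k = poly (fpoly [%e. 0, %e. 1] e) (e n)" for e :: "nat => 'a" using True by (simp add: fpoly_def)
  ultimately show ?thesis by blast
 next
  case False
  have "(%e. e k) \<in> free_funs n" using False term_funs.coord by (simp add: free_funs_def)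
  then show ?thesis by (intro exI[of _ "[%e. e k]"]) (auto simp: fpoly_def)
 qed
next
 case (const c)
 show ?case using fun_ringD(1)[OF fun_ring_free, of c n] by (intro exI[of _ "[%e. c]"]) (auto simp: fpoly_def)
next
 case (add f g)
 then obtain L M where L: "set L \<subseteq> free_funs n" "!!e. f e = poly (fpoly L e) (e n)" and M: "set M \<subseteq> free_funs n" "!!e. g e = poly (fpoly M e) (e n)" by blast
 let ?S = "map (%i e. cf L i e + cf M i e) [0..<length L + length M]"
 have "fpoly ?S e = fpoly L e + fpoly M e" for e
  by (rule poly_eqI) (auto simp: coeff_fpoly cf_map, auto simp: cf_def)
 moreover have "set ?S \<subseteq> free_funs n" using cf_in[OF fun_ring_free L(1)] cf_in[OF fun_ring_free M(1)] by (auto intro!: fun_ringD(2)[OF fun_ring_free])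
 ultimately show ?case using L(2) M(2) by (intro exI[of _ ?S]) simp
next
 case (diff f g)
 then obtain L M where L: "set L \<subseteq> free_funs n" "!!e. f e = poly (fpoly L e) (e n)" and M: "set M \<subseteq> free_funs n" "!!e. g e = poly (fpoly M e) (e n)" by blast
 let ?S = "map (%i e. cf L i e - cf M i e) [0..<length L + length M]"
 have "fpoly ?S e = fpoly L e - fpoly M e" for e
  by (rule poly_eqI) (auto simp: coeff_fpoly cf_map, auto simp: cf_def)
 moreover have "set ?S \<subseteq> free_funs n" using cf_in[OF fun_ring_free L(1)] cf_in[OF fun_ring_free M(1)] by (auto intro!: fun_ringD(3)[OF fun_ring_free])
 ultimately show ?case using L(2) M(2) by (intro exI[of _ ?S]) simp
next
 case (mult f g)
 then obtain L M where L: "set L \<subseteq> free_funs n" "!!e. f e = poly (fpoly L e) (e n)" and M: "set M \<subseteq> free_funs n" "!!e. g e = poly (fpoly M e) (e n)" by blast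
 let ?S = "map (%i e. \<Sum>j\<in>{..i}. cf L j e * cf M (i - j) e) [0..<length L + length M]"
 have "fpoly ?S e = fpoly L e * fpoly M e" for e
 proof (rule poly_eqI)
  fix i
  have "(\<Sum>j\<le>i. cf L j e * cf M (i - j) e) = 0" if "~ i < length L + length M"
  proof (rule sum.neutral, rule ballI)
   fix j assume "j \<in> {..i}"
   then show "cf L j e * cf M (i - j) e = 0" using that by (cases "j < length L") (auto simp: cf_def)
  qed
  then show "coeff (fpoly ?S e) i = coeff (fpoly L e * fpoly M e) i" by (simp add: coeff_mult coeff_fpoly cf_map)
 qed
 moreover have "(%e. \<Sum>j\<in>{..i}. cf L j e * cf M (i - j) e) \<in> free_funs n" for i
  by (intro fun_ring_sum[OF fun_ring_free] fun_ringD(4)[OF fun_ring_free] cf_in[OF fun_ring_free] L(1) M(1)) simp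
 then have "set ?S \<subseteq> free_funs n" by auto
 ultimately show ?case using L(2) M(2) by (intro exI[of _ ?S]) simp
qed

lemma fpoly_free: "set L \<subseteq> free_funs n ==> fpoly L (e(n := x)) = fpoly L e"
 unfolding fpoly_def by (intro arg_cong[of _ _ Poly] map_cong) (auto simp: free_funs_def)

definition sign_det :: "((nat => 'a::linordered_field) => 'a) set => ((nat => 'a) => bool) => bool" where
 "sign_det C P \<longleftrightarrow> finite C & C \<subseteq> term_funs & (ALL e e'. (ALL c:C. sgn (c e) = sgn (c e')) --> P e = P e')"

text \<open>The automorphism given by \<open>sign_controlled\<close> preserves the signs that decide
  the body, so it carries a witness at \<open>e\<close> to a witness at \<open>e'\<close>. Finitely
  many signs of coefficients therefore decide whether a witness exists.\<close>

lemma quantifier_elimination: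
 assumes ivt: "ivt TYPE('a::linordered_field)"
 shows "EX C. sign_det C (%e :: nat => 'a. sat ofield e \<phi>)"
proof (induction \<phi>)
 case (Eq s t)
 have "sign_det {%e. evalt ofield e s - evalt ofield e t} (%e :: nat => 'a. sat ofield e (Eq s t))"
  unfolding sign_det_def by (auto simp: sgn_if intro!: term_funs.diff evalt_term_funs split: if_splits)
 then show ?case by blast
next
 case (Lt s t)
 have "sign_det {%e. evalt ofield e s - evalt ofield e t} (%e :: nat => 'a. sat ofield e (Lt s t))"
  unfolding sign_det_def by (auto simp: sgn_if intro!: term_funs.diff evalt_term_funs split: if_splits)
 then show ?case by blast
next
 case (Neg p)
 then show ?case by (simp add: sign_det_def)
next
 case (Conj p q)
 then obtain C D where "sign_det C (%e :: nat => 'a. sat ofield e p)" "sign_det D (%e :: nat => 'a. sat ofield e q)" by blast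
 then have "sign_det (C \<union> D) (%e :: nat => 'a. sat ofield e (Conj p q))" unfolding sign_det_def sat.simps
  by (intro conjI allI impI) (simp_all, blast)
 then show ?case by blast
next
 case (Ex n p)
 then obtain C where C: "finite C" "C \<subseteq> term_funs" "!!e e' :: nat => 'a. ALL c:C. sgn (c e) = sgn (c e') ==> sat ofield e p = sat ofield e' p"
  unfolding sign_det_def by blast
 have "ALL c. EX L. c \<in> C --> set L \<subseteq> free_funs n & (ALL e. c e = poly (fpoly L e) (e n))" using term_funs_poly C(2) by blast
 from choice[OF this] obtain L where L: "!!c. c \<in> C ==> set (L c) \<subseteq> free_funs n" "!!c e. c \<in> C ==> c e = poly (fpoly (L c) e) (e n)" by blast
 have Lf: "finite (L ` C)" using C(1) by simp
 define N where "N = Max (insert 0 (length ` L ` C))"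
 have LN: "length l <= N" if "l \<in> L ` C" for l unfolding N_def using Lf that by (intro Max_ge) auto
 have "sign_controlled (free_funs n) (L ` C)"
  by (rule sign_controlled[OF ivt fun_ring_free Lf _ LN]) (use L(1) in auto)
 then obtain D where D: "finite D" "D \<subseteq> free_funs n" "!!e e' :: nat => 'a. ALL c:D. sgn (c e) = sgn (c e') ==> EX h. matched (L ` C) e e' h"
  unfolding sign_controlled_def by blast
 have imp: "sat ofield e' (Ex n p)" if agree: "ALL c:D. sgn (c e) = sgn (c e')" and s: "sat ofield e (Ex n p)" for e e' :: "nat => 'a"
 proof -
  obtain h where h: "matched (L ` C) e e' h" using D(3)[OF agree] by blast
  obtain a where a: "sat ofield (e(n := a)) p" using s by auto
  have "sgn (c (e(n := a))) = sgn (c (e'(n := h a)))" if c: "c \<in> C" for c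
  proof -
   have ev: "c (f(n := x)) = poly (fpoly (L c) f) x" for f x
    using L(2)[OF c, of "f(n := x)"] fpoly_free[OF L(1)[OF c], of f x] by simp
   show ?thesis unfolding ev using h[unfolded matched_def] c by blast
  qed
  then have "sat ofield (e'(n := h a)) p" using C(3)[of "e(n := a)" "e'(n := h a)"] a by blast
  then show ?thesis by auto
 qed
 have "sign_det D (%e :: nat => 'a. sat ofield e (Ex n p))"
  unfolding sign_det_def
 proof (intro conjI allI impI)
  show "D \<subseteq> term_funs" using D(2) by (auto simp: free_funs_def)
  fix e e' :: "nat => 'a" assume "ALL c:D. sgn (c e) = sgn (c e')"
  then show "sat ofield e (Ex n p) = sat ofield e' (Ex n p)" using imp[of e e'] imp[of e' e] by metis
 qed (rule D(1))
 then show ?case by blast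
qed

section \<open>Uniform o-minimality and its transfer\<close>

definition same_type :: "'b set => ('b => 'b => bool) => 'b => 'b => bool" where
 "same_type A R x y \<longleftrightarrow> (ALL c:A. (R c x \<longleftrightarrow> R c y) & (c = x \<longleftrightarrow> c = y))"

text \<open>The cut points are the roots, in the home variable, of the polynomials whose signs
  decide \<open>\<phi>\<close>; identically zero ones contribute none. Lengths of coefficient lists
  bound their number uniformly.\<close>

lemma o_minimal:
 assumes ivt: "ivt TYPE('a::linordered_field)"
 shows "EX N. ALL e :: nat => 'a. EX A. finite A & card A <= N &
  (ALL x y. same_type A (<) x y --> sat ofield (e(0 := x)) \<phi> = sat ofield (e(0 := y)) \<phi>)"
proof -
 obtain C where C: "finite C" "C \<subseteq> term_funs" "!!e e' :: nat => 'a. ALL c:C. sgn (c e) = sgn (c e') ==> sat ofield e \<phi> = sat ofield e' \<phi>"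
  using quantifier_elimination[OF ivt, of \<phi>] unfolding sign_det_def by blast
 have "ALL c. EX L. c \<in> C --> set L \<subseteq> free_funs 0 & (ALL e. c e = poly (fpoly L e) (e 0))" using term_funs_poly C(2) by blast
 from choice[OF this] obtain L where L: "!!c. c \<in> C ==> set (L c) \<subseteq> free_funs 0" "!!c e. c \<in> C ==> c e = poly (fpoly (L c) e) (e 0)" by blast
 show ?thesis
 proof (intro exI[of _ "\<Sum>c\<in>C. length (L c)"] allI)
  fix e :: "nat => 'a"
  define Z where "Z c = (if fpoly (L c) e = 0 then {} else {x. poly (fpoly (L c) e) x = 0})" for c
  have Z: "finite (Z c)" "card (Z c) <= length (L c)" for c
  proof -
   show "finite (Z c)" using poly_roots_finite by (auto simp: Z_def)
   show "card (Z c) <= length (L c)"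
   proof (cases "fpoly (L c) e = 0")
    case False
    show ?thesis using card_poly_roots_bound[OF False] degree_fpoly[of "L c" e] False by (simp add: Z_def)
   qed (simp add: Z_def)
  qed
  define A where "A = (\<Union>c\<in>C. Z c)"
  have "card A <= (\<Sum>c\<in>C. card (Z c))" unfolding A_def by (rule card_UN_le[OF C(1)])
  also have "\<dots> <= (\<Sum>c\<in>C. length (L c))" using Z by (intro sum_mono) auto
  finally have cA: "card A <= (\<Sum>c\<in>C. length (L c))" .
  have key: "sat ofield (e(0 := x)) \<phi> = sat ofield (e(0 := y)) \<phi>" if xy: "x <= y" and s: "same_type A (<) x y" for x y
  proof (rule C(3), rule ballI)
   fix c assume c: "c \<in> C"
   have "sgn (poly (fpoly (L c) e) x) = sgn (poly (fpoly (L c) e) y)"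
   proof (cases "x = y | fpoly (L c) e = 0")
    case False
    have "poly (fpoly (L c) e) t ~= 0" if t: "x <= t" "t <= y" for t
    proof
     assume "poly (fpoly (L c) e) t = 0"
     then have "t \<in> A" using False c by (auto simp: A_def Z_def)
     then have "(t < x \<longleftrightarrow> t < y) & (t = x \<longleftrightarrow> t = y)" using s unfolding same_type_def by blast
     then show False using t xy False by auto
    qed
    then show ?thesis using ivt_sgn[OF ivt[unfolded ivt_def, rule_format, of "Suc (degree (fpoly (L c) e))"] _ xy, of "fpoly (L c) e"] by auto
   qed auto
   moreover have "c (e(0 := x)) = poly (fpoly (L c) e) x" for x
    using L(2)[OF c, of "e(0 := x)"] fpoly_free[OF L(1)[OF c], of e x] by simp
   ultimately show "sgn (c (e(0 := x))) = sgn (c (e(0 := y)))" by simp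
  qed
  have "sat ofield (e(0 := x)) \<phi> = sat ofield (e(0 := y)) \<phi>" if s: "same_type A (<) x y" for x y
  proof (cases "x <= y")
   case False
   have "same_type A (<) y x" using s by (auto simp: same_type_def)
   then show ?thesis using key[of y x] False by simp
  qed (use key s in blast)
  then show "EX A. finite A & card A <= (\<Sum>c\<in>C. length (L c)) &
    (ALL x y. same_type A (<) x y --> sat ofield (e(0 := x)) \<phi> = sat ofield (e(0 := y)) \<phi>)"
   using Z(1) C(1) cA by (intro exI[of _ A]) (auto simp: A_def)
 qed
qed

definition Iff :: "fm => fm => fm" where
 "Iff p q = Conj (Neg (Conj p (Neg q))) (Neg (Conj q (Neg p)))"

lemma sat_Iff [simp]: "sat M e (Iff p q) \<longleftrightarrow> (sat M e p \<longleftrightarrow> sat M e q)" and fv_Iff [simp]: "fv (Iff p q) = fv p \<union> fv q"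
 by (auto simp: Iff_def)

definition alls :: "nat list => fm => fm" where "alls xs p = Neg (exs xs (Neg p))"

lemma fv_alls [simp]: "fv (alls xs p) = fv p - set xs"
 by (simp add: alls_def)

lemma sat_alls: "sat M e (alls xs p) \<longleftrightarrow>
 (ALL e'. (ALL i. i ~: set xs --> e' i = e i) --> (ALL i:set xs. e' i \<in> carrier M) --> sat M e' p)"
 by (auto simp: alls_def sat_exs)

text \<open>The cut points are the variables from \<open>N\<close> on, followed by the two points compared.\<close>

definition cut_fm :: "fm => nat => nat => fm" where
 "cut_fm \<phi> N K = exs [N..<N + K] (alls [N + K, N + K + 1]
   (Neg (Conj (conjs (map (%i. Conj (Iff (Lt (Var i) (Var (N + K))) (Lt (Var i) (Var (N + K + 1))))
    (Iff (Eq (Var i) (Var (N + K))) (Eq (Var i) (Var (N + K + 1))))) [N..<N + K]))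
    (Neg (Iff (rn (id(0 := N + K)) \<phi>) (rn (id(0 := N + K + 1)) \<phi>))))))"

lemma sat_cut_fm:
 fixes M :: "'b struc"
 assumes e: "valid M e" and N: "fv \<phi> \<subseteq> {..<N}" "0 < N"
 shows "sat M e (cut_fm \<phi> N K) \<longleftrightarrow> (EX c. (ALL i<K. c i \<in> carrier M) &
   (ALL x:carrier M. ALL y:carrier M. same_type (c ` {..<K}) (slt M) x y --> sat M (e(0 := x)) \<phi> = sat M (e(0 := y)) \<phi>))"
proof -
 define up where "up c x y i = (if i < N then e i else if i < N + K then c (i - N) else if i = N + K then x else if i = N + K + 1 then y else e i)"
  for c :: "nat => 'b" and x y i
 have cut: "(ALL i:{N..<N + K}. Q (c (i - N))) \<longleftrightarrow> (ALL a:c ` {..<K}. Q a)" for c :: "nat => 'b" and Q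
 proof safe
  fix i assume "ALL i:{N..<N + K}. Q (c (i - N))" "i < K"
  then show "Q (c i)" by (auto dest: bspec[of _ _ "N + i"])
 next
  fix i assume "ALL a:c ` {..<K}. Q a" "i \<in> {N..<N + K}"
  then show "Q (c (i - N))" by auto
 qed
 have r1: "sat M (up c x y) (rn (id(0 := N + K)) \<phi>) = sat M (e(0 := x)) \<phi>"
  and r2: "sat M (up c x y) (rn (id(0 := N + K + 1)) \<phi>) = sat M (e(0 := y)) \<phi>" for c x y
  unfolding sat_rn by (rule sat_cong; use N in \<open>auto simp: up_def\<close>)+
 define body where "body = Neg (Conj (conjs (map (%i. Conj (Iff (Lt (Var i) (Var (N + K))) (Lt (Var i) (Var (N + K + 1))))
    (Iff (Eq (Var i) (Var (N + K))) (Eq (Var i) (Var (N + K + 1))))) [N..<N + K]))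
    (Neg (Iff (rn (id(0 := N + K)) \<phi>) (rn (id(0 := N + K + 1)) \<phi>))))"
 have body: "sat M (up c x y) body \<longleftrightarrow> (same_type (c ` {..<K}) (slt M) x y --> sat M (e(0 := x)) \<phi> = sat M (e(0 := y)) \<phi>)" for c x y
 proof -
  have "sat M (up c x y) body \<longleftrightarrow> ((ALL i:{N..<N + K}. (slt M (c (i - N)) x = slt M (c (i - N)) y) & (c (i - N) = x \<longleftrightarrow> c (i - N) = y)) -->
    sat M (e(0 := x)) \<phi> = sat M (e(0 := y)) \<phi>)"
   unfolding body_def by (simp add: r1 r2[simplified]) (simp add: up_def, blast)
  then show ?thesis unfolding same_type_def using cut[of "%a. (slt M a x = slt M a y) & (a = x \<longleftrightarrow> a = y)" c] by simp
 qed
 have "sat M e (cut_fm \<phi> N K) \<longleftrightarrow> (EX c. (ALL i<K. c i \<in> carrier M) & (ALL x:carrier M. ALL y:carrier M. sat M (up c x y) body))"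
 proof
  assume "sat M e (cut_fm \<phi> N K)"
  then obtain e1 where e2: "ALL i. i ~: set [N..<N + K] --> e1 i = e i" "ALL i:set [N..<N + K]. e1 i \<in> carrier M"
   and sa: "sat M e1 (alls [N + K, N + K + 1] body)"
   unfolding cut_fm_def body_def[symmetric] sat_exs by blast
  have e1: "!!i. i ~: {N..<N + K} ==> e1 i = e i" "!!i. i \<in> {N..<N + K} ==> e1 i \<in> carrier M" using e2 by simp_all
  have all: "sat M e' body" if "ALL i. i ~: {N + K, N + K + 1} --> e' i = e1 i" "ALL i:{N + K, N + K + 1}. e' i \<in> carrier M" for e'
   using sa[unfolded sat_alls, rule_format, of e'] that by auto
  have "sat M (up (%i. e1 (N + i)) x y) body" if "x \<in> carrier M" "y \<in> carrier M" for x y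
   by (rule all) (use e1(1) that in \<open>auto simp: up_def\<close>)
  then show "EX c. (ALL i<K. c i \<in> carrier M) & (ALL x:carrier M. ALL y:carrier M. sat M (up c x y) body)"
   using e1(2) by (intro exI[of _ "%i. e1 (N + i)"]) auto
 next
  assume "EX c. (ALL i<K. c i \<in> carrier M) & (ALL x:carrier M. ALL y:carrier M. sat M (up c x y) body)"
  then obtain c where c: "!!i. i < K ==> c i \<in> carrier M" "!!x y. x \<in> carrier M ==> y \<in> carrier M ==> sat M (up c x y) body" by blast
  define e1 where "e1 i = (if i \<in> {N..<N + K} then c (i - N) else e i)" for i
  have wit: "sat M e' body" if e': "!!i. i ~: {N + K, N + K + 1} ==> e' i = e1 i" "!!i. i \<in> {N + K, N + K + 1} ==> e' i \<in> carrier M" for e'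
  proof -
   have "e' = up c (e' (N + K)) (e' (N + K + 1))"
   proof
    fix i show "e' i = up c (e' (N + K)) (e' (N + K + 1)) i"
     using e'(1)[of i] by (cases "i \<in> {N + K, N + K + 1}") (auto simp: up_def e1_def)
   qed
   then show ?thesis using c(2)[of "e' (N + K)" "e' (N + K + 1)"] e'(2) by simp
  qed
  have "sat M e1 (alls [N + K, N + K + 1] body)" unfolding sat_alls by (intro allI impI wit) auto
  then show "sat M e (cut_fm \<phi> N K)" unfolding cut_fm_def body_def[symmetric] sat_exs
   using c(1) by (intro exI[of _ e1]) (auto simp: e1_def)
 qed
 then show ?thesis unfolding body .
qed

lemma fv_cut_fm: "fv \<phi> \<subseteq> {..<N} ==> 0 < N ==> fv (cut_fm \<phi> N K) \<subseteq> {..<N}"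
 unfolding cut_fm_def by (auto simp: fv_rn split: if_splits)

definition cuts :: "'b struc => fm => (nat => 'b) => 'b set => bool" where
 "cuts U \<phi> e A \<longleftrightarrow> finite A & A \<subseteq> carrier U &
   (ALL x:carrier U. ALL y:carrier U. same_type A (slt U) x y --> sat U (e(0 := x)) \<phi> = sat U (e(0 := y)) \<phi>)"

lemma cutsD:
 assumes "cuts U \<phi> e A"
 shows "finite A" "A \<subseteq> carrier U"
  "!!x y. x \<in> carrier U ==> y \<in> carrier U ==> same_type A (slt U) x y ==> sat U (e(0 := x)) \<phi> = sat U (e(0 := y)) \<phi>"
 using assms unfolding cuts_def by blast+

text \<open>As \<open>K\<close> does not depend on the parameters, the existence of \<open>K\<close>
  cut points for all of them is a single sentence and holds in every model.\<close>

lemma o_minimal_model: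
 fixes U :: "'b struc"
 assumes U: "is_model U (Th (ofield :: 'a::linordered_field struc))" and ivt: "ivt TYPE('a)"
 shows "EX K. ALL e. valid U e --> (EX A. cuts U \<phi> e A & card A <= K)"
proof -
 define N where "N = Suc (Max (insert 0 (fv \<phi>)))"
 have N: "fv \<phi> \<subseteq> {..<N}" "0 < N" unfolding N_def by (auto simp: less_Suc_eq_le)
 obtain K where K: "!!e :: nat => 'a. EX A. finite A & card A <= K &
  (ALL x y. same_type A (<) x y --> sat ofield (e(0 := x)) \<phi> = sat ofield (e(0 := y)) \<phi>)" using o_minimal[OF ivt, of \<phi>] by blast
 define \<sigma> where "\<sigma> = alls [0..<N] (cut_fm \<phi> N K)"
 have closed: "fv \<sigma> = {}" unfolding \<sigma>_def using fv_cut_fm[OF N, of K] by auto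
 have "sat ofield e (cut_fm \<phi> N K)" for e :: "nat => 'a"
 proof -
  obtain A where A: "finite A" "card A <= K" "!!x y. same_type A (<) x y ==> sat ofield (e(0 := x)) \<phi> = sat ofield (e(0 := y)) \<phi>"
   using K[of e] by blast
  \<comment> \<open>The formula asks for exactly \<open>K\<close> indices; those from
    \<open>card A\<close> on may add arbitrary points, which only refine the types.\<close>
  obtain f where f: "bij_betw f {0..<card A} A" using ex_bij_betw_nat_finite[OF A(1)] by blast
  have "f ` {0..<card A} \<subseteq> f ` {..<K}" using A(2) by (intro image_mono) auto
  then have sub: "A \<subseteq> f ` {..<K}" using f unfolding bij_betw_def by simp
  have "same_type A (<) x y" if "same_type (f ` {..<K}) (<) x y" for x y using that sub unfolding same_type_def by blast
  then show ?thesis unfolding sat_cut_fm[OF valid_ofield(1) N] using A(3) by (intro exI[of _ f]) auto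
 qed
 then have "sat ofield e \<sigma>" for e :: "nat => 'a" unfolding \<sigma>_def sat_alls by blast
 then have "sat U e (cut_fm \<phi> N K)" if e: "valid U e" for e
 proof -
  have "sat U e \<sigma>" using Th_transfer[OF U closed e, of "%_. 0"] \<open>sat ofield (%_. 0) \<sigma>\<close> by blast
  moreover have "ALL i:set [0..<N]. e i \<in> carrier U" using e by (auto simp: valid_def)
  ultimately show ?thesis unfolding \<sigma>_def sat_alls by blast
 qed
 then have *: "EX c. (ALL i<K. c i \<in> carrier U) &
   (ALL x:carrier U. ALL y:carrier U. same_type (c ` {..<K}) (slt U) x y --> sat U (e(0 := x)) \<phi> = sat U (e(0 := y)) \<phi>)" if "valid U e" for e
  using sat_cut_fm[OF that N] that by blast
 show ?thesis
 proof (intro exI[of _ K] allI impI)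
  fix e assume "valid U e"
  from *[OF this] obtain c where c: "ALL i<K. c i \<in> carrier U"
   "ALL x:carrier U. ALL y:carrier U. same_type (c ` {..<K}) (slt U) x y --> sat U (e(0 := x)) \<phi> = sat U (e(0 := y)) \<phi>" by blast
  have "card (c ` {..<K}) <= K" using card_image_le[of "{..<K}" c] by simp
  then show "EX A. cuts U \<phi> e A & card A <= K"
   unfolding cuts_def using c by (intro exI[of _ "c ` {..<K}"]) auto
 qed
qed

lemma slt_linear:
 fixes U :: "'b struc"
 assumes U: "is_model U (Th (ofield :: 'a::linordered_field struc))"
 shows "strict_linear_order_on (carrier U) (slt U)"
proof -
 have tr: "sat U e p" if "fv p \<subseteq> {0, 1, 2}" "!!e :: nat => 'a. sat ofield e p" "valid U e" for p e
 proof -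
  have "fv (alls [0, 1, 2] p) = {}" using that(1) by auto
  moreover have "sat ofield e (alls [0, 1, 2] p)" for e :: "nat => 'a" unfolding sat_alls using that(2) by blast
  ultimately have "sat U e (alls [0, 1, 2] p)" using Th_transfer[OF U _ that(3)] by blast
  then show ?thesis unfolding sat_alls using that(3) by (auto simp: valid_def)
 qed
 define v where "v a b c i = (if i = (0::nat) then a else if i = 1 then b else c)" for a b c :: 'b and i
 have v: "valid U (v a b c)" if "a \<in> carrier U" "b \<in> carrier U" "c \<in> carrier U" for a b c
  using that by (auto simp: valid_def v_def)
 show ?thesis unfolding strict_linear_order_on_def
 proof (intro conjI ballI impI)
  fix a assume a: "a \<in> carrier U"
  show "~ slt U a a" using tr[of "Neg (Lt (Var 0) (Var 0))" "v a a a"] v[OF a a a] by (simp add: v_def)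
 next
  fix a b c assume abc: "a \<in> carrier U" "b \<in> carrier U" "c \<in> carrier U" "slt U a b" "slt U b c"
  show "slt U a c"
   using tr[of "Neg (Conj (Conj (Lt (Var 0) (Var 1)) (Lt (Var 1) (Var 2))) (Neg (Lt (Var 0) (Var 2))))" "v a b c"] v[OF abc(1-3)] abc by (auto simp: v_def)
 next
  fix a b assume ab: "a \<in> carrier U" "b \<in> carrier U"
  let ?p = "Neg (Conj (Conj (Neg (Lt (Var 0) (Var 1))) (Neg (Eq (Var 0) (Var 1)))) (Neg (Lt (Var 1) (Var 0))))"
  have "sat ofield e ?p" for e :: "nat => 'a" by (simp add: less_linear)
  from tr[OF _ this v[OF ab ab(2)]] show "slt U a b | a = b | slt U b a" by (simp add: v_def)
 qed
qed

section \<open>Balls and convex cells in models of a real closed theory\<close>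

lemma bool_comb_inter: "X \<in> bool_comb C S ==> Y \<in> bool_comb C S ==> X \<subseteq> C ==> X \<inter> Y \<in> bool_comb C S"
proof -
 assume "X \<in> bool_comb C S" "Y \<in> bool_comb C S" "X \<subseteq> C"
 then have "C - ((C - X) \<union> (C - Y)) \<in> bool_comb C S" by (intro bool_comb.compl bool_comb.union)
 moreover have "C - ((C - X) \<union> (C - Y)) = X \<inter> Y" using \<open>X \<subseteq> C\<close> by auto
 ultimately show ?thesis by simp
qed

text \<open>\<open>X\<close> is divided along one ball \<open>B\<close>; the parts inside and
  outside \<open>B\<close> are enlarged to full classes of the remaining balls, to which the
  induction applies, and then cut back by \<open>B\<close> and its complement.\<close>

lemma bool_comb_determined:
 assumes "finite F" "F \<subseteq> S" "!!B. B \<in> S ==> B \<subseteq> C"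
 shows "X \<subseteq> C ==> determined C F X ==> X \<in> bool_comb C S"
 using assms(1,2)
proof (induction F arbitrary: X rule: finite_induct)
 case empty
 then have "X = {} | X = C" unfolding determined_def by blast
 moreover have "C - C \<in> bool_comb C S" by (intro bool_comb.compl bool_comb.top)
 ultimately show ?case using bool_comb.top by auto
next
 case (insert B F)
 have BC: "B \<subseteq> C" "B \<in> bool_comb C S" using insert.prems assms(3) by (auto intro: bool_comb.basic)
 define X1 where "X1 = {x \<in> C. EX y:X \<inter> B. ALL D:F. x \<in> D \<longleftrightarrow> y \<in> D}"
 define X2 where "X2 = {x \<in> C. EX y:X - B. ALL D:F. x \<in> D \<longleftrightarrow> y \<in> D}"
 have X1: "X1 \<in> bool_comb C S"
  by (rule insert.IH) (use insert.prems in \<open>auto simp: X1_def determined_def\<close>)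
 have X2: "X2 \<in> bool_comb C S"
  by (rule insert.IH) (use insert.prems in \<open>auto simp: X2_def determined_def\<close>)
 have "X = (B \<inter> X1) \<union> ((C - B) \<inter> X2)"
 proof (rule Set.set_eqI, rule iffI)
  fix x assume "x \<in> X"
  then show "x \<in> (B \<inter> X1) \<union> ((C - B) \<inter> X2)" using insert.prems(1) unfolding X1_def X2_def by blast
 next
  fix x assume "x \<in> (B \<inter> X1) \<union> ((C - B) \<inter> X2)"
  then obtain y where y: "x \<in> C" "y \<in> X" "x \<in> B \<longleftrightarrow> y \<in> B" "ALL D:F. x \<in> D \<longleftrightarrow> y \<in> D" unfolding X1_def X2_def by blast
  then have "ALL D:insert B F. x \<in> D \<longleftrightarrow> y \<in> D" "y \<in> C" using insert.prems(1) by auto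
  then show "x \<in> X" using insert.prems(2) y(1,2) unfolding determined_def by blast
 qed
 moreover have "(B \<inter> X1) \<union> ((C - B) \<inter> X2) \<in> bool_comb C S"
  by (intro bool_comb.union bool_comb_inter BC X1 X2 bool_comb.compl) auto
 ultimately show ?case by simp
qed

text \<open>Rays and points form a directed family, and a set decided by order types over finitely
  many cut points is a boolean combination of them.\<close>

theorem ivt_imp_VC_minimal:
 fixes U :: "'b struc"
 assumes U: "is_model U (Th (ofield :: 'a::linordered_field struc))" and ivt: "ivt TYPE('a)"
 shows "VC_minimal U"
proof -
 let ?C = "carrier U"
 note lin = slt_linear[OF U, unfolded strict_linear_order_on_def]
 note tr = lin[THEN conjunct2, THEN conjunct1, rule_format]
 note tot = lin[THEN conjunct2, THEN conjunct2, rule_format]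
 define \<Psi> where "\<Psi> = {Lt (Var 1) (Var 0), Eq (Var 1) (Var 0)}"
 have ds: "dset U (Lt (Var 1) (Var 0)) b = {x \<in> ?C. slt U (b 1) x}" "dset U (Eq (Var 1) (Var 0)) b = {x \<in> ?C. b 1 = x}" for b
  by (auto simp: dset_def)
 have "directed U \<Psi>" unfolding directed_def
 proof (intro ballI allI impI)
  fix \<psi> \<psi>' b c assume \<psi>: "\<psi> \<in> \<Psi>" "\<psi>' \<in> \<Psi>" and v: "valid U b" "valid U c"
  have bc: "b 1 \<in> ?C" "c 1 \<in> ?C" using v by (auto simp: valid_def)
  have ray: "{x \<in> ?C. slt U (b 1) x} \<subseteq> {x \<in> ?C. slt U (c 1) x} | {x \<in> ?C. slt U (c 1) x} \<subseteq> {x \<in> ?C. slt U (b 1) x}"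
   using tot[OF bc] tr[OF bc] tr[OF bc(2,1)] by auto
  show "dset U \<psi> b \<subseteq> dset U \<psi>' c | dset U \<psi>' c \<subseteq> dset U \<psi> b | dset U \<psi> b \<inter> dset U \<psi>' c = {}"
   using \<psi> ray unfolding \<Psi>_def by (elim insertE emptyE) (simp_all only: ds, auto)
 qed
 moreover have "dset U \<theta> e \<in> bool_comb ?C {dset U \<psi> b | \<psi> b. \<psi> \<in> \<Psi> & valid U b}" if e: "valid U e" for \<theta> e
 proof -
  obtain A where "cuts U \<theta> e A" using o_minimal_model[OF U ivt, of \<theta>] e by blast
  note A = cutsD[OF this]
  define F where "F = (%a. {x \<in> ?C. slt U a x}) ` A \<union> (%a. {x \<in> ?C. a = x}) ` A"
  show ?thesis
  proof (rule bool_comb_determined[of F])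
   show "finite F" using A(1) by (simp add: F_def)
   show "F \<subseteq> {dset U \<psi> b | \<psi> b. \<psi> \<in> \<Psi> & valid U b}"
   proof
    fix B assume "B \<in> F"
    then obtain a where a: "a \<in> A" "B = {x \<in> ?C. slt U a x} | B = {x \<in> ?C. a = x}" by (auto simp: F_def)
    have "valid U (%_. a)" using a A(2) by (auto simp: valid_def)
    moreover have "B = dset U (Lt (Var 1) (Var 0)) (%_. a) | B = dset U (Eq (Var 1) (Var 0)) (%_. a)" using a(2) unfolding ds .
    ultimately show "B \<in> {dset U \<psi> b | \<psi> b. \<psi> \<in> \<Psi> & valid U b}" unfolding \<Psi>_def by blast
   qed
   show "B \<subseteq> ?C" if "B \<in> {dset U \<psi> b | \<psi> b. \<psi> \<in> \<Psi> & valid U b}" for B using that by (auto simp: dset_def)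
   show "dset U \<theta> e \<subseteq> ?C" by (auto simp: dset_def)
   show "determined ?C F (dset U \<theta> e)" unfolding determined_def
   proof (intro ballI impI)
    fix x y assume xy: "x \<in> ?C" "y \<in> ?C" "ALL B:F. x \<in> B \<longleftrightarrow> y \<in> B"
    have "same_type A (slt U) x y" unfolding same_type_def
    proof (rule ballI)
     fix a assume a: "a \<in> A"
     have "{x \<in> ?C. slt U a x} \<in> F" "{x \<in> ?C. a = x} \<in> F" using a unfolding F_def by blast+
     from this[THEN xy(3)[rule_format]] show "(slt U a x \<longleftrightarrow> slt U a y) & (a = x \<longleftrightarrow> a = y)" using xy(1,2) by simp
    qed
    then show "x \<in> dset U \<theta> e \<longleftrightarrow> y \<in> dset U \<theta> e" using A(3) xy by (simp add: dset_def)
   qed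
  qed
 qed
 ultimately show ?thesis unfolding VC_minimal_def by (intro exI[of _ \<Psi>] conjI allI impI)
qed

text \<open>The order of the model itself works. Points with the same order type over the cut points
  form a convex cell; each cell is described by two subsets of \<open>A\<close>, whence the crude
  bound \<open>2^K * 2^K\<close>.\<close>

theorem ivt_imp_convexly_orderable:
 fixes U :: "'b struc"
 assumes U: "is_model U (Th (ofield :: 'a::linordered_field struc))" and ivt: "ivt TYPE('a)"
 shows "convexly_orderable U"
proof -
 let ?C = "carrier U"
 note order = slt_linear[OF U]
 note lin = order[unfolded strict_linear_order_on_def]
 note irr = lin[THEN conjunct1, rule_format] and tr = lin[THEN conjunct2, THEN conjunct1, rule_format]
 have "EX K::nat. ALL b. valid U b --> (EX \<C>. finite \<C> & card \<C> <= K & (ALL X:\<C>. convex_wrt ?C (slt U) X) & \<Union>\<C> = dset U \<phi> b)" for \<phi>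
 proof -
  obtain K where K: "!!e. valid U e ==> EX A. cuts U \<phi> e A & card A <= K" using o_minimal_model[OF U ivt, of \<phi>] by blast
  show ?thesis
  proof (intro exI[of _ "2 ^ K * 2 ^ K"] allI impI)
   fix b assume "valid U b"
   from K[OF this] obtain A where cA: "cuts U \<phi> b A" "card A <= K" by blast
   note A = cutsD(1)[OF cA(1)] cA(2) cutsD(2,3)[OF cA(1)]
   define \<tau> where "\<tau> x = ({a \<in> A. slt U a x}, {a \<in> A. a = x})" for x
   define cell where "cell t = {y \<in> ?C. \<tau> y = t}" for t
   have st: "same_type A (slt U) x y \<longleftrightarrow> \<tau> x = \<tau> y" for x y unfolding same_type_def \<tau>_def by blast
   have \<tau>: "\<tau> x \<in> Pow A \<times> Pow A" for x by (auto simp: \<tau>_def)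
   have fin: "finite (Pow A \<times> Pow A)" using A(1) by simp
   have sub: "\<tau> ` dset U \<phi> b \<subseteq> Pow A \<times> Pow A" using \<tau> by blast
   show "EX \<C>. finite \<C> & card \<C> <= 2 ^ K * 2 ^ K & (ALL X:\<C>. convex_wrt ?C (slt U) X) & \<Union>\<C> = dset U \<phi> b"
   proof (intro exI[of _ "cell ` \<tau> ` dset U \<phi> b"] conjI)
    have ft: "finite (\<tau> ` dset U \<phi> b)" using finite_subset[OF sub fin] .
    then show "finite (cell ` \<tau> ` dset U \<phi> b)" by simp
    have "card (cell ` \<tau> ` dset U \<phi> b) <= card (\<tau> ` dset U \<phi> b)" by (rule card_image_le[OF ft])
    also have "\<dots> <= card (Pow A \<times> Pow A)" by (rule card_mono[OF fin sub])
    also have "\<dots> = 2 ^ card A * 2 ^ card A" using A(1) by (simp add: card_cartesian_product card_Pow)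
    also have "\<dots> <= 2 ^ K * 2 ^ K" using A(2) by (intro mult_mono power_increasing) auto
    finally show "card (cell ` \<tau> ` dset U \<phi> b) <= 2 ^ K * 2 ^ K" .
    show "ALL X:cell ` \<tau> ` dset U \<phi> b. convex_wrt ?C (slt U) X"
    proof
     fix X assume "X \<in> cell ` \<tau> ` dset U \<phi> b"
     then obtain t where X: "X = cell t" by blast
     show "convex_wrt ?C (slt U) X" unfolding convex_wrt_def X
     proof (intro conjI ballI impI)
      show "cell t \<subseteq> ?C" by (auto simp: cell_def)
      fix x z y assume x: "x \<in> cell t" and z: "z \<in> cell t" and y: "y \<in> ?C" "slt U x y" "slt U y z"
      have C: "x \<in> ?C" "z \<in> ?C" "\<tau> x = t" "\<tau> z = t" using x z by (auto simp: cell_def)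
      have "same_type A (slt U) x z" using st C by simp
      then have s: "!!a. a \<in> A ==> (slt U a x \<longleftrightarrow> slt U a z) & (a = x \<longleftrightarrow> a = z)" unfolding same_type_def by blast
      have "same_type A (slt U) x y" unfolding same_type_def
      proof (intro ballI conjI)
       fix a assume a: "a \<in> A"
       then have aC: "a \<in> ?C" using A(3) by blast
       show "slt U a x \<longleftrightarrow> slt U a y" using s[OF a] tr[OF aC C(1) y(1)] tr[OF aC y(1) C(2)] y by blast
       have "a ~= x" using s[OF a] tr[OF C(1) y(1) C(2) y(2,3)] irr[OF C(1)] by blast
       moreover have "a ~= y" using s[OF a] y tr[OF C(1) y(1) C(1)] irr[OF C(1)] by blast
       ultimately show "a = x \<longleftrightarrow> a = y" by simp
      qed
      then show "y \<in> cell t" using st C y(1) by (simp add: cell_def)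
     qed
    qed
    show "\<Union> (cell ` \<tau> ` dset U \<phi> b) = dset U \<phi> b"
    proof
     show "dset U \<phi> b \<subseteq> \<Union> (cell ` \<tau> ` dset U \<phi> b)" by (auto simp: cell_def dset_def)
     show "\<Union> (cell ` \<tau> ` dset U \<phi> b) \<subseteq> dset U \<phi> b"
      using A(4) st by (auto simp: cell_def dset_def)
    qed
   qed
  qed
 qed
 then show ?thesis unfolding convexly_orderable_def using order by (intro exI[of _ "slt U"] conjI allI)
qed

theorem theorem1p7:
  fixes U :: "'b struc"
  assumes "monster_of (Th (ofield :: 'a::linordered_field struc)) U"
  shows "(VC_minimal U \<longleftrightarrow> convexly_orderable U)
       \<and> (convexly_orderable U \<longleftrightarrow> dp_small U)
       \<and> (dp_small U \<longleftrightarrow> real_closed TYPE('a))"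
proof -
  have model: "is_model U (Th (ofield :: 'a struc))" and sat: "aleph1_saturated U"
    using assms by (simp_all add: monster_of_def)
  then have U: "is_struc U" by (simp add: is_model_def)
  have "VC_minimal U \<Longrightarrow> dp_small U" using VC_minimal_imp_dp_small[OF U sat] .
  moreover have "convexly_orderable U \<Longrightarrow> dp_small U" by (rule convexly_orderable_imp_dp_small)
  moreover have "dp_small U \<Longrightarrow> ivt TYPE('a)" using dps_imp_ivt[OF dp_small_imp_dps[OF assms]] .
  moreover have "ivt TYPE('a) \<longleftrightarrow> real_closed TYPE('a)" using ivt_imp_real_closed real_closed_imp_ivt by blast
  moreover have "ivt TYPE('a) \<Longrightarrow> VC_minimal U" "ivt TYPE('a) \<Longrightarrow> convexly_orderable U"
    using ivt_imp_VC_minimal[OF model] ivt_imp_convexly_orderable[OF model] by blast+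
  ultimately show ?thesis by blast
qed

end
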